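(* Consider the polynomial control-affine system $\dot x=f(x)+g(x)u$, $y=h(x)$ with $f(x)=Ax+\sum_{p=2}^{\ell}F_p x^{\otimes p}$, $g(x)=B+\sum_{p=1}^{\ell}G_p(x^{\otimes p}\otimes I_m)$, $h(x)=Cx+\sum_{p=2}^{\ell}H_p x^{\otimes p}$, where $x\in\mathbb{R}^n$, $u\in\mathbb{R}^m$, $y\in\mathbb{R}^r$. Let $\gamma>\gamma_0\ge 0$ and $\eta=1-\gamma^{-2}$, where $\gamma_0$ denotes the smallest $\tilde\gamma$ such that a stabilizing controller exists for which the $\mathcal{H}_\infty$ norm of the closed-loop system is less than $\tilde\gamma$. Let the past energy function $\mathcal{E}_\gamma^-(x)$, which solves the Hamilton-Jacobi-Bellman equation $$0=\frac{\partial \mathcal{E}_\gamma^-(x)}{\partial x}f(x)+\frac12\frac{\partial \mathcal{E}_\gamma^-(x)}{\partial x}g(x)g(x)^\top\frac{\partial^\top \mathcal{E}_\gamma^-(x)}{\partial x}-\frac{\eta}{2}h(x)^\top h(x),$$ be of the form $\mathcal{E}_\gamma^-(x)\approx\frac12\sum_{i=2}^{d}v_i^\top x^{\otimes i}$ (degree-$d$ Taylor expansion) with coefficients $v_i\in\mathbb{R}^{n^i}$, $i=2,\dots,d$. Then $v_2=\mathrm{vec}[V_2]$, where $V_2$ is the symmetric positive semidefinite solution of the $\mathcal{H}_\infty$ algebraic Riccati equation $$0=A^\top V_2+V_2A-\eta C^\top C+V_2BB^\top V_2 .$$ For $3\le k\le d$, let $\tilde v_k\in\mathbb{R}^{n^k}$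 solve the linear system $$\begin{aligned} \mathcal{L}_k(A+BB^\top V_2)^\top\tilde v_k={}&-\sum_{\substack{i,p\ge2\\ i+p=k+1}}\mathcal{L}_i(F_p)^\top v_i-\frac14\sum_{\substack{i,j>2\\ i+j=k+2}}ij\,\mathrm{vec}\big[V_i^\top BB^\top V_j\big]+\eta\sum_{\substack{p,q\ge1\\ p+q=k}}\mathrm{vec}\big[H_p^\top H_q\big]\\ &-\frac14\sum_{o=1}^{2\ell}\ \sum_{\substack{p,q\ge0\\ p+q=o}}\ \sum_{\substack{i,j\ge2\\ i+j=k-o+2}}ij\,\mathrm{vec}\Big[\big(I_{n^p}\otimes\mathrm{vec}[I_m]^\top\big)\Big(\mathrm{vec}[G_q^\top V_j]^\top\otimes\big(G_p^\top V_i\otimes I_m\big)\Big)\\ &\qquad\qquad\times\big(I_{n^{j-1}}\otimes S_{n^{i-1}\times n^qm}\otimes I_m\big)\big(I_{n^{k-p}}\otimes\mathrm{vec}[I_m]\big)\Big], \end{aligned}$$ where $H_1:=C$ and $G_0:=B$. Then, for $3\le k\le d$, the coefficient $v_k\in\mathbb{R}^{n^k}$ is obtained by symmetrization of $\tilde v_k$.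
   Context: Notation. $x^{\otimes k}=x\otimes\cdots\otimes x$ ($k$ factors), $\otimes$ is the Kronecker product; $\mathrm{vec}[\cdot]$ stacks the columns of a matrix. Matrices: $A\in\mathbb{R}^{n\times n}$, $F_p\in\mathbb{R}^{n\times n^p}$, $B\in\mathbb{R}^{n\times m}$, $G_p\in\mathbb{R}^{n\times mn^p}$, $C\in\mathbb{R}^{r\times n}$, $H_p\in\mathbb{R}^{r\times n^p}$; coefficient matrices $F_p,G_p,H_p$ with $p>\ell$ are zero. The perfect shuffle matrix $S_{q\times p}$ is the permutation matrix with $\mathrm{vec}[M^\top]=S_{q\times p}\mathrm{vec}[M]$ for every $M\in\mathbb{R}^{p\times q}$. For $M\in\mathbb{R}^{p\times q}$, the $k$-way Lyapunov matrix is $\mathcal{L}_k(M)=\sum_{i=1}^k I_p\otimes\cdots\otimes M\otimes\cdots\otimes I_p\in\mathbb{R}^{p^k\times p^{k-1}q}$ ($k$ factors, $M$ in position $i$). A coefficient $v\in\mathbb{R}^{n^k}$ is symmetric if $v^\top(a_1\otimes\cdots\otimes a_k)=v^\top(a_{\sigma(1)}\otimes\cdots\otimes a_{\sigma(k)})$ for all $a_i\in\mathbb{R}^n$ and all permutations $\sigma$; the symmetrization of $\tilde v\in\mathbb{R}^{n^k}$ is the unique symmetric $v$ with $v^\top x^{\otimes k}=\tilde v^\top x^{\otimes k}$ for all $x$ (the average over permutations of the tensor factors). The coefficients $v_i$ are the symmetric representatives of the homogeneous parts of the expansion; $V_i\in\mathbb{R}^{n\times n^{i-1}}$ is the reshaping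 of $v_i$ with $v_i=\mathrm{vec}[V_i]$. Energy function. For $\gamma>0$, $\gamma\ne1$, the $\mathcal{H}_\infty$ past energy is $$\mathcal{E}_\gamma^-(x_0)=\min_{u\in L_2(-\infty,0],\,x(-\infty)=0,\,x(0)=x_0}\frac12\int_{-\infty}^0\eta\|y(t)\|^2+\|u(t)\|^2\,dt.$$ Standing assumption: the displayed HJB equation has a solution with $\mathcal{E}_\gamma^-(0)=0$ such that $-f(x)-g(x)g(x)^\top\,\partial^\top\mathcal{E}_\gamma^-(x)/\partial x$ is asymptotically stable; this solution is the past energy function, and it is analytic near the origin. *)

theory Defs
  imports
    "HOL-Analysis.Analysis"
    "Jordan_Normal_Form.Gauss_Jordan_Elimination"
    "Jordan_Normal_Form.Char_Poly"
begin

(* Vectors and matrices are those of Jordan_Normal_Form, since dimensions such as n^k depend on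
   the running index k. The competing names and notation of HOL-Analysis are switched off. *)

unbundle no vec_syntax
unbundle no inner_syntax
hide_const (open) Finite_Cartesian_Product.vec Finite_Cartesian_Product.mat
  Finite_Cartesian_Product.row Finite_Cartesian_Product.vector_matrix_mult
  Determinants.det

section \<open>Kronecker products, vectorization, Lyapunov and shuffle matrices\<close>

definition vec_sum :: "nat \<Rightarrow> ('i \<Rightarrow> real vec) \<Rightarrow> 'i set \<Rightarrow> real vec" where
  "vec_sum n f S = vec n (\<lambda>i. \<Sum>s\<in>S. f s $ i)"

definition mat_sum :: "nat \<Rightarrow> nat \<Rightarrow> ('i \<Rightarrow> real mat) \<Rightarrow> 'i set \<Rightarrow> real mat" where
  "mat_sum nr nc f S = mat nr nc (\<lambda>ij. \<Sum>s\<in>S. f s $$ ij)"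

definition kron :: "real mat \<Rightarrow> real mat \<Rightarrow> real mat" (infixr \<open>\<otimes>\<^sub>m\<close> 71) where
  "M \<otimes>\<^sub>m N = mat (dim_row M * dim_row N) (dim_col M * dim_col N)
     (\<lambda>(i, j). M $$ (i div dim_row N, j div dim_col N) * N $$ (i mod dim_row N, j mod dim_col N))"

definition kron_list :: "real mat list \<Rightarrow> real mat" where
  "kron_list Ms = foldr kron Ms (1\<^sub>m 1)"

definition kron_vec :: "real vec \<Rightarrow> real vec \<Rightarrow> real vec" where
  "kron_vec a b = vec (dim_vec a * dim_vec b) (\<lambda>i. a $ (i div dim_vec b) * b $ (i mod dim_vec b))"

definition kron_vec_list :: "real vec list \<Rightarrow> real vec" where
  "kron_vec_list as = foldr kron_vec as (vec 1 (\<lambda>_. 1))"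

definition kron_pow :: "real vec \<Rightarrow> nat \<Rightarrow> real vec" (infix \<open>^\<^sub>\<otimes>\<close> 80) where
  "x ^\<^sub>\<otimes> k = kron_vec_list (replicate k x)"

definition col_mat :: "real vec \<Rightarrow> real mat" where
  "col_mat v = mat_of_cols (dim_vec v) [v]"

definition vectorize :: "real mat \<Rightarrow> real vec" where
  "vectorize M = vec (dim_row M * dim_col M) (\<lambda>k. M $$ (k mod dim_row M, k div dim_row M))"

definition lyapunov_mat :: "nat \<Rightarrow> real mat \<Rightarrow> real mat" where
  "lyapunov_mat k M = mat_sum (dim_row M ^ k) (dim_row M ^ (k - 1) * dim_col M)
     (\<lambda>i. kron_list (map (\<lambda>j. if j = i then M else 1\<^sub>m (dim_row M)) [1..<Suc k])) {1..k}"

(* shuffle q p is the perfect shuffle matrix S_{q x p}; it is characterized in shuffle_vectorize. *)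
definition shuffle :: "nat \<Rightarrow> nat \<Rightarrow> real mat" where
  "shuffle q p = mat (p * q) (p * q) (\<lambda>(i, j). if j = (i mod q) * p + i div q then 1 else 0)"

lemma shuffle_vectorize:
  assumes "M \<in> carrier_mat p q"
  shows "shuffle q p *\<^sub>v vectorize M = vectorize M\<^sup>T"
proof (rule eq_vecI)
  show "dim_vec (shuffle q p *\<^sub>v vectorize M) = dim_vec (vectorize M\<^sup>T)"
    using assms by (simp add: shuffle_def vectorize_def mult.commute)
  fix i assume "i < dim_vec (vectorize M\<^sup>T)"
  hence i: "i < p * q" using assms by (simp add: vectorize_def mult.commute)
  hence q: "0 < q" by (cases q) auto
  have p: "0 < p" using i by (cases p) auto
  have c: "i div q < p" using i by (simp add: less_mult_imp_div_less)
  have r: "i mod q < q" using q by simp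
  let ?j = "(i mod q) * p + i div q"
  have "?j < (i mod q) * p + p" using c by simp
  also have "\<dots> = Suc (i mod q) * p" by simp
  also have "\<dots> \<le> q * p" using r by (intro mult_right_mono) auto
  finally have j: "?j < p * q" by (simp add: mult.commute)
  have "(shuffle q p *\<^sub>v vectorize M) $ i
      = (\<Sum>k = 0..<p * q. (if k = ?j then 1 else 0) * vectorize M $ k)"
    using i assms by (simp add: shuffle_def scalar_prod_def vectorize_def)
  also have "\<dots> = (\<Sum>k = 0..<p * q. if k = ?j then vectorize M $ k else 0)"
    by (rule sum.cong) auto
  also have "\<dots> = vectorize M $ ?j" using j by (simp add: sum.delta)
  also have "\<dots> = M $$ (i div q, i mod q)"
    using j c p assms by (simp add: vectorize_def)
  also have "\<dots> = vectorize M\<^sup>T $ i"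
    using i c r assms by (simp add: vectorize_def mult.commute)
  finally show "(shuffle q p *\<^sub>v vectorize M) $ i = vectorize M\<^sup>T $ i" .
qed

section \<open>Symmetric coefficients\<close>

definition symmetric_coeff :: "nat \<Rightarrow> nat \<Rightarrow> real vec \<Rightarrow> bool" where
  "symmetric_coeff n k v \<longleftrightarrow> v \<in> carrier_vec (n ^ k) \<and>
     (\<forall>a \<sigma>. (\<forall>i<k. a i \<in> carrier_vec n) \<and> \<sigma> permutes {..<k} \<longrightarrow>
        v \<bullet> kron_vec_list (map a [0..<k]) = v \<bullet> kron_vec_list (map (\<lambda>i. a (\<sigma> i)) [0..<k]))"

definition symmetrization :: "nat \<Rightarrow> nat \<Rightarrow> real vec \<Rightarrow> real vec" where
  "symmetrization n k w =
     (THE v. symmetric_coeff n k v \<and> (\<forall>x\<in>carrier_vec n. v \<bullet> (x ^\<^sub>\<otimes> k) = w \<bullet> (x ^\<^sub>\<otimes> k)))"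

section \<open>The polynomial control-affine system\<close>

definition drift :: "real mat \<Rightarrow> (nat \<Rightarrow> real mat) \<Rightarrow> nat \<Rightarrow> real vec \<Rightarrow> real vec" where
  "drift A F l x = A *\<^sub>v x + vec_sum (dim_row A) (\<lambda>p. F p *\<^sub>v (x ^\<^sub>\<otimes> p)) {2..l}"

definition input_mat :: "real mat \<Rightarrow> (nat \<Rightarrow> real mat) \<Rightarrow> nat \<Rightarrow> real vec \<Rightarrow> real mat" where
  "input_mat B G l x = B + mat_sum (dim_row B) (dim_col B)
     (\<lambda>p. G p * (col_mat (x ^\<^sub>\<otimes> p) \<otimes>\<^sub>m 1\<^sub>m (dim_col B))) {1..l}"

definition output_map :: "real mat \<Rightarrow> (nat \<Rightarrow> real mat) \<Rightarrow> nat \<Rightarrow> real vec \<Rightarrow> real vec" where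
  "output_map C H l x = C *\<^sub>v x + vec_sum (dim_row C) (\<lambda>p. H p *\<^sub>v (x ^\<^sub>\<otimes> p)) {2..l}"

section \<open>Norms, gradients, power series, asymptotic stability\<close>

definition vnorm :: "'a::real_normed_vector vec \<Rightarrow> real" where
  "vnorm v = L2_set (\<lambda>i. norm (v $ i)) {..<dim_vec v}"

definition gradient :: "nat \<Rightarrow> (real vec \<Rightarrow> real) \<Rightarrow> real vec \<Rightarrow> real vec" where
  "gradient n E x = vec n (\<lambda>i. deriv (\<lambda>t. E (x + t \<cdot>\<^sub>v unit_vec n i)) 0)"

(* The k-th homogeneous part of the series is the polynomial w k \<bullet> (x ^ k). Unconditional
   summation over the single entries (k, j) of the coefficients is absolute convergence of the
   power series; every function that is real analytic at 0 has such an expansion, for instance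
   with symmetric w k. *)
definition has_power_series_at_0 ::
  "nat \<Rightarrow> (real vec \<Rightarrow> real) \<Rightarrow> (nat \<Rightarrow> real vec) \<Rightarrow> bool" where
  "has_power_series_at_0 n E w \<longleftrightarrow> (\<forall>k. w k \<in> carrier_vec (n ^ k)) \<and>
     (\<exists>\<rho>>0. \<forall>x\<in>carrier_vec n. vnorm x < \<rho> \<longrightarrow>
        ((\<lambda>(k, j). w k $ j * (x ^\<^sub>\<otimes> k) $ j) has_sum E x) (SIGMA k:UNIV. {..<n ^ k}))"

definition analytic_at_0 :: "nat \<Rightarrow> (real vec \<Rightarrow> real) \<Rightarrow> bool" where
  "analytic_at_0 n E \<longleftrightarrow> (\<exists>w. has_power_series_at_0 n E w)"

(* The degree-d Taylor polynomial of E at 0 is (1/2) (v 2 \<bullet> x^2 + ... + v d \<bullet> x^d): in particular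
   the parts of degree 0 and 1 vanish. *)
definition energy_taylor_coeffs ::
  "nat \<Rightarrow> nat \<Rightarrow> (real vec \<Rightarrow> real) \<Rightarrow> (nat \<Rightarrow> real vec) \<Rightarrow> bool" where
  "energy_taylor_coeffs n d E v \<longleftrightarrow>
     (\<forall>k\<in>{2..d}. symmetric_coeff n k (v k)) \<and>
     (\<exists>w. has_power_series_at_0 n E w \<and>
        (\<forall>k\<le>d. \<forall>x\<in>carrier_vec n.
           w k \<bullet> (x ^\<^sub>\<otimes> k) = (if 2 \<le> k then 1/2 * (v k \<bullet> (x ^\<^sub>\<otimes> k)) else 0)))"

definition solves_ode :: "nat \<Rightarrow> (real vec \<Rightarrow> real vec) \<Rightarrow> (real \<Rightarrow> real vec) \<Rightarrow> bool" where
  "solves_ode n \<Phi> x \<longleftrightarrow> (\<forall>t\<ge>0. x t \<in> carrier_vec n \<and>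
     (\<forall>i<n. ((\<lambda>s. x s $ i) has_real_derivative \<Phi> (x t) $ i) (at t within {0..})))"

(* Lyapunov stability plus attractivity of the origin. Existence of solutions on [0, oo) for
   small initial values is part of the definition, so that it cannot hold vacuously. *)
definition asymptotically_stable :: "nat \<Rightarrow> (real vec \<Rightarrow> real vec) \<Rightarrow> bool" where
  "asymptotically_stable n \<Phi> \<longleftrightarrow>
     (\<forall>\<epsilon>>0. \<exists>\<delta>>0. \<forall>x0\<in>carrier_vec n. vnorm x0 < \<delta> \<longrightarrow>
        (\<exists>x. solves_ode n \<Phi> x \<and> x 0 = x0) \<and>
        (\<forall>x. solves_ode n \<Phi> x \<and> x 0 = x0 \<longrightarrow> (\<forall>t\<ge>0. vnorm (x t) < \<epsilon>))) \<and>
     (\<exists>\<delta>>0. \<forall>x. solves_ode n \<Phi> x \<and> vnorm (x 0) < \<delta> \<longrightarrow> ((\<lambda>t. vnorm (x t)) \<longlongrightarrow> 0) at_top)"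

section \<open>The past energy function\<close>

(* Caratheodory solutions of x' = f x + g x u on (-oo, 0], with u square integrable. *)
definition admissible_past ::
  "nat \<Rightarrow> nat \<Rightarrow> (real vec \<Rightarrow> real vec) \<Rightarrow> (real vec \<Rightarrow> real mat) \<Rightarrow> real vec \<Rightarrow>
   (real \<Rightarrow> real vec) \<Rightarrow> (real \<Rightarrow> real vec) \<Rightarrow> bool" where
  "admissible_past n m f g x0 u x \<longleftrightarrow>
     (\<forall>t\<le>0. u t \<in> carrier_vec m) \<and>
     (\<forall>i<m. set_borel_measurable lborel {..0} (\<lambda>t. u t $ i)) \<and>
     (\<integral>\<^sup>+t\<in>{..0}. ennreal ((vnorm (u t))\<^sup>2) \<partial>lborel) < \<infinity> \<and>
     (\<forall>t\<le>0. x t \<in> carrier_vec n) \<and>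
     (\<forall>s t. s \<le> t \<and> t \<le> 0 \<longrightarrow> (\<forall>i<n.
        ((\<lambda>\<tau>. (f (x \<tau>) + g (x \<tau>) *\<^sub>v u \<tau>) $ i) has_integral (x t $ i - x s $ i)) {s..t})) \<and>
     ((\<lambda>t. vnorm (x t)) \<longlongrightarrow> 0) at_bot \<and> x 0 = x0"

(* The cost is an extended real because the output need not be square integrable. The input term
   is finite for admissible u, so no undefined difference of infinities arises when \<eta> < 0. *)
definition past_cost ::
  "(real vec \<Rightarrow> real vec) \<Rightarrow> real \<Rightarrow> (real \<Rightarrow> real vec) \<Rightarrow> (real \<Rightarrow> real vec) \<Rightarrow> ereal" where
  "past_cost h \<eta> u x =
     ereal (\<eta>/2) * enn2ereal (\<integral>\<^sup>+t\<in>{..0}. ennreal ((vnorm (h (x t)))\<^sup>2) \<partial>lborel) +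
     ereal (1/2) * enn2ereal (\<integral>\<^sup>+t\<in>{..0}. ennreal ((vnorm (u t))\<^sup>2) \<partial>lborel)"

definition is_past_energy ::
  "nat \<Rightarrow> nat \<Rightarrow> (real vec \<Rightarrow> real vec) \<Rightarrow> (real vec \<Rightarrow> real mat) \<Rightarrow> (real vec \<Rightarrow> real vec) \<Rightarrow>
   real \<Rightarrow> (real vec \<Rightarrow> real) \<Rightarrow> bool" where
  "is_past_energy n m f g h \<eta> E \<longleftrightarrow> (\<exists>\<rho>>0. \<forall>x0\<in>carrier_vec n. vnorm x0 < \<rho> \<longrightarrow>
     (\<exists>u x. admissible_past n m f g x0 u x \<and> past_cost h \<eta> u x = ereal (E x0)) \<and>
     (\<forall>u x. admissible_past n m f g x0 u x \<longrightarrow> ereal (E x0) \<le> past_cost h \<eta> u x))"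

definition solves_past_HJB ::
  "nat \<Rightarrow> (real vec \<Rightarrow> real vec) \<Rightarrow> (real vec \<Rightarrow> real mat) \<Rightarrow> (real vec \<Rightarrow> real vec) \<Rightarrow>
   real \<Rightarrow> (real vec \<Rightarrow> real) \<Rightarrow> bool" where
  "solves_past_HJB n f g h \<eta> E \<longleftrightarrow> (\<exists>\<rho>>0. \<forall>x\<in>carrier_vec n. vnorm x < \<rho> \<longrightarrow>
     0 = gradient n E x \<bullet> f x + 1/2 * (gradient n E x \<bullet> ((g x * (g x)\<^sup>T) *\<^sub>v gradient n E x))
       - \<eta>/2 * (h x \<bullet> h x))"

section \<open>The optimal closed-loop level \<open>\<gamma>\<^sub>0\<close>\<close>

definition hurwitz :: "real mat \<Rightarrow> bool" where
  "hurwitz M \<longleftrightarrow> (\<forall>s. eigenvalue (map_mat complex_of_real M) s \<longrightarrow> Re s < 0)"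

definition spectral_norm :: "complex mat \<Rightarrow> real" where
  "spectral_norm M = Sup {vnorm (M *\<^sub>v x) | x. x \<in> carrier_vec (dim_col M) \<and> vnorm x \<le> 1}"

definition transfer_mat ::
  "real mat \<Rightarrow> real mat \<Rightarrow> real mat \<Rightarrow> real mat \<Rightarrow> complex \<Rightarrow> complex mat" where
  "transfer_mat A B C D s =
     map_mat complex_of_real C *
       the (mat_inverse (s \<cdot>\<^sub>m 1\<^sub>m (dim_row A) - map_mat complex_of_real A)) *
       map_mat complex_of_real B + map_mat complex_of_real D"

definition Hinf_norm :: "(complex \<Rightarrow> complex mat) \<Rightarrow> ereal" where
  "Hinf_norm T = (SUP s\<in>{s. 0 < Re s}. ereal (spectral_norm (T s)))"

(* Normalized H-infinity control problem for the linearization at the origin: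
     x' = A x + B (u + w1),  y = C x + w2,  performance output z = (C x, u),
   closed with a linear output feedback controller of arbitrary order q,
     \<xi>' = Ka \<xi> + Kb y,  u = Kc \<xi> + Kd y.
   The four block matrices realize the closed loop from (w1, w2) to z with state (x, \<xi>). *)
definition Hinf_level_achievable ::
  "nat \<Rightarrow> nat \<Rightarrow> nat \<Rightarrow> real mat \<Rightarrow> real mat \<Rightarrow> real mat \<Rightarrow> real \<Rightarrow> bool" where
  "Hinf_level_achievable n m r A B C g \<longleftrightarrow>
     (\<exists>q. \<exists>Ka\<in>carrier_mat q q. \<exists>Kb\<in>carrier_mat q r. \<exists>Kc\<in>carrier_mat m q. \<exists>Kd\<in>carrier_mat m r.
        let Acl = four_block_mat (A + B * Kd * C) (B * Kc) (Kb * C) Ka;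
            Bcl = four_block_mat B (B * Kd) (0\<^sub>m q m) Kb;
            Ccl = four_block_mat C (0\<^sub>m r q) (Kd * C) Kc;
            Dcl = four_block_mat (0\<^sub>m r m) (0\<^sub>m r r) (0\<^sub>m m m) Kd
        in hurwitz Acl \<and> Hinf_norm (transfer_mat Acl Bcl Ccl Dcl) < ereal g)"

(* The achievable levels form an upward closed set that in general has no least element, so the
   optimal level is the infimum; it is \<infinity> when no controller exists. *)
definition Hinf_optimal_level ::
  "nat \<Rightarrow> nat \<Rightarrow> nat \<Rightarrow> real mat \<Rightarrow> real mat \<Rightarrow> real mat \<Rightarrow> ereal" where
  "Hinf_optimal_level n m r A B C = Inf {ereal g | g. Hinf_level_achievable n m r A B C g}"

section \<open>Right-hand side of the linear systems for the coefficients\<close>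

definition cross_term ::
  "nat \<Rightarrow> nat \<Rightarrow> (nat \<Rightarrow> real mat) \<Rightarrow> (nat \<Rightarrow> real mat) \<Rightarrow> nat \<Rightarrow> nat \<Rightarrow> nat \<Rightarrow> nat \<Rightarrow> nat \<Rightarrow> real vec" where
  "cross_term n m G V k p q i j = vectorize
     ((1\<^sub>m (n^p) \<otimes>\<^sub>m (col_mat (vectorize (1\<^sub>m m)))\<^sup>T)
      * ((col_mat (vectorize ((G q)\<^sup>T * V j)))\<^sup>T \<otimes>\<^sub>m (((G p)\<^sup>T * V i) \<otimes>\<^sub>m 1\<^sub>m m))
      * (1\<^sub>m (n^(j-1)) \<otimes>\<^sub>m shuffle (n^(i-1)) (n^q * m) \<otimes>\<^sub>m 1\<^sub>m m)
      * (1\<^sub>m (n^(k-p)) \<otimes>\<^sub>m col_mat (vectorize (1\<^sub>m m))))"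

definition past_rhs ::
  "nat \<Rightarrow> nat \<Rightarrow> nat \<Rightarrow> real \<Rightarrow> (nat \<Rightarrow> real mat) \<Rightarrow> (nat \<Rightarrow> real mat) \<Rightarrow> (nat \<Rightarrow> real mat) \<Rightarrow>
   (nat \<Rightarrow> real vec) \<Rightarrow> (nat \<Rightarrow> real mat) \<Rightarrow> nat \<Rightarrow> real vec" where
  "past_rhs n m l \<eta> F G H v V k =
     - vec_sum (n^k) (\<lambda>(i, p). (lyapunov_mat i (F p))\<^sup>T *\<^sub>v v i)
         {(i, p). 2 \<le> i \<and> 2 \<le> p \<and> i + p = k + 1}
     - (1/4) \<cdot>\<^sub>v vec_sum (n^k)
         (\<lambda>(i, j). real (i * j) \<cdot>\<^sub>v vectorize ((V i)\<^sup>T * G 0 * (G 0)\<^sup>T * V j))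
         {(i, j). 2 < i \<and> 2 < j \<and> i + j = k + 2}
     + \<eta> \<cdot>\<^sub>v vec_sum (n^k) (\<lambda>(p, q). vectorize ((H p)\<^sup>T * H q))
         {(p, q). 1 \<le> p \<and> 1 \<le> q \<and> p + q = k}
     - (1/4) \<cdot>\<^sub>v vec_sum (n^k)
         (\<lambda>a. vec_sum (n^k)
           (\<lambda>(p, q). vec_sum (n^k)
             (\<lambda>(i, j). real (i * j) \<cdot>\<^sub>v cross_term n m G V k p q i j)
             {(i, j). 2 \<le> i \<and> 2 \<le> j \<and> i + j + a = k + 2})
           {(p, q). p + q = a})
         {1..2 * l}"

end

theory Submission
  imports Defs
    "Jordan_Normal_Form.Schur_Decomposition"
    "HOL-Library.Landau_Symbols"
    "HOL-Complex_Analysis.Conformal_Mappings"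
begin

unbundle no vec_syntax
unbundle no inner_syntax
hide_const (open) Finite_Cartesian_Product.vec Finite_Cartesian_Product.mat
  Finite_Cartesian_Product.row Finite_Cartesian_Product.vector_matrix_mult
  Determinants.det

text \<open>Write \<open>Ac = A + B B\<^sup>T V\<^sub>2\<close> and test every identity on \<open>x\<^sup>\<otimes>\<^sup>k\<close>. The homogeneous part of degree \<open>k\<close> of the HJB
  equation is the Riccati equation for \<open>k = 2\<close>; for \<open>k \<ge> 3\<close> it says that \<open>v\<^sub>k\<close> itself satisfies the linear
  system in the tested sense, where \<open>L\<^sub>k(Ac)\<^sup>T v\<close> becomes the derivative of \<open>v\<^sup>T x\<^sup>\<otimes>\<^sup>k\<close> along \<open>Ac x\<close>. If all
  eigenvalues of \<open>Ac\<close> have positive real part, a homogeneous polynomial is determined by this derivative,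
  so that every solution of the system has the same symmetrization \<open>v\<^sub>k\<close>.

  By asymptotic stability the eigenvalues of the linearization \<open>-Ac\<close> have nonpositive real parts (Chetaev).
  An imaginary eigenvalue is excluded by an achievable level \<open>g < \<gamma>\<close>: its eigenvector is a frequency at
  which the closed loop bound and the Riccati equation together force zero input and zero output, against
  detectability. The same bound on the closed right half plane yields that \<open>V\<^sub>2\<close> is positive semidefinite.\<close>

section \<open>Kronecker products and symmetric coefficients\<close>

text \<open>The sign of \<eta> is the obstacle. For \<gamma> > 1 the source term \<eta> C^T C of the
  Riccati equation is positive semidefinite; for \<gamma> < 1 it is negative semidefinite, and then
  the equation alone neither keeps the spectrum of Ac off the imaginary axis nor makes V_2
  semidefinite. An achievable level g < \<gamma> compensates for this with a strict margin, because
  1 - \<eta> = 1/\<gamma>^2 is exactly the weight that the level bound puts on the output. Stability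
  of the nonlinear closed loop cannot supply the missing strict inequality: x' = -x^3 is
  asymptotically stable although its linearization vanishes. The linear system lives on all n^k
  entries, and a given solution need not be symmetric. Testing on powers sees only the symmetric
  part, so a solution and v_k are compared as polynomials; they need not agree as vectors.
  Uniqueness is therefore needed only for polynomials, and it is obtained there by a minimum
  argument, without the spectrum of the Lyapunov matrix.\<close>

lemma sum_div_mod:
  fixes f :: "nat \<Rightarrow> nat \<Rightarrow> 'a::comm_monoid_add"
  shows "(\<Sum>i = 0..<a * b. f (i div b) (i mod b)) = (\<Sum>i = 0..<a. \<Sum>j = 0..<b. f i j)"
proof -
  have "(\<Sum>i = 0..<a * b. f (i div b) (i mod b))
      = (\<Sum>m<a. \<Sum>i = m * b..<m * b + b. f (i div b) (i mod b))"
    by (simp add: sum.nat_group atLeast0LessThan)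
  also have "\<dots> = (\<Sum>m<a. \<Sum>j = 0..<b. f m j)"
  proof (rule sum.cong[OF refl])
    fix m
    have "(\<Sum>i = 0 + m * b..<b + m * b. f (i div b) (i mod b))
        = (\<Sum>i = 0..<b. f ((i + m * b) div b) ((i + m * b) mod b))"
      by (rule sum.shift_bounds_nat_ivl)
    also have "\<dots> = (\<Sum>j = 0..<b. f m j)"
      by (rule sum.cong) auto
    finally show "(\<Sum>i = m * b..<m * b + b. f (i div b) (i mod b)) = (\<Sum>j = 0..<b. f m j)"
      by (simp add: add.commute)
  qed
  finally show ?thesis by (simp add: atLeast0LessThan)
qed

lemma div_mod_less:
  fixes i a b :: nat
  assumes "i < a * b" shows "i div b < a" "i mod b < b"
proof -
  show "i div b < a" using assms by (simp add: less_mult_imp_div_less)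
  show "i mod b < b" using assms by (cases b) auto
qed

lemma dim_kron_vec [simp]: "dim_vec (kron_vec a b) = dim_vec a * dim_vec b"
  by (simp add: kron_vec_def)

lemma index_kron_vec:
  "i < dim_vec a * dim_vec b \<Longrightarrow> kron_vec a b $ i = a $ (i div dim_vec b) * b $ (i mod dim_vec b)"
  by (simp add: kron_vec_def)

lemma kron_vec_carrier [intro]:
  "a \<in> carrier_vec p \<Longrightarrow> b \<in> carrier_vec q \<Longrightarrow> kron_vec a b \<in> carrier_vec (p * q)"
  by (auto intro: carrier_vecI)

text \<open>With b and c denoting the dimensions of the last two factors, an index i has the three
  mixed-radix digits i div (b c), (i div c) mod b and i mod c. Both bracketings read off the same
  digits.\<close>

lemma kron_vec_assoc: "kron_vec (kron_vec a b) c = kron_vec a (kron_vec b c)"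
proof (rule eq_vecI)
  show "dim_vec (kron_vec (kron_vec a b) c) = dim_vec (kron_vec a (kron_vec b c))" by simp
  fix i assume "i < dim_vec (kron_vec a (kron_vec b c))"
  hence i: "i < dim_vec a * (dim_vec b * dim_vec c)" by simp
  hence i': "i < dim_vec a * dim_vec b * dim_vec c" by (simp add: mult.assoc)
  let ?b = "dim_vec b" and ?c = "dim_vec c"
  have e: "i mod (?b * ?c) = ?c * (i div ?c mod ?b) + i mod ?c"
    using mod_mult2_eq[of i ?c ?b] by (simp add: mult.commute)
  have "i mod (?b * ?c) div ?c = i div ?c mod ?b"
    using div_mod_less(2)[OF i'] unfolding e by (subst div_mult_self4) auto
  moreover have "i mod (?b * ?c) mod ?c = i mod ?c"
    by (simp add: e)
  moreover have "i div ?c div ?b = i div (?b * ?c)"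
    using div_mult2_eq[of i ?c ?b] by (simp add: mult.commute)
  ultimately show "kron_vec (kron_vec a b) c $ i = kron_vec a (kron_vec b c) $ i"
    using i i' div_mod_less[OF i] div_mod_less[OF i'] by (simp add: index_kron_vec)
qed

lemma scalar_prod_kron_vec:
  assumes "dim_vec a = dim_vec c" "dim_vec b = dim_vec d"
  shows "kron_vec a b \<bullet> kron_vec c d = (a \<bullet> c) * (b \<bullet> d)"
proof -
  have "kron_vec a b \<bullet> kron_vec c d = (\<Sum>i = 0..<dim_vec a * dim_vec b.
      (\<lambda>i j. (a $ i * c $ i) * (b $ j * d $ j)) (i div dim_vec b) (i mod dim_vec b))"
    unfolding scalar_prod_def by (rule sum.cong) (auto simp: assms index_kron_vec)
  also have "\<dots> = (\<Sum>i = 0..<dim_vec a. \<Sum>j = 0..<dim_vec b. (a $ i * c $ i) * (b $ j * d $ j))"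
    by (rule sum_div_mod)
  also have "\<dots> = (a \<bullet> c) * (b \<bullet> d)"
    by (simp add: scalar_prod_def assms sum_product)
  finally show ?thesis .
qed

lemma dim_kron [simp]:
  "dim_row (M \<otimes>\<^sub>m N) = dim_row M * dim_row N" "dim_col (M \<otimes>\<^sub>m N) = dim_col M * dim_col N"
  by (simp_all add: kron_def)

lemma kron_carrier [intro]:
  "M \<in> carrier_mat a b \<Longrightarrow> N \<in> carrier_mat c d \<Longrightarrow> M \<otimes>\<^sub>m N \<in> carrier_mat (a * c) (b * d)"
  by (auto intro: carrier_matI)

lemma row_kron:
  assumes "i < dim_row M * dim_row N"
  shows "row (M \<otimes>\<^sub>m N) i = kron_vec (row M (i div dim_row N)) (row N (i mod dim_row N))"
  using assms by (auto simp: kron_def index_kron_vec div_mod_less)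

lemma kron_mult_kron_vec:
  assumes "dim_vec a = dim_col M" "dim_vec b = dim_col N"
  shows "(M \<otimes>\<^sub>m N) *\<^sub>v kron_vec a b = kron_vec (M *\<^sub>v a) (N *\<^sub>v b)"
  by (rule eq_vecI)
    (auto simp: row_kron index_kron_vec div_mod_less assms scalar_prod_kron_vec)

lemma transpose_kron: "(M \<otimes>\<^sub>m N)\<^sup>T = M\<^sup>T \<otimes>\<^sub>m N\<^sup>T"
  by (rule eq_matI) (auto simp: kron_def div_mod_less)

lemma kron_vec_one [simp]:
  "kron_vec (vec (Suc 0) (\<lambda>_. 1)) b = b" "kron_vec b (vec (Suc 0) (\<lambda>_. 1)) = b"
  by (rule eq_vecI; simp add: index_kron_vec)+

lemma dim_vectorize [simp]: "dim_vec (vectorize M) = dim_row M * dim_col M"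
  by (simp add: vectorize_def)

text \<open>Columns are stacked, so the column index is the leading digit: the vector on the column
  side comes first in the Kronecker product.\<close>

lemma vectorize_scalar_prod_kron_vec:
  assumes "M \<in> carrier_mat p q" "a \<in> carrier_vec p" "b \<in> carrier_vec q"
  shows "vectorize M \<bullet> kron_vec b a = a \<bullet> (M *\<^sub>v b)"
proof -
  have "vectorize M \<bullet> kron_vec b a
      = (\<Sum>i = 0..<q * p. (\<lambda>j i. M $$ (i, j) * (b $ j * a $ i)) (i div p) (i mod p))"
    unfolding scalar_prod_def using assms
    by (intro sum.cong) (auto simp: index_kron_vec vectorize_def mult.commute)
  also have "\<dots> = (\<Sum>j = 0..<q. \<Sum>i = 0..<p. M $$ (i, j) * (b $ j * a $ i))"
    by (rule sum_div_mod)
  also have "\<dots> = (\<Sum>i = 0..<p. \<Sum>j = 0..<q. M $$ (i, j) * (b $ j * a $ i))"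
    by (rule sum.swap)
  also have "\<dots> = a \<bullet> (M *\<^sub>v b)"
    using assms by (auto simp: scalar_prod_def sum_distrib_left mult_ac intro!: sum.cong)
  finally show ?thesis .
qed

text \<open>\<open>kron_vec b a\<close> is the vectorization of the rank one matrix a b^T, and the
  shuffle transposes it.\<close>

lemma shuffle_mult_kron_vec:
  assumes "a \<in> carrier_vec p" "b \<in> carrier_vec q"
  shows "shuffle q p *\<^sub>v kron_vec b a = kron_vec a b"
proof -
  define M where "M = mat p q (\<lambda>(i, j). a $ i * b $ j)"
  have "kron_vec b a = vectorize M"
    by (rule eq_vecI) (use assms in \<open>auto simp: M_def vectorize_def index_kron_vec mult.commute div_mod_less\<close>)
  moreover have "kron_vec a b = vectorize M\<^sup>T"
  proof (rule eq_vecI)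
    fix i assume "i < dim_vec (vectorize M\<^sup>T)"
    hence i: "i < p * q" by (simp add: M_def mult.commute)
    thus "kron_vec a b $ i = vectorize M\<^sup>T $ i"
      using assms div_mod_less[OF i]
      by (simp add: M_def vectorize_def index_kron_vec mult.commute[of q p])
  qed (use assms in \<open>simp add: M_def\<close>)
  ultimately show ?thesis
    using shuffle_vectorize[of M p q] by (simp add: M_def)
qed

lemma dim_shuffle [simp]: "dim_row (shuffle q p) = p * q" "dim_col (shuffle q p) = p * q"
  by (simp_all add: shuffle_def)

lemma dim_col_mat [simp]: "dim_row (col_mat v) = dim_vec v" "dim_col (col_mat v) = 1"
  by (simp_all add: col_mat_def)

lemma col_mat_mult_one: "col_mat x *\<^sub>v vec 1 (\<lambda>_. 1) = x"
  by (rule eq_vecI) (auto simp: col_mat_def scalar_prod_def mat_of_cols_def)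

lemma transpose_col_mat_mult:
  "dim_vec v = dim_vec x \<Longrightarrow> (col_mat v)\<^sup>T *\<^sub>v x = vec 1 (\<lambda>_. v \<bullet> x)"
  by (rule eq_vecI) (auto simp: col_mat_def scalar_prod_def mat_of_cols_def)

text \<open>Inserting the one-entry vector 1 as a left Kronecker factor of b brings the product into
  the form of the mixed product rule.\<close>

lemma col_mat_kron_mult:
  assumes "M \<in> carrier_mat p q" "b \<in> carrier_vec q"
  shows "(col_mat x \<otimes>\<^sub>m M) *\<^sub>v b = kron_vec x (M *\<^sub>v b)"
  using kron_mult_kron_vec[of "vec 1 (\<lambda>_. 1)" "col_mat x" b M] assms
  by (simp add: col_mat_mult_one[simplified])

lemma kron_vec_list_simps [simp]:
  "kron_vec_list [] = vec (Suc 0) (\<lambda>_. 1)"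
  "kron_vec_list (a # as) = kron_vec a (kron_vec_list as)"
  by (simp_all add: kron_vec_list_def)

lemma kron_list_simps [simp]:
  "kron_list [] = 1\<^sub>m (Suc 0)" "kron_list (a # as) = a \<otimes>\<^sub>m kron_list as"
  by (simp_all add: kron_list_def)

lemma kron_vec_list_append:
  "kron_vec_list (as @ bs) = kron_vec (kron_vec_list as) (kron_vec_list bs)"
  by (induction as) (simp_all add: kron_vec_assoc)

lemma kron_vec_list_carrier:
  "set as \<subseteq> carrier_vec n \<Longrightarrow> kron_vec_list as \<in> carrier_vec (n ^ length as)"
  by (induction as) (auto intro: carrier_vecI)

text \<open>The dimension equation strengthens the induction, because the mixed product rule demands
  it of the tails.\<close>

lemma kron_list_mult_kron_vec_list:
  assumes "list_all2 (\<lambda>M a. dim_vec a = dim_col M) Ms as"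
  shows "kron_list Ms *\<^sub>v kron_vec_list as = kron_vec_list (map2 (\<lambda>M a. M *\<^sub>v a) Ms as)
    \<and> dim_vec (kron_vec_list as) = dim_col (kron_list Ms)"
  using assms
proof (induction rule: list_all2_induct)
  case Nil
  show ?case by (simp add: one_mult_mat_vec)
next
  case (Cons M Ms a as)
  thus ?case by (simp add: kron_mult_kron_vec)
qed

lemma kron_pow_0 [simp]: "x ^\<^sub>\<otimes> 0 = vec (Suc 0) (\<lambda>_. 1)"
  by (simp add: kron_pow_def)

lemma kron_pow_Suc: "x ^\<^sub>\<otimes> Suc k = kron_vec x (x ^\<^sub>\<otimes> k)"
  by (simp add: kron_pow_def)

lemma kron_pow_add: "x ^\<^sub>\<otimes> (a + b) = kron_vec (x ^\<^sub>\<otimes> a) (x ^\<^sub>\<otimes> b)"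
  by (simp add: kron_pow_def replicate_add kron_vec_list_append)

lemma kron_pow_1 [simp]: "x ^\<^sub>\<otimes> Suc 0 = x"
  by (simp add: kron_pow_Suc)

lemma dim_kron_pow [simp]: "dim_vec (x ^\<^sub>\<otimes> k) = dim_vec x ^ k"
  by (induction k) (simp_all add: kron_pow_Suc)

lemma kron_pow_carrier [intro]: "x \<in> carrier_vec n \<Longrightarrow> x ^\<^sub>\<otimes> k \<in> carrier_vec (n ^ k)"
  by (auto intro: carrier_vecI)

lemma smult_kron_vec:
  "kron_vec (c \<cdot>\<^sub>v a) b = c \<cdot>\<^sub>v kron_vec a b" "kron_vec a (c \<cdot>\<^sub>v b) = c \<cdot>\<^sub>v kron_vec a b"
  by (rule eq_vecI; simp add: index_kron_vec div_mod_less)+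

lemma kron_pow_smult: "(c \<cdot>\<^sub>v x) ^\<^sub>\<otimes> k = c ^ k \<cdot>\<^sub>v (x ^\<^sub>\<otimes> k)"
  by (induction k) (auto simp: kron_pow_Suc smult_kron_vec smult_smult_assoc mult.commute)

section \<open>Finite sums, and derivatives of Kronecker powers\<close>

lemma dim_vec_sum [simp]: "dim_vec (vec_sum n f S) = n"
  by (simp add: vec_sum_def)

lemma vec_sum_carrier [simp]: "vec_sum n f S \<in> carrier_vec n"
  by (simp add: carrier_vecI)

lemma scalar_prod_vec_sum:
  assumes "u \<in> carrier_vec n" "\<And>s. s \<in> S \<Longrightarrow> f s \<in> carrier_vec n"
  shows "u \<bullet> vec_sum n f S = (\<Sum>s\<in>S. u \<bullet> f s)"
proof -
  have "u \<bullet> vec_sum n f S = (\<Sum>i = 0..<n. \<Sum>s\<in>S. u $ i * f s $ i)"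
    by (auto simp: scalar_prod_def vec_sum_def sum_distrib_left)
  also have "\<dots> = (\<Sum>s\<in>S. \<Sum>i = 0..<n. u $ i * f s $ i)" by (rule sum.swap)
  also have "\<dots> = (\<Sum>s\<in>S. u \<bullet> f s)"
    by (rule sum.cong) (use assms(2) in \<open>force simp: scalar_prod_def\<close>)+
  finally show ?thesis .
qed

lemma vec_sum_scalar_prod:
  assumes "u \<in> carrier_vec n"
  shows "vec_sum n f S \<bullet> u = (\<Sum>s\<in>S. f s \<bullet> u)"
proof -
  have "vec_sum n f S \<bullet> u = (\<Sum>i = 0..<n. \<Sum>s\<in>S. f s $ i * u $ i)"
    using assms by (auto simp: scalar_prod_def vec_sum_def sum_distrib_right)
  also have "\<dots> = (\<Sum>s\<in>S. \<Sum>i = 0..<n. f s $ i * u $ i)" by (rule sum.swap)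
  also have "\<dots> = (\<Sum>s\<in>S. f s \<bullet> u)"
    by (rule sum.cong) (use assms in \<open>auto simp: scalar_prod_def\<close>)
  finally show ?thesis .
qed

lemma mat_sum_carrier [simp]: "mat_sum nr nc f S \<in> carrier_mat nr nc"
  by (simp add: mat_sum_def)

lemma dim_mat_sum [simp]: "dim_row (mat_sum nr nc f S) = nr" "dim_col (mat_sum nr nc f S) = nc"
  by (simp_all add: mat_sum_def)

lemma mat_sum_mult_vec:
  assumes "\<And>s. s \<in> S \<Longrightarrow> f s \<in> carrier_mat nr nc" "x \<in> carrier_vec nc"
  shows "mat_sum nr nc f S *\<^sub>v x = vec_sum nr (\<lambda>s. f s *\<^sub>v x) S"
proof (rule eq_vecI)
  fix i assume "i < dim_vec (vec_sum nr (\<lambda>s. f s *\<^sub>v x) S)"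
  hence i: "i < nr" by simp
  have "(mat_sum nr nc f S *\<^sub>v x) $ i = (\<Sum>j = 0..<nc. \<Sum>s\<in>S. f s $$ (i, j) * x $ j)"
    using i assms(2) by (simp add: mat_sum_def scalar_prod_def sum_distrib_right)
  also have "\<dots> = (\<Sum>s\<in>S. \<Sum>j = 0..<nc. f s $$ (i, j) * x $ j)" by (rule sum.swap)
  also have "\<dots> = (\<Sum>s\<in>S. (f s *\<^sub>v x) $ i)"
  proof (rule sum.cong[OF refl])
    fix s assume "s \<in> S"
    hence "f s \<in> carrier_mat nr nc" by (rule assms(1))
    thus "(\<Sum>j = 0..<nc. f s $$ (i, j) * x $ j) = (f s *\<^sub>v x) $ i"
      using assms(2) i by (simp add: scalar_prod_def)
  qed
  finally show "(mat_sum nr nc f S *\<^sub>v x) $ i = vec_sum nr (\<lambda>s. f s *\<^sub>v x) S $ i"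
    using i by (simp add: vec_sum_def)
qed simp

text \<open>The derivative of the k-th Kronecker power at x in direction y: one factor x is replaced
  by y, in each position a. The same expression is what a Lyapunov matrix makes of a power.\<close>

definition dkron :: "nat \<Rightarrow> nat \<Rightarrow> real vec \<Rightarrow> real vec \<Rightarrow> real vec" where
  "dkron n k x y =
     vec_sum (n ^ k) (\<lambda>a. kron_vec (x ^\<^sub>\<otimes> a) (kron_vec y (x ^\<^sub>\<otimes> (k - 1 - a)))) {..<k}"

lemma dkron_carrier [simp]: "dkron n k x y \<in> carrier_vec (n ^ k)"
  by (simp add: dkron_def)

lemma dim_dkron [simp]: "dim_vec (dkron n k x y) = n ^ k"
  by (simp add: dkron_def)

lemma kron_insert_carrier:
  assumes "x \<in> carrier_vec n" "y \<in> carrier_vec n" "a < k"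
  shows "kron_vec (x ^\<^sub>\<otimes> a) (kron_vec y (x ^\<^sub>\<otimes> (k - 1 - a))) \<in> carrier_vec (n ^ k)"
proof -
  have "n ^ k = n ^ a * (n * n ^ (k - 1 - a))"
    unfolding power_Suc[symmetric] power_add[symmetric]
    by (rule arg_cong[where f = "(^) n"]) (use assms(3) in simp)
  thus ?thesis using assms by (auto intro!: carrier_vecI)
qed

lemma scalar_prod_dkron:
  assumes "u \<in> carrier_vec (n ^ k)" "x \<in> carrier_vec n" "y \<in> carrier_vec n"
  shows "u \<bullet> dkron n k x y
    = (\<Sum>a<k. u \<bullet> kron_vec (x ^\<^sub>\<otimes> a) (kron_vec y (x ^\<^sub>\<otimes> (k - 1 - a))))"
  unfolding dkron_def using assms kron_insert_carrier
  by (intro scalar_prod_vec_sum) auto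

lemma dkron_0: "dkron n 0 x y = 0\<^sub>v 1"
  by (auto simp: dkron_def vec_sum_def)

lemma kron_vec_vec_sum:
  assumes "x \<in> carrier_vec n" "\<And>s. s \<in> S \<Longrightarrow> f s \<in> carrier_vec m"
  shows "kron_vec x (vec_sum m f S) = vec_sum (n * m) (\<lambda>s. kron_vec x (f s)) S"
proof (rule eq_vecI)
  fix i assume "i < dim_vec (vec_sum (n * m) (\<lambda>s. kron_vec x (f s)) S)"
  hence i: "i < n * m" by simp
  have "(\<Sum>s\<in>S. kron_vec x (f s) $ i) = (\<Sum>s\<in>S. x $ (i div m) * f s $ (i mod m))"
  proof (rule sum.cong[OF refl])
    fix s assume "s \<in> S"
    hence "dim_vec (f s) = m" using assms by auto
    thus "kron_vec x (f s) $ i = x $ (i div m) * f s $ (i mod m)"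
      using i assms(1) by (simp add: index_kron_vec)
  qed
  thus "kron_vec x (vec_sum m f S) $ i = vec_sum (n * m) (\<lambda>s. kron_vec x (f s)) S $ i"
    using i assms div_mod_less[OF i]
    by (simp add: index_kron_vec vec_sum_def sum_distrib_left)
qed (use assms in simp)

text \<open>The Leibniz rule for x \<otimes> x^k. The later inductions on the degree run through
  this recursion instead of the sum.\<close>

lemma dkron_Suc:
  assumes "x \<in> carrier_vec n" "y \<in> carrier_vec n"
  shows "dkron n (Suc k) x y = kron_vec y (x ^\<^sub>\<otimes> k) + kron_vec x (dkron n k x y)"
proof (rule eq_vecI)
  let ?f = "\<lambda>k a. kron_vec (x ^\<^sub>\<otimes> a) (kron_vec y (x ^\<^sub>\<otimes> (k - 1 - a)))"
  have eq: "kron_vec x (dkron n k x y) = vec_sum (n * n ^ k) (\<lambda>a. kron_vec x (?f k a)) {..<k}"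
    unfolding dkron_def by (rule kron_vec_vec_sum) (use assms kron_insert_carrier in auto)
  fix i assume "i < dim_vec (kron_vec y (x ^\<^sub>\<otimes> k) + kron_vec x (dkron n k x y))"
  hence i: "i < n * n ^ k" using assms by (simp add: dkron_def)
  have s: "kron_vec (x ^\<^sub>\<otimes> Suc a) z = kron_vec x (kron_vec (x ^\<^sub>\<otimes> a) z)" for a z
    by (simp add: kron_pow_Suc kron_vec_assoc)
  have "dkron n (Suc k) x y $ i = (\<Sum>a<Suc k. ?f (Suc k) a $ i)"
    using i by (simp add: dkron_def vec_sum_def)
  also have "\<dots> = ?f (Suc k) 0 $ i + (\<Sum>a<k. ?f (Suc k) (Suc a) $ i)"
    by (rule sum.lessThan_Suc_shift)
  also have "\<dots> = (kron_vec y (x ^\<^sub>\<otimes> k) + kron_vec x (dkron n k x y)) $ i"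
    using i assms unfolding eq by (simp add: vec_sum_def s)
  finally show "dkron n (Suc k) x y $ i = (kron_vec y (x ^\<^sub>\<otimes> k) + kron_vec x (dkron n k x y)) $ i" .
qed (use assms in \<open>simp add: dkron_def\<close>)

lemma has_derivative_kron_pow_index:
  assumes x: "x \<in> carrier_vec n" and y: "y \<in> carrier_vec n" and "j < n ^ k"
  shows "((\<lambda>t. ((x + t \<cdot>\<^sub>v y) ^\<^sub>\<otimes> k) $ j) has_real_derivative dkron n k (x + s \<cdot>\<^sub>v y) y $ j) (at s)"
  using assms(3)
proof (induction k arbitrary: j)
  case 0
  thus ?case by (simp add: dkron_0)
next
  case (Suc k)
  let ?z = "\<lambda>t. x + t \<cdot>\<^sub>v y"
  have z: "?z t \<in> carrier_vec n" for t using x y by auto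
  have j: "j < n * n ^ k" using Suc.prems by simp
  note j' = div_mod_less[OF j]
  have 1: "((\<lambda>t. ?z t $ (j div n ^ k)) has_real_derivative y $ (j div n ^ k)) (at s)"
    using x y j' by (auto intro!: derivative_eq_intros)
  have "((\<lambda>t. ?z t $ (j div n ^ k) * (?z t ^\<^sub>\<otimes> k) $ (j mod n ^ k)) has_real_derivative
      y $ (j div n ^ k) * (?z s ^\<^sub>\<otimes> k) $ (j mod n ^ k) +
      ?z s $ (j div n ^ k) * dkron n k (?z s) y $ (j mod n ^ k)) (at s)"
    using DERIV_mult[OF 1 Suc.IH[OF j'(2)]] by (simp add: mult.commute)
  moreover have "?z t $ (j div n ^ k) * (?z t ^\<^sub>\<otimes> k) $ (j mod n ^ k) = (?z t ^\<^sub>\<otimes> Suc k) $ j" for t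
    using j z[of t] x y by (simp add: kron_pow_Suc index_kron_vec)
  moreover have "y $ (j div n ^ k) * (?z s ^\<^sub>\<otimes> k) $ (j mod n ^ k) +
      ?z s $ (j div n ^ k) * dkron n k (?z s) y $ (j mod n ^ k) = dkron n (Suc k) (?z s) y $ j"
    using j x y z[of s] unfolding dkron_Suc[OF z y]
    by (simp add: index_kron_vec)
  ultimately show ?case by simp
qed

lemma has_derivative_scalar_prod_kron_pow:
  assumes "x \<in> carrier_vec n" "y \<in> carrier_vec n" "u \<in> carrier_vec (n ^ k)"
  shows "((\<lambda>t. u \<bullet> ((x + t \<cdot>\<^sub>v y) ^\<^sub>\<otimes> k)) has_real_derivative u \<bullet> dkron n k (x + s \<cdot>\<^sub>v y) y) (at s)"
proof -
  have d: "dim_vec ((x + t \<cdot>\<^sub>v y) ^\<^sub>\<otimes> k) = n ^ k" for t using assms by simp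
  have "((\<lambda>t. \<Sum>j = 0..<n ^ k. u $ j * ((x + t \<cdot>\<^sub>v y) ^\<^sub>\<otimes> k) $ j) has_real_derivative
      (\<Sum>j = 0..<n ^ k. u $ j * dkron n k (x + s \<cdot>\<^sub>v y) y $ j)) (at s)"
    by (intro DERIV_sum DERIV_cmult has_derivative_kron_pow_index) (use assms in auto)
  thus ?thesis unfolding scalar_prod_def d by (simp add: dkron_def)
qed

text \<open>The power is cut into i - 1 single factors, a block of p factors that meets M, and k - i
  single factors; the mixed product rule then acts block by block.\<close>

lemma lyapunov_summand_mult_kron_pow:
  assumes M: "M \<in> carrier_mat n (n ^ p)" and x: "x \<in> carrier_vec n" and i: "1 \<le> i" "i \<le> k"
  shows "kron_list (map (\<lambda>j. if j = i then M else 1\<^sub>m (dim_row M)) [1..<Suc k]) *\<^sub>v x ^\<^sub>\<otimes> (k - 1 + p)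
      = kron_vec (x ^\<^sub>\<otimes> (i - 1)) (kron_vec (M *\<^sub>v x ^\<^sub>\<otimes> p) (x ^\<^sub>\<otimes> (k - i)))" (is ?eq)
    and "kron_list (map (\<lambda>j. if j = i then M else 1\<^sub>m (dim_row M)) [1..<Suc k])
      \<in> carrier_mat (n ^ k) (n ^ (k - 1 + p))" (is ?carrier)
proof -
  let ?L = "map (\<lambda>j. if j = i then M else 1\<^sub>m (dim_row M)) [1..<Suc k]"
  let ?Ms = "replicate (i - 1) (1\<^sub>m n) @ [M] @ replicate (k - i) (1\<^sub>m n)"
  let ?as = "replicate (i - 1) x @ [x ^\<^sub>\<otimes> p] @ replicate (k - i) x"
  have L: "?L = ?Ms"
    by (rule nth_equalityI) (use i M in \<open>auto simp: nth_append nth_Cons' simp del: upt_Suc\<close>)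
  have all2: "list_all2 (\<lambda>M a. dim_vec a = dim_col M) ?Ms ?as"
    using M x by (auto simp: list_all2_conv_all_nth nth_append nth_Cons')
  have r: "map2 (*\<^sub>v) (replicate c (1\<^sub>m n)) (replicate c x) = replicate c x" for c
    using one_mult_mat_vec[OF x] by (induction c) auto
  have "map2 (\<lambda>M a. M *\<^sub>v a) ?Ms ?as = replicate (i - 1) x @ [M *\<^sub>v x ^\<^sub>\<otimes> p] @ replicate (k - i) x"
    using r[of "i - 1"] r[of "k - i"] by simp
  moreover have "kron_vec_list ?as = x ^\<^sub>\<otimes> ((i - 1) + (p + (k - i)))"
    by (simp add: kron_vec_list_append kron_pow_add flip: kron_pow_def)
  moreover have "x ^\<^sub>\<otimes> ((i - 1) + (p + (k - i))) = x ^\<^sub>\<otimes> (k - 1 + p)"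
    using i by (intro arg_cong[where f="\<lambda>e. x ^\<^sub>\<otimes> e"]) linarith
  ultimately have as1: "map2 (\<lambda>M a. M *\<^sub>v a) ?Ms ?as
        = replicate (i - 1) x @ [M *\<^sub>v x ^\<^sub>\<otimes> p] @ replicate (k - i) x"
      and as2: "kron_vec_list ?as = x ^\<^sub>\<otimes> (k - 1 + p)"
    by (simp_all only:)
  have "kron_list ?L *\<^sub>v x ^\<^sub>\<otimes> (k - 1 + p)
      = kron_vec_list (replicate (i - 1) x @ [M *\<^sub>v x ^\<^sub>\<otimes> p] @ replicate (k - i) x)"
    and col: "dim_col (kron_list ?L) = n ^ (k - 1 + p)"
    using kron_list_mult_kron_vec_list[OF all2] x unfolding L as1 as2 by simp_all
  thus eq: ?eq by (simp add: kron_vec_list_append flip: kron_pow_def)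
  \<comment> \<open>The row dimension is read off the equation just proved, whose two sides have
    equally many entries.\<close>
  have "dim_row (kron_list ?L) = n ^ (i - 1) * (n * n ^ (k - i))"
    using arg_cong[OF eq, of dim_vec] M x by simp
  also have "\<dots> = n ^ k" unfolding power_Suc[symmetric] power_add[symmetric]
    by (rule arg_cong[where f = "(^) n"]) (use i in auto)
  finally show ?carrier using col by auto
qed

lemma lyapunov_mat_carrier:
  assumes "M \<in> carrier_mat n (n ^ p)"
  shows "lyapunov_mat k M \<in> carrier_mat (n ^ k) (n ^ (k - 1 + p))"
  using assms by (simp add: lyapunov_mat_def power_add)

lemma lyapunov_mat_mult_kron_pow:
  assumes M: "M \<in> carrier_mat n (n ^ p)" and x: "x \<in> carrier_vec n"
  shows "lyapunov_mat k M *\<^sub>v x ^\<^sub>\<otimes> (k - 1 + p) = dkron n k x (M *\<^sub>v x ^\<^sub>\<otimes> p)"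
proof -
  have "lyapunov_mat k M *\<^sub>v x ^\<^sub>\<otimes> (k - 1 + p) = vec_sum (n ^ k)
     (\<lambda>i. kron_vec (x ^\<^sub>\<otimes> (i - 1)) (kron_vec (M *\<^sub>v x ^\<^sub>\<otimes> p) (x ^\<^sub>\<otimes> (k - i)))) {1..k}"
    (is "_ = vec_sum _ ?g _")
  proof -
    have "lyapunov_mat k M *\<^sub>v x ^\<^sub>\<otimes> (k - 1 + p) = vec_sum (n ^ k)
      (\<lambda>i. kron_list (map (\<lambda>j. if j = i then M else 1\<^sub>m (dim_row M)) [1..<Suc k]) *\<^sub>v x ^\<^sub>\<otimes> (k - 1 + p)) {1..k}"
      using mat_sum_mult_vec[of "{1..k}", OF lyapunov_summand_mult_kron_pow(2)[OF M x] kron_pow_carrier[OF x]] M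
      by (simp add: lyapunov_mat_def power_add del: upt_Suc)
    also have "\<dots> = vec_sum (n ^ k) ?g {1..k}"
      unfolding vec_sum_def using lyapunov_summand_mult_kron_pow(1)[OF M x]
      by (intro eq_vecI) (auto intro!: sum.cong simp del: upt_Suc)
    finally show ?thesis .
  qed
  also have "\<dots> = dkron n k x (M *\<^sub>v x ^\<^sub>\<otimes> p)"
    by (auto simp: vec_sum_def dkron_def sum.atLeast1_atMost_eq)
  finally show ?thesis .
qed

text \<open>Tested on a power, the transposed Lyapunov matrix is the derivative of v^T x^k along the
  vector field M x^p. The exponent is a separate variable so that the rule fits degrees given by
  equations such as i + p = k + 1.\<close>

lemma lyapunov_mat_transpose_scalar_prod:
  assumes M: "M \<in> carrier_mat n (n ^ p)" and x: "x \<in> carrier_vec n" and v: "v \<in> carrier_vec (n ^ k)"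
    and K: "K = k - 1 + p"
  shows "((lyapunov_mat k M)\<^sup>T *\<^sub>v v) \<bullet> x ^\<^sub>\<otimes> K = v \<bullet> dkron n k x (M *\<^sub>v x ^\<^sub>\<otimes> p)"
  unfolding K lyapunov_mat_mult_kron_pow[OF M x, symmetric]
  by (rule transpose_vec_mult_scalar[OF lyapunov_mat_carrier[OF M] kron_pow_carrier[OF x] v])

section \<open>Symmetric coefficients and polarization\<close>

lemma symmetric_coeff_carrier: "symmetric_coeff n k v \<Longrightarrow> v \<in> carrier_vec (n ^ k)"
  by (simp add: symmetric_coeff_def)

text \<open>Symmetry speaks of permutations of positions; equal multisets provide such a
  permutation, and multisets are easier to compare than positions.\<close>

lemma symmetric_coeff_mset_eq:
  assumes v: "symmetric_coeff n k v" and "length xs = k" "set xs \<subseteq> carrier_vec n"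
    and "mset xs = mset ys"
  shows "v \<bullet> kron_vec_list xs = v \<bullet> kron_vec_list ys"
proof -
  have len: "length ys = k" and sub: "set ys \<subseteq> carrier_vec n"
    using assms mset_eq_length mset_eq_setD by metis+
  obtain p where p: "p permutes {..<length ys}" "permute_list p ys = xs"
    using mset_eq_permutation[OF assms(4)] by blast
  have "v \<bullet> kron_vec_list (map (\<lambda>i. ys ! i) [0..<k]) = v \<bullet> kron_vec_list (map (\<lambda>i. ys ! (p i)) [0..<k])"
    using v p(1) sub len unfolding symmetric_coeff_def by (metis nth_mem subsetD)
  thus ?thesis using p(2) len by (metis map_nth permute_list_def)
qed

lemma kron_vec_list_replicate: "kron_vec_list (replicate k x) = x ^\<^sub>\<otimes> k"
  by (simp add: kron_pow_def)

text \<open>All k insertions of y agree. The last position is the normal form because the leading k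
  - 1 factors index the columns of the reshaped matrix and the last one its rows.\<close>

lemma symmetric_coeff_dkron:
  assumes v: "symmetric_coeff n k v" and x: "x \<in> carrier_vec n" and y: "y \<in> carrier_vec n"
  shows "v \<bullet> dkron n k x y = real k * (v \<bullet> kron_vec (x ^\<^sub>\<otimes> (k - 1)) y)"
proof -
  have "v \<bullet> dkron n k x y = (\<Sum>a<k. v \<bullet> kron_vec (x ^\<^sub>\<otimes> a) (kron_vec y (x ^\<^sub>\<otimes> (k - 1 - a))))"
    by (rule scalar_prod_dkron) (use assms symmetric_coeff_carrier in auto)
  also have "\<dots> = (\<Sum>a<k. v \<bullet> kron_vec (x ^\<^sub>\<otimes> (k - 1)) y)"
  proof (rule sum.cong[OF refl])
    fix a assume "a \<in> {..<k}"
    hence a: "a < k" by simp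
    have "v \<bullet> kron_vec_list (replicate a x @ y # replicate (k - 1 - a) x)
        = v \<bullet> kron_vec_list (replicate (k - 1) x @ [y])"
    proof (rule symmetric_coeff_mset_eq[OF v])
      have "mset (replicate a x @ y # replicate (k - 1 - a) x)
          = mset (y # replicate (a + (k - 1 - a)) x)"
        by (simp add: replicate_add)
      also have "a + (k - 1 - a) = k - 1" using a by simp
      finally show "mset (replicate a x @ y # replicate (k - 1 - a) x)
        = mset (replicate (k - 1) x @ [y])" by simp
    qed (use a x y in auto)
    thus "v \<bullet> kron_vec (x ^\<^sub>\<otimes> a) (kron_vec y (x ^\<^sub>\<otimes> (k - 1 - a))) = v \<bullet> kron_vec (x ^\<^sub>\<otimes> (k - 1)) y"
      by (simp add: kron_vec_list_append kron_vec_list_replicate)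
  qed
  finally show ?thesis by simp
qed

lemma has_derivative_scalar_prod_kron_vec_kron_pow:
  assumes x: "x \<in> carrier_vec n" and y: "y \<in> carrier_vec n" and b: "b \<in> carrier_vec N"
    and u: "u \<in> carrier_vec (N * n ^ k)"
  shows "((\<lambda>t. u \<bullet> kron_vec b ((x + t \<cdot>\<^sub>v y) ^\<^sub>\<otimes> k)) has_real_derivative
     u \<bullet> kron_vec b (dkron n k (x + s \<cdot>\<^sub>v y) y)) (at s)"
proof -
  have d: "dim_vec (kron_vec b ((x + t \<cdot>\<^sub>v y) ^\<^sub>\<otimes> k)) = N * n ^ k"
    "dim_vec (kron_vec b (dkron n k (x + t \<cdot>\<^sub>v y) y)) = N * n ^ k" for t using assms by auto
  have "((\<lambda>t. \<Sum>j = 0..<N * n ^ k. u $ j * (b $ (j div n ^ k) * ((x + t \<cdot>\<^sub>v y) ^\<^sub>\<otimes> k) $ (j mod n ^ k)))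
      has_real_derivative
      (\<Sum>j = 0..<N * n ^ k. u $ j * (b $ (j div n ^ k) * dkron n k (x + s \<cdot>\<^sub>v y) y $ (j mod n ^ k)))) (at s)"
  proof (intro DERIV_sum DERIV_cmult has_derivative_kron_pow_index x y)
    fix j assume "j \<in> {0..<N * n ^ k}"
    thus "j mod n ^ k < n ^ k" by (intro div_mod_less(2)[of j N]) auto
  qed
  moreover have "u \<bullet> kron_vec b ((x + t \<cdot>\<^sub>v y) ^\<^sub>\<otimes> k)
     = (\<Sum>j = 0..<N * n ^ k. u $ j * (b $ (j div n ^ k) * ((x + t \<cdot>\<^sub>v y) ^\<^sub>\<otimes> k) $ (j mod n ^ k)))" for t
    unfolding scalar_prod_def d using assms by (intro sum.cong) (auto simp: index_kron_vec)
  moreover have "u \<bullet> kron_vec b (dkron n k (x + s \<cdot>\<^sub>v y) y)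
     = (\<Sum>j = 0..<N * n ^ k. u $ j * (b $ (j div n ^ k) * dkron n k (x + s \<cdot>\<^sub>v y) y $ (j mod n ^ k)))"
    unfolding scalar_prod_def d using assms by (intro sum.cong) (auto simp: index_kron_vec)
  ultimately show ?thesis by simp
qed

text \<open>Polarization by differentiation. A polynomial that vanishes for all x has a vanishing
  derivative in direction y, and by symmetry this derivative is m > 0 times the value with one copy
  of x replaced by y. Repeating this fills one slot after the other.\<close>

lemma symmetric_coeff_polarization:
  assumes u: "symmetric_coeff n k u" and zero: "\<And>x. x \<in> carrier_vec n \<Longrightarrow> u \<bullet> x ^\<^sub>\<otimes> k = 0"
  shows "length as \<le> k \<Longrightarrow> set as \<subseteq> carrier_vec n \<Longrightarrow> x \<in> carrier_vec n \<Longrightarrow>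
     u \<bullet> kron_vec (kron_vec_list as) (x ^\<^sub>\<otimes> (k - length as)) = 0"
proof (induction as arbitrary: x)
  case Nil
  thus ?case using zero by simp
next
  case (Cons y as)
  define m where "m = k - length as"
  have m: "0 < m" "k = length as + m" using Cons.prems by (auto simp: m_def)
  have y: "y \<in> carrier_vec n" and as: "set as \<subseteq> carrier_vec n" using Cons.prems by auto
  note x = \<open>x \<in> carrier_vec n\<close>
  let ?b = "kron_vec_list as"
  have b: "?b \<in> carrier_vec (n ^ length as)" by (rule kron_vec_list_carrier[OF as])
  have uc: "u \<in> carrier_vec (n ^ length as * n ^ m)"
    using symmetric_coeff_carrier[OF u] by (simp add: m power_add)
  have "((\<lambda>t. u \<bullet> kron_vec ?b ((x + t \<cdot>\<^sub>v y) ^\<^sub>\<otimes> m)) has_real_derivative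
     u \<bullet> kron_vec ?b (dkron n m (x + 0 \<cdot>\<^sub>v y) y)) (at 0)"
    by (rule has_derivative_scalar_prod_kron_vec_kron_pow[OF x y b uc])
  moreover have "u \<bullet> kron_vec ?b ((x + t \<cdot>\<^sub>v y) ^\<^sub>\<otimes> m) = 0" for t
    using Cons.IH[of "x + t \<cdot>\<^sub>v y"] Cons.prems x y by (simp add: m_def)
  moreover have "x + 0 \<cdot>\<^sub>v y = x" using x y by auto
  ultimately have "((\<lambda>t. 0) has_real_derivative u \<bullet> kron_vec ?b (dkron n m x y)) (at 0)"
    by (simp only:)
  from DERIV_unique[OF DERIV_const this]
  have "0 = u \<bullet> kron_vec ?b (dkron n m x y)" .
  also have "kron_vec ?b (dkron n m x y) = vec_sum (n ^ length as * n ^ m)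
      (\<lambda>a. kron_vec ?b (kron_vec (x ^\<^sub>\<otimes> a) (kron_vec y (x ^\<^sub>\<otimes> (m - 1 - a))))) {..<m}"
    unfolding dkron_def by (rule kron_vec_vec_sum[OF b]) (use kron_insert_carrier x y in auto)
  also have "u \<bullet> \<dots> = (\<Sum>a<m. u \<bullet> kron_vec ?b (kron_vec (x ^\<^sub>\<otimes> a) (kron_vec y (x ^\<^sub>\<otimes> (m - 1 - a)))))"
    by (rule scalar_prod_vec_sum[OF uc]) (use kron_insert_carrier x y b in auto)
  also have "\<dots> = (\<Sum>a<m. u \<bullet> kron_vec (kron_vec_list (y # as)) (x ^\<^sub>\<otimes> (m - 1)))"
  proof (rule sum.cong[OF refl])
    fix a assume "a \<in> {..<m}"
    hence a: "a < m" by simp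
    have "u \<bullet> kron_vec_list (as @ replicate a x @ y # replicate (m - 1 - a) x)
        = u \<bullet> kron_vec_list ((y # as) @ replicate (m - 1) x)"
    proof (rule symmetric_coeff_mset_eq[OF u])
      have "mset (as @ replicate a x @ y # replicate (m - 1 - a) x)
          = mset (y # as @ replicate (a + (m - 1 - a)) x)"
        by (simp add: replicate_add)
      also have "a + (m - 1 - a) = m - 1" using a by simp
      finally show "mset (as @ replicate a x @ y # replicate (m - 1 - a) x)
        = mset ((y # as) @ replicate (m - 1) x)" by simp
    qed (use a x y as m in auto)
    thus "u \<bullet> kron_vec ?b (kron_vec (x ^\<^sub>\<otimes> a) (kron_vec y (x ^\<^sub>\<otimes> (m - 1 - a))))
        = u \<bullet> kron_vec (kron_vec_list (y # as)) (x ^\<^sub>\<otimes> (m - 1))"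
      by (simp only: kron_vec_list_append kron_vec_list_simps kron_vec_list_replicate)
  qed
  also have "\<dots> = real m * (u \<bullet> kron_vec (kron_vec_list (y # as)) (x ^\<^sub>\<otimes> (m - 1)))" by simp
  finally have "u \<bullet> kron_vec (kron_vec_list (y # as)) (x ^\<^sub>\<otimes> (m - 1)) = 0"
    using m(1) by simp
  moreover have "k - length (y # as) = m - 1" by (simp add: m_def)
  ultimately show ?case by (simp only:)
qed

text \<open>The base n digits of c name the unit vectors of the k factors.\<close>

lemma unit_vec_kron_vec_list:
  assumes "c < n ^ k"
  shows "\<exists>as. length as = k \<and> set as \<subseteq> carrier_vec n \<and> kron_vec_list as = unit_vec (n ^ k) c"
  using assms
proof (induction k arbitrary: c)
  case 0
  thus ?case by (intro exI[of _ "[]"]) auto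
next
  case (Suc k)
  hence c: "c < n * n ^ k" by simp
  note c' = div_mod_less[OF c]
  obtain as where as: "length as = k" "set as \<subseteq> carrier_vec n"
      "kron_vec_list as = unit_vec (n ^ k) (c mod n ^ k)"
    using Suc.IH[OF c'(2)] by blast
  have "kron_vec (unit_vec n (c div n ^ k)) (unit_vec (n ^ k) (c mod n ^ k)) = unit_vec (n * n ^ k) c"
  proof (rule eq_vecI)
    fix i assume "i < dim_vec (unit_vec (n * n ^ k) c :: real vec)"
    hence i: "i < n * n ^ k" by simp
    have "i div n ^ k = c div n ^ k \<and> i mod n ^ k = c mod n ^ k \<longleftrightarrow> i = c"
      by (metis div_mult_mod_eq)
    thus "kron_vec (unit_vec n (c div n ^ k)) (unit_vec (n ^ k) (c mod n ^ k)) $ i = unit_vec (n * n ^ k) c $ i"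
      using i c c' div_mod_less[OF i] by (auto simp: index_kron_vec unit_vec_def)
  qed simp
  thus ?case using as by (intro exI[of _ "unit_vec n (c div n ^ k) # as"]) auto
qed

lemma symmetric_coeff_eq_zeroI:
  assumes u: "symmetric_coeff n k u" and zero: "\<And>x. x \<in> carrier_vec n \<Longrightarrow> u \<bullet> x ^\<^sub>\<otimes> k = 0"
  shows "u = 0\<^sub>v (n ^ k)"
proof (rule eq_vecI)
  have uc: "u \<in> carrier_vec (n ^ k)" by (rule symmetric_coeff_carrier[OF u])
  thus "dim_vec u = dim_vec (0\<^sub>v (n ^ k) :: real vec)" by simp
  fix c assume "c < dim_vec (0\<^sub>v (n ^ k) :: real vec)"
  hence c: "c < n ^ k" by simp
  obtain as where as: "length as = k" "set as \<subseteq> carrier_vec n" "kron_vec_list as = unit_vec (n ^ k) c"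
    using unit_vec_kron_vec_list[OF c] by blast
  \<comment> \<open>All k slots are taken, so the remaining power has exponent 0 and its base point
    is arbitrary.\<close>
  have "u \<bullet> kron_vec (kron_vec_list as) (0\<^sub>v n ^\<^sub>\<otimes> (k - length as)) = 0"
    by (rule symmetric_coeff_polarization[OF u zero]) (use as in auto)
  thus "u $ c = 0\<^sub>v (n ^ k) $ c" using as c uc by simp
qed

lemma symmetric_coeff_minus:
  assumes "symmetric_coeff n k u" "symmetric_coeff n k v"
  shows "symmetric_coeff n k (u - v)"
proof -
  have "(u - v) \<bullet> kron_vec_list (map a [0..<k]) = (u - v) \<bullet> kron_vec_list (map (\<lambda>i. a (\<sigma> i)) [0..<k])"
    if a: "\<forall>i<k. a i \<in> carrier_vec n" and \<sigma>: "\<sigma> permutes {..<k}" for a \<sigma>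
  proof -
    have "\<forall>i<k. \<sigma> i < k" using \<sigma> permutes_in_image by fastforce
    hence sub: "set (map a [0..<k]) \<subseteq> carrier_vec n" "set (map (\<lambda>i. a (\<sigma> i)) [0..<k]) \<subseteq> carrier_vec n"
      using a by auto
    have "kron_vec_list (map a [0..<k]) \<in> carrier_vec (n ^ k)"
      "kron_vec_list (map (\<lambda>i. a (\<sigma> i)) [0..<k]) \<in> carrier_vec (n ^ k)"
      using sub[THEN kron_vec_list_carrier] by simp_all
    moreover have "u \<bullet> kron_vec_list (map a [0..<k]) = u \<bullet> kron_vec_list (map (\<lambda>i. a (\<sigma> i)) [0..<k])"
      "v \<bullet> kron_vec_list (map a [0..<k]) = v \<bullet> kron_vec_list (map (\<lambda>i. a (\<sigma> i)) [0..<k])"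
      using assms a \<sigma> unfolding symmetric_coeff_def by blast+
    ultimately show ?thesis
      using assms[THEN symmetric_coeff_carrier] by (simp add: minus_scalar_prod_distrib)
  qed
  thus ?thesis
    using assms[THEN symmetric_coeff_carrier] unfolding symmetric_coeff_def by auto
qed

text \<open>The coefficient v witnesses the description itself; uniqueness holds because a symmetric
  coefficient is determined by its polynomial.\<close>

lemma symmetrization_eqI:
  assumes v: "symmetric_coeff n k v"
    and eq: "\<And>x. x \<in> carrier_vec n \<Longrightarrow> v \<bullet> x ^\<^sub>\<otimes> k = w \<bullet> x ^\<^sub>\<otimes> k"
  shows "symmetrization n k w = v"
  unfolding symmetrization_def
proof (rule the_equality)
  fix v' assume v': "symmetric_coeff n k v' \<and> (\<forall>x\<in>carrier_vec n. v' \<bullet> x ^\<^sub>\<otimes> k = w \<bullet> x ^\<^sub>\<otimes> k)"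
  have c: "v \<in> carrier_vec (n ^ k)" "v' \<in> carrier_vec (n ^ k)"
    using v v' symmetric_coeff_carrier by auto
  have "v' - v = 0\<^sub>v (n ^ k)"
    by (rule symmetric_coeff_eq_zeroI[OF symmetric_coeff_minus])
      (use v v' c eq in \<open>auto simp: minus_scalar_prod_distrib[of _ "n ^ k"] kron_pow_carrier\<close>)
  show "v' = v"
  proof (rule eq_vecI)
    fix i assume "i < dim_vec v"
    thus "v' $ i = v $ i"
      using arg_cong[OF \<open>v' - v = 0\<^sub>v (n ^ k)\<close>, of "\<lambda>z. z $ i"] c by simp
  qed (use c in simp)
qed (use v eq in auto)

section \<open>Right-hand side terms tested on Kronecker powers\<close>

text \<open>The contribution of G_p and V_i to g(x)^T times the gradient of the energy, of degree p
  + i - 1 in x and without the factor i/2.\<close>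

definition input_term :: "nat \<Rightarrow> (nat \<Rightarrow> real mat) \<Rightarrow> (nat \<Rightarrow> real mat) \<Rightarrow> real vec \<Rightarrow> nat \<Rightarrow> nat \<Rightarrow> real vec" where
  "input_term m G V x p i =
     (col_mat (x ^\<^sub>\<otimes> p) \<otimes>\<^sub>m 1\<^sub>m m)\<^sup>T *\<^sub>v ((G p)\<^sup>T *\<^sub>v (V i *\<^sub>v x ^\<^sub>\<otimes> (i - 1)))"

lemma vectorize_one: "vectorize (1\<^sub>m m) = vec_sum (m * m) (\<lambda>a. kron_vec (unit_vec m a) (unit_vec m a)) {..<m}"
proof (rule eq_vecI)
  fix i assume "i < dim_vec (vec_sum (m * m) (\<lambda>a. kron_vec (unit_vec m a) (unit_vec m a)) {..<m})"
  hence i: "i < m * m" by simp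
  have "(\<Sum>a<m. kron_vec (unit_vec m a) (unit_vec m a) $ i)
      = (\<Sum>a<m. if a = i div m then (if i mod m = i div m then 1 else 0) else 0)"
    using i div_mod_less[OF i] by (intro sum.cong) (auto simp: index_kron_vec unit_vec_def)
  also have "\<dots> = vectorize (1\<^sub>m m) $ i"
    using i div_mod_less[OF i] by (simp add: vectorize_def)
  finally show "vectorize (1\<^sub>m m) $ i = vec_sum (m * m) (\<lambda>a. kron_vec (unit_vec m a) (unit_vec m a)) {..<m} $ i"
    using i by (simp add: vec_sum_def)
qed simp

text \<open>Multiplying by vec I_m inserts the sum of e_a \<otimes> e_a. A contraction with it is
  thus a sum over the input channels a, which can be treated one at a time.\<close>

lemma scalar_prod_kron_vec_vectorize_one:
  assumes "z \<in> carrier_vec (N * (m * m))" "y \<in> carrier_vec N"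
  shows "z \<bullet> kron_vec y (vectorize (1\<^sub>m m))
    = (\<Sum>a<m. z \<bullet> kron_vec y (kron_vec (unit_vec m a) (unit_vec m a)))"
proof -
  have "kron_vec y (vectorize (1\<^sub>m m))
      = vec_sum (N * (m * m)) (\<lambda>a. kron_vec y (kron_vec (unit_vec m a) (unit_vec m a))) {..<m}"
    unfolding vectorize_one by (rule kron_vec_vec_sum) (use assms in auto)
  moreover have "kron_vec y (kron_vec (unit_vec m a) (unit_vec m a)) \<in> carrier_vec (N * (m * m))" for a
    using assms(2) by (intro kron_vec_carrier) auto
  ultimately show ?thesis using scalar_prod_vec_sum[OF assms(1), of "{..<m}" "\<lambda>a. kron_vec y (kron_vec (unit_vec m a) (unit_vec m a))"]
    by (simp only:)
qed

lemma input_term_index: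
  assumes "a < m" "G p \<in> carrier_mat n (m * n ^ p)" "V i \<in> carrier_mat n (n ^ (i - 1))" "x \<in> carrier_vec n"
  shows "input_term m G V x p i $ a
     = ((G p)\<^sup>T *\<^sub>v (V i *\<^sub>v x ^\<^sub>\<otimes> (i - 1))) \<bullet> kron_vec (x ^\<^sub>\<otimes> p) (unit_vec m a)"
proof -
  let ?T = "col_mat (x ^\<^sub>\<otimes> p) \<otimes>\<^sub>m 1\<^sub>m m" and ?b = "(G p)\<^sup>T *\<^sub>v (V i *\<^sub>v x ^\<^sub>\<otimes> (i - 1))"
  have T: "?T \<in> carrier_mat (n ^ p * m) m" using assms by (auto intro!: carrier_matI)
  have b: "?b \<in> carrier_vec (n ^ p * m)" using assms by (auto intro!: carrier_vecI)
  have "input_term m G V x p i $ a = (?T\<^sup>T *\<^sub>v ?b) \<bullet> unit_vec m a"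
    using assms T by (subst scalar_prod_right_unit) (auto simp: input_term_def)
  also have "\<dots> = ?b \<bullet> (?T *\<^sub>v unit_vec m a)"
    by (rule transpose_vec_mult_scalar[OF T _ b]) simp
  also have "?T *\<^sub>v unit_vec m a = kron_vec (x ^\<^sub>\<otimes> p) (unit_vec m a)"
    by (subst col_mat_kron_mult[where p=m and q=m]) auto
  finally show ?thesis .
qed

lemma input_term_carrier: "input_term m G V x p i \<in> carrier_vec m"
  by (rule carrier_vecI) (simp add: input_term_def)

text \<open>Read from right to left on x^(k-p): the last factor appends e_a \<otimes> e_a, the
  shuffle moves the block x^(i-1) behind x^q \<otimes> e_a, the second factor contracts x^(j-1) and
  x^q \<otimes> e_a with vec[G_q^T V_j] to a scalar, and the first factor pairs the two remaining
  copies of the channel. What is left is the sum over a of the products of the a-th entries of two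
  input terms.\<close>

lemma cross_term_scalar_prod:
  assumes G: "\<And>p. G p \<in> carrier_mat n (m * n ^ p)"
    and Vi: "V i \<in> carrier_mat n (n ^ (i - 1))" and Vj: "V j \<in> carrier_mat n (n ^ (j - 1))"
    and x: "x \<in> carrier_vec n" and ij: "2 \<le> i" "2 \<le> j" and k: "i + j + (p + q) = k + 2"
  shows "cross_term n m G V k p q i j \<bullet> x ^\<^sub>\<otimes> k = input_term m G V x p i \<bullet> input_term m G V x q j"
    and "cross_term n m G V k p q i j \<in> carrier_vec (n ^ k)"
proof -
  let ?I = "vectorize (1\<^sub>m m)"
  let ?bi = "(G p)\<^sup>T *\<^sub>v (V i *\<^sub>v x ^\<^sub>\<otimes> (i - 1))" and ?bj = "(G q)\<^sup>T *\<^sub>v (V j *\<^sub>v x ^\<^sub>\<otimes> (j - 1))"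
  let ?e = "unit_vec m :: nat \<Rightarrow> real vec"
  define M1 where "M1 = 1\<^sub>m (n^p) \<otimes>\<^sub>m (col_mat ?I)\<^sup>T"
  define M2 where "M2 = (col_mat (vectorize ((G q)\<^sup>T * V j)))\<^sup>T \<otimes>\<^sub>m (((G p)\<^sup>T * V i) \<otimes>\<^sub>m 1\<^sub>m m)"
  define M3 where "M3 = 1\<^sub>m (n^(j-1)) \<otimes>\<^sub>m shuffle (n^(i-1)) (n^q * m) \<otimes>\<^sub>m 1\<^sub>m m"
  define M4 where "M4 = 1\<^sub>m (n^(k-p)) \<otimes>\<^sub>m col_mat ?I"
  \<comment> \<open>The column side of the matrix product carries the degree k - p, split into the
    blocks j - 1, i - 1 and q; the row side carries the degree p.\<close>
  have kp: "k - p = (j - 1) + ((i - 1) + q)" using ij k by simp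
  have kk: "k = (k - p) + p" using ij k by simp
  note Gp = G[of p] and Gq = G[of q]
  have M1: "M1 \<in> carrier_mat (n^p) (n^p * (m * m))"
    unfolding M1_def by (rule carrier_matI) auto
  have M2: "M2 \<in> carrier_mat (n^p * (m * m)) (n ^ (k - p) * (m * m))"
    unfolding M2_def kp using Gp Gq Vi Vj by (intro carrier_matI) (auto simp: power_add)
  have M3: "M3 \<in> carrier_mat (n ^ (k - p) * (m * m)) (n ^ (k - p) * (m * m))"
    unfolding M3_def kp by (intro carrier_matI) (auto simp: power_add)
  have M4: "M4 \<in> carrier_mat (n ^ (k - p) * (m * m)) (n ^ (k - p))"
    unfolding M4_def by (intro carrier_matI) auto
  define y where "y = x ^\<^sub>\<otimes> (k - p)"
  have y: "y \<in> carrier_vec (n ^ (k - p))" using x by (auto simp: y_def)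
  have y_eq: "y = kron_vec (x ^\<^sub>\<otimes> (j - 1)) (kron_vec (x ^\<^sub>\<otimes> (i - 1)) (x ^\<^sub>\<otimes> q))"
    by (simp only: y_def kp kron_pow_add)
  have I: "?I \<in> carrier_vec (m * m)" by (rule carrier_vecI) simp
  have xp: "x ^\<^sub>\<otimes> p \<in> carrier_vec (n ^ p)" using x by auto
  have N: "M1 * M2 * M3 * M4 \<in> carrier_mat (n ^ p) (n ^ (k - p))" using M1 M2 M3 M4 by auto
  have c: "cross_term n m G V k p q i j = vectorize (M1 * M2 * M3 * M4)"
    by (simp add: cross_term_def M1_def M2_def M3_def M4_def)
  show "cross_term n m G V k p q i j \<in> carrier_vec (n ^ k)"
    unfolding c using N kk by (intro carrier_vecI) (use M1 M4 in \<open>simp flip: power_add\<close>)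
  have M4y: "M4 *\<^sub>v y = kron_vec y ?I"
    using kron_mult_kron_vec[of y "1\<^sub>m (n^(k-p))" "vec 1 (\<lambda>_. 1)" "col_mat ?I"] y
    by (simp add: M4_def col_mat_mult_one[simplified])
  have M1x: "M1\<^sup>T *\<^sub>v x ^\<^sub>\<otimes> p = kron_vec (x ^\<^sub>\<otimes> p) ?I"
    using kron_mult_kron_vec[of "x ^\<^sub>\<otimes> p" "1\<^sub>m (n^p)" "vec 1 (\<lambda>_. 1)" "col_mat ?I"] x
      one_mult_mat_vec[OF xp]
    by (simp add: M1_def transpose_kron col_mat_mult_one[simplified])
  \<comment> \<open>For a single channel a the middle factors leave a scalar, the a-th entry of the
    input term for q and j, times a vector that still waits for its contraction with the row
    side.\<close>
  have step: "(M2 * M3) *\<^sub>v kron_vec y (kron_vec (?e a) (?e a))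
      = (?bj \<bullet> kron_vec (x ^\<^sub>\<otimes> q) (?e a)) \<cdot>\<^sub>v kron_vec ?bi (?e a)" if a: "a < m" for a
  proof -
    let ?w = "kron_vec (x ^\<^sub>\<otimes> q) (?e a)"
    have w: "?w \<in> carrier_vec (n ^ q * m)" using x by auto
    have "kron_vec y (kron_vec (?e a) (?e a))
        = kron_vec (x ^\<^sub>\<otimes> (j - 1)) (kron_vec (kron_vec (x ^\<^sub>\<otimes> (i - 1)) ?w) (?e a))"
      by (simp add: y_eq kron_vec_assoc)
    moreover have "M3 *\<^sub>v \<dots> = kron_vec (x ^\<^sub>\<otimes> (j - 1)) (kron_vec (kron_vec ?w (x ^\<^sub>\<otimes> (i - 1))) (?e a))"
    proof -
      have d: "dim_vec (kron_vec (x ^\<^sub>\<otimes> (i - 1)) ?w) = dim_col (shuffle (n ^ (i - 1)) (n ^ q * m))"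
        using x by simp
      have "(shuffle (n ^ (i - 1)) (n ^ q * m) \<otimes>\<^sub>m 1\<^sub>m m) *\<^sub>v kron_vec (kron_vec (x ^\<^sub>\<otimes> (i - 1)) ?w) (?e a)
        = kron_vec (shuffle (n ^ (i - 1)) (n ^ q * m) *\<^sub>v kron_vec (x ^\<^sub>\<otimes> (i - 1)) ?w) (1\<^sub>m m *\<^sub>v ?e a)"
        by (rule kron_mult_kron_vec[OF d]) simp
      also have "\<dots> = kron_vec (kron_vec ?w (x ^\<^sub>\<otimes> (i - 1))) (?e a)"
        by (simp only: shuffle_mult_kron_vec[OF w kron_pow_carrier[OF x]] one_mult_mat_vec[OF unit_vec_carrier])
      finally have inner: "(shuffle (n ^ (i - 1)) (n ^ q * m) \<otimes>\<^sub>m 1\<^sub>m m) *\<^sub>v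
        kron_vec (kron_vec (x ^\<^sub>\<otimes> (i - 1)) ?w) (?e a) = kron_vec (kron_vec ?w (x ^\<^sub>\<otimes> (i - 1))) (?e a)" .
      have "M3 *\<^sub>v kron_vec (x ^\<^sub>\<otimes> (j - 1)) (kron_vec (kron_vec (x ^\<^sub>\<otimes> (i - 1)) ?w) (?e a))
        = kron_vec (1\<^sub>m (n^(j-1)) *\<^sub>v x ^\<^sub>\<otimes> (j - 1)) ((shuffle (n ^ (i - 1)) (n ^ q * m) \<otimes>\<^sub>m 1\<^sub>m m) *\<^sub>v
            kron_vec (kron_vec (x ^\<^sub>\<otimes> (i - 1)) ?w) (?e a))"
        unfolding M3_def by (rule kron_mult_kron_vec) (use x d in simp_all)
      thus ?thesis by (simp only: inner one_mult_mat_vec[OF kron_pow_carrier[OF x]])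
    qed
    moreover have "\<dots> = kron_vec (kron_vec (x ^\<^sub>\<otimes> (j - 1)) ?w) (kron_vec (x ^\<^sub>\<otimes> (i - 1)) (?e a))"
      by (simp add: kron_vec_assoc)
    moreover have "M2 *\<^sub>v \<dots> = kron_vec (vec 1 (\<lambda>_. ?bj \<bullet> ?w)) (kron_vec ?bi (?e a))"
    proof -
      have "vectorize ((G q)\<^sup>T * V j) \<bullet> kron_vec (x ^\<^sub>\<otimes> (j - 1)) ?w = ?w \<bullet> (((G q)\<^sup>T * V j) *\<^sub>v x ^\<^sub>\<otimes> (j - 1))"
        by (rule vectorize_scalar_prod_kron_vec[where p="m * n^q" and q="n ^ (j - 1)"])
          (use Gq Vj w x in \<open>simp_all add: mult.commute kron_pow_carrier\<close>)
      also have "((G q)\<^sup>T * V j) *\<^sub>v x ^\<^sub>\<otimes> (j - 1) = ?bj"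
        by (rule assoc_mult_mat_vec[where n\<^sub>1="m * n^q" and n\<^sub>2=n and n\<^sub>3="n ^ (j - 1)"]) (use Gq Vj x in auto)
      also have "?w \<bullet> ?bj = ?bj \<bullet> ?w"
        using Gq Vj w x by (intro comm_scalar_prod[where n="n^q * m"] carrier_vecI) (simp_all add: mult.commute)
      finally have 1: "vectorize ((G q)\<^sup>T * V j) \<bullet> kron_vec (x ^\<^sub>\<otimes> (j - 1)) ?w = ?bj \<bullet> ?w" .
      have 2: "((G p)\<^sup>T * V i) *\<^sub>v x ^\<^sub>\<otimes> (i - 1) = ?bi"
        by (rule assoc_mult_mat_vec[where n\<^sub>1="m * n^p" and n\<^sub>2=n and n\<^sub>3="n ^ (i - 1)"]) (use Gp Vi x in auto)
      have d: "dim_vec (vectorize ((G q)\<^sup>T * V j)) = dim_vec (kron_vec (x ^\<^sub>\<otimes> (j - 1)) ?w)"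
        using Gq Vj x by simp
      have "M2 *\<^sub>v kron_vec (kron_vec (x ^\<^sub>\<otimes> (j - 1)) ?w) (kron_vec (x ^\<^sub>\<otimes> (i - 1)) (?e a))
        = kron_vec ((col_mat (vectorize ((G q)\<^sup>T * V j)))\<^sup>T *\<^sub>v kron_vec (x ^\<^sub>\<otimes> (j - 1)) ?w)
            ((((G p)\<^sup>T * V i) \<otimes>\<^sub>m 1\<^sub>m m) *\<^sub>v kron_vec (x ^\<^sub>\<otimes> (i - 1)) (?e a))"
        unfolding M2_def by (rule kron_mult_kron_vec) (use d Vi x in simp_all)
      also have "(((G p)\<^sup>T * V i) \<otimes>\<^sub>m 1\<^sub>m m) *\<^sub>v kron_vec (x ^\<^sub>\<otimes> (i - 1)) (?e a) = kron_vec ?bi (?e a)"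
        using kron_mult_kron_vec[of "x ^\<^sub>\<otimes> (i - 1)" "(G p)\<^sup>T * V i" "?e a" "1\<^sub>m m"] Vi x
          one_mult_mat_vec[OF unit_vec_carrier] unfolding 2 by simp
      finally show ?thesis unfolding transpose_col_mat_mult[OF d] 1 .
    qed
    moreover have "kron_vec (vec 1 (\<lambda>_. c)) z = c \<cdot>\<^sub>v z" for c z
      by (rule eq_vecI) (auto simp: index_kron_vec)
    moreover have "kron_vec y (kron_vec (?e a) (?e a)) \<in> carrier_vec (n ^ (k - p) * (m * m))"
      using y by (intro kron_vec_carrier) auto
    ultimately show ?thesis using assoc_mult_mat_vec[OF M2 M3] by simp
  qed
  \<comment> \<open>The row side is expanded over channels c as well; orthonormality of the unit
    vectors leaves only c = a.\<close>
  have kb: "kron_vec (x ^\<^sub>\<otimes> p) ?I \<bullet> kron_vec ?bi (?e a) = ?bi \<bullet> kron_vec (x ^\<^sub>\<otimes> p) (?e a)" if a: "a < m" for a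
  proof -
    have bi: "?bi \<in> carrier_vec (n ^ p * m)" using Gp Vi x by (auto intro!: carrier_vecI)
    have c1: "kron_vec ?bi (?e a) \<in> carrier_vec (n ^ p * (m * m))"
      using kron_vec_carrier[OF bi unit_vec_carrier, of m a] by (simp add: mult.assoc)
    have c2: "kron_vec (x ^\<^sub>\<otimes> p) ?I \<in> carrier_vec (n ^ p * (m * m))" using xp I by (intro kron_vec_carrier) auto
    have "kron_vec (x ^\<^sub>\<otimes> p) ?I \<bullet> kron_vec ?bi (?e a) = kron_vec ?bi (?e a) \<bullet> kron_vec (x ^\<^sub>\<otimes> p) ?I"
      by (rule comm_scalar_prod[OF c2 c1])
    also have "\<dots> = (\<Sum>c<m. kron_vec ?bi (?e a) \<bullet> kron_vec (x ^\<^sub>\<otimes> p) (kron_vec (?e c) (?e c)))"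
      by (rule scalar_prod_kron_vec_vectorize_one[OF c1 xp])
    also have "\<dots> = (\<Sum>c<m. if c = a then ?bi \<bullet> kron_vec (x ^\<^sub>\<otimes> p) (?e a) else 0)"
    proof (rule sum.cong[OF refl])
      fix c assume "c \<in> {..<m}"
      hence "kron_vec ?bi (?e a) \<bullet> kron_vec (kron_vec (x ^\<^sub>\<otimes> p) (?e c)) (?e c)
         = (?bi \<bullet> kron_vec (x ^\<^sub>\<otimes> p) (?e c)) * (?e a \<bullet> ?e c)"
        using carrier_vecD[OF bi] x by (intro scalar_prod_kron_vec) (simp_all del: dim_mult_mat_vec)
      also have "?e a \<bullet> ?e c = (if c = a then 1 else 0)"
        using a \<open>c \<in> {..<m}\<close> by (subst scalar_prod_right_unit) (auto simp: unit_vec_def)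
      finally show "kron_vec ?bi (?e a) \<bullet> kron_vec (x ^\<^sub>\<otimes> p) (kron_vec (?e c) (?e c))
          = (if c = a then ?bi \<bullet> kron_vec (x ^\<^sub>\<otimes> p) (?e a) else 0)"
        by (auto simp: kron_vec_assoc)
    qed
    also have "\<dots> = ?bi \<bullet> kron_vec (x ^\<^sub>\<otimes> p) (?e a)" using a by simp
    finally show ?thesis .
  qed
  have M123: "M1 * (M2 * M3) \<in> carrier_mat (n ^ p) (n ^ (k - p) * (m * m))" using M1 M2 M3 by auto
  have M23: "M2 * M3 \<in> carrier_mat (n^p * (m * m)) (n ^ (k - p) * (m * m))" using M2 M3 by auto
  let ?z = "(M1 * (M2 * M3))\<^sup>T *\<^sub>v x ^\<^sub>\<otimes> p"
  have z: "?z \<in> carrier_vec (n ^ (k - p) * (m * m))" using M123 xp by auto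
  have "cross_term n m G V k p q i j \<bullet> x ^\<^sub>\<otimes> k = vectorize (M1 * M2 * M3 * M4) \<bullet> kron_vec y (x ^\<^sub>\<otimes> p)"
    unfolding c y_def kron_pow_add[symmetric] using kk by simp
  also have "\<dots> = x ^\<^sub>\<otimes> p \<bullet> ((M1 * M2 * M3 * M4) *\<^sub>v y)"
    by (rule vectorize_scalar_prod_kron_vec[OF N xp y])
  also have "M1 * M2 * M3 * M4 = M1 * (M2 * M3) * M4" using assoc_mult_mat[OF M1 M2 M3] by simp
  also have "\<dots> *\<^sub>v y = (M1 * (M2 * M3)) *\<^sub>v kron_vec y ?I"
    using assoc_mult_mat_vec[OF M123 M4 y] M4y by simp
  also have "x ^\<^sub>\<otimes> p \<bullet> \<dots> = ?z \<bullet> kron_vec y ?I"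
    by (rule transpose_vec_mult_scalar[OF M123 _ xp, symmetric]) (use y I in auto)
  also have "\<dots> = (\<Sum>a<m. ?z \<bullet> kron_vec y (kron_vec (?e a) (?e a)))"
    by (rule scalar_prod_kron_vec_vectorize_one[OF z y])
  also have "\<dots> = (\<Sum>a<m. input_term m G V x p i $ a * input_term m G V x q j $ a)"
  proof (rule sum.cong[OF refl])
    fix a assume "a \<in> {..<m}"
    hence a: "a < m" by simp
    let ?v = "kron_vec y (kron_vec (?e a) (?e a))"
    have v: "?v \<in> carrier_vec (n ^ (k - p) * (m * m))" using y by (intro kron_vec_carrier) auto
    have c1: "(M2 * M3) *\<^sub>v ?v \<in> carrier_vec (n^p * (m * m))" using M23 v by auto
    have "?z \<bullet> ?v = x ^\<^sub>\<otimes> p \<bullet> (M1 *\<^sub>v ((M2 * M3) *\<^sub>v ?v))"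
      using transpose_vec_mult_scalar[OF M123 v xp] assoc_mult_mat_vec[OF M1 M23 v] by simp
    also have "\<dots> = (M1\<^sup>T *\<^sub>v x ^\<^sub>\<otimes> p) \<bullet> ((M2 * M3) *\<^sub>v ?v)"
      by (rule transpose_vec_mult_scalar[OF M1 c1 xp, symmetric])
    also have "\<dots> = (?bj \<bullet> kron_vec (x ^\<^sub>\<otimes> q) (?e a)) * (?bi \<bullet> kron_vec (x ^\<^sub>\<otimes> p) (?e a))"
      unfolding M1x step[OF a] kb[OF a, symmetric]
      by (subst scalar_prod_smult_right) (use Gp Vi x in auto)
    also have "\<dots> = input_term m G V x p i $ a * input_term m G V x q j $ a"
      unfolding input_term_index[of a m G p n V i x, OF a Gp Vi x] input_term_index[of a m G q n V j x, OF a Gq Vj x] by (rule mult.commute)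
    finally show "?z \<bullet> ?v = input_term m G V x p i $ a * input_term m G V x q j $ a" .
  qed
  also have "\<dots> = input_term m G V x p i \<bullet> input_term m G V x q j"
    using input_term_carrier[of m G V x q j] by (simp add: scalar_prod_def atLeast0LessThan)
  finally show "cross_term n m G V k p q i j \<bullet> x ^\<^sub>\<otimes> k = input_term m G V x p i \<bullet> input_term m G V x q j" .
qed

lemma vectorize_transpose_mult_scalar_prod:
  assumes M: "M \<in> carrier_mat r (n ^ p)" and N: "N \<in> carrier_mat r (n ^ q)"
    and x: "x \<in> carrier_vec n" and k: "k = p + q"
  shows "vectorize (M\<^sup>T * N) \<bullet> x ^\<^sub>\<otimes> k = (M *\<^sub>v x ^\<^sub>\<otimes> p) \<bullet> (N *\<^sub>v x ^\<^sub>\<otimes> q)"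
proof -
  have xs: "x ^\<^sub>\<otimes> p \<in> carrier_vec (n ^ p)" "x ^\<^sub>\<otimes> q \<in> carrier_vec (n ^ q)" using x by auto
  have MN: "M\<^sup>T * N \<in> carrier_mat (n ^ p) (n ^ q)" using M N by auto
  have Nx: "N *\<^sub>v x ^\<^sub>\<otimes> q \<in> carrier_vec r" using N xs by auto
  have "vectorize (M\<^sup>T * N) \<bullet> x ^\<^sub>\<otimes> k = x ^\<^sub>\<otimes> p \<bullet> ((M\<^sup>T * N) *\<^sub>v x ^\<^sub>\<otimes> q)"
    unfolding k add.commute[of p] kron_pow_add
    by (rule vectorize_scalar_prod_kron_vec[OF MN xs])
  also have "\<dots> = (M\<^sup>T *\<^sub>v (N *\<^sub>v x ^\<^sub>\<otimes> q)) \<bullet> x ^\<^sub>\<otimes> p"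
    using assoc_mult_mat_vec[of "M\<^sup>T" _ r N _ "x ^\<^sub>\<otimes> q"] M N xs
    by (subst comm_scalar_prod[where n="n ^ p"]) auto
  also have "\<dots> = (N *\<^sub>v x ^\<^sub>\<otimes> q) \<bullet> (M *\<^sub>v x ^\<^sub>\<otimes> p)"
    by (rule transpose_vec_mult_scalar[OF M xs(1) Nx])
  also have "\<dots> = (M *\<^sub>v x ^\<^sub>\<otimes> p) \<bullet> (N *\<^sub>v x ^\<^sub>\<otimes> q)"
    using Nx M xs by (intro comm_scalar_prod) auto
  finally show ?thesis .
qed

lemma input_term_0:
  assumes "G 0 \<in> carrier_mat n m" "V i \<in> carrier_mat n (n ^ (i - 1))" "x \<in> carrier_vec n"
  shows "input_term m G V x 0 i = (G 0)\<^sup>T *\<^sub>v (V i *\<^sub>v x ^\<^sub>\<otimes> (i - 1))"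
proof -
  have "col_mat (x ^\<^sub>\<otimes> 0) \<otimes>\<^sub>m 1\<^sub>m m = 1\<^sub>m m"
    by (rule eq_matI) (auto simp: kron_def col_mat_def mat_of_cols_def)
  moreover have "(G 0)\<^sup>T *\<^sub>v (V i *\<^sub>v x ^\<^sub>\<otimes> (i - 1)) \<in> carrier_vec m"
    using assms by (intro carrier_vecI) simp
  ultimately show ?thesis by (simp add: input_term_def one_mult_mat_vec)
qed

section \<open>Lyapunov functions and Chetaev instability\<close>

abbreviation cmat :: "real mat \<Rightarrow> complex mat" where "cmat \<equiv> map_mat complex_of_real"

lemma sum_mult_le_sum_squares:
  fixes u :: "nat \<Rightarrow> real"
  shows "(\<Sum>i<n. \<Sum>j<n. u i * u j) \<le> real n * (\<Sum>i<n. (u i)\<^sup>2)"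
proof -
  have "(\<Sum>i<n. \<Sum>j<n. u i * u j) \<le> (\<Sum>i<n. \<Sum>j<n. ((u i)\<^sup>2 + (u j)\<^sup>2) / 2)"
  proof (intro sum_mono)
    fix i j
    show "u i * u j \<le> ((u i)\<^sup>2 + (u j)\<^sup>2) / 2"
      using sum_squares_bound[of "u i" "u j"] by simp
  qed
  also have "\<dots> = real n * (\<Sum>i<n. (u i)\<^sup>2)"
    by (simp add: sum.distrib sum_distrib_left sum_distrib_right mult_ac flip: sum_divide_distrib)
  finally show ?thesis .
qed

lemma cmod_sum_square_le:
  fixes a :: "nat \<Rightarrow> complex"
  shows "(cmod (\<Sum>j<n. a j * b j))\<^sup>2 \<le> (\<Sum>j<n. (cmod (a j))\<^sup>2) * (\<Sum>j<n. (cmod (b j))\<^sup>2)"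
proof -
  have "cmod (\<Sum>j<n. a j * b j) \<le> (\<Sum>j<n. cmod (a j) * cmod (b j))"
    by (rule order.trans[OF norm_sum]) (simp add: norm_mult)
  hence "(cmod (\<Sum>j<n. a j * b j))\<^sup>2 \<le> (\<Sum>j<n. cmod (a j) * cmod (b j))\<^sup>2"
    by (intro power_mono) auto
  also have "\<dots> \<le> (\<Sum>j<n. (cmod (a j))\<^sup>2) * (\<Sum>j<n. (cmod (b j))\<^sup>2)"
    by (rule Cauchy_Schwarz_ineq_sum)
  finally show ?thesis .
qed

lemma mult_mat_vec_sum:
  fixes M :: "'a::semiring_0 mat"
  assumes "M \<in> carrier_mat a b" "z \<in> carrier_vec b" "i < a"
  shows "(M *\<^sub>v z) $ i = (\<Sum>j<b. M $$ (i, j) * z $ j)"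
  using assms by (simp add: scalar_prod_def atLeast0LessThan)

text \<open>Rescaling the coordinates of a Schur basis makes the strictly upper triangular part
  arbitrarily small, so that the signed sum of squares is a quadratic Lyapunov function.\<close>

lemma schur_lyapunov:
  fixes M :: "complex mat" and c :: real
  assumes M: "M \<in> carrier_mat n n" and spec: "\<forall>s. eigenvalue M s \<longrightarrow> Re s \<noteq> c"
  shows "\<exists>S \<sigma> \<delta> \<mu>. S \<in> carrier_mat n n \<and> 0 < \<delta> \<and> 0 < \<mu> \<and>
    (\<forall>z\<in>carrier_vec n.
       c * (\<Sum>i<n. \<sigma> i * (cmod ((S *\<^sub>v z) $ i))\<^sup>2) + \<delta> * (\<Sum>i<n. (cmod ((S *\<^sub>v z) $ i))\<^sup>2)
       \<le> (\<Sum>i<n. \<sigma> i * Re (cnj ((S *\<^sub>v z) $ i) * (S *\<^sub>v (M *\<^sub>v z)) $ i))) \<and>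
    (\<forall>z\<in>carrier_vec n. \<mu> * (\<Sum>i<n. (cmod (z $ i))\<^sup>2) \<le> (\<Sum>i<n. (cmod ((S *\<^sub>v z) $ i))\<^sup>2)) \<and>
    ((\<forall>s. eigenvalue M s \<longrightarrow> c < Re s) \<longrightarrow> (\<forall>i<n. \<sigma> i = (1 :: real)))"
proof -
  obtain es where es: "char_poly M = (\<Prod>e\<leftarrow>es. [:- e, 1:])"
    using char_poly_factorized[OF M] by blast
  obtain T P Q where sd: "schur_decomposition M es = (T, P, Q)" by (cases "schur_decomposition M es")
  note schur = schur_decomposition[OF M es sd]
  have ut: "upper_triangular T" and dg: "diag_mat T = es" using schur by blast+
  have "n = dim_row M" using M by simp
  note wit = similar_mat_witD[OF this conjunct1[OF schur]]
  have PQ: "P * Q = 1\<^sub>m n" "Q * P = 1\<^sub>m n" and MT: "M = P * T * Q"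
    and car: "T \<in> carrier_mat n n" "P \<in> carrier_mat n n" "Q \<in> carrier_mat n n"
    using wit by blast+
  have len: "length es = n" using dg car by (auto simp: diag_mat_def)
  have ev: "eigenvalue M (T $$ (i, i))" if "i < n" for i
  proof -
    have "T $$ (i, i) \<in> set es" using that dg car by (auto simp: diag_mat_def)
    thus ?thesis unfolding eigenvalue_root_char_poly[OF M] es by (rule linear_poly_root)
  qed
  \<comment> \<open>The sign records on which side of the line Re s = c the i-th eigenvalue
    lies.\<close>
  define \<sigma> where "\<sigma> i = (if c < Re (T $$ (i, i)) then 1 else - 1 :: real)" for i
  \<comment> \<open>The distance of the spectrum from the line; the inserted 1 keeps the set
    nonempty for n = 0.\<close>
  define \<delta>0 where "\<delta>0 = Min (insert 1 ((\<lambda>i. \<bar>Re (T $$ (i, i)) - c\<bar>) ` {..<n}))"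
  have \<delta>0: "0 < \<delta>0" using spec[rule_format, OF ev] by (simp add: \<delta>0_def)
  have \<delta>0_le: "\<delta>0 \<le> \<bar>Re (T $$ (i, i)) - c\<bar>" if "i < n" for i
    unfolding \<delta>0_def by (rule Min_le) (use that in auto)
  define \<tau> where "\<tau> = (\<Sum>i<n. \<Sum>j<n. cmod (T $$ (i, j)))"
  have \<tau>: "0 \<le> \<tau>" by (auto simp: \<tau>_def intro!: sum_nonneg)
  have \<tau>_le: "cmod (T $$ (i, j)) \<le> \<tau>" if "i < n" "j < n" for i j
  proof -
    have "cmod (T $$ (i, j)) \<le> (\<Sum>j<n. cmod (T $$ (i, j)))"
      by (rule member_le_sum) (use that in auto)
    also have "\<dots> \<le> \<tau>" unfolding \<tau>_def
      by (rule member_le_sum[of i _ "\<lambda>i. \<Sum>j<n. cmod (T $$ (i, j))"]) (use that in \<open>auto intro: sum_nonneg\<close>)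
    finally show ?thesis .
  qed
  \<comment> \<open>Scaling the i-th coordinate by \<theta>^i divides the entry (i, j) of T by
    \<theta>^(j-i), hence by at least \<theta> above the diagonal. This \<theta> makes the total
    off-diagonal contribution at most half of \<delta>0.\<close>
  define \<theta> where "\<theta> = 1 + 2 * \<tau> * n / \<delta>0"
  have \<theta>: "1 \<le> \<theta>" using \<tau> \<delta>0 by (simp add: \<theta>_def)
  have \<theta>_le: "\<tau> / \<theta> * n \<le> \<delta>0 / 2"
  proof -
    have "\<tau> * n * 2 \<le> \<delta>0 * \<theta>" using \<delta>0 by (simp add: \<theta>_def field_simps)
    thus ?thesis using \<theta> by (simp add: field_simps)
  qed
  define S where "S = mat n n (\<lambda>(i, j). complex_of_real (\<theta> ^ i) * Q $$ (i, j))"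
  have S: "S \<in> carrier_mat n n" by (simp add: S_def)
  have S_index: "(S *\<^sub>v z) $ i = of_real (\<theta> ^ i) * (Q *\<^sub>v z) $ i" if "i < n" "z \<in> carrier_vec n" for i z
    unfolding mult_mat_vec_sum[OF S that(2,1)] mult_mat_vec_sum[OF car(3) that(2,1)] sum_distrib_left
    using that(1) by (simp add: S_def mult.assoc)
  have SM: "(S *\<^sub>v (M *\<^sub>v z)) $ i = (\<Sum>j<n. (if j < i then 0 else T $$ (i, j) / of_real (\<theta> ^ (j - i))) * (S *\<^sub>v z) $ j)"
    if i: "i < n" and z: "z \<in> carrier_vec n" for i z
  proof -
    have Qz: "Q *\<^sub>v z \<in> carrier_vec n" using car z by auto
    have "Q * M = T * Q"
    proof -
      have "Q * M = Q * (P * (T * Q))" using car by (simp add: MT assoc_mult_mat[of _ n n])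
      also have "\<dots> = (Q * P) * (T * Q)" using car by (simp add: assoc_mult_mat[of _ n n _ n _ n])
      finally show ?thesis using car PQ by simp
    qed
    hence "Q *\<^sub>v (M *\<^sub>v z) = T *\<^sub>v (Q *\<^sub>v z)"
      using assoc_mult_mat_vec[of Q n n M n z] assoc_mult_mat_vec[of T n n Q n z] car M z by simp
    hence "(S *\<^sub>v (M *\<^sub>v z)) $ i = of_real (\<theta> ^ i) * (\<Sum>j<n. T $$ (i, j) * (Q *\<^sub>v z) $ j)"
      using S_index[OF i, of "M *\<^sub>v z"] mult_mat_vec_carrier[OF M z] mult_mat_vec_sum[OF car(1) Qz i] by simp
    also have "\<dots> = (\<Sum>j<n. (if j < i then 0 else T $$ (i, j) / of_real (\<theta> ^ (j - i))) * (S *\<^sub>v z) $ j)"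
      unfolding sum_distrib_left
    proof (rule sum.cong[OF refl])
      fix j assume "j \<in> {..<n}"
      hence j: "j < n" by simp
      show "of_real (\<theta> ^ i) * (T $$ (i, j) * (Q *\<^sub>v z) $ j)
        = (if j < i then 0 else T $$ (i, j) / of_real (\<theta> ^ (j - i))) * (S *\<^sub>v z) $ j"
      proof (cases "j < i")
        case True
        thus ?thesis using ut i car by (auto simp: upper_triangular_def)
      next
        case False
        have "\<theta> ^ j = \<theta> ^ i * \<theta> ^ (j - i)" using False by (simp flip: power_add)
        thus ?thesis using False S_index[OF j z] \<theta> by simp
      qed
    qed
    finally show ?thesis .
  qed
  have main: "(\<Sum>i<n. \<sigma> i * Re (cnj ((S *\<^sub>v z) $ i) * (S *\<^sub>v (M *\<^sub>v z)) $ i))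
       \<ge> c * (\<Sum>i<n. \<sigma> i * (cmod ((S *\<^sub>v z) $ i))\<^sup>2) + (\<delta>0 / 2) * (\<Sum>i<n. (cmod ((S *\<^sub>v z) $ i))\<^sup>2)"
    if z: "z \<in> carrier_vec n" for z
  proof -
    let ?y = "\<lambda>i. (S *\<^sub>v z) $ i"
    let ?r = "\<lambda>i j. if j \<le> i then 0 else T $$ (i, j) / of_real (\<theta> ^ (j - i))"
    have summand: "\<sigma> i * Re (cnj (?y i) * (S *\<^sub>v (M *\<^sub>v z)) $ i)
        \<ge> c * (\<sigma> i * (cmod (?y i))\<^sup>2) + \<delta>0 * (cmod (?y i))\<^sup>2 - (\<Sum>j<n. \<tau> / \<theta> * (cmod (?y i) * cmod (?y j)))"
      if i: "i < n" for i
    proof -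
      have "(S *\<^sub>v (M *\<^sub>v z)) $ i = (\<Sum>j<n. (if j = i then T $$ (i, i) * ?y i else 0) + ?r i j * ?y j)"
        unfolding SM[OF i z] by (rule sum.cong) auto
      also have "\<dots> = T $$ (i, i) * ?y i + (\<Sum>j<n. ?r i j * ?y j)"
        using i by (simp add: sum.distrib)
      finally have "cnj (?y i) * (S *\<^sub>v (M *\<^sub>v z)) $ i
          = T $$ (i, i) * (?y i * cnj (?y i)) + cnj (?y i) * (\<Sum>j<n. ?r i j * ?y j)"
        by (simp add: algebra_simps)
      hence "Re (cnj (?y i) * (S *\<^sub>v (M *\<^sub>v z)) $ i)
          = Re (T $$ (i, i)) * (cmod (?y i))\<^sup>2 + Re (cnj (?y i) * (\<Sum>j<n. ?r i j * ?y j))"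
        by (simp only: complex_norm_square[symmetric] plus_complex.sel) simp
      hence eq: "\<sigma> i * Re (cnj (?y i) * (S *\<^sub>v (M *\<^sub>v z)) $ i)
          = \<sigma> i * Re (T $$ (i, i)) * (cmod (?y i))\<^sup>2 + \<sigma> i * Re (cnj (?y i) * (\<Sum>j<n. ?r i j * ?y j))"
        by (simp add: algebra_simps)
      have "\<bar>\<sigma> i * Re (cnj (?y i) * (\<Sum>j<n. ?r i j * ?y j))\<bar> = \<bar>Re (cnj (?y i) * (\<Sum>j<n. ?r i j * ?y j))\<bar>"
        by (auto simp: \<sigma>_def abs_mult)
      also have "\<dots> \<le> cmod (cnj (?y i) * (\<Sum>j<n. ?r i j * ?y j))" by (rule abs_Re_le_cmod)
      also have "\<dots> = cmod (?y i) * cmod (\<Sum>j<n. ?r i j * ?y j)" by (simp add: norm_mult)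
      also have "\<dots> \<le> cmod (?y i) * (\<Sum>j<n. \<tau> / \<theta> * cmod (?y j))"
      proof (intro mult_left_mono order.trans[OF norm_sum] sum_mono)
        fix j assume "j \<in> {..<n}"
        hence j: "j < n" by simp
        have "cmod (?r i j) \<le> \<tau> / \<theta>"
        proof (cases "j \<le> i")
          case True
          thus ?thesis using \<tau> \<theta> by simp
        next
          case False
          have "\<theta> ^ 1 \<le> \<theta> ^ (j - i)" by (rule power_increasing) (use False \<theta> in auto)
          hence "cmod (T $$ (i, j)) / \<theta> ^ (j - i) \<le> \<tau> / \<theta>"
            using \<tau>_le[OF i j] \<theta> \<tau> by (intro frac_le) auto
          thus ?thesis using False \<theta> by (simp add: norm_divide norm_power)
        qed
        thus "cmod (?r i j * ?y j) \<le> \<tau> / \<theta> * cmod (?y j)"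
          using mult_right_mono[OF _ norm_ge_zero] by (simp only: norm_mult)
      qed auto
      also have "\<dots> = (\<Sum>j<n. \<tau> / \<theta> * (cmod (?y i) * cmod (?y j)))"
        by (simp add: sum_distrib_left mult_ac)
      finally have b: "\<bar>\<sigma> i * Re (cnj (?y i) * (\<Sum>j<n. ?r i j * ?y j))\<bar> \<le> (\<Sum>j<n. \<tau> / \<theta> * (cmod (?y i) * cmod (?y j)))" .
      have "\<sigma> i * Re (T $$ (i, i)) \<ge> c * \<sigma> i + \<delta>0"
        using \<delta>0_le[OF i] spec[rule_format, OF ev[OF i]] by (auto simp: \<sigma>_def)
      hence "\<sigma> i * Re (T $$ (i, i)) * (cmod (?y i))\<^sup>2 \<ge> (c * \<sigma> i + \<delta>0) * (cmod (?y i))\<^sup>2"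
        by (intro mult_right_mono) auto
      thus ?thesis using b eq by (simp add: algebra_simps)
    qed
    have "(\<Sum>i<n. c * (\<sigma> i * (cmod (?y i))\<^sup>2) + \<delta>0 * (cmod (?y i))\<^sup>2 - (\<Sum>j<n. \<tau> / \<theta> * (cmod (?y i) * cmod (?y j))))
        \<le> (\<Sum>i<n. \<sigma> i * Re (cnj (?y i) * (S *\<^sub>v (M *\<^sub>v z)) $ i))"
      by (intro sum_mono summand) auto
    moreover have "(\<Sum>i<n. c * (\<sigma> i * (cmod (?y i))\<^sup>2) + \<delta>0 * (cmod (?y i))\<^sup>2 - (\<Sum>j<n. \<tau> / \<theta> * (cmod (?y i) * cmod (?y j))))
      = c * (\<Sum>i<n. \<sigma> i * (cmod (?y i))\<^sup>2) + \<delta>0 * (\<Sum>i<n. (cmod (?y i))\<^sup>2)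
        - \<tau> / \<theta> * (\<Sum>i<n. \<Sum>j<n. cmod (?y i) * cmod (?y j))"
      by (simp add: sum.distrib sum_subtractf sum_distrib_left)
    moreover have "\<tau> / \<theta> * (\<Sum>i<n. \<Sum>j<n. cmod (?y i) * cmod (?y j)) \<le> \<tau> / \<theta> * (real n * (\<Sum>i<n. (cmod (?y i))\<^sup>2))"
      by (intro mult_left_mono sum_mult_le_sum_squares) (use \<tau> \<theta> in auto)
    moreover have "\<tau> / \<theta> * (real n * (\<Sum>i<n. (cmod (?y i))\<^sup>2)) \<le> \<delta>0 / 2 * (\<Sum>i<n. (cmod (?y i))\<^sup>2)"
      unfolding mult.assoc[symmetric] by (intro mult_right_mono \<theta>_le sum_nonneg) auto
    ultimately show ?thesis by linarith
  qed
  \<comment> \<open>The squared Frobenius norm of P, the inverse of Q, enlarged by 1 to be positive.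
    As \<theta> \<ge> 1, the scaled coordinates dominate those of Q, so 1/K also serves for
    S.\<close>
  define K where "K = 1 + (\<Sum>i<n. \<Sum>j<n. (cmod (P $$ (i, j)))\<^sup>2)"
  have K: "0 < K" unfolding K_def by (intro add_pos_nonneg sum_nonneg) auto
  have low: "1 / K * (\<Sum>i<n. (cmod (z $ i))\<^sup>2) \<le> (\<Sum>i<n. (cmod ((S *\<^sub>v z) $ i))\<^sup>2)"
    if z: "z \<in> carrier_vec n" for z
  proof -
    have Qz: "Q *\<^sub>v z \<in> carrier_vec n" using car z by auto
    have z_eq: "z = P *\<^sub>v (Q *\<^sub>v z)"
      using assoc_mult_mat_vec[of P n n Q n z] car z PQ by simp
    have "(\<Sum>i<n. (cmod (z $ i))\<^sup>2) \<le> (\<Sum>i<n. (\<Sum>j<n. (cmod (P $$ (i, j)))\<^sup>2) * (\<Sum>j<n. (cmod ((Q *\<^sub>v z) $ j))\<^sup>2))"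
    proof (rule sum_mono)
      fix i assume "i \<in> {..<n}"
      hence "z $ i = (\<Sum>j<n. P $$ (i, j) * (Q *\<^sub>v z) $ j)"
        using mult_mat_vec_sum[OF car(2) Qz, of i] z_eq by simp
      thus "(cmod (z $ i))\<^sup>2 \<le> (\<Sum>j<n. (cmod (P $$ (i, j)))\<^sup>2) * (\<Sum>j<n. (cmod ((Q *\<^sub>v z) $ j))\<^sup>2)"
        using cmod_sum_square_le by simp
    qed
    also have "\<dots> \<le> K * (\<Sum>j<n. (cmod ((Q *\<^sub>v z) $ j))\<^sup>2)"
      unfolding sum_distrib_right[symmetric] K_def by (intro mult_right_mono sum_nonneg) auto
    also have "\<dots> \<le> K * (\<Sum>i<n. (cmod ((S *\<^sub>v z) $ i))\<^sup>2)"
    proof (intro mult_left_mono sum_mono)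
      fix i assume "i \<in> {..<n}"
      hence "(cmod ((S *\<^sub>v z) $ i))\<^sup>2 = (\<theta> ^ i)\<^sup>2 * (cmod ((Q *\<^sub>v z) $ i))\<^sup>2"
        using S_index[of i z] z \<theta> by (simp add: norm_mult norm_power power_mult_distrib)
      moreover have "1 \<le> (\<theta> ^ i)\<^sup>2" using \<theta> by (simp add: one_le_power)
      ultimately show "(cmod ((Q *\<^sub>v z) $ i))\<^sup>2 \<le> (cmod ((S *\<^sub>v z) $ i))\<^sup>2"
        using mult_right_mono[of 1 "(\<theta> ^ i)\<^sup>2" "(cmod ((Q *\<^sub>v z) $ i))\<^sup>2"] by simp
    qed (use K in auto)
    finally show ?thesis using K by (simp add: field_simps)
  qed
  have "(\<forall>s. eigenvalue M s \<longrightarrow> c < Re s) \<longrightarrow> (\<forall>i<n. \<sigma> i = 1)"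
    using ev by (auto simp: \<sigma>_def)
  moreover have "0 < \<delta>0 / 2" "0 < 1 / K" using \<delta>0 K by simp_all
  ultimately show ?thesis
    by (intro exI[of _ S] exI[of _ \<sigma>] exI[of _ "\<delta>0 / 2"] exI[of _ "1 / K"] conjI ballI S main low)
qed


abbreviation cvec :: "real vec \<Rightarrow> complex vec" where "cvec \<equiv> map_vec complex_of_real"

lemma Re_complex_of_real_mult: "Re (complex_of_real r * z) = r * Re z"
  by simp

lemma cvec_carrier: "x \<in> carrier_vec n \<Longrightarrow> cvec x \<in> carrier_vec n"
  by simp

lemma cvec_mult: "A \<in> carrier_mat a b \<Longrightarrow> x \<in> carrier_vec b \<Longrightarrow> cmat A *\<^sub>v cvec x = cvec (A *\<^sub>v x)"
  by (rule of_real_hom.mult_mat_vec_hom[symmetric])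

lemma eigenvector_cnj:
  assumes M: "M \<in> carrier_mat n n" and z: "eigenvector (cmat M) z s"
  shows "eigenvector (cmat M) (map_vec cnj z) (cnj s)"
proof -
  have zc: "z \<in> carrier_vec n" "z \<noteq> 0\<^sub>v n" "cmat M *\<^sub>v z = s \<cdot>\<^sub>v z"
    using z M by (auto simp: eigenvector_def)
  have "cmat M *\<^sub>v map_vec cnj z = cnj s \<cdot>\<^sub>v map_vec cnj z"
  proof (rule eq_vecI)
    fix i assume "i < dim_vec (cnj s \<cdot>\<^sub>v map_vec cnj z)"
    hence i: "i < n" using zc by simp
    have "(cmat M *\<^sub>v map_vec cnj z) $ i = cnj ((cmat M *\<^sub>v z) $ i)"
      using M zc(1) i by (subst (1 2) mult_mat_vec_sum[where a=n and b=n]) auto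
    thus "(cmat M *\<^sub>v map_vec cnj z) $ i = (cnj s \<cdot>\<^sub>v map_vec cnj z) $ i"
      using zc i by simp
  qed (use M zc in simp)
  moreover have "map_vec cnj z \<noteq> 0\<^sub>v n"
  proof
    assume z0: "map_vec cnj z = 0\<^sub>v n"
    have "cnj (z $ i) = 0" if "i < n" for i
      using arg_cong[OF z0, of "\<lambda>v. v $ i"] that zc(1) by simp
    thus False using zc by (auto simp: vec_eq_iff)
  qed
  ultimately show ?thesis using M zc by (simp add: eigenvector_def)
qed

text \<open>The signed sum of squares in the scaled Schur basis, restricted to real vectors. Its
  coercivity serves the uniqueness of homogeneous polynomials; the real direction of positive value
  is where Chetaev's argument starts.\<close>

lemma lyapunov_form:
  fixes M :: "real mat" and c :: real
  assumes M: "M \<in> carrier_mat n n" and spec: "\<forall>s. eigenvalue (cmat M) s \<longrightarrow> Re s \<noteq> c"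
  shows "\<exists>P \<delta> \<mu>. P \<in> carrier_mat n n \<and> P\<^sup>T = P \<and> 0 < \<delta> \<and> 0 < \<mu> \<and>
    (\<forall>x\<in>carrier_vec n. c * (x \<bullet> (P *\<^sub>v x)) + \<delta> * (x \<bullet> x) \<le> x \<bullet> (P *\<^sub>v (M *\<^sub>v x))) \<and>
    ((\<forall>s. eigenvalue (cmat M) s \<longrightarrow> c < Re s) \<longrightarrow> (\<forall>x\<in>carrier_vec n. \<mu> * (x \<bullet> x) \<le> x \<bullet> (P *\<^sub>v x))) \<and>
    ((\<exists>s. eigenvalue (cmat M) s \<and> c < Re s) \<longrightarrow> (\<exists>x\<in>carrier_vec n. 0 < x \<bullet> (P *\<^sub>v x)))"
proof -
  have cM: "cmat M \<in> carrier_mat n n" using M by simp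
  obtain S \<sigma> \<delta> \<mu> where S: "S \<in> carrier_mat n n" and pos: "0 < \<delta>" "0 < \<mu>"
    and ineq': "\<forall>z\<in>carrier_vec n.
       c * (\<Sum>i<n. \<sigma> i * (cmod ((S *\<^sub>v z) $ i))\<^sup>2) + \<delta> * (\<Sum>i<n. (cmod ((S *\<^sub>v z) $ i))\<^sup>2)
       \<le> (\<Sum>i<n. \<sigma> i * Re (cnj ((S *\<^sub>v z) $ i) * (S *\<^sub>v (cmat M *\<^sub>v z)) $ i))"
    and low': "\<forall>z\<in>carrier_vec n. \<mu> * (\<Sum>i<n. (cmod (z $ i))\<^sup>2) \<le> (\<Sum>i<n. (cmod ((S *\<^sub>v z) $ i))\<^sup>2)"
    and one: "(\<forall>s. eigenvalue (cmat M) s \<longrightarrow> c < Re s) \<longrightarrow> (\<forall>i<n. \<sigma> i = 1)"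
    using schur_lyapunov[OF cM spec] by (elim exE conjE) (rule that)
  note ineq = bspec[OF ineq'] and low = bspec[OF low']
  \<comment> \<open>The entrywise real part of the Hermitian matrix of the form; the imaginary part
    is antisymmetric and contributes nothing on real vectors.\<close>
  define P where "P = mat n n (\<lambda>(a, b). \<Sum>i<n. \<sigma> i * Re (cnj (S $$ (i, a)) * S $$ (i, b)))"
  have P: "P \<in> carrier_mat n n" by (simp add: P_def)
  have sym: "P\<^sup>T = P"
    by (rule eq_matI) (auto simp: P_def mult.commute intro!: sum.cong)
  have form: "x \<bullet> (P *\<^sub>v y) = (\<Sum>i<n. \<sigma> i * Re (cnj ((S *\<^sub>v cvec x) $ i) * (S *\<^sub>v cvec y) $ i))"
    if x: "x \<in> carrier_vec n" and y: "y \<in> carrier_vec n" for x y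
  proof -
    have "x \<bullet> (P *\<^sub>v y) = (\<Sum>a<n. \<Sum>b<n. \<Sum>i<n. x $ a * y $ b * (\<sigma> i * Re (cnj (S $$ (i, a)) * S $$ (i, b))))"
    proof -
      have "x \<bullet> (P *\<^sub>v y) = (\<Sum>a<n. x $ a * (\<Sum>b<n. P $$ (a, b) * y $ b))"
        using P by (simp add: scalar_prod_def[of x] atLeast0LessThan mult_mat_vec_sum[OF P y] del: index_mult_mat_vec)
      also have "\<dots> = (\<Sum>a<n. \<Sum>b<n. \<Sum>i<n. x $ a * y $ b * (\<sigma> i * Re (cnj (S $$ (i, a)) * S $$ (i, b))))"
        unfolding sum_distrib_left
      proof (intro sum.cong refl)
        fix a b assume "a \<in> {..<n}" "b \<in> {..<n}"
        hence "P $$ (a, b) = (\<Sum>i<n. \<sigma> i * Re (cnj (S $$ (i, a)) * S $$ (i, b)))" by (simp add: P_def)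
        thus "x $ a * (P $$ (a, b) * y $ b) = (\<Sum>i<n. x $ a * y $ b * (\<sigma> i * Re (cnj (S $$ (i, a)) * S $$ (i, b))))"
          by (simp only: sum_distrib_left sum_distrib_right) (simp only: mult_ac)
      qed
      finally show ?thesis .
    qed
    also have "\<dots> = (\<Sum>a<n. \<Sum>i<n. \<Sum>b<n. x $ a * y $ b * (\<sigma> i * Re (cnj (S $$ (i, a)) * S $$ (i, b))))"
      by (rule sum.cong[OF refl], rule sum.swap)
    also have "\<dots> = (\<Sum>i<n. \<Sum>a<n. \<Sum>b<n. x $ a * y $ b * (\<sigma> i * Re (cnj (S $$ (i, a)) * S $$ (i, b))))"
      by (rule sum.swap)
    also have "\<dots> = (\<Sum>i<n. \<sigma> i * Re (cnj ((S *\<^sub>v cvec x) $ i) * (S *\<^sub>v cvec y) $ i))"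
    proof (rule sum.cong[OF refl])
      fix i assume "i \<in> {..<n}"
      hence i: "i < n" by simp
      have "cnj ((S *\<^sub>v cvec x) $ i) * (S *\<^sub>v cvec y) $ i
          = (\<Sum>a<n. \<Sum>b<n. complex_of_real (x $ a * y $ b) * (cnj (S $$ (i, a)) * S $$ (i, b)))"
        unfolding mult_mat_vec_sum[OF S cvec_carrier[OF x] i] mult_mat_vec_sum[OF S cvec_carrier[OF y] i]
          cnj_sum sum_product
        using x y by (intro sum.cong) (auto simp: mult_ac)
      thus "(\<Sum>a<n. \<Sum>b<n. x $ a * y $ b * (\<sigma> i * Re (cnj (S $$ (i, a)) * S $$ (i, b))))
          = \<sigma> i * Re (cnj ((S *\<^sub>v cvec x) $ i) * (S *\<^sub>v cvec y) $ i)"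
        by (simp only: Re_sum Re_complex_of_real_mult sum_distrib_left) (simp only: mult_ac)
    qed
    finally show ?thesis .
  qed
  have sq: "Re (cnj w * w) = (cmod w)\<^sup>2" for w
    unfolding cmod_power2 by (simp add: power2_eq_square)
  have form2: "x \<bullet> (P *\<^sub>v x) = (\<Sum>i<n. \<sigma> i * (cmod ((S *\<^sub>v cvec x) $ i))\<^sup>2)"
    if x: "x \<in> carrier_vec n" for x
    unfolding form[OF x x] sq ..
  have low2: "\<mu> * (x \<bullet> x) \<le> (\<Sum>i<n. (cmod ((S *\<^sub>v cvec x) $ i))\<^sup>2)" if x: "x \<in> carrier_vec n" for x
    using low[of "cvec x"] x by (simp add: scalar_prod_def atLeast0LessThan power2_eq_square)
  \<comment> \<open>The gain in terms of the coordinates S x is converted into one in terms of x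
    through \<mu>; hence the constant \<delta> \<mu>.\<close>
  have 1: "c * (x \<bullet> (P *\<^sub>v x)) + (\<delta> * \<mu>) * (x \<bullet> x) \<le> x \<bullet> (P *\<^sub>v (M *\<^sub>v x))"
    if x: "x \<in> carrier_vec n" for x
  proof -
    have Mx: "M *\<^sub>v x \<in> carrier_vec n" using M x by auto
    have "\<delta> * (\<mu> * (x \<bullet> x)) \<le> \<delta> * (\<Sum>i<n. (cmod ((S *\<^sub>v cvec x) $ i))\<^sup>2)"
      using low2[OF x] pos by (intro mult_left_mono) auto
    thus ?thesis using ineq[of "cvec x"] x
      unfolding form2[OF x] form[OF x Mx] cvec_mult[OF M x] by (simp add: mult.assoc)
  qed
  have 2: "\<mu> * (x \<bullet> x) \<le> x \<bullet> (P *\<^sub>v x)"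
    if "\<forall>s. eigenvalue (cmat M) s \<longrightarrow> c < Re s" "x \<in> carrier_vec n" for x
    using low2[OF that(2)] mp[OF one that(1)] form2[OF that(2)] by simp
  \<comment> \<open>On an eigenvector the Lyapunov inequality reads c W + (something positive) \<le>
    Re s W, so that W has the sign of Re s - c.\<close>
  have Wpos: "0 < (\<Sum>i<n. \<sigma> i * (cmod ((S *\<^sub>v z) $ i))\<^sup>2)"
    if z: "eigenvector (cmat M) z s" and s: "c < Re s" for z s
  proof -
    have zc: "z \<in> carrier_vec n" "z \<noteq> 0\<^sub>v n" "cmat M *\<^sub>v z = s \<cdot>\<^sub>v z"
      using z M by (auto simp: eigenvector_def)
    let ?W = "\<Sum>i<n. \<sigma> i * (cmod ((S *\<^sub>v z) $ i))\<^sup>2"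
    have "\<exists>i<n. z $ i \<noteq> 0" using zc by (auto simp: vec_eq_iff)
    hence "0 < (\<Sum>i<n. (cmod (z $ i))\<^sup>2)" by (auto intro!: sum_pos2)
    hence "0 < \<mu> * (\<Sum>i<n. (cmod (z $ i))\<^sup>2)" using pos by simp
    hence p: "0 < \<delta> * (\<Sum>i<n. (cmod ((S *\<^sub>v z) $ i))\<^sup>2)" using low[OF zc(1)] pos by simp
    have "(\<Sum>i<n. \<sigma> i * Re (cnj ((S *\<^sub>v z) $ i) * (S *\<^sub>v (cmat M *\<^sub>v z)) $ i)) = Re s * ?W"
      unfolding sum_distrib_left
    proof (rule sum.cong[OF refl])
      fix i assume "i \<in> {..<n}"
      hence "(S *\<^sub>v (cmat M *\<^sub>v z)) $ i = s * (S *\<^sub>v z) $ i"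
        using S zc by (simp add: mult_mat_vec[of S n n])
      hence "cnj ((S *\<^sub>v z) $ i) * (S *\<^sub>v (cmat M *\<^sub>v z)) $ i = s * complex_of_real ((cmod ((S *\<^sub>v z) $ i))\<^sup>2)"
        by (simp only: complex_norm_square) (simp only: mult_ac)
      thus "\<sigma> i * Re (cnj ((S *\<^sub>v z) $ i) * (S *\<^sub>v (cmat M *\<^sub>v z)) $ i) = Re s * (\<sigma> i * (cmod ((S *\<^sub>v z) $ i))\<^sup>2)"
        by (simp only:) simp
    qed
    hence "c * ?W < Re s * ?W" using ineq[OF zc(1)] p by linarith
    hence "0 < (Re s - c) * ?W" by (simp add: algebra_simps)
    thus ?thesis using s by (simp add: zero_less_mult_iff)
  qed
  have 3: "\<exists>x\<in>carrier_vec n. 0 < x \<bullet> (P *\<^sub>v x)" if ev: "eigenvalue (cmat M) s" and s: "c < Re s" for s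
  proof -
    obtain z where z: "eigenvector (cmat M) z s" using ev by (auto simp: eigenvalue_def)
    have zc: "z \<in> carrier_vec n" using z M by (auto simp: eigenvector_def)
    define a b where "a = map_vec Re z" and "b = map_vec Im z"
    have ab: "a \<in> carrier_vec n" "b \<in> carrier_vec n" using zc by (auto simp: a_def b_def)
    have dec: "(S *\<^sub>v z) $ i = (S *\<^sub>v cvec a) $ i + \<i> * (S *\<^sub>v cvec b) $ i"
      "(S *\<^sub>v map_vec cnj z) $ i = (S *\<^sub>v cvec a) $ i - \<i> * (S *\<^sub>v cvec b) $ i" if i: "i < n" for i
    proof -
      have e: "z $ j = of_real (a $ j) + \<i> * of_real (b $ j)" if "j < n" for j
        using that zc by (simp add: a_def b_def complex_eq)
      have "(S *\<^sub>v z) $ i = (\<Sum>j<n. S $$ (i, j) * of_real (a $ j) + \<i> * (S $$ (i, j) * of_real (b $ j)))"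
        unfolding mult_mat_vec_sum[OF S zc i] by (intro sum.cong) (auto simp: e algebra_simps)
      thus "(S *\<^sub>v z) $ i = (S *\<^sub>v cvec a) $ i + \<i> * (S *\<^sub>v cvec b) $ i"
        using ab by (simp add: mult_mat_vec_sum[OF S _ i] sum.distrib sum_distrib_left)
      have "(S *\<^sub>v map_vec cnj z) $ i
        = (\<Sum>j<n. S $$ (i, j) * of_real (a $ j) - \<i> * (S $$ (i, j) * of_real (b $ j)))"
        using zc by (subst mult_mat_vec_sum[OF S _ i]) (auto simp: e algebra_simps intro!: sum.cong)
      thus "(S *\<^sub>v map_vec cnj z) $ i = (S *\<^sub>v cvec a) $ i - \<i> * (S *\<^sub>v cvec b) $ i"
        using ab by (simp add: mult_mat_vec_sum[OF S _ i] sum_subtractf sum_distrib_left)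
    qed
    \<comment> \<open>The eigenvector may be complex. The form is positive at z and at its
      conjugate, and the parallelogram law distributes the sum over the real and the imaginary part;
      at one of them it must be positive.\<close>
    have par: "(cmod (u + \<i> * w))\<^sup>2 + (cmod (u - \<i> * w))\<^sup>2 = 2 * (cmod u)\<^sup>2 + 2 * (cmod w)\<^sup>2" for u w
      unfolding cmod_power2 by (simp add: power2_eq_square algebra_simps)
    have "0 < (\<Sum>i<n. \<sigma> i * (cmod ((S *\<^sub>v z) $ i))\<^sup>2) + (\<Sum>i<n. \<sigma> i * (cmod ((S *\<^sub>v map_vec cnj z) $ i))\<^sup>2)"
      using Wpos[OF z s] Wpos[OF eigenvector_cnj[OF M z]] s by simp
    also have "\<dots> = (\<Sum>i<n. \<sigma> i * (2 * (cmod ((S *\<^sub>v cvec a) $ i))\<^sup>2 + 2 * (cmod ((S *\<^sub>v cvec b) $ i))\<^sup>2))"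
      unfolding sum.distrib[symmetric] distrib_left[symmetric]
      by (rule sum.cong[OF refl]) (simp add: dec par)
    also have "\<dots> = 2 * (a \<bullet> (P *\<^sub>v a)) + 2 * (b \<bullet> (P *\<^sub>v b))"
      unfolding form2[OF ab(1)] form2[OF ab(2)]
      by (simp add: sum.distrib sum_distrib_left algebra_simps)
    finally have "0 < a \<bullet> (P *\<^sub>v a) \<or> 0 < b \<bullet> (P *\<^sub>v b)" by linarith
    thus ?thesis using ab by blast
  qed
  show ?thesis
    by (intro exI[of _ P] exI[of _ "\<delta> * \<mu>"] exI[of _ \<mu>] conjI ballI impI P sym 1 2)
      (use pos 3 in auto)
qed

section \<open>Homogeneous polynomials and their derivative along a linear field\<close>

lemma kron_vec_lincomb:
  "dim_vec y = dim_vec z \<Longrightarrow> kron_vec (c \<cdot>\<^sub>v y + z) b = c \<cdot>\<^sub>v kron_vec y b + kron_vec z b"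
  "dim_vec y = dim_vec z \<Longrightarrow> kron_vec b (c \<cdot>\<^sub>v y + z) = c \<cdot>\<^sub>v kron_vec b y + kron_vec b z"
  by (rule eq_vecI; simp add: index_kron_vec div_mod_less algebra_simps)+

lemma dkron_lincomb:
  assumes x: "x \<in> carrier_vec n" and y: "y \<in> carrier_vec n" and z: "z \<in> carrier_vec n"
  shows "dkron n k x (c \<cdot>\<^sub>v y + z) = c \<cdot>\<^sub>v dkron n k x y + dkron n k x z"
proof (induction k)
  case 0
  show ?case by (auto simp: dkron_0)
next
  case (Suc k)
  have yz: "c \<cdot>\<^sub>v y + z \<in> carrier_vec n" using y z by auto
  have d: "dim_vec y = dim_vec z" "dim_vec (dkron n k x y) = dim_vec (dkron n k x z)" using y z by auto
  show ?case
    unfolding dkron_Suc[OF x yz] dkron_Suc[OF x y] dkron_Suc[OF x z] Suc.IH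
      kron_vec_lincomb(1)[OF d(1)] kron_vec_lincomb(2)[OF d(2)]
    by (rule eq_vecI) (use x y z in \<open>auto simp: algebra_simps\<close>)
qed

lemma dkron_smult:
  assumes x: "x \<in> carrier_vec n" and y: "y \<in> carrier_vec n"
  shows "dkron n k x (c \<cdot>\<^sub>v y) = c \<cdot>\<^sub>v dkron n k x y"
proof (induction k)
  case 0
  show ?case by (auto simp: dkron_0)
next
  case (Suc k)
  have cy: "c \<cdot>\<^sub>v y \<in> carrier_vec n" using y by auto
  show ?case unfolding dkron_Suc[OF x cy] dkron_Suc[OF x y] Suc.IH smult_kron_vec
    by (rule eq_vecI) (use x y in \<open>auto simp: algebra_simps\<close>)
qed

text \<open>Euler's identity for homogeneous functions of degree k.\<close>

lemma dkron_self:
  assumes x: "x \<in> carrier_vec n"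
  shows "dkron n k x x = real k \<cdot>\<^sub>v (x ^\<^sub>\<otimes> k)"
proof (induction k)
  case 0
  show ?case by (auto simp: dkron_0)
next
  case (Suc k)
  show ?case unfolding dkron_Suc[OF x x] Suc.IH smult_kron_vec kron_pow_Suc
    by (rule eq_vecI) (auto simp: algebra_simps)
qed

text \<open>Vectors are parametrized by functions on the natural numbers, whose product topology
  provides continuity here and compactness for the minimum below.\<close>

lemma continuous_on_kron_pow_index:
  "j < n ^ k \<Longrightarrow> continuous_on UNIV (\<lambda>\<phi>. (vec n \<phi> ^\<^sub>\<otimes> k) $ j :: real)"
proof (induction k arbitrary: j)
  case 0
  thus ?case by simp
next
  case (Suc k)
  hence j: "j < n * n ^ k" by simp
  have "(vec n \<phi> ^\<^sub>\<otimes> Suc k) $ j = \<phi> (j div n ^ k) * (vec n \<phi> ^\<^sub>\<otimes> k) $ (j mod n ^ k)" for \<phi>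
    using j div_mod_less[OF j] by (simp add: kron_pow_Suc index_kron_vec)
  thus ?case using Suc.IH[OF div_mod_less(2)[OF j]]
    by (simp only:) (intro continuous_intros continuous_on_product_coordinates)
qed

lemma continuous_on_scalar_prod_kron_pow:
  assumes "u \<in> carrier_vec (n ^ k)"
  shows "continuous_on UNIV (\<lambda>\<phi>. u \<bullet> (vec n \<phi> ^\<^sub>\<otimes> k) :: real)"
proof -
  have "u \<bullet> (vec n \<phi> ^\<^sub>\<otimes> k) = (\<Sum>j = 0..<n ^ k. u $ j * (vec n \<phi> ^\<^sub>\<otimes> k) $ j)" for \<phi>
    by (simp add: scalar_prod_def)
  thus ?thesis
    by (simp only:) (intro continuous_intros continuous_on_kron_pow_index, auto)
qed

lemma continuous_on_quadratic_form:
  assumes P: "P \<in> carrier_mat n n"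
  shows "continuous_on UNIV (\<lambda>\<phi>. vec n \<phi> \<bullet> (P *\<^sub>v vec n \<phi>) :: real)"
proof -
  have "vec n \<phi> \<bullet> (P *\<^sub>v vec n \<phi>) = (\<Sum>i<n. \<phi> i * (\<Sum>j<n. P $$ (i, j) * \<phi> j))" for \<phi>
    using P by (simp add: scalar_prod_def[of "vec n \<phi>"] atLeast0LessThan mult_mat_vec_sum[OF P] del: index_mult_mat_vec)
  thus ?thesis
    by (simp only:) (intro continuous_intros continuous_on_product_coordinates)
qed

lemma quadratic_form_add_smult:
  assumes P: "P \<in> carrier_mat n n" "P\<^sup>T = P" and x: "x \<in> carrier_vec n" and y: "y \<in> carrier_vec n"
  shows "(x + t \<cdot>\<^sub>v y) \<bullet> (P *\<^sub>v (x + t \<cdot>\<^sub>v y))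
    = x \<bullet> (P *\<^sub>v x) + 2 * t * (x \<bullet> (P *\<^sub>v y)) + t\<^sup>2 * (y \<bullet> (P *\<^sub>v y) :: real)"
proof -
  have Px: "P *\<^sub>v x \<in> carrier_vec n" "P *\<^sub>v y \<in> carrier_vec n" using P x y by auto
  have "y \<bullet> (P *\<^sub>v x) = (P\<^sup>T *\<^sub>v y) \<bullet> x" by (rule transpose_vec_mult_scalar[OF P(1) x y, symmetric])
  also have "\<dots> = x \<bullet> (P *\<^sub>v y)" using P Px x by (simp add: comm_scalar_prod[of _ n])
  finally have s: "y \<bullet> (P *\<^sub>v x) = x \<bullet> (P *\<^sub>v y)" .
  have ty: "t \<cdot>\<^sub>v y \<in> carrier_vec n" using y by auto
  have "P *\<^sub>v (x + t \<cdot>\<^sub>v y) = P *\<^sub>v x + t \<cdot>\<^sub>v (P *\<^sub>v y)"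
    using P x y by (simp add: mult_add_distrib_mat_vec[of P n n] mult_mat_vec[of P n n])
  thus ?thesis using x y Px ty s
    by (simp add: add_scalar_prod_distrib[of _ n] scalar_prod_add_distrib[of _ n] power2_eq_square algebra_simps)
qed

text \<open>A minimum point of the polynomial on a sublevel set of the Lyapunov function cannot have a negative value:
  moving from it a little against the vector field and outwards would decrease the value.\<close>

lemma lyapunov_derivative_nonneg_imp_nonneg:
  assumes k: "1 \<le> k" and u: "u \<in> carrier_vec (n ^ k)" and A: "A \<in> carrier_mat n n"
    and P: "P \<in> carrier_mat n n" "P\<^sup>T = P" and pos: "0 < \<delta>" "0 < \<mu>"
    and low: "\<And>x. x \<in> carrier_vec n \<Longrightarrow> \<mu> * (x \<bullet> x) \<le> x \<bullet> (P *\<^sub>v x)"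
    and lyap: "\<And>x. x \<in> carrier_vec n \<Longrightarrow> \<delta> * (x \<bullet> x) \<le> x \<bullet> (P *\<^sub>v (A *\<^sub>v x))"
    and deriv: "\<And>x. x \<in> carrier_vec n \<Longrightarrow> 0 \<le> u \<bullet> dkron n k x (A *\<^sub>v x)"
    and x1: "x1 \<in> carrier_vec n"
  shows "0 \<le> u \<bullet> (x1 ^\<^sub>\<otimes> k)"
proof (rule ccontr)
  assume neg: "\<not> 0 \<le> u \<bullet> (x1 ^\<^sub>\<otimes> k)"
  let ?p = "\<lambda>x. u \<bullet> (x ^\<^sub>\<otimes> k)" and ?W = "\<lambda>x. x \<bullet> (P *\<^sub>v x)"
  have sq_nonneg: "0 \<le> x \<bullet> x" for x :: "real vec"
    by (auto simp: scalar_prod_def intro!: sum_nonneg)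
  have W_nonneg: "0 \<le> ?W x" if "x \<in> carrier_vec n" for x
    by (rule order.trans[OF _ low[OF that]]) (use sq_nonneg[of x] pos in simp)
  \<comment> \<open>Coordinates from n on are pinned to 0, which keeps the box compact without
    affecting \<open>vec n\<close>. The half width 1 + 1/\<mu> dominates the square root of 1/\<mu>,
    the bound that coercivity gives on the sublevel set.\<close>
  define box where "box = (\<Pi>\<^sub>E i\<in>UNIV. if i < n then {- (1 + 1 / \<mu>)..1 + 1 / \<mu>} else {0 :: real})"
  define S where "S = box \<inter> {\<phi>. ?W (vec n \<phi>) \<le> 1}"
  have "compactin (product_topology (\<lambda>i. euclidean) UNIV) box"
    unfolding box_def compactin_PiE by (intro disjI2 ballI) simp
  hence "compact box" by (simp add: euclidean_product_topology compactin_euclidean_iff)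
  moreover have "closed {\<phi>. ?W (vec n \<phi>) \<le> 1}"
    by (intro closed_Collect_le continuous_on_quadratic_form P continuous_intros)
  ultimately have comp: "compact S" unfolding S_def by (rule compact_Int_closed)
  have in_S: "(\<lambda>i. if i < n then x $ i else 0) \<in> S" if x: "x \<in> carrier_vec n" "?W x \<le> 1" for x
  proof -
    have "\<bar>x $ i\<bar> \<le> 1 + 1 / \<mu>" if i: "i < n" for i
    proof -
      have "\<mu> * (x $ i)\<^sup>2 \<le> \<mu> * (x \<bullet> x)"
        unfolding scalar_prod_def power2_eq_square using i x pos
        by (intro mult_left_mono member_le_sum) auto
      also have "\<dots> \<le> 1" using low[OF x(1)] x(2) by simp
      finally have "(x $ i)\<^sup>2 \<le> 1 / \<mu>" using pos by (simp add: field_simps)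
      also have "\<dots> \<le> (1 + 1 / \<mu>)\<^sup>2" using pos by (simp add: power2_eq_square field_simps)
      finally have "\<bar>x $ i\<bar> \<le> \<bar>1 + 1 / \<mu>\<bar>" by (simp only: abs_le_square_iff)
      thus ?thesis using pos by simp
    qed
    hence "- (1 + 1 / \<mu>) \<le> x $ i \<and> x $ i \<le> 1 + 1 / \<mu>" if "i < n" for i
      using that by (metis abs_le_iff minus_le_iff)
    hence "(\<lambda>i. if i < n then x $ i else 0) \<in> box"
      unfolding box_def by (simp add: PiE_def Pi_def)
    moreover have "vec n (\<lambda>i. if i < n then x $ i else 0) = x" using x by auto
    ultimately show ?thesis using x by (simp add: S_def)
  qed
  have "(\<lambda>i. if i < n then 0\<^sub>v n $ i else 0) \<in> S"
    by (rule in_S) (use P in \<open>auto simp: scalar_prod_def\<close>)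
  hence "S \<noteq> {}" by blast
  hence "\<exists>\<phi>\<in>S. \<forall>\<psi>\<in>S. ?p (vec n \<phi>) \<le> ?p (vec n \<psi>)"
    by (rule continuous_attains_inf[OF comp])
      (rule continuous_on_subset[OF continuous_on_scalar_prod_kron_pow[OF u] subset_UNIV])
  then obtain \<phi> where \<phi>: "\<phi> \<in> S" and min: "\<forall>\<psi>\<in>S. ?p (vec n \<phi>) \<le> ?p (vec n \<psi>)" by blast
  define x where "x = vec n \<phi>"
  have x: "x \<in> carrier_vec n" by (simp add: x_def)
  have Wx: "?W x \<le> 1" using \<phi> by (simp add: S_def x_def)
  have min': "?p x \<le> ?p z" if z: "z \<in> carrier_vec n" "?W z \<le> 1" for z
  proof -
    have "vec n (\<lambda>i. if i < n then z $ i else 0) = z" using z by auto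
    thus ?thesis using bspec[OF min in_S[OF z]] by (simp add: x_def)
  qed
  \<comment> \<open>Shrinks x1 into the sublevel set; by homogeneity the polynomial stays negative
    there, hence so is the minimum.\<close>
  define c where "c = 1 / (1 + ?W x1)"
  have c: "0 < c" "c \<le> 1" "c * ?W x1 \<le> 1" using W_nonneg[OF x1] by (auto simp: c_def field_simps)
  have "?W (c \<cdot>\<^sub>v x1) = c * (c * ?W x1)"
    using P x1 by (simp add: mult_mat_vec[of P n n])
  also have "\<dots> \<le> 1 * 1" using c W_nonneg[OF x1] by (intro mult_mono) auto
  finally have "?p x \<le> ?p (c \<cdot>\<^sub>v x1)" using x1 by (intro min') auto
  also have "\<dots> = c ^ k * ?p x1" using u x1 by (simp add: kron_pow_smult)
  also have "\<dots> < 0" using neg c by (simp add: mult_pos_neg)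
  finally have px: "?p x < 0" .
  have "x \<noteq> 0\<^sub>v n"
  proof
    assume "x = 0\<^sub>v n"
    hence "x = 0 \<cdot>\<^sub>v x" using x by auto
    hence "?p x = ?p (0 \<cdot>\<^sub>v x)" by simp
    also have "\<dots> = 0" using k u x by (simp add: kron_pow_smult)
    finally show False using px by simp
  qed
  then obtain i where i: "i < n" "x $ i \<noteq> 0" using x by (auto simp: vec_eq_iff)
  have "0 < x $ i * x $ i" using i by (auto simp: zero_less_mult_iff)
  also have "\<dots> \<le> x \<bullet> x" unfolding scalar_prod_def using i x
    by (intro member_le_sum[of i _ "\<lambda>i. x $ i * x $ i"]) auto
  finally have xx: "0 < x \<bullet> x" .
  \<comment> \<open>Small enough that y = -A x + \<kappa> x still decreases the Lyapunov function.
    The outward part \<kappa> x decreases the polynomial strictly, by Euler's identity at a negative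
    value, and the part -A x does not increase it.\<close>
  define \<kappa> where "\<kappa> = \<delta> * (x \<bullet> x) / (1 + ?W x)"
  have \<kappa>: "0 < \<kappa>" "\<kappa> * ?W x < \<delta> * (x \<bullet> x)"
    using xx pos W_nonneg[OF x] by (auto simp: \<kappa>_def field_simps add_pos_nonneg)
  define y where "y = - 1 \<cdot>\<^sub>v (A *\<^sub>v x) + \<kappa> \<cdot>\<^sub>v x"
  have Ax: "A *\<^sub>v x \<in> carrier_vec n" using A x by auto
  have y: "y \<in> carrier_vec n" using Ax x by (auto simp: y_def)
  have "x \<bullet> (P *\<^sub>v y) = \<kappa> * ?W x - x \<bullet> (P *\<^sub>v (A *\<^sub>v x))"
    unfolding y_def using P x Ax
    by (simp add: mult_add_distrib_mat_vec[of P n n] mult_mat_vec[of P n n] scalar_prod_add_distrib[of _ n])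
  hence xPy: "x \<bullet> (P *\<^sub>v y) < 0" using \<kappa> lyap[OF x] by simp
  have "((\<lambda>t. ?W (x + t \<cdot>\<^sub>v y)) has_real_derivative 2 * (x \<bullet> (P *\<^sub>v y))) (at 0)"
    unfolding quadratic_form_add_smult[OF P x y] by (auto intro!: derivative_eq_intros)
  from DERIV_neg_dec_right[OF this] xPy
  have "\<exists>d>0. \<forall>h>0. h < d \<longrightarrow> ?W (x + (0 + h) \<cdot>\<^sub>v y) < ?W (x + 0 \<cdot>\<^sub>v y)" by (simp add: mult_less_0_iff)
  then obtain d1 where d1: "0 < d1" "\<And>t. 0 < t \<Longrightarrow> t < d1 \<Longrightarrow> ?W (x + t \<cdot>\<^sub>v y) < ?W (x + 0 \<cdot>\<^sub>v y)"
    by auto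
  have x0: "x + 0 \<cdot>\<^sub>v y = x" using x y by auto
  have "u \<bullet> dkron n k x y = - (u \<bullet> dkron n k x (A *\<^sub>v x)) + \<kappa> * (real k * ?p x)"
  proof -
    have "dkron n k x y = - 1 \<cdot>\<^sub>v dkron n k x (A *\<^sub>v x) + dkron n k x (\<kappa> \<cdot>\<^sub>v x)"
      unfolding y_def by (rule dkron_lincomb) (use x Ax in auto)
    also have "dkron n k x (\<kappa> \<cdot>\<^sub>v x) = \<kappa> \<cdot>\<^sub>v (real k \<cdot>\<^sub>v (x ^\<^sub>\<otimes> k))"
      unfolding dkron_smult[OF x x] dkron_self[OF x] ..
    finally show ?thesis
      using x u dkron_carrier[of n k x "A *\<^sub>v x"] dkron_carrier[of n k x x] kron_pow_carrier[OF x, of k]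
      by (simp add: scalar_prod_add_distrib[of _ "n ^ k"])
  qed
  moreover have "0 \<le> u \<bullet> dkron n k x (A *\<^sub>v x)" by (rule deriv[OF x])
  moreover have "\<kappa> * (real k * ?p x) < 0" using \<kappa> k px by (auto intro!: mult_pos_neg)
  ultimately have "u \<bullet> dkron n k x y < 0" by linarith
  moreover have "((\<lambda>t. ?p (x + t \<cdot>\<^sub>v y)) has_real_derivative u \<bullet> dkron n k (x + 0 \<cdot>\<^sub>v y) y) (at 0)"
    by (rule has_derivative_scalar_prod_kron_pow[OF x y u])
  ultimately have "\<exists>d>0. \<forall>h>0. h < d \<longrightarrow> ?p (x + (0 + h) \<cdot>\<^sub>v y) < ?p (x + 0 \<cdot>\<^sub>v y)"
    unfolding x0 using DERIV_neg_dec_right[of "\<lambda>t. ?p (x + t \<cdot>\<^sub>v y)" _ 0] by (auto simp: x0)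
  then obtain d2 where d2: "0 < d2" "\<And>t. 0 < t \<Longrightarrow> t < d2 \<Longrightarrow> ?p (x + t \<cdot>\<^sub>v y) < ?p (x + 0 \<cdot>\<^sub>v y)"
    by auto
  define t where "t = min d1 d2 / 2"
  have t: "0 < t" "t < d1" "t < d2" using d1 d2 by (auto simp: t_def)
  have "?p x \<le> ?p (x + t \<cdot>\<^sub>v y)"
    by (rule min') (use d1(2)[OF t(1,2)] Wx x y in \<open>auto simp: x0\<close>)
  thus False using d2(2)[OF t(1,3)] x0 by simp
qed

section \<open>Estimates of the Euclidean norm, and instability by linearization\<close>

lemma vnorm_square_real: "(vnorm x)\<^sup>2 = x \<bullet> (x :: real vec)"
  by (simp add: vnorm_def L2_set_def scalar_prod_def atLeast0LessThan sum_nonneg power2_eq_square)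

lemma vnorm_nonneg [simp]: "0 \<le> vnorm x"
  by (simp add: vnorm_def L2_set_nonneg)

lemma abs_scalar_prod_le_vnorm:
  assumes "dim_vec x = dim_vec y"
  shows "\<bar>x \<bullet> y\<bar> \<le> vnorm x * vnorm (y :: real vec)"
proof -
  have "\<bar>x \<bullet> y\<bar> \<le> (\<Sum>i<dim_vec y. \<bar>x $ i\<bar> * \<bar>y $ i\<bar>)"
    unfolding scalar_prod_def atLeast0LessThan abs_mult[symmetric] by (rule sum_abs)
  also have "\<dots> \<le> L2_set (\<lambda>i. \<bar>x $ i\<bar>) {..<dim_vec y} * L2_set (\<lambda>i. \<bar>y $ i\<bar>) {..<dim_vec y}"
    using L2_set_mult_ineq[of "\<lambda>i. \<bar>x $ i\<bar>" "\<lambda>i. \<bar>y $ i\<bar>"] by simp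
  finally show ?thesis using assms by (simp add: vnorm_def)
qed

lemma vnorm_mult_mat_vec_le:
  fixes P :: "real mat"
  assumes P: "P \<in> carrier_mat a b"
  shows "\<exists>K\<ge>0. \<forall>x\<in>carrier_vec b. vnorm (P *\<^sub>v x) \<le> K * vnorm x"
proof -
  define K where "K = sqrt (\<Sum>i<a. \<Sum>j<b. (P $$ (i, j))\<^sup>2)"
  have K: "0 \<le> K" "K\<^sup>2 = (\<Sum>i<a. \<Sum>j<b. (P $$ (i, j))\<^sup>2)" by (auto simp: K_def sum_nonneg)
  have "vnorm (P *\<^sub>v x) \<le> K * vnorm x" if x: "x \<in> carrier_vec b" for x
  proof (rule power2_le_imp_le)
    have "(vnorm (P *\<^sub>v x))\<^sup>2 = (\<Sum>i<a. (\<Sum>j<b. P $$ (i, j) * x $ j)\<^sup>2)"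
      unfolding vnorm_def L2_set_def using P
      by (simp add: sum_nonneg mult_mat_vec_sum[OF P x] del: index_mult_mat_vec)
    also have "\<dots> \<le> (\<Sum>i<a. (\<Sum>j<b. (P $$ (i, j))\<^sup>2) * (\<Sum>j<b. (x $ j)\<^sup>2))"
      by (intro sum_mono Cauchy_Schwarz_ineq_sum)
    also have "\<dots> = K\<^sup>2 * (vnorm x)\<^sup>2"
      using x by (simp add: K vnorm_def L2_set_def sum_nonneg sum_distrib_right)
    finally show "(vnorm (P *\<^sub>v x))\<^sup>2 \<le> (K * vnorm x)\<^sup>2" by (simp add: power_mult_distrib)
  qed (use K in auto)
  thus ?thesis using K(1) by blast
qed

lemma vnorm_smult: "vnorm (c \<cdot>\<^sub>v x) = \<bar>c\<bar> * vnorm (x :: real vec)"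
proof (rule power2_eq_imp_eq)
  show "(vnorm (c \<cdot>\<^sub>v x))\<^sup>2 = (\<bar>c\<bar> * vnorm x)\<^sup>2"
    unfolding power_mult_distrib vnorm_square_real by (simp add: power2_eq_square)
qed auto

text \<open>Finiteness allows the choice of a line Re s = c that avoids the spectrum.\<close>

lemma finite_eigenvalues:
  assumes "M \<in> carrier_mat n n" shows "finite {s :: complex. eigenvalue M s}"
proof -
  have "char_poly M \<noteq> 0" using degree_monic_char_poly[OF assms] by auto
  thus ?thesis using poly_roots_finite eigenvalue_root_char_poly[OF assms] by simp
qed

text \<open>Chetaev's argument: \<open>x\<^sup>T P x\<close> grows exponentially along solutions near the origin.\<close>

lemma asymptotically_stable_imp_Re_eigenvalue_le:
  assumes M: "M \<in> carrier_mat n n" and \<rho>: "0 < \<rho>"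
    and lin: "\<And>x. x \<in> carrier_vec n \<Longrightarrow> vnorm x < \<rho> \<Longrightarrow>
      \<Phi> x \<in> carrier_vec n \<and> vnorm (\<Phi> x - M *\<^sub>v x) \<le> K * (vnorm x)\<^sup>2"
    and stable: "asymptotically_stable n \<Phi>"
    and ev: "eigenvalue (cmat M) s"
  shows "Re s \<le> 0"
proof (rule ccontr)
  assume "\<not> Re s \<le> 0"
  hence s: "0 < Re s" by simp
  \<comment> \<open>The rate c must be positive to force growth, smaller than Re s to leave an
    eigenvalue to its right, and off the spectrum for the Lyapunov form to exist.\<close>
  have "infinite ({0<..<Re s} - Re ` {s. eigenvalue (cmat M) s})"
    using finite_eigenvalues[of "cmat M" n] M s by (intro Diff_infinite_finite) auto
  then obtain c where "c \<in> {0<..<Re s} - Re ` {s. eigenvalue (cmat M) s}"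
    using infinite_imp_nonempty by blast
  hence c: "0 < c" "c < Re s" "\<forall>s. eigenvalue (cmat M) s \<longrightarrow> Re s \<noteq> c" by auto
  obtain P \<delta> where P: "P \<in> carrier_mat n n" "P\<^sup>T = P" and \<delta>: "0 < \<delta>"
    and lyap: "\<forall>x\<in>carrier_vec n. c * (x \<bullet> (P *\<^sub>v x)) + \<delta> * (x \<bullet> x) \<le> x \<bullet> (P *\<^sub>v (M *\<^sub>v x))"
    and ex: "(\<exists>s. eigenvalue (cmat M) s \<and> c < Re s) \<longrightarrow> (\<exists>x\<in>carrier_vec n. 0 < x \<bullet> (P *\<^sub>v x))"
    using lyapunov_form[OF M c(3)] by (elim exE conjE) (rule that)
  obtain x1 where x1: "x1 \<in> carrier_vec n" "0 < x1 \<bullet> (P *\<^sub>v x1)" using ex ev c by blast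
  obtain N where N1: "0 \<le> N" and N2: "\<forall>x\<in>carrier_vec n. vnorm (P *\<^sub>v x) \<le> N * vnorm x"
    using vnorm_mult_mat_vec_le[OF P(1)] by blast
  note N = N1 bspec[OF N2]
  \<comment> \<open>Within this radius the quadratic remainder, weighted with the norm bound N of P,
    is absorbed by \<delta> |x|^2. The added 1 keeps the denominator positive.\<close>
  define \<epsilon> where "\<epsilon> = min \<rho> (\<delta> / (N * \<bar>K\<bar> + 1))"
  have \<epsilon>: "0 < \<epsilon>" "\<epsilon> \<le> \<rho>" "\<epsilon> * (N * \<bar>K\<bar>) \<le> \<delta>"
  proof -
    have p: "0 < N * \<bar>K\<bar> + 1" using N by (simp add: add_nonneg_pos)
    show "0 < \<epsilon>" "\<epsilon> \<le> \<rho>" using \<rho> \<delta> p by (auto simp: \<epsilon>_def)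
    have "\<epsilon> * (N * \<bar>K\<bar>) \<le> \<delta> / (N * \<bar>K\<bar> + 1) * (N * \<bar>K\<bar> + 1)"
      using N p \<delta> by (intro mult_mono) (auto simp: \<epsilon>_def)
    thus "\<epsilon> * (N * \<bar>K\<bar>) \<le> \<delta>" using p by simp
  qed
  have "\<exists>d>0. \<forall>x0\<in>carrier_vec n. vnorm x0 < d \<longrightarrow>
      (\<exists>x. solves_ode n \<Phi> x \<and> x 0 = x0) \<and> (\<forall>x. solves_ode n \<Phi> x \<and> x 0 = x0 \<longrightarrow> (\<forall>t\<ge>0. vnorm (x t) < \<epsilon>))"
    using stable \<epsilon>(1) unfolding asymptotically_stable_def by simp
  then obtain d where d: "0 < d" and ex_sol: "\<forall>x0\<in>carrier_vec n. vnorm x0 < d \<longrightarrow>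
      (\<exists>x. solves_ode n \<Phi> x \<and> x 0 = x0) \<and> (\<forall>x. solves_ode n \<Phi> x \<and> x 0 = x0 \<longrightarrow> (\<forall>t\<ge>0. vnorm (x t) < \<epsilon>))"
    by (elim exE conjE) (rule that)
  \<comment> \<open>Scales the direction of positive value into the neighbourhood that stability
    provides.\<close>
  define b where "b = d / (1 + vnorm x1)"
  have b: "0 < b" using d vnorm_nonneg[of x1] by (simp add: b_def add_pos_nonneg)
  have "vnorm (b \<cdot>\<^sub>v x1) < d"
    using d vnorm_nonneg[of x1] by (simp add: vnorm_smult b_def field_simps add_pos_nonneg)
  then obtain x where ode: "solves_ode n \<Phi> x" and x0: "x 0 = b \<cdot>\<^sub>v x1" and small: "\<And>t. 0 \<le> t \<Longrightarrow> vnorm (x t) < \<epsilon>"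
    using bspec[OF ex_sol, of "b \<cdot>\<^sub>v x1"] x1 by auto
  have xc: "x t \<in> carrier_vec n" if "0 \<le> t" for t using ode that by (auto simp: solves_ode_def)
  have xd: "((\<lambda>s. x s $ i) has_real_derivative \<Phi> (x t) $ i) (at t within {0..})" if "0 \<le> t" "i < n" for t i
    using ode that by (auto simp: solves_ode_def)
  have \<Phi>c: "\<Phi> (x t) \<in> carrier_vec n" "vnorm (\<Phi> (x t) - M *\<^sub>v x t) \<le> K * (vnorm (x t))\<^sup>2" if "0 \<le> t" for t
    using lin[OF xc[OF that]] small[OF that] \<epsilon>(2) by auto
  let ?W = "\<lambda>x. x \<bullet> (P *\<^sub>v x)"
  have bil: "y \<bullet> (P *\<^sub>v z) = (\<Sum>i<n. \<Sum>j<n. P $$ (i, j) * (y $ i * z $ j))"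
    if "y \<in> carrier_vec n" "z \<in> carrier_vec n" for y z
  proof -
    have "y \<bullet> (P *\<^sub>v z) = (\<Sum>i<n. y $ i * (\<Sum>j<n. P $$ (i, j) * z $ j))"
      using P by (simp add: scalar_prod_def[of y] atLeast0LessThan mult_mat_vec_sum[OF P(1) that(2)]
        del: index_mult_mat_vec)
    thus ?thesis by (simp only: sum_distrib_left mult.left_commute)
  qed
  have Wd: "((\<lambda>s. ?W (x s)) has_real_derivative 2 * (x t \<bullet> (P *\<^sub>v \<Phi> (x t)))) (at t within {0..})"
    if t: "0 \<le> t" for t
  proof -
    have "\<Phi> (x t) \<bullet> (P *\<^sub>v x t) = (P\<^sup>T *\<^sub>v \<Phi> (x t)) \<bullet> x t"
      by (rule transpose_vec_mult_scalar[OF P(1) xc[OF t] \<Phi>c(1)[OF t], symmetric])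
    also have "\<dots> = x t \<bullet> (P *\<^sub>v \<Phi> (x t))"
      using P(2) mult_mat_vec_carrier[OF P(1) \<Phi>c(1)[OF t]] xc[OF t] by (simp add: comm_scalar_prod[of _ n])
    finally have e: "\<Phi> (x t) \<bullet> (P *\<^sub>v x t) = x t \<bullet> (P *\<^sub>v \<Phi> (x t))" .
    have "((\<lambda>s. \<Sum>i<n. \<Sum>j<n. P $$ (i, j) * (x s $ i * x s $ j)) has_real_derivative
       (\<Sum>i<n. \<Sum>j<n. P $$ (i, j) * (\<Phi> (x t) $ i * x t $ j + \<Phi> (x t) $ j * x t $ i))) (at t within {0..})"
      by (intro DERIV_sum DERIV_cmult DERIV_mult xd) (use t in auto)
    also have "(\<Sum>i<n. \<Sum>j<n. P $$ (i, j) * (\<Phi> (x t) $ i * x t $ j + \<Phi> (x t) $ j * x t $ i))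
        = \<Phi> (x t) \<bullet> (P *\<^sub>v x t) + x t \<bullet> (P *\<^sub>v \<Phi> (x t))"
      unfolding bil[OF xc[OF t] \<Phi>c(1)[OF t]] bil[OF \<Phi>c(1)[OF t] xc[OF t]] sum.distrib[symmetric]
      by (intro sum.cong refl) (simp add: algebra_simps)
    also have "\<dots> = 2 * (x t \<bullet> (P *\<^sub>v \<Phi> (x t)))" using e by simp
    finally show ?thesis
      by (rule has_field_derivative_transform_within[where d=1]) (use t bil[OF xc xc] in simp_all)
  qed
  have grow: "c * ?W (x t) \<le> x t \<bullet> (P *\<^sub>v \<Phi> (x t))" if t: "0 \<le> t" for t
  proof -
    note xt = xc[OF t] and \<Phi>t = \<Phi>c[OF t]
    have Mx: "M *\<^sub>v x t \<in> carrier_vec n" using M xt by auto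
    let ?r = "\<Phi> (x t) - M *\<^sub>v x t"
    have r: "?r \<in> carrier_vec n" using \<Phi>t Mx by auto
    have "\<Phi> (x t) = M *\<^sub>v x t + ?r" by (rule eq_vecI) (use \<Phi>t(1) Mx M in simp_all)
    hence "x t \<bullet> (P *\<^sub>v \<Phi> (x t)) = x t \<bullet> (P *\<^sub>v (M *\<^sub>v x t)) + x t \<bullet> (P *\<^sub>v ?r)"
      using mult_add_distrib_mat_vec[OF P(1) Mx r]
        scalar_prod_add_distrib[OF xt mult_mat_vec_carrier[OF P(1) Mx] mult_mat_vec_carrier[OF P(1) r]] by simp
    moreover have "\<bar>x t \<bullet> (P *\<^sub>v ?r)\<bar> \<le> \<delta> * (x t \<bullet> x t)"
    proof -
      have "\<bar>x t \<bullet> (P *\<^sub>v ?r)\<bar> \<le> vnorm (x t) * vnorm (P *\<^sub>v ?r)"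
        by (rule abs_scalar_prod_le_vnorm) (use P xt in auto)
      also have "\<dots> \<le> vnorm (x t) * (N * (K * (vnorm (x t))\<^sup>2))"
        by (intro mult_left_mono order.trans[OF N(2)[OF r]] \<Phi>t(2) N(1)) auto
      also have "\<dots> \<le> vnorm (x t) * (N * (\<bar>K\<bar> * (vnorm (x t))\<^sup>2))"
        by (intro mult_left_mono mult_right_mono N(1)) auto
      also have "\<dots> = (vnorm (x t) * (N * \<bar>K\<bar>)) * (vnorm (x t))\<^sup>2" by (simp add: mult_ac)
      also have "\<dots> \<le> \<delta> * (vnorm (x t))\<^sup>2"
        using small[OF t] N(1) by (intro mult_right_mono order.trans[OF _ \<epsilon>(3)] mult_right_mono) auto
      finally show ?thesis by (simp add: vnorm_square_real)
    qed
    ultimately show ?thesis using bspec[OF lyap xt] by linarith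
  qed
  have exp_grow: "?W (x 0) \<le> ?W (x t) * exp (- 2 * c * t)" if t: "0 \<le> t" for t
  proof -
    let ?h = "\<lambda>s. ?W (x s) * exp (- 2 * c * s)"
    have hd: "(?h has_real_derivative 2 * (x s \<bullet> (P *\<^sub>v \<Phi> (x s)) - c * ?W (x s)) * exp (- 2 * c * s)) (at s within {0..})"
      if "0 \<le> s" for s
      by (rule derivative_eq_intros Wd[OF that] refl)+ (simp add: algebra_simps)
    have "?h 0 \<le> ?h t"
    proof (rule DERIV_nonneg_imp_increasing_open[OF t])
      fix s assume s: "0 < s" "s < t"
      have "at s within {0..} = at s" using s by (intro at_within_interior) (simp add: interior_Ici[of "-1"])
      moreover have "0 \<le> 2 * (x s \<bullet> (P *\<^sub>v \<Phi> (x s)) - c * ?W (x s)) * exp (- 2 * c * s)"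
        using grow[of s] s by simp
      ultimately show "\<exists>y. (?h has_real_derivative y) (at s) \<and> 0 \<le> y" using hd[of s] s by auto
    next
      have "continuous_on {0..} ?h" using hd by (intro DERIV_continuous_on) auto
      thus "continuous_on {0..t} ?h" by (rule continuous_on_subset) auto
    qed
    thus ?thesis by simp
  qed
  have W0: "0 < ?W (x 0)"
    using P x1 b by (simp add: x0 mult_mat_vec[of P n n])
  have bound: "?W (x t) \<le> N * \<epsilon>\<^sup>2" if t: "0 \<le> t" for t
  proof -
    have "?W (x t) \<le> vnorm (x t) * vnorm (P *\<^sub>v x t)"
      using abs_scalar_prod_le_vnorm[of "x t" "P *\<^sub>v x t"] P xc[OF t] by auto
    also have "\<dots> \<le> \<epsilon> * (N * \<epsilon>)"
      using small[OF t] \<epsilon>(1) N(1) by (intro mult_mono order.trans[OF N(2)[OF xc[OF t]]] mult_left_mono) auto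
    finally show ?thesis by (simp add: power2_eq_square mult_ac)
  qed
  \<comment> \<open>Since e^z \<ge> 1 + z, at this time the exponential lower bound for the form
    exceeds its upper bound N \<epsilon>^2 by its initial value.\<close>
  define t where "t = N * \<epsilon>\<^sup>2 / ?W (x 0) / (2 * c)"
  have t: "0 \<le> t" using N W0 c by (simp add: t_def)
  have "?W (x 0) * exp (2 * c * t) \<le> ?W (x t)"
    using exp_grow[OF t] by (simp add: exp_minus field_simps)
  moreover have "1 + 2 * c * t \<le> exp (2 * c * t)" by (rule exp_ge_add_one_self)
  hence "?W (x 0) * (1 + 2 * c * t) \<le> ?W (x 0) * exp (2 * c * t)" using W0 by simp
  moreover have "?W (x 0) * (1 + 2 * c * t) = ?W (x 0) + N * \<epsilon>\<^sup>2"
    using W0 c by (simp add: t_def field_simps)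
  ultimately show False using bound[OF t] W0 by linarith
qed

section \<open>Homogeneous parts of the HJB equation\<close>

lemma abs_kron_pow_index_le:
  fixes x :: "real vec"
  assumes x: "x \<in> carrier_vec n" and R: "\<And>i. i < n \<Longrightarrow> \<bar>x $ i\<bar> \<le> R"
  shows "j < n ^ k \<Longrightarrow> \<bar>(x ^\<^sub>\<otimes> k) $ j\<bar> \<le> R ^ k"
proof (induction k arbitrary: j)
  case (Suc k)
  hence j: "j < n * n ^ k" by simp
  have "\<bar>x $ (j div n ^ k)\<bar> * \<bar>(x ^\<^sub>\<otimes> k) $ (j mod n ^ k)\<bar> \<le> R * R ^ k"
    using R[OF div_mod_less(1)[OF j]] Suc.IH[OF div_mod_less(2)[OF j]] by (intro mult_mono) auto
  thus ?case using j x by (simp add: kron_pow_Suc index_kron_vec abs_mult)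
qed simp

text \<open>The majorant is the derivative of R^k, and the Leibniz recursion reproduces it.\<close>

lemma abs_dkron_index_le:
  assumes x: "x \<in> carrier_vec n" and y: "y \<in> carrier_vec n"
    and R: "\<And>i. i < n \<Longrightarrow> \<bar>x $ i\<bar> \<le> R" and one: "\<And>i. i < n \<Longrightarrow> \<bar>y $ i\<bar> \<le> 1"
  shows "j < n ^ k \<Longrightarrow> \<bar>dkron n k x y $ j\<bar> \<le> real k * R ^ (k - 1)"
proof (induction k arbitrary: j)
  case 0
  thus ?case by (simp add: dkron_0)
next
  case (Suc k)
  hence j: "j < n * n ^ k" by simp
  note j' = div_mod_less[OF j]
  have "0 \<le> R" using R[OF j'(1)] by simp
  have "dkron n (Suc k) x y $ j
      = y $ (j div n ^ k) * (x ^\<^sub>\<otimes> k) $ (j mod n ^ k) + x $ (j div n ^ k) * dkron n k x y $ (j mod n ^ k)"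
    unfolding dkron_Suc[OF x y] using j x y by (simp add: index_kron_vec)
  also have "\<bar>\<dots>\<bar> \<le> \<bar>y $ (j div n ^ k)\<bar> * \<bar>(x ^\<^sub>\<otimes> k) $ (j mod n ^ k)\<bar>
      + \<bar>x $ (j div n ^ k)\<bar> * \<bar>dkron n k x y $ (j mod n ^ k)\<bar>"
    unfolding abs_mult[symmetric] by (rule abs_triangle_ineq)
  also have "\<dots> \<le> 1 * R ^ k + R * (real k * R ^ (k - 1))"
    using one[OF j'(1)] R[OF j'(1)] abs_kron_pow_index_le[OF x R j'(2)] Suc.IH[OF j'(2)]
    by (intro add_mono mult_mono) (use \<open>0 \<le> R\<close> in auto)
  also have "\<dots> = real (Suc k) * R ^ (Suc k - 1)"
    by (cases k) (auto simp: algebra_simps)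
  finally show ?case .
qed

lemma abs_scalar_prod_le_sum:
  fixes u z :: "real vec"
  assumes "u \<in> carrier_vec N" "z \<in> carrier_vec N" "\<And>j. j < N \<Longrightarrow> \<bar>z $ j\<bar> \<le> c"
  shows "\<bar>u \<bullet> z\<bar> \<le> (\<Sum>j<N. \<bar>u $ j\<bar>) * c"
proof -
  have "\<bar>u \<bullet> z\<bar> \<le> (\<Sum>j<N. \<bar>u $ j * z $ j\<bar>)"
    using assms(2) unfolding scalar_prod_def by (simp add: atLeast0LessThan sum_abs)
  also have "\<dots> \<le> (\<Sum>j<N. \<bar>u $ j\<bar> * c)"
    by (intro sum_mono) (use assms in \<open>auto simp: abs_mult intro: mult_left_mono\<close>)
  finally show ?thesis by (simp add: sum_distrib_right)
qed

lemma vnorm_le_sum: "vnorm (x :: real vec) \<le> (\<Sum>i<dim_vec x. \<bar>x $ i\<bar>)"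
  unfolding vnorm_def by (rule order.trans[OF L2_set_le_sum]) auto

lemma abs_index_le_vnorm: "i < dim_vec x \<Longrightarrow> \<bar>x $ i\<bar> \<le> vnorm (x :: real vec)"
  unfolding vnorm_def using member_le_L2_set[of "{..<dim_vec x}" i "\<lambda>i. norm (x $ i)"] by auto

text \<open>At a constant vector all monomials of degree k have the value r^k. Absolute convergence
  at this single point therefore bounds the sums of the absolute coefficients.\<close>

lemma kron_pow_const: "j < n ^ k \<Longrightarrow> (vec n (\<lambda>_. r) ^\<^sub>\<otimes> k) $ j = r ^ k"
proof (induction k arbitrary: j)
  case (Suc k)
  hence j: "j < n * n ^ k" by simp
  show ?case using j div_mod_less[OF j] Suc.IH[of "j mod n ^ k"]
    by (simp add: kron_pow_Suc index_kron_vec)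
qed simp

text \<open>The price of termwise differentiation: halving the radius pays for the factor k.\<close>

lemma nat_le_power2: "1 \<le> k \<Longrightarrow> real k \<le> 2 ^ (k - 1)"
proof (induction k)
  case (Suc k)
  show ?case
  proof (cases "k = 0")
    case False
    hence "real k \<le> 2 ^ (k - 1)" using Suc by auto
    moreover have "(1::real) \<le> 2 ^ (k - 1)" by simp
    moreover have "(2::real) ^ k = 2 * 2 ^ (k - 1)" using False by (cases k) auto
    ultimately have "real (Suc k) \<le> 2 ^ k" by linarith
    thus ?thesis by simp
  qed simp
qed simp

text \<open>Grouping an unconditional sum by degree. The absolute version supplies the majorants for
  the gradient.\<close>

lemma power_series_at_0_sums:
  assumes c: "\<forall>k. w k \<in> carrier_vec (n ^ k)" and x: "x \<in> carrier_vec n"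
    and hs: "((\<lambda>(k, j). w k $ j * (x ^\<^sub>\<otimes> k) $ j) has_sum e) (SIGMA k:UNIV. {..<n ^ k})"
  shows "(\<lambda>k. w k \<bullet> (x ^\<^sub>\<otimes> k)) sums e"
    and "summable (\<lambda>k. \<Sum>j<n ^ k. \<bar>w k $ j * (x ^\<^sub>\<otimes> k) $ j\<bar>)"
proof -
  have "((\<lambda>j. case (k, j) of (k, j) \<Rightarrow> w k $ j * (x ^\<^sub>\<otimes> k) $ j) has_sum w k \<bullet> (x ^\<^sub>\<otimes> k)) {..<n ^ k}" for k
    using has_sum_finite[of "{..<n ^ k}" "\<lambda>j. w k $ j * (x ^\<^sub>\<otimes> k) $ j"] x
    by (simp add: scalar_prod_def atLeast0LessThan)
  from has_sum_SigmaD[OF hs this] show "(\<lambda>k. w k \<bullet> (x ^\<^sub>\<otimes> k)) sums e"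
    by (simp add: has_sum_imp_sums)
  have "(\<lambda>(k, j). w k $ j * (x ^\<^sub>\<otimes> k) $ j) summable_on (SIGMA k:UNIV. {..<n ^ k})"
    using hs by (rule has_sum_imp_summable)
  hence "(\<lambda>z. norm (case z of (k, j) \<Rightarrow> w k $ j * (x ^\<^sub>\<otimes> k) $ j)) summable_on (SIGMA k:UNIV. {..<n ^ k})"
    by (subst (asm) summable_on_iff_abs_summable_on_real)
  then obtain s where s: "((\<lambda>z. norm (case z of (k, j) \<Rightarrow> w k $ j * (x ^\<^sub>\<otimes> k) $ j)) has_sum s) (SIGMA k:UNIV. {..<n ^ k})"
    by (auto simp: summable_on_def)
  have "((\<lambda>j. norm (case (k, j) of (k, j) \<Rightarrow> w k $ j * (x ^\<^sub>\<otimes> k) $ j)) has_sum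
      (\<Sum>j<n ^ k. \<bar>w k $ j * (x ^\<^sub>\<otimes> k) $ j\<bar>)) {..<n ^ k}" for k
    using has_sum_finite[of "{..<n ^ k}" "\<lambda>j. \<bar>w k $ j * (x ^\<^sub>\<otimes> k) $ j\<bar>"] by simp
  from has_sum_SigmaD[OF s this] have "(\<lambda>k. \<Sum>j<n ^ k. \<bar>w k $ j * (x ^\<^sub>\<otimes> k) $ j\<bar>) sums s"
    by (rule has_sum_imp_sums)
  thus "summable (\<lambda>k. \<Sum>j<n ^ k. \<bar>w k $ j * (x ^\<^sub>\<otimes> k) $ j\<bar>)" by (rule sums_summable)
qed

text \<open>The series is differentiated term by term with the Weierstrass majorant a_k k
  (r/2)^(k-1). In the tail the powers of the norm beyond d are absorbed by that majorant, which
  leaves the d-th power.\<close>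

lemma gradient_power_series_remainder:
  assumes ps: "has_power_series_at_0 n E w"
  shows "\<exists>\<rho>>0. \<exists>K\<ge>0. \<forall>x\<in>carrier_vec n. vnorm x < \<rho> \<longrightarrow> (\<forall>i<n.
     \<bar>gradient n E x $ i - (\<Sum>k\<le>d. w k \<bullet> dkron n k x (unit_vec n i))\<bar> \<le> K * vnorm x ^ d)"
proof -
  obtain \<rho> where wc: "\<forall>k. w k \<in> carrier_vec (n ^ k)" and \<rho>: "0 < \<rho>"
    and hs: "\<forall>x\<in>carrier_vec n. vnorm x < \<rho> \<longrightarrow>
        ((\<lambda>(k, j). w k $ j * (x ^\<^sub>\<otimes> k) $ j) has_sum E x) (SIGMA k:UNIV. {..<n ^ k})"
    using ps unfolding has_power_series_at_0_def by (elim exE conjE) (rule that)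
  \<comment> \<open>The cube of half width r lies in the ball of convergence, because the norm is at
    most the sum of the n coordinates.\<close>
  define r where "r = \<rho> / (1 + real n)"
  have r: "0 < r" "real n * r < \<rho>" using \<rho> by (auto simp: r_def field_simps)
  define a where "a k = (\<Sum>j<n ^ k. \<bar>w k $ j\<bar>)" for k
  have a: "0 \<le> a k" for k by (simp add: a_def sum_nonneg)
  have small: "vnorm x < \<rho>" if "x \<in> carrier_vec n" "\<And>i. i < n \<Longrightarrow> \<bar>x $ i\<bar> \<le> r" for x
  proof -
    have "vnorm x \<le> (\<Sum>i<n. \<bar>x $ i\<bar>)" using vnorm_le_sum[of x] that by simp
    also have "\<dots> \<le> (\<Sum>i<n. r)" by (intro sum_mono that(2)) simp
    finally show ?thesis using r by simp
  qed
  have ar: "summable (\<lambda>k. a k * r ^ k)"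
  proof -
    let ?c = "vec n (\<lambda>_. r)"
    have c: "?c \<in> carrier_vec n" by simp
    have "vnorm ?c < \<rho>" by (rule small) (use r in auto)
    hence "summable (\<lambda>k. \<Sum>j<n ^ k. \<bar>w k $ j * (?c ^\<^sub>\<otimes> k) $ j\<bar>)"
      using power_series_at_0_sums(2)[OF wc c] hs c by blast
    moreover have "(\<Sum>j<n ^ k. \<bar>w k $ j * (?c ^\<^sub>\<otimes> k) $ j\<bar>) = a k * r ^ k" for k
      unfolding a_def sum_distrib_right using r by (intro sum.cong) (auto simp: kron_pow_const abs_mult)
    ultimately show ?thesis by (simp only:)
  qed
  define m where "m k = a k * (real k * (r / 2) ^ (k - 1))" for k
  have m: "0 \<le> m k" for k using a r by (simp add: m_def)
  have m_sum: "summable m"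
  proof (rule summable_comparison_test')
    show "summable (\<lambda>k. a k * r ^ k / r)" by (intro summable_divide ar)
    fix k :: nat
    have "real k * (r / 2) ^ (k - 1) \<le> r ^ k / r"
    proof (cases "k = 0")
      case False
      hence "real k * (r / 2) ^ (k - 1) \<le> 2 ^ (k - 1) * (r / 2) ^ (k - 1)"
        using r by (intro mult_right_mono nat_le_power2) auto
      also have "\<dots> = r ^ (k - 1)" by (simp flip: power_mult_distrib)
      also have "\<dots> = r ^ k / r" using False r by (cases k) auto
      finally show ?thesis .
    qed (use r in simp)
    hence "m k \<le> a k * (r ^ k / r)" unfolding m_def by (intro mult_left_mono a)
    thus "norm (m k) \<le> a k * r ^ k / r" using m[of k] by simp
  qed
  \<comment> \<open>The tail is compared with the majorant at r/2, from which the factor (r/2)^d has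
    to be taken back.\<close>
  define K where "K = (\<Sum>k. m k) / (r / 2) ^ d"
  have K: "0 \<le> K" using r m by (auto simp: K_def intro!: divide_nonneg_nonneg suminf_nonneg m_sum)
  \<comment> \<open>A quarter of r for x and another quarter for the increment t keep the whole
    segment inside the cube of half width r/2.\<close>
  have main: "\<bar>gradient n E x $ i - (\<Sum>k\<le>d. w k \<bullet> dkron n k x (unit_vec n i))\<bar> \<le> K * vnorm x ^ d"
    if x: "x \<in> carrier_vec n" and vx: "vnorm x < r / 4" and i: "i < n" for x i
  proof -
    let ?e = "unit_vec n i :: real vec"
    let ?z = "\<lambda>t. x + t \<cdot>\<^sub>v ?e"
    have e1: "\<bar>?e $ j\<bar> \<le> 1" if "j < n" for j using that i by (simp add: unit_vec_def)
    have z: "?z t \<in> carrier_vec n" for t using x by auto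
    have zb: "\<bar>?z t $ j\<bar> \<le> r / 2" if t: "\<bar>t\<bar> \<le> r / 4" and j: "j < n" for t j
    proof -
      have "\<bar>x $ j\<bar> \<le> r / 4" using abs_index_le_vnorm[of j x] x j vx by simp
      moreover have "\<bar>t * ?e $ j\<bar> \<le> r / 4"
        using mult_mono[OF t e1[OF j]] r by (simp add: abs_mult)
      ultimately have "\<bar>x $ j + t * ?e $ j\<bar> \<le> r / 2" by linarith
      thus ?thesis using x j by simp
    qed
    have f'_bound: "norm (w k \<bullet> dkron n k (?z t) ?e) \<le> m k" if t: "\<bar>t\<bar> \<le> r / 4" for k t
      unfolding real_norm_def m_def a_def
      by (rule abs_scalar_prod_le_sum[OF wc[rule_format] dkron_carrier
            abs_dkron_index_le[OF z unit_vec_carrier zb[OF t] e1]])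
    let ?S = "{- r / 4..r / 4}"
    have "((\<lambda>t. \<Sum>k. w k \<bullet> (?z t ^\<^sub>\<otimes> k)) has_field_derivative (\<Sum>k. w k \<bullet> dkron n k (?z 0) ?e)) (at 0)"
    proof (rule has_field_derivative_series'(2)[where S = ?S and x0 = 0])
      show "((\<lambda>t. w k \<bullet> (?z t ^\<^sub>\<otimes> k)) has_field_derivative w k \<bullet> dkron n k (?z t) ?e) (at t within ?S)" for k t
        by (rule has_field_derivative_at_within[OF has_derivative_scalar_prod_kron_pow])
          (use x wc in auto)
      have "uniform_limit ?S (\<lambda>N t. \<Sum>k<N. w k \<bullet> dkron n k (?z t) ?e) (\<lambda>t. \<Sum>k. w k \<bullet> dkron n k (?z t) ?e) sequentially"
        by (rule Weierstrass_m_test[OF f'_bound m_sum]) auto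
      thus "uniformly_convergent_on ?S (\<lambda>N t. \<Sum>k<N. w k \<bullet> dkron n k (?z t) ?e)"
        by (auto simp: uniformly_convergent_on_def)
      have "vnorm (?z 0) < \<rho>"
      proof (rule small[OF z])
        fix j assume "j < n"
        thus "\<bar>?z 0 $ j\<bar> \<le> r" using zb[of 0 j] r by linarith
      qed
      thus "summable (\<lambda>k. w k \<bullet> (?z 0 ^\<^sub>\<otimes> k))"
        using power_series_at_0_sums(1)[OF wc z] hs z by (intro sums_summable) blast
    qed (use r in auto)
    moreover have "(\<Sum>k. w k \<bullet> (?z t ^\<^sub>\<otimes> k)) = E (?z t)" if t: "\<bar>t\<bar> \<le> r / 4" for t
    proof -
      have "vnorm (?z t) < \<rho>"
      proof (rule small[OF z])
        fix j assume "j < n"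
        thus "\<bar>?z t $ j\<bar> \<le> r" using zb[OF t, of j] r by linarith
      qed
      hence "(\<lambda>k. w k \<bullet> (?z t ^\<^sub>\<otimes> k)) sums E (?z t)"
        using power_series_at_0_sums(1)[OF wc z] hs z by blast
      thus ?thesis by (rule sums_unique[symmetric])
    qed
    ultimately have "((\<lambda>t. E (?z t)) has_field_derivative (\<Sum>k. w k \<bullet> dkron n k (?z 0) ?e)) (at 0)"
      by (elim has_field_derivative_transform_within[where d="r / 4"]) (use r in auto)
    moreover have z0: "?z 0 = x" using x by auto
    ultimately have g: "gradient n E x $ i = (\<Sum>k. w k \<bullet> dkron n k x ?e)"
      using i by (simp add: gradient_def DERIV_imp_deriv)
    have b0: "norm (w k \<bullet> dkron n k x ?e) \<le> m k" for k using f'_bound[of 0 k] r z0 by simp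
    have sm: "summable (\<lambda>k. w k \<bullet> dkron n k x ?e)"
      by (rule summable_comparison_test'[OF m_sum]) (use b0 in auto)
    \<comment> \<open>Terms of degree at least d + 1 have gradients of degree at least d, the order
      of the remainder.\<close>
    have "(\<Sum>k. w k \<bullet> dkron n k x ?e)
        = (\<Sum>k. w (k + Suc d) \<bullet> dkron n (k + Suc d) x ?e) + (\<Sum>k<Suc d. w k \<bullet> dkron n k x ?e)"
      by (rule suminf_split_initial_segment[OF sm])
    hence "gradient n E x $ i - (\<Sum>k\<le>d. w k \<bullet> dkron n k x ?e) = (\<Sum>k. w (k + Suc d) \<bullet> dkron n (k + Suc d) x ?e)"
      by (simp add: g lessThan_Suc_atMost)
    also have "\<bar>\<dots>\<bar> \<le> (\<Sum>k. m (k + Suc d) * (vnorm x / (r / 2)) ^ d)"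
    proof -
      have "norm (w (k + Suc d) \<bullet> dkron n (k + Suc d) x ?e) \<le> m (k + Suc d) * (vnorm x / (r / 2)) ^ d" for k
      proof -
        let ?k = "k + Suc d"
        have "\<bar>w ?k \<bullet> dkron n ?k x ?e\<bar> \<le> a ?k * (real ?k * vnorm x ^ (?k - 1))"
          unfolding a_def
          by (rule abs_scalar_prod_le_sum[OF wc[rule_format] dkron_carrier
            abs_dkron_index_le[OF x unit_vec_carrier _ e1]])
            (use abs_index_le_vnorm[of _ x] x in auto)
        also have "vnorm x ^ (?k - 1) = vnorm x ^ k * vnorm x ^ d" by (simp add: power_add)
        also have "a ?k * (real ?k * (vnorm x ^ k * vnorm x ^ d)) \<le> a ?k * (real ?k * ((r / 2) ^ k * vnorm x ^ d))"
          using vx r by (intro mult_left_mono mult_right_mono power_mono a) auto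
        also have "\<dots> = m ?k * (vnorm x / (r / 2)) ^ d"
          using r by (simp add: m_def power_add power_divide field_simps)
        finally show ?thesis by simp
      qed
      thus ?thesis unfolding real_norm_def[symmetric]
        by (intro norm_suminf_le summable_mult2 summable_ignore_initial_segment m_sum)
    qed
    also have "\<dots> = (\<Sum>k. m (k + Suc d)) * (vnorm x / (r / 2)) ^ d"
      by (rule suminf_mult2[symmetric]) (intro summable_ignore_initial_segment m_sum)
    also have "\<dots> \<le> (\<Sum>k. m k) * (vnorm x / (r / 2)) ^ d"
    proof (intro mult_right_mono)
      show "(\<Sum>k. m (k + Suc d)) \<le> (\<Sum>k. m k)"
        using suminf_split_initial_segment[OF m_sum, of "Suc d"] m by (simp add: sum_nonneg)
    qed (use r in simp)
    also have "\<dots> = K * vnorm x ^ d" by (simp add: K_def power_divide)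
    finally show ?thesis .
  qed
  show ?thesis
    by (intro exI[of _ "r / 4"] exI[of _ K] conjI ballI impI allI main K) (use r in auto)
qed

text \<open>Coefficients with the same polynomial have the same derivative even if they differ as
  vectors. The Taylor hypothesis prescribes only the homogeneous polynomials of the power series,
  and its coefficients may be asymmetric.\<close>

lemma scalar_prod_dkron_cong:
  assumes u: "u \<in> carrier_vec (n ^ k)" and u': "u' \<in> carrier_vec (n ^ k)"
    and eq: "\<And>x. x \<in> carrier_vec n \<Longrightarrow> u \<bullet> (x ^\<^sub>\<otimes> k) = c * (u' \<bullet> (x ^\<^sub>\<otimes> k))"
    and x: "x \<in> carrier_vec n" and y: "y \<in> carrier_vec n"
  shows "u \<bullet> dkron n k x y = c * (u' \<bullet> dkron n k x y)"
proof -
  have x0: "x + 0 \<cdot>\<^sub>v y = x" using x y by auto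
  have "((\<lambda>t. u \<bullet> ((x + t \<cdot>\<^sub>v y) ^\<^sub>\<otimes> k)) has_real_derivative u \<bullet> dkron n k x y) (at 0)"
    using has_derivative_scalar_prod_kron_pow[OF x y u, of 0] by (simp only: x0)
  moreover have "u \<bullet> ((x + t \<cdot>\<^sub>v y) ^\<^sub>\<otimes> k) = c * (u' \<bullet> ((x + t \<cdot>\<^sub>v y) ^\<^sub>\<otimes> k))" for t
    by (rule eq) (use x y in auto)
  moreover have "((\<lambda>t. c * (u' \<bullet> ((x + t \<cdot>\<^sub>v y) ^\<^sub>\<otimes> k))) has_real_derivative c * (u' \<bullet> dkron n k x y)) (at 0)"
    using DERIV_cmult[OF has_derivative_scalar_prod_kron_pow[OF x y u', of 0]] by (simp only: x0)
  ultimately show ?thesis using DERIV_unique by (simp only:)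
qed

text \<open>The gradient of v^T x^k is k V x^(k-1); this is how the reshaped matrices enter.\<close>

lemma symmetric_vectorize_dkron:
  assumes v: "symmetric_coeff n k v" and V: "V \<in> carrier_mat n (n ^ (k - 1))" "v = vectorize V"
    and x: "x \<in> carrier_vec n" and y: "y \<in> carrier_vec n"
  shows "v \<bullet> dkron n k x y = real k * (y \<bullet> (V *\<^sub>v x ^\<^sub>\<otimes> (k - 1)))"
  unfolding symmetric_coeff_dkron[OF v x y]
  using vectorize_scalar_prod_kron_vec[OF V(1) y kron_pow_carrier[OF x]] V(2) by simp

text \<open>The order d' is free because the HJB equation needs the expansion to order d, the
  linearization only to order 2.\<close>

lemma gradient_taylor_remainder:
  assumes taylor: "energy_taylor_coeffs n d E v" and d': "d' \<le> d"
    and V: "\<And>i. 2 \<le> i \<Longrightarrow> i \<le> d \<Longrightarrow> V i \<in> carrier_mat n (n^(i-1)) \<and> v i = vectorize (V i)"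
  shows "\<exists>\<rho>>0. \<exists>K\<ge>0. \<forall>x\<in>carrier_vec n. vnorm x < \<rho> \<longrightarrow> (\<forall>i<n.
     \<bar>gradient n E x $ i - (\<Sum>k\<in>{2..d'}. real k / 2 * (V k *\<^sub>v x ^\<^sub>\<otimes> (k - 1)) $ i)\<bar> \<le> K * vnorm x ^ d')"
proof -
  obtain w where ps: "has_power_series_at_0 n E w"
    and w: "\<forall>k\<le>d. \<forall>x\<in>carrier_vec n.
           w k \<bullet> (x ^\<^sub>\<otimes> k) = (if 2 \<le> k then 1/2 * (v k \<bullet> (x ^\<^sub>\<otimes> k)) else 0)"
    and sym: "\<forall>k\<in>{2..d}. symmetric_coeff n k (v k)"
    using taylor unfolding energy_taylor_coeffs_def by (elim exE conjE) (rule that)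
  have wc: "w k \<in> carrier_vec (n ^ k)" for k using ps by (simp add: has_power_series_at_0_def)
  have "(\<Sum>k\<le>d'. w k \<bullet> dkron n k x (unit_vec n i)) = (\<Sum>k\<in>{2..d'}. real k / 2 * (V k *\<^sub>v x ^\<^sub>\<otimes> (k - 1)) $ i)"
    if x: "x \<in> carrier_vec n" and i: "i < n" for x i
  proof -
    \<comment> \<open>The parts of degree 0 and 1 vanish as polynomials, so their derivatives
      vanish; this is the congruence with factor 0.\<close>
    have "w k \<bullet> dkron n k x (unit_vec n i) = 0" if "k \<le> d'" "k < 2" for k
      using scalar_prod_dkron_cong[OF wc wc, of k 0 x "unit_vec n i"] w x that d' by simp
    hence "(\<Sum>k\<le>d'. w k \<bullet> dkron n k x (unit_vec n i)) = (\<Sum>k\<in>{2..d'}. w k \<bullet> dkron n k x (unit_vec n i))"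
      by (intro sum.mono_neutral_right) auto
    also have "\<dots> = (\<Sum>k\<in>{2..d'}. real k / 2 * (V k *\<^sub>v x ^\<^sub>\<otimes> (k - 1)) $ i)"
    proof (rule sum.cong[OF refl])
      fix k assume "k \<in> {2..d'}"
      hence k: "2 \<le> k" "k \<le> d" using d' by auto
      note s = bspec[OF sym, of k]
      have "w k \<bullet> dkron n k x (unit_vec n i) = 1 / 2 * (v k \<bullet> dkron n k x (unit_vec n i))"
        by (rule scalar_prod_dkron_cong[OF wc]) (use k w x s symmetric_coeff_carrier in auto)
      also have "v k \<bullet> dkron n k x (unit_vec n i) = real k * (unit_vec n i \<bullet> (V k *\<^sub>v x ^\<^sub>\<otimes> (k - 1)))"
        by (rule symmetric_vectorize_dkron) (use k s V x in auto)
      also have "unit_vec n i \<bullet> (V k *\<^sub>v x ^\<^sub>\<otimes> (k - 1)) = (V k *\<^sub>v x ^\<^sub>\<otimes> (k - 1)) $ i"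
        by (rule scalar_prod_left_unit[of _ n]) (use V[OF k] i in \<open>auto intro!: carrier_vecI\<close>)
      finally show "w k \<bullet> dkron n k x (unit_vec n i) = real k / 2 * (V k *\<^sub>v x ^\<^sub>\<otimes> (k - 1)) $ i" by simp
    qed
    finally show ?thesis .
  qed
  thus ?thesis using gradient_power_series_remainder[OF ps, of d'] by simp
qed

section \<open>Comparing powers of t along a ray\<close>

lemma eventually_at_right_0_less:
  "0 < \<tau> \<Longrightarrow> eventually (\<lambda>t. 0 < t \<and> t < \<tau>) (at_right (0::real))"
  by (auto simp: eventually_at_right_field intro!: exI[of _ \<tau>])

lemma power_bigo_at_right_0:
  assumes k: "N \<le> k" shows "(\<lambda>t. t ^ k) \<in> O[at_right 0](\<lambda>t::real. t ^ N)"
proof (rule bigoI)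
  show "eventually (\<lambda>t. norm (t ^ k) \<le> 1 * norm (t ^ N)) (at_right (0::real))"
    using eventually_at_right_0_less[of 1, simplified]
  proof eventually_elim
    case (elim t)
    thus ?case using power_decreasing[OF k, of t] by (simp add: power_abs)
  qed
qed

lemma sum_lincomb:
  fixes c e :: real
  shows "(\<Sum>k\<in>A. u k * t k) + c * (\<Sum>k\<in>A. v k * t k) - e * (\<Sum>k\<in>A. w k * t k)
    = (\<Sum>k\<in>A. (u k + c * v k - e * w k) * t k)"
  by (simp add: sum.distrib sum_subtractf sum_distrib_left algebra_simps)

lemma zero_mat_mult_vec: "x \<in> carrier_vec b \<Longrightarrow> 0\<^sub>m a b *\<^sub>v x = 0\<^sub>v a"
  by (rule eq_vecI) auto

lemma scalar_prod_sum: "w \<in> carrier_vec n \<Longrightarrow> v \<bullet> w = (\<Sum>a<n. v $ a * w $ a)"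
  by (simp add: scalar_prod_def atLeast0LessThan)

lemma sum_powers_bigo_at_right_0:
  assumes "\<And>s. s \<in> S \<Longrightarrow> N \<le> e s"
  shows "(\<lambda>t. \<Sum>s\<in>S. c s * t ^ e s) \<in> O[at_right 0](\<lambda>t::real. t ^ N)"
  by (intro big_sum_in_bigo) (use assms power_bigo_at_right_0 in \<open>auto\<close>)

lemma collect_powers:
  fixes t :: real
  assumes "finite S" "\<And>s. s \<in> S \<Longrightarrow> e s \<le> N"
  shows "(\<Sum>s\<in>S. c s * t ^ e s) = (\<Sum>k\<le>N. (\<Sum>s\<in>{s\<in>S. e s = k}. c s) * t ^ k)"
proof -
  have "(\<Sum>s\<in>S. c s * t ^ e s) = (\<Sum>k\<in>{..N}. \<Sum>s\<in>{s\<in>S. e s = k}. c s * t ^ e s)"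
    by (rule sum.group[symmetric]) (use assms in auto)
  thus ?thesis by (simp add: sum_distrib_right)
qed

text \<open>Once the lower coefficients are known to vanish, division by t^k and t \<rightarrow> 0
  isolates the k-th one.\<close>

lemma coeff_eq_zero_if_bigo:
  fixes b :: "nat \<Rightarrow> real"
  assumes O: "(\<lambda>t. \<Sum>k\<le>N. b k * t ^ k) \<in> O[at_right 0](\<lambda>t. t ^ Suc d)"
  shows "k \<le> d \<Longrightarrow> k \<le> N \<Longrightarrow> b k = 0"
proof (induction k rule: less_induct)
  case (less k)
  have "(\<Sum>j\<le>N. b j * t ^ j) = b k * t ^ k + (\<Sum>j\<in>{Suc k..N}. b j * t ^ j)" for t
  proof -
    have "(\<Sum>j\<le>N. b j * t ^ j) = (\<Sum>j\<in>{k..N}. b j * t ^ j)"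
      by (rule sum.mono_neutral_right) (use less in auto)
    also have "{k..N} = insert k {Suc k..N}" using less.prems by auto
    finally show ?thesis by simp
  qed
  hence "b k * t ^ k = (\<Sum>j\<le>N. b j * t ^ j) - (\<Sum>j\<in>{Suc k..N}. b j * t ^ j)" for t by simp
  moreover have "(\<lambda>t. (\<Sum>j\<le>N. b j * t ^ j) - (\<Sum>j\<in>{Suc k..N}. b j * t ^ j)) \<in> O[at_right 0](\<lambda>t. t ^ Suc k)"
    using less.prems
    by (intro sum_in_bigo landau_o.big_trans[OF O] power_bigo_at_right_0 sum_powers_bigo_at_right_0) auto
  ultimately have "(\<lambda>t. b k * t ^ k) \<in> O[at_right 0](\<lambda>t. t ^ Suc k)" by simp
  then obtain c where "eventually (\<lambda>t. norm (b k * t ^ k) \<le> c * norm (t ^ Suc k)) (at_right 0)"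
    by (elim landau_o.bigE) (rule that)
  hence ev: "eventually (\<lambda>t. \<bar>b k\<bar> \<le> c * t) (at_right 0)"
    using eventually_at_right_less[of "0::real"]
  proof eventually_elim
    case (elim t)
    hence "\<bar>b k\<bar> * t ^ k \<le> (c * t) * t ^ k" by (simp add: abs_mult power_abs mult_ac)
    thus ?case using elim by (simp add: mult_le_cancel_right_pos)
  qed
  have "((\<lambda>t. c * t) \<longlongrightarrow> c * 0) (at_right 0)" by (intro tendsto_intros)
  from tendsto_lowerbound[OF this ev] show ?case by simp
qed

lemma sum_prod_powers:
  fixes t :: real
  shows "(\<Sum>a<N. (\<Sum>s\<in>S. c s a * t ^ e s) * (\<Sum>r\<in>R. c' r a * t ^ e' r))
    = (\<Sum>z\<in>S \<times> R. (\<Sum>a<N. c (fst z) a * c' (snd z) a) * t ^ (e (fst z) + e' (snd z)))"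
proof -
  have "(\<Sum>a<N. (\<Sum>s\<in>S. c s a * t ^ e s) * (\<Sum>r\<in>R. c' r a * t ^ e' r))
      = (\<Sum>a<N. \<Sum>z\<in>S \<times> R. c (fst z) a * c' (snd z) a * t ^ (e (fst z) + e' (snd z)))"
    unfolding sum_product sum.cartesian_product
    by (intro sum.cong refl) (auto simp: power_add mult_ac)
  also have "\<dots> = (\<Sum>z\<in>S \<times> R. \<Sum>a<N. c (fst z) a * c' (snd z) a * t ^ (e (fst z) + e' (snd z)))"
    by (rule sum.swap)
  finally show ?thesis by (simp only: sum_distrib_right)
qed

text \<open>The update at 1 puts the linear part into the same family as the higher ones, and
  \<open>max l 1\<close> retains it when l = 0.\<close>

lemma poly_map_index:
  assumes M: "M \<in> carrier_mat r n" and N: "\<And>p. N p \<in> carrier_mat r (n ^ p)" and x: "x \<in> carrier_vec n" and a: "a < r"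
  shows "(M *\<^sub>v (t \<cdot>\<^sub>v x) + vec_sum r (\<lambda>p. N p *\<^sub>v ((t \<cdot>\<^sub>v x) ^\<^sub>\<otimes> p)) {2..l}) $ a
    = (\<Sum>p\<in>{1..max l 1}. ((N(1 := M)) p *\<^sub>v x ^\<^sub>\<otimes> p) $ a * t ^ p)"
proof -
  have s: "(N p *\<^sub>v ((t \<cdot>\<^sub>v x) ^\<^sub>\<otimes> p)) $ a = (N p *\<^sub>v x ^\<^sub>\<otimes> p) $ a * t ^ p" for p
    unfolding kron_pow_smult mult_mat_vec[OF N kron_pow_carrier[OF x]] using N[of p] a by simp
  have s1: "(M *\<^sub>v (t \<cdot>\<^sub>v x)) $ a = (M *\<^sub>v x) $ a * t"
    unfolding mult_mat_vec[OF M x] using M a by simp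
  have "{1..max l 1} = insert 1 {2..l}" by auto
  hence "(\<Sum>p\<in>{1..max l 1}. ((N(1 := M)) p *\<^sub>v x ^\<^sub>\<otimes> p) $ a * t ^ p)
      = (M *\<^sub>v x) $ a * t + (\<Sum>p\<in>{2..l}. ((N(1 := M)) p *\<^sub>v x ^\<^sub>\<otimes> p) $ a * t ^ p)"
    by (simp only: sum.insert finite_atLeastAtMost) simp
  also have "(\<Sum>p\<in>{2..l}. ((N(1 := M)) p *\<^sub>v x ^\<^sub>\<otimes> p) $ a * t ^ p) = (\<Sum>p\<in>{2..l}. (N p *\<^sub>v ((t \<cdot>\<^sub>v x) ^\<^sub>\<otimes> p)) $ a)"
    by (rule sum.cong) (auto simp: s)
  finally show ?thesis using a s1 M by (simp add: vec_sum_def)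
qed

lemma kron_pow_col_mat_carrier:
  "x \<in> carrier_vec n \<Longrightarrow> col_mat (x ^\<^sub>\<otimes> p) \<otimes>\<^sub>m 1\<^sub>m m \<in> carrier_mat (m * n ^ p) m"
  by (rule carrier_matI) (auto simp: mult.commute)

lemma input_mat_index:
  assumes B: "B \<in> carrier_mat n m" and G: "\<And>p. G p \<in> carrier_mat n (m * n ^ p)" and G0: "G 0 = B"
    and x: "x \<in> carrier_vec n" and i: "i < n" and a: "a < m"
  shows "input_mat B G l (t \<cdot>\<^sub>v x) $$ (i, a)
    = (\<Sum>p\<in>{..l}. (G p * (col_mat (x ^\<^sub>\<otimes> p) \<otimes>\<^sub>m 1\<^sub>m m)) $$ (i, a) * t ^ p)"
proof -
  have s: "(G p * (col_mat ((t \<cdot>\<^sub>v x) ^\<^sub>\<otimes> p) \<otimes>\<^sub>m 1\<^sub>m m)) $$ (i, a)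
      = (G p * (col_mat (x ^\<^sub>\<otimes> p) \<otimes>\<^sub>m 1\<^sub>m m)) $$ (i, a) * t ^ p" for p
  proof -
    have "col_mat ((t \<cdot>\<^sub>v x) ^\<^sub>\<otimes> p) \<otimes>\<^sub>m 1\<^sub>m m = t ^ p \<cdot>\<^sub>m (col_mat (x ^\<^sub>\<otimes> p) \<otimes>\<^sub>m 1\<^sub>m m)"
      unfolding kron_pow_smult
      by (rule eq_matI) (auto simp: kron_def col_mat_def mat_of_cols_def div_mod_less)
    hence "G p * (col_mat ((t \<cdot>\<^sub>v x) ^\<^sub>\<otimes> p) \<otimes>\<^sub>m 1\<^sub>m m) = t ^ p \<cdot>\<^sub>m (G p * (col_mat (x ^\<^sub>\<otimes> p) \<otimes>\<^sub>m 1\<^sub>m m))"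
      using mult_smult_distrib[OF G kron_pow_col_mat_carrier[OF x]] by simp
    thus ?thesis using i a G[of p] by simp
  qed
  have z: "G 0 * (col_mat (x ^\<^sub>\<otimes> 0) \<otimes>\<^sub>m 1\<^sub>m m) = B"
  proof -
    have "col_mat (x ^\<^sub>\<otimes> 0) \<otimes>\<^sub>m 1\<^sub>m m = 1\<^sub>m m"
      by (rule eq_matI) (auto simp: kron_def col_mat_def mat_of_cols_def)
    thus ?thesis using B G0 by simp
  qed
  have "{..l} = insert 0 {1..l}" by auto
  hence "(\<Sum>p\<in>{..l}. (G p * (col_mat (x ^\<^sub>\<otimes> p) \<otimes>\<^sub>m 1\<^sub>m m)) $$ (i, a) * t ^ p)
    = B $$ (i, a) + (\<Sum>p\<in>{1..l}. (G p * (col_mat (x ^\<^sub>\<otimes> p) \<otimes>\<^sub>m 1\<^sub>m m)) $$ (i, a) * t ^ p)"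
    using z by (simp del: kron_pow_0)
  also have "(\<Sum>p\<in>{1..l}. (G p * (col_mat (x ^\<^sub>\<otimes> p) \<otimes>\<^sub>m 1\<^sub>m m)) $$ (i, a) * t ^ p)
    = (\<Sum>p\<in>{1..l}. (G p * (col_mat ((t \<cdot>\<^sub>v x) ^\<^sub>\<otimes> p) \<otimes>\<^sub>m 1\<^sub>m m)) $$ (i, a))"
    by (rule sum.cong) (auto simp: s)
  finally show ?thesis using B i a by (simp add: input_mat_def mat_sum_def)
qed

lemma input_term_eq_transpose_mult:
  assumes G: "G p \<in> carrier_mat n (m * n ^ p)" and V: "V i \<in> carrier_mat n (n ^ (i - 1))"
    and x: "x \<in> carrier_vec n" and a: "a < m"
  shows "input_term m G V x p i $ a
    = (\<Sum>b<n. (G p * (col_mat (x ^\<^sub>\<otimes> p) \<otimes>\<^sub>m 1\<^sub>m m)) $$ (b, a) * (V i *\<^sub>v x ^\<^sub>\<otimes> (i - 1)) $ b)"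
proof -
  let ?T = "col_mat (x ^\<^sub>\<otimes> p) \<otimes>\<^sub>m 1\<^sub>m m" and ?z = "V i *\<^sub>v x ^\<^sub>\<otimes> (i - 1)"
  note T = kron_pow_col_mat_carrier[OF x, of p m]
  have z: "?z \<in> carrier_vec n" using V x by (auto intro!: mult_mat_vec_carrier)
  have GT: "G p * ?T \<in> carrier_mat n m" using G T by auto
  have "input_term m G V x p i = (?T\<^sup>T * (G p)\<^sup>T) *\<^sub>v ?z"
    unfolding input_term_def by (rule assoc_mult_mat_vec[symmetric]) (use T G z in auto)
  also have "?T\<^sup>T * (G p)\<^sup>T = (G p * ?T)\<^sup>T" using transpose_mult[OF G T] by simp
  finally have "input_term m G V x p i $ a = ((G p * ?T)\<^sup>T *\<^sub>v ?z) $ a" by simp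
  also have "\<dots> = (\<Sum>b<n. (G p * ?T)\<^sup>T $$ (a, b) * ?z $ b)"
    by (rule mult_mat_vec_sum[where a=m]) (use GT z a in auto)
  also have "\<dots> = (\<Sum>b<n. (G p * ?T) $$ (b, a) * ?z $ b)"
    by (rule sum.cong) (use a G T x in \<open>auto\<close>)
  finally show ?thesis .
qed

lemma sandwich_eq_norm:
  assumes g: "g \<in> carrier_mat n m" and z: "z \<in> carrier_vec n"
  shows "z \<bullet> ((g * g\<^sup>T) *\<^sub>v z) = (g\<^sup>T *\<^sub>v z) \<bullet> (g\<^sup>T *\<^sub>v z :: real vec)"
proof -
  have gz: "g\<^sup>T *\<^sub>v z \<in> carrier_vec m" using g z by auto
  have "(g * g\<^sup>T) *\<^sub>v z = g *\<^sub>v (g\<^sup>T *\<^sub>v z)" using assoc_mult_mat_vec[of g n m "g\<^sup>T" n z] g z by simp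
  thus ?thesis using transpose_vec_mult_scalar[OF g gz z] by simp
qed

lemma input_term_zero:
  assumes "G p = 0\<^sub>m n (m * n ^ p)" "V i \<in> carrier_mat n (n ^ (i - 1))" "x \<in> carrier_vec n"
  shows "input_term m G V x p i = 0\<^sub>v m"
proof (rule eq_vecI)
  fix a assume "a < dim_vec (0\<^sub>v m :: real vec)"
  hence a: "a < m" by simp
  have "(0\<^sub>m n (m * n ^ p) * (col_mat (x ^\<^sub>\<otimes> p) \<otimes>\<^sub>m 1\<^sub>m m)) = (0\<^sub>m n m :: real mat)"
    by (rule left_mult_zero_mat[OF kron_pow_col_mat_carrier[OF assms(3)]])
  thus "input_term m G V x p i $ a = 0\<^sub>v m $ a"
    using input_term_eq_transpose_mult[of G p n m V i x a] assms a by simp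
qed (use input_term_carrier in auto)

text \<open>On the ray t x the data are polynomials in t, and the gradient is one up to O(t^d). In
  the HJB equation this error is multiplied by f = O(t), or by g^T times the gradient, again O(t).
  Replacing the gradient by its Taylor polynomial thus costs O(t^(d+1)), and all coefficients up to
  t^d vanish. The index sets of the conclusion are not cut off at l, because the terms beyond l are
  zero.\<close>

lemma HJB_homogeneous_part:
  assumes A: "A \<in> carrier_mat n n" and B: "B \<in> carrier_mat n m" and C: "C \<in> carrier_mat r n"
    and F: "\<And>p. F p \<in> carrier_mat n (n^p)"
    and G: "\<And>p. G p \<in> carrier_mat n (m * n^p)"
    and H: "\<And>p. H p \<in> carrier_mat r (n^p)"
    and G0: "G 0 = B" and H1: "H 1 = C"
    and F_zero: "\<And>p. 2 \<le> p \<Longrightarrow> l < p \<Longrightarrow> F p = 0\<^sub>m n (n^p)"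
    and G_zero: "\<And>p. 1 \<le> p \<Longrightarrow> l < p \<Longrightarrow> G p = 0\<^sub>m n (m * n^p)"
    and H_zero: "\<And>p. 2 \<le> p \<Longrightarrow> l < p \<Longrightarrow> H p = 0\<^sub>m r (n^p)"
    and HJB: "solves_past_HJB n (drift A F l) (input_mat B G l) (output_map C H l) \<eta> E"
    and d: "2 \<le> d"
    and taylor: "energy_taylor_coeffs n d E v"
    and V: "\<And>i. 2 \<le> i \<Longrightarrow> i \<le> d \<Longrightarrow> V i \<in> carrier_mat n (n^(i-1)) \<and> v i = vectorize (V i)"
    and x: "x \<in> carrier_vec n" and k: "2 \<le> k" "k \<le> d"
  shows "(\<Sum>(i, p)\<in>{(i, p). 2 \<le> i \<and> 1 \<le> p \<and> i + p = k + 1}.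
            real i / 2 * ((V i *\<^sub>v x ^\<^sub>\<otimes> (i - 1)) \<bullet> ((F(1 := A)) p *\<^sub>v x ^\<^sub>\<otimes> p)))
       + 1/2 * (\<Sum>((p, i), (q, j))\<in>{((p, i), (q, j)). 2 \<le> i \<and> 2 \<le> j \<and> p + q + i + j = k + 2}.
            real i / 2 * (real j / 2) * (input_term m G V x p i \<bullet> input_term m G V x q j))
       - \<eta>/2 * (\<Sum>(p, q)\<in>{(p, q). 1 \<le> p \<and> 1 \<le> q \<and> p + q = k}.
            (H p *\<^sub>v x ^\<^sub>\<otimes> p) \<bullet> (H q *\<^sub>v x ^\<^sub>\<otimes> q)) = 0"
proof -
  let ?f = "drift A F l" and ?g = "input_mat B G l" and ?h = "output_map C H l"
  let ?L = "max l 1" and ?F = "F(1 := A)"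
  let ?it = "input_term m G V x" and ?Vx = "\<lambda>i. V i *\<^sub>v x ^\<^sub>\<otimes> (i - 1)"
  define gr where "gr t = gradient n E (t \<cdot>\<^sub>v x)" for t
  define Q where "Q a t = (\<Sum>i\<in>{2..d}. (real i / 2 * ?Vx i $ a) * t ^ (i - 1))" for a and t :: real
  define R where "R a t = gr t $ a - Q a t" for a t
  define fp where "fp a t = (\<Sum>p\<in>{1..?L}. (?F p *\<^sub>v x ^\<^sub>\<otimes> p) $ a * t ^ p)" for a and t :: real
  define hp where "hp a t = (\<Sum>p\<in>{1..?L}. (H p *\<^sub>v x ^\<^sub>\<otimes> p) $ a * t ^ p)" for a and t :: real
  define gp where "gp b a t = (\<Sum>p\<in>{..l}. (G p * (col_mat (x ^\<^sub>\<otimes> p) \<otimes>\<^sub>m 1\<^sub>m m)) $$ (b, a) * t ^ p)" for b a and t :: real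
  \<comment> \<open>The polynomial part of g^T times the gradient, as a sum of input terms over the
    pairs (p, i).\<close>
  define y0 where "y0 a t = (\<Sum>z\<in>{..l} \<times> {2..d}. (real (snd z) / 2 * ?it (fst z) (snd z) $ a) * t ^ (fst z + (snd z - 1)))" for a and t :: real
  have FA: "?F p \<in> carrier_mat n (n ^ p)" for p using F A by (cases "p = 1") auto
  have H1': "H(1 := C) = H" using H1 by auto
  have Vc: "V i \<in> carrier_mat n (n ^ (i - 1))" if "i \<in> {2..d}" for i using V that by auto
  have Vxc: "?Vx i \<in> carrier_vec n" if "i \<in> {2..d}" for i
    using Vc[OF that] x by (auto intro!: mult_mat_vec_carrier)
  have f_idx: "?f (t \<cdot>\<^sub>v x) $ a = fp a t" if "a < n" for a t
    using poly_map_index[OF A F x that, of t l] A by (simp add: drift_def fp_def)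
  have h_idx: "?h (t \<cdot>\<^sub>v x) $ a = hp a t" if "a < r" for a t
    using poly_map_index[OF C H x that, of t l] C unfolding H1' by (simp add: output_map_def hp_def)
  have g_idx: "?g (t \<cdot>\<^sub>v x) $$ (b, a) = gp b a t" if "b < n" "a < m" for a b t
    unfolding gp_def by (rule input_mat_index[OF B G G0 x that])
  have fc: "?f (t \<cdot>\<^sub>v x) \<in> carrier_vec n" for t
    by (rule carrier_vecI) (use A in \<open>simp add: drift_def\<close>)
  have hc: "?h (t \<cdot>\<^sub>v x) \<in> carrier_vec r" for t
    by (rule carrier_vecI) (use C in \<open>simp add: output_map_def\<close>)
  have gc: "?g (t \<cdot>\<^sub>v x) \<in> carrier_mat n m" for t
    using B by (simp add: input_mat_def)
  have grc: "gr t \<in> carrier_vec n" for t by (simp add: gr_def gradient_def)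
  define y where "y a t = (\<Sum>b<n. gp b a t * gr t $ b)" for a t
  have y_idx: "((?g (t \<cdot>\<^sub>v x))\<^sup>T *\<^sub>v gr t) $ a = y a t" if a: "a < m" for a t
  proof -
    have "((?g (t \<cdot>\<^sub>v x))\<^sup>T *\<^sub>v gr t) $ a = (\<Sum>b<n. (?g (t \<cdot>\<^sub>v x))\<^sup>T $$ (a, b) * gr t $ b)"
      by (rule mult_mat_vec_sum[where a=m]) (use gc[of t] grc a in auto)
    also have "\<dots> = y a t" unfolding y_def
      by (rule sum.cong) (use gc[of t] a g_idx in auto)
    finally show ?thesis .
  qed
  have "\<exists>\<rho>>0. \<exists>K\<ge>0. \<forall>x\<in>carrier_vec n. vnorm x < \<rho> \<longrightarrow> (\<forall>i<n.
     \<bar>gradient n E x $ i - (\<Sum>k\<in>{2..d}. real k / 2 * (V k *\<^sub>v x ^\<^sub>\<otimes> (k - 1)) $ i)\<bar> \<le> K * vnorm x ^ d)"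
    by (rule gradient_taylor_remainder[OF taylor order.refl V])
  then obtain \<rho>1 K where \<rho>1: "0 < \<rho>1" and K: "0 \<le> K" and rem: "\<forall>x\<in>carrier_vec n. vnorm x < \<rho>1 \<longrightarrow> (\<forall>i<n.
     \<bar>gradient n E x $ i - (\<Sum>k\<in>{2..d}. real k / 2 * (V k *\<^sub>v x ^\<^sub>\<otimes> (k - 1)) $ i)\<bar> \<le> K * vnorm x ^ d)"
    by (elim exE conjE) (rule that)
  obtain \<rho>2 where \<rho>2: "0 < \<rho>2" and hjb: "\<forall>x\<in>carrier_vec n. vnorm x < \<rho>2 \<longrightarrow>
     0 = gradient n E x \<bullet> ?f x + 1/2 * (gradient n E x \<bullet> ((?g x * (?g x)\<^sup>T) *\<^sub>v gradient n E x))
       - \<eta>/2 * (?h x \<bullet> ?h x)"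
    using HJB unfolding solves_past_HJB_def by (elim exE conjE) (rule that)
  define \<tau> where "\<tau> = min \<rho>1 \<rho>2 / (1 + vnorm x)"
  have v1: "0 < 1 + vnorm x" using vnorm_nonneg[of x] by linarith
  have \<tau>: "0 < \<tau>" using \<rho>1 \<rho>2 v1 by (simp add: \<tau>_def)
  note ev = eventually_at_right_0_less[OF \<tau>]
  have small: "vnorm (t \<cdot>\<^sub>v x) < \<rho>1" "vnorm (t \<cdot>\<^sub>v x) < \<rho>2" if "0 < t \<and> t < \<tau>" for t
  proof -
    have "vnorm (t \<cdot>\<^sub>v x) = t * vnorm x" using that by (simp add: vnorm_smult)
    also have "\<dots> \<le> t * (1 + vnorm x)" using that by (intro mult_left_mono) auto
    also have "\<dots> < \<tau> * (1 + vnorm x)" using that v1 by (intro mult_strict_right_mono) auto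
    also have "\<dots> = min \<rho>1 \<rho>2" using v1 by (simp add: \<tau>_def)
    finally show "vnorm (t \<cdot>\<^sub>v x) < \<rho>1" "vnorm (t \<cdot>\<^sub>v x) < \<rho>2" by auto
  qed
  have R_O: "R a \<in> O[at_right 0](\<lambda>t. t ^ d)" if a: "a < n" for a
  proof -
    have "eventually (\<lambda>t. norm (R a t) \<le> (K * vnorm x ^ d) * norm (t ^ d)) (at_right 0)"
      using ev
    proof eventually_elim
      case (elim t)
      have tx: "t \<cdot>\<^sub>v x \<in> carrier_vec n" using x by auto
      have "(\<Sum>i\<in>{2..d}. real i / 2 * (V i *\<^sub>v (t \<cdot>\<^sub>v x) ^\<^sub>\<otimes> (i - 1)) $ a) = Q a t"
        unfolding Q_def
      proof (rule sum.cong[OF refl])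
        fix i assume i: "i \<in> {2..d}"
        show "real i / 2 * (V i *\<^sub>v (t \<cdot>\<^sub>v x) ^\<^sub>\<otimes> (i - 1)) $ a = real i / 2 * ?Vx i $ a * t ^ (i - 1)"
          unfolding kron_pow_smult mult_mat_vec[OF Vc[OF i] kron_pow_carrier[OF x]] using Vc[OF i] a by simp
      qed
      with bspec[OF rem tx, rule_format, OF small(1)[OF elim] a]
      have "\<bar>R a t\<bar> \<le> K * vnorm (t \<cdot>\<^sub>v x) ^ d"
        unfolding R_def gr_def by (simp only:)
      also have "\<dots> = K * vnorm x ^ d * norm (t ^ d)"
        using elim by (simp add: vnorm_smult power_mult_distrib)
      finally show ?case by simp
    qed
    thus ?thesis by (rule bigoI)
  qed
  have fp_O: "fp a \<in> O[at_right 0](\<lambda>t. t ^ 1)" for a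
    unfolding fp_def by (rule sum_powers_bigo_at_right_0) auto
  have gp_O: "gp b a \<in> O[at_right 0](\<lambda>t. t ^ 0)" for a b
    unfolding gp_def by (rule sum_powers_bigo_at_right_0) auto
  have y0_O: "y0 a \<in> O[at_right 0](\<lambda>t. t ^ 1)" for a
    unfolding y0_def by (rule sum_powers_bigo_at_right_0) auto
  have y_split: "y a t = y0 a t + (\<Sum>b<n. gp b a t * R b t)" if a: "a < m" for a t
  proof -
    have "(\<Sum>b<n. gp b a t * Q b t)
      = (\<Sum>z\<in>{..l} \<times> {2..d}. (\<Sum>b<n. (G (fst z) * (col_mat (x ^\<^sub>\<otimes> fst z) \<otimes>\<^sub>m 1\<^sub>m m)) $$ (b, a) * (real (snd z) / 2 * ?Vx (snd z) $ b))
          * t ^ (fst z + (snd z - 1)))"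
      unfolding gp_def Q_def by (rule sum_prod_powers)
    also have "\<dots> = y0 a t" unfolding y0_def
    proof (rule sum.cong[OF refl])
      fix z assume z: "z \<in> {..l} \<times> {2..d}"
      hence i: "snd z \<in> {2..d}" by auto
      have "(\<Sum>b<n. (G (fst z) * (col_mat (x ^\<^sub>\<otimes> fst z) \<otimes>\<^sub>m 1\<^sub>m m)) $$ (b, a) * (real (snd z) / 2 * ?Vx (snd z) $ b))
          = real (snd z) / 2 * ?it (fst z) (snd z) $ a"
        unfolding input_term_eq_transpose_mult[of G "fst z" n m V "snd z" x a, OF G Vc[OF i] x a] sum_distrib_left
        by (intro sum.cong refl) (simp only: mult_ac)
      thus "(\<Sum>b<n. (G (fst z) * (col_mat (x ^\<^sub>\<otimes> fst z) \<otimes>\<^sub>m 1\<^sub>m m)) $$ (b, a) * (real (snd z) / 2 * ?Vx (snd z) $ b)) * t ^ (fst z + (snd z - 1))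
          = real (snd z) / 2 * ?it (fst z) (snd z) $ a * t ^ (fst z + (snd z - 1))" by simp
    qed
    finally have e: "(\<Sum>b<n. gp b a t * Q b t) = y0 a t" .
    have "gr t $ b = Q b t + R b t" for b by (simp add: R_def)
    thus ?thesis unfolding y_def using e by (simp add: distrib_left sum.distrib)
  qed
  define S where "S a t = (\<Sum>b<n. gp b a t * R b t)" for a t
  have S_O: "S a \<in> O[at_right 0](\<lambda>t. t ^ d)" for a
  proof -
    have "(\<lambda>t. gp b a t * R b t) \<in> O[at_right 0](\<lambda>t. t ^ 0 * t ^ d)" if "b < n" for b
      by (intro landau_o.big_mult gp_O R_O that)
    thus ?thesis unfolding S_def by (intro big_sum_in_bigo) auto
  qed
  have S_O1: "S a \<in> O[at_right 0](\<lambda>t. t ^ 1)" for a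
    by (rule landau_o.big_trans[OF S_O power_bigo_at_right_0]) (use d in simp)
  have rearrange: "- b - 1/2 * e = a + 1/2 * c - z" if "0 = (a + b) + 1/2 * (c + e) - z" for a b c e z :: real
    using that by (simp add: field_simps)
  define T where "T t = (\<Sum>a<n. Q a t * fp a t) + 1/2 * (\<Sum>a<m. y0 a t * y0 a t) - \<eta>/2 * (\<Sum>a<r. hp a t * hp a t)" for t
  \<comment> \<open>The error in the quadratic term is (y0 + S)^2 - y0^2 = S (y0 + (y0 + S)), a
    factor O(t^d) times a factor O(t).\<close>
  have "(\<lambda>t. - (\<Sum>a<n. R a t * fp a t) - 1/2 * (\<Sum>a<m. S a t * (y0 a t + (y0 a t + S a t)))) \<in> O[at_right 0](\<lambda>t. t ^ Suc d)"
  proof -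
    have 1: "(\<lambda>t. R a t * fp a t) \<in> O[at_right 0](\<lambda>t. t ^ Suc d)" if "a < n" for a
      using landau_o.big_mult[OF R_O[OF that] fp_O] by (simp add: mult.commute)
    have 2: "(\<lambda>t. S a t * (y0 a t + (y0 a t + S a t))) \<in> O[at_right 0](\<lambda>t. t ^ Suc d)" for a
    proof -
      have "(\<lambda>t. y0 a t + (y0 a t + S a t)) \<in> O[at_right 0](\<lambda>t. t ^ 1)"
        by (intro sum_in_bigo y0_O S_O1)
      from landau_o.big_mult[OF S_O this, of a] show ?thesis by (simp add: mult.commute)
    qed
    have "(\<lambda>t. (\<Sum>a<n. R a t * fp a t)) \<in> O[at_right 0](\<lambda>t. t ^ Suc d)"
      by (intro big_sum_in_bigo 1) auto
    hence "(\<lambda>t. - (\<Sum>a<n. R a t * fp a t)) \<in> O[at_right 0](\<lambda>t. t ^ Suc d)" by simp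
    moreover have "(\<lambda>t. 1/2 * (\<Sum>a<m. S a t * (y0 a t + (y0 a t + S a t)))) \<in> O[at_right 0](\<lambda>t. t ^ Suc d)"
      by (intro landau_o.big.cmult_in_iff[THEN iffD2] disjI2 big_sum_in_bigo 2) auto
    ultimately show ?thesis by (rule sum_in_bigo(2))
  qed
  note rem_O = this
  have "eventually (\<lambda>t. - (\<Sum>a<n. R a t * fp a t) - 1/2 * (\<Sum>a<m. S a t * (y0 a t + (y0 a t + S a t))) = T t) (at_right 0)"
    using ev
  proof eventually_elim
    case (elim t)
    have tx: "t \<cdot>\<^sub>v x \<in> carrier_vec n" using x by auto
    let ?y = "(?g (t \<cdot>\<^sub>v x))\<^sup>T *\<^sub>v gr t"
    have yc: "?y \<in> carrier_vec m" using gc[of t] grc by auto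
    have "0 = gr t \<bullet> ?f (t \<cdot>\<^sub>v x) + 1/2 * (?y \<bullet> ?y) - \<eta>/2 * (?h (t \<cdot>\<^sub>v x) \<bullet> ?h (t \<cdot>\<^sub>v x))"
      using bspec[OF hjb tx] small(2)[OF elim] sandwich_eq_norm[OF gc grc] by (simp add: gr_def)
    also have "gr t \<bullet> ?f (t \<cdot>\<^sub>v x) = (\<Sum>a<n. (Q a t + R a t) * fp a t)"
      using fc[of t] by (auto simp: scalar_prod_def atLeast0LessThan f_idx R_def)
    also have "?y \<bullet> ?y = (\<Sum>a<m. (y0 a t + S a t) * (y0 a t + S a t))"
      unfolding scalar_prod_sum[OF yc]
      by (rule sum.cong) (simp_all add: y_idx y_split S_def del: index_mult_mat_vec)
    also have "?h (t \<cdot>\<^sub>v x) \<bullet> ?h (t \<cdot>\<^sub>v x) = (\<Sum>a<r. hp a t * hp a t)"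
      using hc[of t] by (auto simp: scalar_prod_def atLeast0LessThan h_idx)
    also have "(\<Sum>a<n. (Q a t + R a t) * fp a t) = (\<Sum>a<n. Q a t * fp a t) + (\<Sum>a<n. R a t * fp a t)"
      by (simp only: distrib_right sum.distrib)
    also have "(\<Sum>a<m. (y0 a t + S a t) * (y0 a t + S a t))
        = (\<Sum>a<m. y0 a t * y0 a t) + (\<Sum>a<m. S a t * (y0 a t + (y0 a t + S a t)))"
      unfolding sum.distrib[symmetric] by (rule sum.cong[OF refl]) (simp add: algebra_simps)
    finally show ?case unfolding T_def by (rule rearrange)
  qed
  hence T_O: "T \<in> O[at_right 0](\<lambda>t. t ^ Suc d)"
    by (rule landau_o.big.in_cong[THEN iffD1, OF _ rem_O])
  let ?S1 = "{2..d} \<times> {1..?L}" and ?S2 = "({..l} \<times> {2..d}) \<times> ({..l} \<times> {2..d})" and ?S3 = "{1..?L} \<times> {1..?L}"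
  let ?e1 = "\<lambda>z::nat\<times>nat. (fst z - 1) + snd z"
  let ?e2 = "\<lambda>z::(nat\<times>nat)\<times>(nat\<times>nat). (fst (fst z) + (snd (fst z) - 1)) + (fst (snd z) + (snd (snd z) - 1))"
  let ?e3 = "\<lambda>z::nat\<times>nat. fst z + snd z"
  let ?c1 = "\<lambda>z. \<Sum>a<n. (real (fst z) / 2 * ?Vx (fst z) $ a) * (?F (snd z) *\<^sub>v x ^\<^sub>\<otimes> snd z) $ a"
  let ?c2 = "\<lambda>z. \<Sum>a<m. (real (snd (fst z)) / 2 * ?it (fst (fst z)) (snd (fst z)) $ a)
      * (real (snd (snd z)) / 2 * ?it (fst (snd z)) (snd (snd z)) $ a)"
  let ?c3 = "\<lambda>z. \<Sum>a<r. (H (fst z) *\<^sub>v x ^\<^sub>\<otimes> fst z) $ a * (H (snd z) *\<^sub>v x ^\<^sub>\<otimes> snd z) $ a"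
  \<comment> \<open>Large enough to exceed every exponent that occurs in the three products.\<close>
  let ?N = "2 * (d + ?L)"
  define b where "b k = (\<Sum>z\<in>{z\<in>?S1. ?e1 z = k}. ?c1 z) + 1/2 * (\<Sum>z\<in>{z\<in>?S2. ?e2 z = k}. ?c2 z)
      - \<eta>/2 * (\<Sum>z\<in>{z\<in>?S3. ?e3 z = k}. ?c3 z)" for k
  have "T t = (\<Sum>k\<le>?N. b k * t ^ k)" for t
  proof -
    have "(\<Sum>a<n. Q a t * fp a t) = (\<Sum>z\<in>?S1. ?c1 z * t ^ ?e1 z)"
      unfolding Q_def fp_def by (rule sum_prod_powers)
    also have "\<dots> = (\<Sum>k\<le>?N. (\<Sum>z\<in>{z\<in>?S1. ?e1 z = k}. ?c1 z) * t ^ k)"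
      by (rule collect_powers) auto
    finally have 1: "(\<Sum>a<n. Q a t * fp a t) = (\<Sum>k\<le>?N. (\<Sum>z\<in>{z\<in>?S1. ?e1 z = k}. ?c1 z) * t ^ k)" .
    have "(\<Sum>a<m. y0 a t * y0 a t) = (\<Sum>z\<in>?S2. ?c2 z * t ^ ?e2 z)"
      unfolding y0_def by (rule sum_prod_powers)
    also have "\<dots> = (\<Sum>k\<le>?N. (\<Sum>z\<in>{z\<in>?S2. ?e2 z = k}. ?c2 z) * t ^ k)"
      by (rule collect_powers) auto
    finally have 2: "(\<Sum>a<m. y0 a t * y0 a t) = (\<Sum>k\<le>?N. (\<Sum>z\<in>{z\<in>?S2. ?e2 z = k}. ?c2 z) * t ^ k)" .
    have "(\<Sum>a<r. hp a t * hp a t) = (\<Sum>z\<in>?S3. ?c3 z * t ^ ?e3 z)"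
      unfolding hp_def by (rule sum_prod_powers)
    also have "\<dots> = (\<Sum>k\<le>?N. (\<Sum>z\<in>{z\<in>?S3. ?e3 z = k}. ?c3 z) * t ^ k)"
      by (rule collect_powers) auto
    finally have 3: "(\<Sum>a<r. hp a t * hp a t) = (\<Sum>k\<le>?N. (\<Sum>z\<in>{z\<in>?S3. ?e3 z = k}. ?c3 z) * t ^ k)" .
    show ?thesis unfolding T_def 1 2 3 b_def by (rule sum_lincomb)
  qed
  hence "T = (\<lambda>t. \<Sum>k\<le>?N. b k * t ^ k)" by (rule ext)
  hence "(\<lambda>t. \<Sum>k\<le>?N. b k * t ^ k) \<in> O[at_right 0](\<lambda>t. t ^ Suc d)" using T_O by (simp only:)
  hence bk: "b k = 0" by (rule coeff_eq_zero_if_bigo) (use k in auto)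
  have e1: "(\<Sum>z\<in>{z\<in>?S1. ?e1 z = k}. ?c1 z)
     = (\<Sum>(i, p)\<in>{(i, p). 2 \<le> i \<and> 1 \<le> p \<and> i + p = k + 1}. real i / 2 * (?Vx i \<bullet> (?F p *\<^sub>v x ^\<^sub>\<otimes> p)))"
  proof -
    have "(\<Sum>(i, p)\<in>{(i, p). 2 \<le> i \<and> 1 \<le> p \<and> i + p = k + 1}. real i / 2 * (?Vx i \<bullet> (?F p *\<^sub>v x ^\<^sub>\<otimes> p)))
        = (\<Sum>z\<in>{(i, p). 2 \<le> i \<and> 1 \<le> p \<and> i + p = k + 1}. ?c1 z)"
    proof (rule sum.cong[OF refl], clarify)
      fix i p show "real i / 2 * (?Vx i \<bullet> (?F p *\<^sub>v x ^\<^sub>\<otimes> p)) = ?c1 (i, p)"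
        unfolding scalar_prod_sum[OF mult_mat_vec_carrier[OF FA kron_pow_carrier[OF x]]] sum_distrib_left
        by (simp only: fst_conv snd_conv mult.assoc)
    qed
    also have "\<dots> = (\<Sum>z\<in>{z\<in>?S1. ?e1 z = k}. ?c1 z)"
    proof (rule sum.mono_neutral_right)
      show "finite {(i::nat, p). 2 \<le> i \<and> 1 \<le> p \<and> i + p = k + 1}"
        by (rule finite_subset[of _ "{..k+1} \<times> {..k+1}"]) auto
      show "\<forall>z\<in>{(i, p). 2 \<le> i \<and> 1 \<le> p \<and> i + p = k + 1} - {z\<in>?S1. ?e1 z = k}. ?c1 z = 0"
      proof
        fix z assume z: "z \<in> {(i, p). 2 \<le> i \<and> 1 \<le> p \<and> i + p = k + 1} - {z\<in>?S1. ?e1 z = k}"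
        obtain i p where zip: "z = (i, p)" by (cases z)
        \<comment> \<open>As i \<le> k \<le> d and the range of p always contains 1, a pair can be
          missing only because of p > l, where F p = 0.\<close>
        have "2 \<le> p \<and> l < p" using k z unfolding zip by auto
        hence "?F p = 0\<^sub>m n (n ^ p)" using F_zero by auto
        hence "?F p *\<^sub>v x ^\<^sub>\<otimes> p = 0\<^sub>v n" using x by (simp add: zero_mat_mult_vec[OF kron_pow_carrier[OF x]])
        thus "?c1 z = 0" unfolding zip by (simp del: index_mult_mat_vec fun_upd_apply)
      qed
    qed auto
    finally show ?thesis ..
  qed
  have e2: "(\<Sum>z\<in>{z\<in>?S2. ?e2 z = k}. ?c2 z)
     = (\<Sum>((p, i), (q, j))\<in>{((p, i), (q, j)). 2 \<le> i \<and> 2 \<le> j \<and> p + q + i + j = k + 2}.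
            real i / 2 * (real j / 2) * (?it p i \<bullet> ?it q j))"
  proof -
    have "(\<Sum>((p, i), (q, j))\<in>{((p, i), (q, j)). 2 \<le> i \<and> 2 \<le> j \<and> p + q + i + j = k + 2}.
            real i / 2 * (real j / 2) * (?it p i \<bullet> ?it q j))
        = (\<Sum>z\<in>{((p, i), (q, j)). 2 \<le> i \<and> 2 \<le> j \<and> p + q + i + j = k + 2}. ?c2 z)"
    proof (rule sum.cong[OF refl], clarify)
      fix i p j q show "real i / 2 * (real j / 2) * (?it p i \<bullet> ?it q j) = ?c2 ((p, i), (q, j))"
        unfolding scalar_prod_sum[OF input_term_carrier] sum_distrib_left
        by (simp only: fst_conv snd_conv mult_ac)
    qed
    also have "\<dots> = (\<Sum>z\<in>{z\<in>?S2. ?e2 z = k}. ?c2 z)"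
    proof (rule sum.mono_neutral_right)
      show "finite {((p::nat, i::nat), (q::nat, j::nat)). 2 \<le> i \<and> 2 \<le> j \<and> p + q + i + j = k + 2}"
        by (rule finite_subset[of _ "({..k+2} \<times> {..k+2}) \<times> ({..k+2} \<times> {..k+2})"]) auto
      show "\<forall>z\<in>{((p, i), (q, j)). 2 \<le> i \<and> 2 \<le> j \<and> p + q + i + j = k + 2} - {z\<in>?S2. ?e2 z = k}. ?c2 z = 0"
      proof
        fix z assume z: "z \<in> {((p, i), (q, j)). 2 \<le> i \<and> 2 \<le> j \<and> p + q + i + j = k + 2} - {z\<in>?S2. ?e2 z = k}"
        obtain p i q j where zip: "z = ((p, i), (q, j))" by (cases z) auto
        have i: "i \<in> {2..d}" and j: "j \<in> {2..d}" and "l < p \<or> l < q" using k z unfolding zip by auto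
        moreover have "?it p i = 0\<^sub>v m" if "l < p"
          by (rule input_term_zero[of G p n m V i x, OF G_zero Vc[OF i] x]) (use that in auto)
        moreover have "?it q j = 0\<^sub>v m" if "l < q"
          by (rule input_term_zero[of G q n m V j x, OF G_zero Vc[OF j] x]) (use that in auto)
        ultimately have "?it p i = 0\<^sub>v m \<or> ?it q j = 0\<^sub>v m" by blast
        thus "?c2 z = 0" unfolding zip by auto
      qed
    qed auto
    finally show ?thesis ..
  qed
  have e3: "(\<Sum>z\<in>{z\<in>?S3. ?e3 z = k}. ?c3 z)
     = (\<Sum>(p, q)\<in>{(p, q). 1 \<le> p \<and> 1 \<le> q \<and> p + q = k}. (H p *\<^sub>v x ^\<^sub>\<otimes> p) \<bullet> (H q *\<^sub>v x ^\<^sub>\<otimes> q))"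
  proof -
    have "(\<Sum>(p, q)\<in>{(p, q). 1 \<le> p \<and> 1 \<le> q \<and> p + q = k}. (H p *\<^sub>v x ^\<^sub>\<otimes> p) \<bullet> (H q *\<^sub>v x ^\<^sub>\<otimes> q))
        = (\<Sum>z\<in>{(p, q). 1 \<le> p \<and> 1 \<le> q \<and> p + q = k}. ?c3 z)"
    proof (rule sum.cong[OF refl], clarify)
      fix p q show "(H p *\<^sub>v x ^\<^sub>\<otimes> p) \<bullet> (H q *\<^sub>v x ^\<^sub>\<otimes> q) = ?c3 (p, q)"
        unfolding scalar_prod_sum[OF mult_mat_vec_carrier[OF H kron_pow_carrier[OF x]]]
        by (simp only: fst_conv snd_conv)
    qed
    also have "\<dots> = (\<Sum>z\<in>{z\<in>?S3. ?e3 z = k}. ?c3 z)"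
    proof (rule sum.mono_neutral_right)
      show "finite {(p::nat, q). 1 \<le> p \<and> 1 \<le> q \<and> p + q = k}"
        by (rule finite_subset[of _ "{..k} \<times> {..k}"]) auto
      show "\<forall>z\<in>{(p, q). 1 \<le> p \<and> 1 \<le> q \<and> p + q = k} - {z\<in>?S3. ?e3 z = k}. ?c3 z = 0"
      proof
        fix z assume z: "z \<in> {(p, q). 1 \<le> p \<and> 1 \<le> q \<and> p + q = k} - {z\<in>?S3. ?e3 z = k}"
        obtain p q where zip: "z = (p, q)" by (cases z)
        have "(2 \<le> p \<and> l < p) \<or> (2 \<le> q \<and> l < q)" using z unfolding zip by auto
        hence "H p = 0\<^sub>m r (n ^ p) \<or> H q = 0\<^sub>m r (n ^ q)" using H_zero by auto
        hence "H p *\<^sub>v x ^\<^sub>\<otimes> p = 0\<^sub>v r \<or> H q *\<^sub>v x ^\<^sub>\<otimes> q = 0\<^sub>v r"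
          by (auto simp: zero_mat_mult_vec[OF kron_pow_carrier[OF x]])
        thus "?c3 z = 0" unfolding zip by (auto simp del: index_mult_mat_vec)
      qed
    qed auto
    finally show ?thesis ..
  qed
  show ?thesis using bk unfolding b_def e1 e2 e3 .
qed

section \<open>Consequences of an achievable level\<close>

lemma vnorm_square: "(vnorm x)\<^sup>2 = (\<Sum>i<dim_vec x. (norm (x $ i))\<^sup>2)"
  by (simp add: vnorm_def L2_set_def sum_nonneg)

lemma vnorm_zero [simp]: "vnorm (0\<^sub>v n) = 0"
  by (simp add: vnorm_def L2_set_def)

lemma norm_index_le_vnorm: "i < dim_vec x \<Longrightarrow> norm (x $ i) \<le> vnorm x"
  unfolding vnorm_def using member_le_L2_set[of "{..<dim_vec x}" i "\<lambda>i. norm (x $ i)"] by auto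

lemma vnorm_triangle_diff:
  assumes "dim_vec x = dim_vec y"
  shows "vnorm x \<le> vnorm (x - y) + vnorm (y :: complex vec)"
proof -
  have "vnorm x \<le> L2_set (\<lambda>i. norm ((x - y) $ i) + norm (y $ i)) {..<dim_vec x}"
    unfolding vnorm_def
  proof (rule L2_set_mono)
    fix i assume "i \<in> {..<dim_vec x}"
    thus "norm (x $ i) \<le> norm ((x - y) $ i) + norm (y $ i)"
      using norm_triangle_ineq[of "x $ i - y $ i" "y $ i"] assms by simp
  qed simp
  also have "\<dots> \<le> vnorm (x - y) + vnorm y"
    unfolding vnorm_def using L2_set_triangle_ineq[of "\<lambda>i. norm ((x - y) $ i)" "\<lambda>i. norm (y $ i)" "{..<dim_vec x}"] assms
    by simp
  finally show ?thesis .
qed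

lemma vnorm_smult_complex: "vnorm (c \<cdot>\<^sub>v x) = norm c * vnorm (x :: complex vec)"
proof (rule power2_eq_imp_eq)
  show "(vnorm (c \<cdot>\<^sub>v x))\<^sup>2 = (norm c * vnorm x)\<^sup>2"
    by (simp add: vnorm_square power_mult_distrib norm_mult sum_distrib_left)
qed auto

lemma vnorm_mult_complex_mat_vec_le:
  fixes P :: "complex mat"
  assumes P: "P \<in> carrier_mat a b"
  shows "\<exists>K\<ge>0. \<forall>x\<in>carrier_vec b. vnorm (P *\<^sub>v x) \<le> K * vnorm x"
proof -
  define K where "K = sqrt (\<Sum>i<a. \<Sum>j<b. (norm (P $$ (i, j)))\<^sup>2)"
  have K: "0 \<le> K" "K\<^sup>2 = (\<Sum>i<a. \<Sum>j<b. (norm (P $$ (i, j)))\<^sup>2)" by (auto simp: K_def sum_nonneg)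
  have "vnorm (P *\<^sub>v x) \<le> K * vnorm x" if x: "x \<in> carrier_vec b" for x
  proof (rule power2_le_imp_le)
    have "(vnorm (P *\<^sub>v x))\<^sup>2 = (\<Sum>i<a. (norm (\<Sum>j<b. P $$ (i, j) * x $ j))\<^sup>2)"
      unfolding vnorm_square using P by (simp add: mult_mat_vec_sum[OF P x] del: index_mult_mat_vec)
    also have "\<dots> \<le> (\<Sum>i<a. (\<Sum>j<b. (norm (P $$ (i, j)))\<^sup>2) * (\<Sum>j<b. (norm (x $ j))\<^sup>2))"
      by (intro sum_mono cmod_sum_square_le)
    also have "\<dots> = K\<^sup>2 * (vnorm x)\<^sup>2"
      using x by (simp add: K vnorm_square sum_distrib_right)
    finally show "(vnorm (P *\<^sub>v x))\<^sup>2 \<le> (K * vnorm x)\<^sup>2" by (simp add: power_mult_distrib)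
  qed (use K in auto)
  thus ?thesis using K(1) by blast
qed

text \<open>The Frobenius bound makes the supremum over the unit ball finite; homogeneity carries it
  to all vectors.\<close>

lemma spectral_norm_bound:
  assumes P: "P \<in> carrier_mat a b"
  shows "0 \<le> spectral_norm P" and "x \<in> carrier_vec b \<Longrightarrow> vnorm (P *\<^sub>v x) \<le> spectral_norm P * vnorm x"
proof -
  let ?S = "{vnorm (P *\<^sub>v x) | x. x \<in> carrier_vec (dim_col P) \<and> vnorm x \<le> 1}"
  obtain K where K: "0 \<le> K" "\<forall>x\<in>carrier_vec b. vnorm (P *\<^sub>v x) \<le> K * vnorm x"
    using vnorm_mult_complex_mat_vec_le[OF P] by blast
  have bdd: "bdd_above ?S"
  proof (rule bdd_aboveI)
    fix z assume "z \<in> ?S"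
    then obtain x where x: "x \<in> carrier_vec b" "vnorm x \<le> 1" "z = vnorm (P *\<^sub>v x)" using P by auto
    have "z \<le> K * vnorm x" using K(2) x by simp
    also have "\<dots> \<le> K * 1" using x K(1) by (intro mult_left_mono)
    finally show "z \<le> K" by simp
  qed
  have upper: "vnorm (P *\<^sub>v x) \<le> spectral_norm P" if "x \<in> carrier_vec b" "vnorm x \<le> 1" for x
    unfolding spectral_norm_def by (rule cSup_upper[OF _ bdd]) (use that P in auto)
  show "0 \<le> spectral_norm P"
    by (rule order.trans[OF vnorm_nonneg upper[of "0\<^sub>v b"]]) auto
  assume x: "x \<in> carrier_vec b"
  show "vnorm (P *\<^sub>v x) \<le> spectral_norm P * vnorm x"
  proof (cases "vnorm x = 0")
    case True
    thus ?thesis using K(2) x by fastforce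
  next
    case False
    hence pos: "0 < vnorm x" using vnorm_nonneg[of x] by linarith
    let ?c = "complex_of_real (1 / vnorm x)"
    have "vnorm (?c \<cdot>\<^sub>v x) \<le> 1" using pos by (simp add: vnorm_smult_complex norm_divide)
    hence "vnorm (P *\<^sub>v (?c \<cdot>\<^sub>v x)) \<le> spectral_norm P" using x by (intro upper) auto
    also have "P *\<^sub>v (?c \<cdot>\<^sub>v x) = ?c \<cdot>\<^sub>v (P *\<^sub>v x)" by (rule mult_mat_vec[OF P x])
    finally have "1 / vnorm x * vnorm (P *\<^sub>v x) \<le> spectral_norm P"
      using pos by (simp add: vnorm_smult_complex norm_divide)
    thus ?thesis using pos by (simp add: field_simps)
  qed
qed

section \<open>Resolvents on the closed right half plane\<close>

lemma smult_mat_mult_vec: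
  fixes M :: "complex mat"
  assumes "M \<in> carrier_mat a b" "x \<in> carrier_vec b"
  shows "(c \<cdot>\<^sub>m M) *\<^sub>v x = c \<cdot>\<^sub>v (M *\<^sub>v x)"
  by (rule eq_vecI) (use assms in \<open>auto simp: scalar_prod_def sum_distrib_left mult_ac\<close>)

lemma resolvent_mult:
  fixes N :: "complex mat"
  assumes N: "N \<in> carrier_mat k k" and X: "X \<in> carrier_vec k"
  shows "(s \<cdot>\<^sub>m 1\<^sub>m k - N) *\<^sub>v X = s \<cdot>\<^sub>v X - N *\<^sub>v X"
proof -
  have "(s \<cdot>\<^sub>m 1\<^sub>m k) *\<^sub>v X = s \<cdot>\<^sub>v X"
    using X by (simp add: smult_mat_mult_vec[of "1\<^sub>m k" k k])
  thus ?thesis using N X by (simp add: minus_mult_distrib_mat_vec[of _ k k])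
qed

lemma resolvent_det_nonzero:
  fixes N :: "complex mat"
  assumes N: "N \<in> carrier_mat k k" and s: "\<not> eigenvalue N s"
  shows "det (s \<cdot>\<^sub>m 1\<^sub>m k - N) \<noteq> 0"
proof
  have c: "s \<cdot>\<^sub>m 1\<^sub>m k - N \<in> carrier_mat k k" using N by auto
  assume "det (s \<cdot>\<^sub>m 1\<^sub>m k - N) = 0"
  then obtain X where X: "X \<in> carrier_vec k" "X \<noteq> 0\<^sub>v k" "(s \<cdot>\<^sub>m 1\<^sub>m k - N) *\<^sub>v X = 0\<^sub>v k"
    using det_0_iff_vec_prod_zero_field[OF c] by blast
  have "s \<cdot>\<^sub>v X - N *\<^sub>v X = 0\<^sub>v k" using X(3) resolvent_mult[OF N X(1)] by simp
  hence "N *\<^sub>v X = s \<cdot>\<^sub>v X"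
    by (intro eq_vecI) (use N X(1) in \<open>auto simp: vec_eq_iff\<close>)
  hence "eigenvalue N s" using X N by (auto simp: eigenvalue_def eigenvector_def)
  thus False using s by contradiction
qed

lemma holomorphic_on_det:
  assumes "\<And>s. A s \<in> carrier_mat k k" "\<And>i j. i < k \<Longrightarrow> j < k \<Longrightarrow> (\<lambda>s. A s $$ (i, j)) holomorphic_on S"
  shows "(\<lambda>s. det (A s :: complex mat)) holomorphic_on S"
  unfolding det_def'[OF assms(1)]
proof (intro holomorphic_on_sum holomorphic_on_mult holomorphic_on_const holomorphic_on_prod assms(2))
  fix p i assume "p \<in> {p. p permutes {0..<k}}" "i \<in> {0..<k}"
  thus "i < k" "p i < k" using permutes_in_image[of p "{0..<k}" i] by auto
qed

text \<open>By Cramer's rule the resolvent is the adjugate over the determinant, a rational function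
  whose poles all lie in the open left half plane; it is therefore holomorphic up to and including
  the imaginary axis.\<close>

lemma resolvent_exists:
  fixes N :: "complex mat"
  assumes N: "N \<in> carrier_mat k k" and b: "b \<in> carrier_vec k"
    and stab: "\<And>s. eigenvalue N s \<Longrightarrow> Re s < 0"
  shows "\<exists>\<nu>. (\<forall>s. 0 \<le> Re s \<longrightarrow> \<nu> s \<in> carrier_vec k \<and> s \<cdot>\<^sub>v \<nu> s - N *\<^sub>v \<nu> s = b) \<and>
     (\<forall>i<k. (\<lambda>s. \<nu> s $ i) holomorphic_on {s. 0 \<le> Re s})"
proof -
  let ?R = "\<lambda>s. s \<cdot>\<^sub>m 1\<^sub>m k - N"
  have R: "?R s \<in> carrier_mat k k" for s using N by auto
  define \<nu> where "\<nu> s = (1 / det (?R s)) \<cdot>\<^sub>v (adj_mat (?R s) *\<^sub>v b)" for s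
  have nz: "det (?R s) \<noteq> 0" if "0 \<le> Re s" for s
    by (rule resolvent_det_nonzero[OF N]) (use stab[of s] that in auto)
  have adj: "adj_mat (?R s) \<in> carrier_mat k k" for s by (rule adj_mat(1)[OF R])
  have c: "\<nu> s \<in> carrier_vec k" for s using adj[of s] b by (simp add: \<nu>_def)
  have "s \<cdot>\<^sub>v \<nu> s - N *\<^sub>v \<nu> s = b" if "0 \<le> Re s" for s
  proof -
    have ab: "adj_mat (?R s) *\<^sub>v b \<in> carrier_vec k" using adj[of s] b by auto
    have "?R s *\<^sub>v \<nu> s = (1 / det (?R s)) \<cdot>\<^sub>v ((?R s * adj_mat (?R s)) *\<^sub>v b)"
      unfolding \<nu>_def mult_mat_vec[OF R ab] assoc_mult_mat_vec[OF R adj b] ..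
    also have "?R s * adj_mat (?R s) = det (?R s) \<cdot>\<^sub>m 1\<^sub>m k" by (rule adj_mat(2)[OF R])
    also have "(det (?R s) \<cdot>\<^sub>m 1\<^sub>m k) *\<^sub>v b = det (?R s) \<cdot>\<^sub>v b"
      using b by (simp add: smult_mat_mult_vec[of "1\<^sub>m k" k k])
    finally show ?thesis using nz[OF that] b resolvent_mult[OF N c] by (simp add: smult_smult_assoc)
  qed
  moreover have "(\<lambda>s. \<nu> s $ i) holomorphic_on {s. 0 \<le> Re s}" if i: "i < k" for i
  proof -
    have ent: "(\<lambda>s. ?R s $$ (a, c)) holomorphic_on S" if "a < k" "c < k" for a c S
    proof -
      have "?R s $$ (a, c) = s * (if a = c then 1 else 0) - N $$ (a, c)" for s
        using that N by auto
      thus ?thesis by (simp only:) (intro holomorphic_intros)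
    qed
    have adj_ent: "(\<lambda>s. adj_mat (?R s) $$ (i, j)) holomorphic_on S" if j: "j < k" for j S
    proof -
      have "adj_mat (?R s) $$ (i, j) = (- 1) ^ (j + i) * det (mat_delete (?R s) j i)" for s
        using N i j by (simp add: adj_mat_def cofactor_def)
      moreover have "(\<lambda>s. det (mat_delete (?R s) j i)) holomorphic_on S"
      proof (rule holomorphic_on_det)
        show "mat_delete (?R s) j i \<in> carrier_mat (k - 1) (k - 1)" for s
          using mat_delete_carrier[OF R] .
        fix a c assume ac: "a < k - 1" "c < k - 1"
        have "mat_delete (?R s) j i $$ (a, c) = ?R s $$ (if a < j then a else Suc a, if c < i then c else Suc c)" for s
          using ac N by (simp add: mat_delete_def)
        moreover have "(\<lambda>s. ?R s $$ (if a < j then a else Suc a, if c < i then c else Suc c)) holomorphic_on S"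
          by (rule ent) (use ac in auto)
        ultimately show "(\<lambda>s. mat_delete (?R s) j i $$ (a, c)) holomorphic_on S" by (simp only:)
      qed
      ultimately show ?thesis by (simp only:) (intro holomorphic_intros)
    qed
    have "\<nu> s $ i = 1 / det (?R s) * (\<Sum>j<k. adj_mat (?R s) $$ (i, j) * b $ j)" for s
      using adj[of s] i by (simp add: \<nu>_def mult_mat_vec_sum[OF adj b i] del: index_mult_mat_vec)
    thus ?thesis
      by (simp only:) (intro holomorphic_intros adj_ent holomorphic_on_det[OF R] ent; use nz in auto)
  qed
  ultimately show ?thesis using c by blast
qed

text \<open>Infinity approached within the closed right half plane, the domain on which the
  resolvents are controlled.\<close>

definition right_infinity :: "complex filter" where
  "right_infinity = inf at_infinity (principal {s. 0 \<le> Re s})"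

lemma eventually_right_infinity:
  "eventually P right_infinity \<longleftrightarrow> (\<exists>b. \<forall>s. b \<le> norm s \<and> 0 \<le> Re s \<longrightarrow> P s)"
  unfolding right_infinity_def eventually_inf_principal eventually_at_infinity by auto

lemma filterlim_of_real_right_infinity: "filterlim complex_of_real right_infinity at_top"
  unfolding filterlim_def le_filter_def eventually_filtermap eventually_right_infinity
proof (intro allI impI, elim exE)
  fix P b assume "\<forall>s. b \<le> norm s \<and> 0 \<le> Re s \<longrightarrow> P s"
  thus "eventually (\<lambda>t. P (complex_of_real t)) at_top"
    using eventually_ge_at_top[of "max 0 b"] by (auto elim!: eventually_mono)
qed

text \<open>For large s the term s \<nu> dominates N \<nu>, so that \<nu> = O(1/|s|). Inserting this
  into s \<nu> = b + N \<nu> gives the second limit.\<close>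

lemma resolvent_decay:
  fixes N :: "complex mat" and \<nu> :: "complex \<Rightarrow> complex vec"
  assumes N: "N \<in> carrier_mat k k" and b: "b \<in> carrier_vec k"
    and \<nu>: "\<And>s. 0 \<le> Re s \<Longrightarrow> \<nu> s \<in> carrier_vec k \<and> s \<cdot>\<^sub>v \<nu> s - N *\<^sub>v \<nu> s = b"
  shows "i < k \<Longrightarrow> ((\<lambda>s. \<nu> s $ i) \<longlongrightarrow> 0) right_infinity"
    and "i < k \<Longrightarrow> ((\<lambda>s. s * \<nu> s $ i) \<longlongrightarrow> b $ i) right_infinity"
proof -
  obtain K where K: "0 \<le> K" "\<forall>x\<in>carrier_vec k. vnorm (N *\<^sub>v x) \<le> K * vnorm x"
    using vnorm_mult_complex_mat_vec_le[OF N] by blast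
  \<comment> \<open>Beyond 2 K + 1 the norm bound K of N is at most |s|/2 and s is nonzero.\<close>
  have bound: "vnorm (\<nu> s) \<le> 2 * vnorm b / norm s" if s: "2 * K + 1 \<le> norm s" "0 \<le> Re s" for s
  proof -
    have c: "\<nu> s \<in> carrier_vec k" and e: "s \<cdot>\<^sub>v \<nu> s - N *\<^sub>v \<nu> s = b" using \<nu> s by auto
    have "norm s * vnorm (\<nu> s) = vnorm (s \<cdot>\<^sub>v \<nu> s)" by (simp add: vnorm_smult_complex)
    also have "\<dots> \<le> vnorm (s \<cdot>\<^sub>v \<nu> s - N *\<^sub>v \<nu> s) + vnorm (N *\<^sub>v \<nu> s)"
      by (rule vnorm_triangle_diff) (use N c in auto)
    also have "\<dots> \<le> vnorm b + K * vnorm (\<nu> s)" using e K(2) c by simp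
    also have "K * vnorm (\<nu> s) \<le> (norm s / 2) * vnorm (\<nu> s)" using s by (intro mult_right_mono) auto
    finally have "norm s * vnorm (\<nu> s) \<le> 2 * vnorm b" by linarith
    moreover have "0 < norm s" using s K(1) by linarith
    ultimately show ?thesis by (simp add: pos_le_divide_eq mult.commute)
  qed
  have lim: "((\<lambda>s. \<nu> s $ i) \<longlongrightarrow> 0) right_infinity" if i: "i < k" for i
  proof (rule Lim_null_comparison)
    show "eventually (\<lambda>s. norm (\<nu> s $ i) \<le> 2 * vnorm b / norm s) right_infinity"
      unfolding eventually_right_infinity
    proof (intro exI[of _ "2 * K + 1"] allI impI)
      fix s assume s: "2 * K + 1 \<le> norm s \<and> 0 \<le> Re s"
      have "norm (\<nu> s $ i) \<le> vnorm (\<nu> s)" by (rule norm_index_le_vnorm) (use \<nu>[of s] s i in auto)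
      thus "norm (\<nu> s $ i) \<le> 2 * vnorm b / norm s" using bound[of s] s by linarith
    qed
    have "((\<lambda>s::complex. 2 * vnorm b / norm s) \<longlongrightarrow> 0) at_infinity"
      by (intro real_tendsto_divide_at_top[OF tendsto_const] filterlim_norm_at_top)
    thus "((\<lambda>s. 2 * vnorm b / norm s) \<longlongrightarrow> 0) right_infinity"
      by (rule tendsto_mono[rotated]) (simp add: right_infinity_def)
  qed
  thus "i < k \<Longrightarrow> ((\<lambda>s. \<nu> s $ i) \<longlongrightarrow> 0) right_infinity" .
  assume i: "i < k"
  have "((\<lambda>s. b $ i + (\<Sum>j<k. N $$ (i, j) * \<nu> s $ j)) \<longlongrightarrow> b $ i + (\<Sum>j<k. N $$ (i, j) * 0)) right_infinity"
    by (intro tendsto_intros lim) auto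
  moreover have "eventually (\<lambda>s. s * \<nu> s $ i = b $ i + (\<Sum>j<k. N $$ (i, j) * \<nu> s $ j)) right_infinity"
    unfolding eventually_right_infinity
  proof (intro exI[of _ 0] allI impI)
    fix s :: complex assume s: "0 \<le> norm s \<and> 0 \<le> Re s"
    hence c: "\<nu> s \<in> carrier_vec k" and e: "s \<cdot>\<^sub>v \<nu> s - N *\<^sub>v \<nu> s = b" using \<nu> by auto
    have "s * \<nu> s $ i - (N *\<^sub>v \<nu> s) $ i = b $ i" unfolding e[symmetric] using i c N by simp
    thus "s * \<nu> s $ i = b $ i + (\<Sum>j<k. N $$ (i, j) * \<nu> s $ j)"
      unfolding mult_mat_vec_sum[OF N c i] by (simp add: algebra_simps)
  qed
  ultimately show "((\<lambda>s. s * \<nu> s $ i) \<longlongrightarrow> b $ i) right_infinity"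
    by (simp add: tendsto_cong)
qed

text \<open>The maximum principle for -\<chi> on large half discs: the diameter is covered by the
  boundary condition, the arc by the decay at infinity.\<close>

lemma right_half_plane_minimum_principle:
  assumes hol: "\<chi> holomorphic_on {s. 0 \<le> Re s}"
    and lim: "(\<chi> \<longlongrightarrow> 0) right_infinity"
    and bdry: "\<And>s. Re s = 0 \<Longrightarrow> 0 \<le> Re (\<chi> s)" and s: "0 < Re s"
  shows "0 \<le> Re (\<chi> s)"
proof (rule ccontr)
  assume "\<not> 0 \<le> Re (\<chi> s)"
  \<comment> \<open>Half the depth of the supposed negative value, so that the bound \<epsilon>
    contradicts the value 2 \<epsilon> of the real part of -\<chi> at s.\<close>
  define \<epsilon> where "\<epsilon> = - Re (\<chi> s) / 2"
  have \<epsilon>: "0 < \<epsilon>" using \<open>\<not> 0 \<le> Re (\<chi> s)\<close> by (simp add: \<epsilon>_def)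
  have "eventually (\<lambda>s. dist (\<chi> s) 0 < \<epsilon>) right_infinity" by (rule tendstoD[OF lim \<epsilon>])
  then obtain b where b: "\<forall>s. b \<le> norm s \<and> 0 \<le> Re s \<longrightarrow> dist (\<chi> s) 0 < \<epsilon>"
    unfolding eventually_right_infinity by blast
  \<comment> \<open>The radius puts s inside the half disc and the arc into the region where \<chi>
    is small.\<close>
  define r where "r = max b (norm s + 1)"
  define S where "S = ball 0 r \<inter> {s. 0 < Re s}"
  have cl: "closure S \<subseteq> cball 0 r \<inter> {s. 0 \<le> Re s}"
    by (rule closure_minimal)
      (auto simp: S_def intro!: closed_Int closed_Collect_le continuous_intros)
  have op: "open S" unfolding S_def by (intro open_Int open_ball open_Collect_less continuous_intros)
  have "Re (- \<chi> s) \<le> \<epsilon>"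
  proof (rule maximum_real_frontier[of "\<lambda>s. - \<chi> s" S])
    show "(\<lambda>s. - \<chi> s) holomorphic_on interior S"
      unfolding interior_open[OF op]
      by (intro holomorphic_intros holomorphic_on_subset[OF hol]) (auto simp: S_def)
    show "continuous_on (closure S) (\<lambda>s. - \<chi> s)"
      by (intro continuous_intros continuous_on_subset[OF holomorphic_on_imp_continuous_on[OF hol]]) (use cl in auto)
    show "bounded S" by (rule bounded_subset[of "ball 0 r"]) (auto simp: S_def)
    show "s \<in> S" using s by (simp add: S_def r_def)
    fix z assume z: "z \<in> frontier S"
    have z1: "norm z \<le> r" "0 \<le> Re z" using z cl by (auto simp: frontier_def)
    have "z \<notin> S" using z op by (simp add: frontier_def interior_open)
    hence "norm z = r \<or> Re z = 0" using z1 by (auto simp: S_def)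
    thus "Re (- \<chi> z) \<le> \<epsilon>"
    proof
      assume "norm z = r"
      hence "dist (\<chi> z) 0 < \<epsilon>" using b z1 by (simp add: r_def)
      thus ?thesis using abs_Re_le_cmod[of "\<chi> z"] by simp
    next
      assume "Re z = 0"
      thus ?thesis using bdry[of z] \<epsilon> by simp
    qed
  qed
  thus False using \<epsilon> by (simp add: \<epsilon>_def)
qed

section \<open>Closed-loop bounds in the frequency domain\<close>

lemma transfer_mat_bound:
  assumes A: "A \<in> carrier_mat N N" and B: "B \<in> carrier_mat N M" and C: "C \<in> carrier_mat R N" and D: "D \<in> carrier_mat R M"
    and hurw: "hurwitz A" and norm: "Hinf_norm (transfer_mat A B C D) < ereal g"
    and s: "0 < Re s" and X: "X \<in> carrier_vec N" and w: "w \<in> carrier_vec M"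
    and eq: "s \<cdot>\<^sub>v X - cmat A *\<^sub>v X = cmat B *\<^sub>v w"
  shows "vnorm (cmat C *\<^sub>v X + cmat D *\<^sub>v w) \<le> g * vnorm w" and "0 < g"
proof -
  let ?R = "s \<cdot>\<^sub>m 1\<^sub>m N - cmat A"
  have cA: "cmat A \<in> carrier_mat N N" and cB: "cmat B \<in> carrier_mat N M" and cC: "cmat C \<in> carrier_mat R N"
    and cD: "cmat D \<in> carrier_mat R M" using A B C D by auto
  have R: "?R \<in> carrier_mat N N" using A by auto
  have "\<not> eigenvalue (cmat A) s" using hurw s by (auto simp: hurwitz_def)
  hence "det ?R \<noteq> 0" by (rule resolvent_det_nonzero[OF cA])
  hence "?R \<in> Units (ring_mat TYPE(complex) N ())" by (rule det_non_zero_imp_unit[OF R])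
  then obtain I where I: "mat_inverse ?R = Some I"
    using mat_inverse(1)[OF R, of "()"] by (cases "mat_inverse ?R") auto
  have I2: "I * ?R = 1\<^sub>m N" "I \<in> carrier_mat N N" using mat_inverse(2)[OF R I] by auto
  have Bw: "cmat B *\<^sub>v w \<in> carrier_vec N" using cB w by auto
  have "?R *\<^sub>v X = cmat B *\<^sub>v w" using resolvent_mult[OF cA X] eq by simp
  hence "I *\<^sub>v (cmat B *\<^sub>v w) = (I * ?R) *\<^sub>v X" using assoc_mult_mat_vec[OF I2(2) R X] by simp
  also have "\<dots> = X" using I2 X by simp
  finally have IX: "I *\<^sub>v (cmat B *\<^sub>v w) = X" .
  let ?T = "transfer_mat A B C D s"
  have T: "?T = cmat C * I * cmat B + cmat D" using A I by (simp add: transfer_mat_def)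
  have CI: "cmat C * I \<in> carrier_mat R N" using cC I2 by auto
  have CIB: "cmat C * I * cmat B \<in> carrier_mat R M" using CI cB by auto
  have Tc: "?T \<in> carrier_mat R M" unfolding T using CIB cD by auto
  have "?T *\<^sub>v w = (cmat C * I * cmat B) *\<^sub>v w + cmat D *\<^sub>v w"
    unfolding T by (rule add_mult_distrib_mat_vec[OF CIB cD w])
  also have "(cmat C * I * cmat B) *\<^sub>v w = cmat C *\<^sub>v (I *\<^sub>v (cmat B *\<^sub>v w))"
    using assoc_mult_mat_vec[OF CI cB w] assoc_mult_mat_vec[OF cC I2(2) Bw] by simp
  finally have Tw: "?T *\<^sub>v w = cmat C *\<^sub>v X + cmat D *\<^sub>v w" using IX by simp
  have "ereal (spectral_norm ?T) \<le> Hinf_norm (transfer_mat A B C D)"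
    unfolding Hinf_norm_def by (rule SUP_upper) (use s in simp)
  from le_less_trans[OF this norm] have sn: "spectral_norm ?T < g" by simp
  show "0 < g" using spectral_norm_bound(1)[OF Tc] sn by linarith
  have "vnorm (?T *\<^sub>v w) \<le> spectral_norm ?T * vnorm w" by (rule spectral_norm_bound(2)[OF Tc w])
  also have "\<dots> \<le> g * vnorm w" using sn by (intro mult_right_mono) auto
  finally show "vnorm (cmat C *\<^sub>v X + cmat D *\<^sub>v w) \<le> g * vnorm w" using Tw by simp
qed

lemma continuous_on_tendsto_at_right:
  fixes f :: "complex \<Rightarrow> 'b::topological_space"
  assumes "continuous_on {s. 0 \<le> Re s} f" "0 \<le> Re s"
  shows "((\<lambda>\<epsilon>. f (s + complex_of_real \<epsilon>)) \<longlongrightarrow> f s) (at_right 0)"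
proof (rule continuous_on_tendsto_compose[OF assms(1)])
  show "((\<lambda>\<epsilon>. s + complex_of_real \<epsilon>) \<longlongrightarrow> s) (at_right 0)"
    by (rule tendsto_eq_intros refl)+ simp
  show "eventually (\<lambda>\<epsilon>. s + complex_of_real \<epsilon> \<in> {s. 0 \<le> Re s}) (at_right 0)"
    using eventually_at_right_less[of "0::real"] assms(2) by (auto elim!: eventually_mono)
qed (use assms in simp)

text \<open>The norm is a supremum over the open half plane, whereas imaginary frequencies are
  needed. As A is Hurwitz the resolvent is continuous up to the axis, and the bound passes to the
  limit from s + \<epsilon>.\<close>

lemma transfer_mat_bound_closed:
  assumes A: "A \<in> carrier_mat N N" and B: "B \<in> carrier_mat N M" and C: "C \<in> carrier_mat R N" and D: "D \<in> carrier_mat R M"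
    and hurw: "hurwitz A" and norm: "Hinf_norm (transfer_mat A B C D) < ereal g"
    and s: "0 \<le> Re s" and X: "X \<in> carrier_vec N" and w: "w \<in> carrier_vec M"
    and eq: "s \<cdot>\<^sub>v X - cmat A *\<^sub>v X = cmat B *\<^sub>v w"
  shows "(\<Sum>i<R. (cmod ((cmat C *\<^sub>v X + cmat D *\<^sub>v w) $ i))\<^sup>2) \<le> g\<^sup>2 * (\<Sum>i<M. (cmod (w $ i))\<^sup>2)"
proof -
  have cA: "cmat A \<in> carrier_mat N N" and cB: "cmat B \<in> carrier_mat N M" and cC: "cmat C \<in> carrier_mat R N"
    and cD: "cmat D \<in> carrier_mat R M" using A B C D by auto
  have Bw: "cmat B *\<^sub>v w \<in> carrier_vec N" using cB w by auto
  obtain \<nu> where \<nu>: "\<forall>s. 0 \<le> Re s \<longrightarrow> \<nu> s \<in> carrier_vec N \<and> s \<cdot>\<^sub>v \<nu> s - cmat A *\<^sub>v \<nu> s = cmat B *\<^sub>v w"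
    and hol: "\<forall>i<N. (\<lambda>s. \<nu> s $ i) holomorphic_on {s. 0 \<le> Re s}"
  proof -
    have "\<exists>\<nu>. (\<forall>s. 0 \<le> Re s \<longrightarrow> \<nu> s \<in> carrier_vec N \<and> s \<cdot>\<^sub>v \<nu> s - cmat A *\<^sub>v \<nu> s = cmat B *\<^sub>v w) \<and>
      (\<forall>i<N. (\<lambda>s. \<nu> s $ i) holomorphic_on {s. 0 \<le> Re s})"
      by (rule resolvent_exists[OF cA Bw]) (use hurw in \<open>auto simp: hurwitz_def\<close>)
    thus ?thesis by (elim exE conjE) (rule that)
  qed
  define Fn where "Fn s = (\<Sum>i<R. (cmod ((\<Sum>j<N. cmat C $$ (i, j) * \<nu> s $ j) + (cmat D *\<^sub>v w) $ i))\<^sup>2)" for s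
  have Fn_eq: "Fn s = (\<Sum>i<R. (cmod ((cmat C *\<^sub>v \<nu> s + cmat D *\<^sub>v w) $ i))\<^sup>2)" if "0 \<le> Re s" for s
  proof -
    have c: "\<nu> s \<in> carrier_vec N" using \<nu> that by blast
    show ?thesis unfolding Fn_def
      by (rule sum.cong[OF refl]) (use mult_mat_vec_sum[OF cC c] cD in auto)
  qed
  have cont: "continuous_on {s. 0 \<le> Re s} Fn"
    unfolding Fn_def using hol
    by (intro continuous_intros) (auto intro: holomorphic_on_imp_continuous_on)
  have sq: "(vnorm z)\<^sup>2 = (\<Sum>i<R. (cmod (z $ i))\<^sup>2)" if "z \<in> carrier_vec R" for z
    using that by (simp add: vnorm_square)
  have bound: "Fn s \<le> g\<^sup>2 * (\<Sum>i<M. (cmod (w $ i))\<^sup>2)" if s: "0 < Re s" for s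
  proof -
    have c: "\<nu> s \<in> carrier_vec N" and e: "s \<cdot>\<^sub>v \<nu> s - cmat A *\<^sub>v \<nu> s = cmat B *\<^sub>v w" using \<nu> s by auto
    note b = transfer_mat_bound[OF A B C D hurw norm s c w e]
    have zc: "cmat C *\<^sub>v \<nu> s + cmat D *\<^sub>v w \<in> carrier_vec R" using cC cD c w by auto
    have "(vnorm (cmat C *\<^sub>v \<nu> s + cmat D *\<^sub>v w))\<^sup>2 \<le> (g * vnorm w)\<^sup>2"
      by (intro power_mono b(1)) auto
    moreover have "(vnorm w)\<^sup>2 = (\<Sum>i<M. (cmod (w $ i))\<^sup>2)" using w by (simp add: vnorm_square)
    ultimately show ?thesis
      using Fn_eq[of s] s sq[OF zc] by (simp add: power_mult_distrib)
  qed
  have "Fn s \<le> g\<^sup>2 * (\<Sum>i<M. (cmod (w $ i))\<^sup>2)"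
  proof (rule tendsto_upperbound[OF continuous_on_tendsto_at_right[OF cont s]])
    show "eventually (\<lambda>\<epsilon>. Fn (s + complex_of_real \<epsilon>) \<le> g\<^sup>2 * (\<Sum>i<M. (cmod (w $ i))\<^sup>2)) (at_right 0)"
      using eventually_at_right_less[of "0::real"] s by (auto elim!: eventually_mono intro!: bound)
  qed simp
  \<comment> \<open>The given X is the resolvent solution, since s is not an eigenvalue.\<close>
  moreover have "\<nu> s = X"
  proof -
    have c: "\<nu> s \<in> carrier_vec N" and e: "s \<cdot>\<^sub>v \<nu> s - cmat A *\<^sub>v \<nu> s = cmat B *\<^sub>v w" using \<nu> s by auto
    let ?R = "s \<cdot>\<^sub>m 1\<^sub>m N - cmat A"
    have R: "?R \<in> carrier_mat N N" using cA by auto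
    have "\<not> eigenvalue (cmat A) s" using hurw s by (auto simp: hurwitz_def)
    hence nz: "det ?R \<noteq> 0" by (rule resolvent_det_nonzero[OF cA])
    have d: "\<nu> s - X \<in> carrier_vec N" using c X by auto
    have "?R *\<^sub>v (\<nu> s - X) = ?R *\<^sub>v \<nu> s - ?R *\<^sub>v X" by (rule mult_minus_distrib_mat_vec[OF R c X])
    also have "\<dots> = cmat B *\<^sub>v w - cmat B *\<^sub>v w" unfolding resolvent_mult[OF cA c] resolvent_mult[OF cA X] e eq ..
    also have "\<dots> = 0\<^sub>v N" using Bw by simp
    finally have "\<nu> s - X = 0\<^sub>v N" using det_0_iff_vec_prod_zero_field[OF R] nz d by blast
    thus ?thesis using c X by (intro eq_vecI) (auto simp: vec_eq_iff)
  qed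
  ultimately show ?thesis using Fn_eq[OF s] by simp
qed

text \<open>The cancellation behind the silent controller: what the gains Kd and Kb make of the
  plant output is removed by the opposite measurement disturbance.\<close>

lemma append_vec_cancel:
  fixes a b c u y :: "'a::comm_ring_1 vec"
  assumes "a \<in> carrier_vec n" "b \<in> carrier_vec n" "u \<in> carrier_vec n" "c \<in> carrier_vec q" "y \<in> carrier_vec r"
  shows "((a + b) @\<^sub>v c) + ((u + (-1) \<cdot>\<^sub>v b) @\<^sub>v ((-1) \<cdot>\<^sub>v c)) = (a + u) @\<^sub>v 0\<^sub>v q"
    and "(y @\<^sub>v c) + (0\<^sub>v r @\<^sub>v ((-1) \<cdot>\<^sub>v c)) = y @\<^sub>v 0\<^sub>v q"
  by (rule eq_vecI; use assms in \<open>auto simp: append_vec_def Let_def\<close>)+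

text \<open>Subtracting the free response f removes the initial state b and leaves the forced
  equation, to which the transfer matrix applies.\<close>

lemma shifted_resolvent_equation:
  fixes X f P Q W T b :: "'a::comm_ring_1 vec"
  assumes "X \<in> carrier_vec N" "f \<in> carrier_vec N" "P \<in> carrier_vec N" "Q \<in> carrier_vec N" "W \<in> carrier_vec N"
    "T \<in> carrier_vec N" "b \<in> carrier_vec N"
    and eqs: "P + W = T" "s \<cdot>\<^sub>v f - Q = b" "s \<cdot>\<^sub>v X - T = b"
  shows "s \<cdot>\<^sub>v (X - f) - (P - Q) = W"
proof (rule eq_vecI)
  fix i assume "i < dim_vec W"
  hence i: "i < N" using assms by simp
  have h: "P $ i + W $ i = T $ i" "s * f $ i - Q $ i = b $ i" "s * X $ i - T $ i = b $ i"
    using i assms(1-7) arg_cong[OF eqs(1), of "\<lambda>v. v $ i"] arg_cong[OF eqs(2), of "\<lambda>v. v $ i"]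
      arg_cong[OF eqs(3), of "\<lambda>v. v $ i"] by simp_all
  have "s * (X $ i - f $ i) - (P $ i - Q $ i) = (s * X $ i - T $ i) - (s * f $ i - Q $ i) + (T $ i - P $ i)"
    by (simp add: right_diff_distrib)
  also have "\<dots> = b $ i - b $ i + (P $ i + W $ i - P $ i)" by (simp only: h)
  also have "\<dots> = W $ i" by simp
  finally have "s * (X $ i - f $ i) - (P $ i - Q $ i) = W $ i" .
  thus "(s \<cdot>\<^sub>v (X - f) - (P - Q)) $ i = W $ i" using i assms(1-7) by simp
qed (use assms in simp)

text \<open>With the disturbances w1 = u and w2 = -C v the controller sees no input, so at the state
  (v, 0) the closed loop acts like the open plant with input u, and its performance output is (C v,
  0).\<close>

lemma closed_loop_identity:
  assumes A: "A \<in> carrier_mat n n" and B: "B \<in> carrier_mat n m" and C: "C \<in> carrier_mat r n"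
    and Ka: "Ka \<in> carrier_mat q q" and Kb: "Kb \<in> carrier_mat q r" and Kc: "Kc \<in> carrier_mat m q" and Kd: "Kd \<in> carrier_mat m r"
    and v: "v \<in> carrier_vec n" and u: "u \<in> carrier_vec m"
  defines "w \<equiv> u @\<^sub>v ((-1) \<cdot>\<^sub>v (cmat C *\<^sub>v v))"
  shows "cmat (four_block_mat (A + B * Kd * C) (B * Kc) (Kb * C) Ka) *\<^sub>v (v @\<^sub>v 0\<^sub>v q)
      + cmat (four_block_mat B (B * Kd) (0\<^sub>m q m) Kb) *\<^sub>v w = (cmat A *\<^sub>v v + cmat B *\<^sub>v u) @\<^sub>v 0\<^sub>v q"
    and "cmat (four_block_mat C (0\<^sub>m r q) (Kd * C) Kc) *\<^sub>v (v @\<^sub>v 0\<^sub>v q)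
      + cmat (four_block_mat (0\<^sub>m r m) (0\<^sub>m r r) (0\<^sub>m m m) Kd) *\<^sub>v w = (cmat C *\<^sub>v v) @\<^sub>v 0\<^sub>v m"
proof -
  let ?y = "cmat C *\<^sub>v v"
  have c: "cmat A \<in> carrier_mat n n" "cmat B \<in> carrier_mat n m" "cmat C \<in> carrier_mat r n" "cmat Ka \<in> carrier_mat q q"
    "cmat Kb \<in> carrier_mat q r" "cmat Kc \<in> carrier_mat m q" "cmat Kd \<in> carrier_mat m r"
    using A B C Ka Kb Kc Kd by auto
  have y: "?y \<in> carrier_vec r" "(-1) \<cdot>\<^sub>v ?y \<in> carrier_vec r" using c(3) v by auto
  have hom: "cmat (X * Y) = cmat X * cmat Y" if "X \<in> carrier_mat a b" "Y \<in> carrier_mat b d" for X Y a b d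
    using that by (rule of_real_hom.mat_hom_mult)
  have add: "cmat (A + B * Kd * C) = cmat A + cmat (B * Kd * C)"
    by (rule eq_matI) (use A B Kd C in auto)
  have BK: "B * Kd \<in> carrier_mat n r" "B * Kd * C \<in> carrier_mat n n" "B * Kc \<in> carrier_mat n q" "Kb * C \<in> carrier_mat q n" "Kd * C \<in> carrier_mat m n"
    "A + B * Kd * C \<in> carrier_mat n n"
    using A B C Kb Kc Kd by auto
  have zero: "cmat (0\<^sub>m a b) = 0\<^sub>m a b" for a b by (rule eq_matI) auto
  have BKy: "cmat (B * Kd) *\<^sub>v ((-1) \<cdot>\<^sub>v ?y) = (-1) \<cdot>\<^sub>v (cmat (B * Kd) *\<^sub>v ?y)" "cmat Kb *\<^sub>v ((-1) \<cdot>\<^sub>v ?y) = (-1) \<cdot>\<^sub>v (cmat Kb *\<^sub>v ?y)"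
    "cmat Kd *\<^sub>v ((-1) \<cdot>\<^sub>v ?y) = (-1) \<cdot>\<^sub>v (cmat Kd *\<^sub>v ?y)"
    using BK c y by (auto intro!: mult_mat_vec)
  have p1: "cmat (B * Kd * C) *\<^sub>v v = cmat (B * Kd) *\<^sub>v ?y"
    unfolding hom[OF BK(1) C] by (rule assoc_mult_mat_vec) (use BK c v in auto)
  have p2: "cmat (Kb * C) *\<^sub>v v = cmat Kb *\<^sub>v ?y"
    unfolding hom[OF Kb C] by (rule assoc_mult_mat_vec) (use c v in auto)
  have p3: "cmat (Kd * C) *\<^sub>v v = cmat Kd *\<^sub>v ?y"
    unfolding hom[OF Kd C] by (rule assoc_mult_mat_vec) (use c v in auto)
  have z: "M *\<^sub>v 0\<^sub>v b = 0\<^sub>v a" if "M \<in> carrier_mat a b" for M :: "complex mat" and a b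
    using that by (auto intro!: eq_vecI)
  have cv: "cmat A *\<^sub>v v \<in> carrier_vec n" "cmat (B * Kd) *\<^sub>v ?y \<in> carrier_vec n" "cmat B *\<^sub>v u \<in> carrier_vec n"
    "cmat Kb *\<^sub>v ?y \<in> carrier_vec q" "cmat Kd *\<^sub>v ?y \<in> carrier_vec m"
    using c BK(1) v u y(1) by (auto intro!: mult_mat_vec_carrier)
  have neg: "(-1) \<cdot>\<^sub>v (cmat Kb *\<^sub>v ?y) \<in> carrier_vec q" "(-1) \<cdot>\<^sub>v (cmat Kd *\<^sub>v ?y) \<in> carrier_vec m"
    using cv by auto
  have 1: "cmat (four_block_mat (A + B * Kd * C) (B * Kc) (Kb * C) Ka) *\<^sub>v (v @\<^sub>v 0\<^sub>v q)
    = (cmat A *\<^sub>v v + cmat (B * Kd) *\<^sub>v ?y) @\<^sub>v (cmat Kb *\<^sub>v ?y)"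
  proof -
    have "cmat (four_block_mat (A + B * Kd * C) (B * Kc) (Kb * C) Ka) *\<^sub>v (v @\<^sub>v 0\<^sub>v q)
      = (cmat (A + B * Kd * C) *\<^sub>v v + cmat (B * Kc) *\<^sub>v 0\<^sub>v q) @\<^sub>v (cmat (Kb * C) *\<^sub>v v + cmat Ka *\<^sub>v 0\<^sub>v q)"
      unfolding map_four_block_mat[OF BK(6,3,4) Ka]
      by (rule four_block_mat_mult_vec[of _ n n _ q _ q]) (use BK Ka v in auto)
    also have "cmat (A + B * Kd * C) *\<^sub>v v = cmat A *\<^sub>v v + cmat (B * Kd) *\<^sub>v ?y"
      unfolding add p1[symmetric] by (rule add_mult_distrib_mat_vec[of _ n n]) (use A BK v in auto)
    also have "cmat (B * Kc) *\<^sub>v 0\<^sub>v q = 0\<^sub>v n" by (rule z) (use BK in auto)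
    also have "cmat Ka *\<^sub>v 0\<^sub>v q = 0\<^sub>v q" by (rule z) (use Ka in auto)
    also have "cmat (Kb * C) *\<^sub>v v = cmat Kb *\<^sub>v ?y" by (rule p2)
    finally show ?thesis unfolding right_zero_vec[OF add_carrier_vec[OF cv(1,2)]] right_zero_vec[OF cv(4)] .
  qed
  have 2: "cmat (four_block_mat B (B * Kd) (0\<^sub>m q m) Kb) *\<^sub>v w
    = (cmat B *\<^sub>v u + (-1) \<cdot>\<^sub>v (cmat (B * Kd) *\<^sub>v ?y)) @\<^sub>v ((-1) \<cdot>\<^sub>v (cmat Kb *\<^sub>v ?y))"
  proof -
    have "cmat (four_block_mat B (B * Kd) (0\<^sub>m q m) Kb) *\<^sub>v w
      = (cmat B *\<^sub>v u + cmat (B * Kd) *\<^sub>v ((-1) \<cdot>\<^sub>v ?y)) @\<^sub>v (cmat (0\<^sub>m q m) *\<^sub>v u + cmat Kb *\<^sub>v ((-1) \<cdot>\<^sub>v ?y))"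
      unfolding w_def map_four_block_mat[OF B BK(1) zero_carrier_mat Kb]
      by (rule four_block_mat_mult_vec[of _ n m _ r _ q]) (use B BK Kb u y in auto)
    also have "cmat (0\<^sub>m q m) *\<^sub>v u = 0\<^sub>v q" unfolding zero by (rule zero_mat_mult_vec[OF u])
    finally show ?thesis unfolding BKy left_zero_vec[OF neg(1)] .
  qed
  show "cmat (four_block_mat (A + B * Kd * C) (B * Kc) (Kb * C) Ka) *\<^sub>v (v @\<^sub>v 0\<^sub>v q)
      + cmat (four_block_mat B (B * Kd) (0\<^sub>m q m) Kb) *\<^sub>v w = (cmat A *\<^sub>v v + cmat B *\<^sub>v u) @\<^sub>v 0\<^sub>v q"
    unfolding 1 2 by (rule append_vec_cancel(1)[OF cv(1-4) y(1)])
  have 3: "cmat (four_block_mat C (0\<^sub>m r q) (Kd * C) Kc) *\<^sub>v (v @\<^sub>v 0\<^sub>v q) = ?y @\<^sub>v (cmat Kd *\<^sub>v ?y)"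
  proof -
    have "cmat (four_block_mat C (0\<^sub>m r q) (Kd * C) Kc) *\<^sub>v (v @\<^sub>v 0\<^sub>v q)
      = (cmat C *\<^sub>v v + cmat (0\<^sub>m r q) *\<^sub>v 0\<^sub>v q) @\<^sub>v (cmat (Kd * C) *\<^sub>v v + cmat Kc *\<^sub>v 0\<^sub>v q)"
      unfolding map_four_block_mat[OF C zero_carrier_mat BK(5) Kc]
      by (rule four_block_mat_mult_vec[of _ r n _ q _ m]) (use BK C Kc v in auto)
    also have "cmat (0\<^sub>m r q) *\<^sub>v 0\<^sub>v q = 0\<^sub>v r" by (rule z) auto
    also have "cmat Kc *\<^sub>v 0\<^sub>v q = 0\<^sub>v m" by (rule z) (use Kc in auto)
    also have "cmat (Kd * C) *\<^sub>v v = cmat Kd *\<^sub>v ?y" by (rule p3)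
    finally show ?thesis unfolding right_zero_vec[OF y(1)] right_zero_vec[OF cv(5)] .
  qed
  have 4: "cmat (four_block_mat (0\<^sub>m r m) (0\<^sub>m r r) (0\<^sub>m m m) Kd) *\<^sub>v w = 0\<^sub>v r @\<^sub>v ((-1) \<cdot>\<^sub>v (cmat Kd *\<^sub>v ?y))"
  proof -
    have "cmat (four_block_mat (0\<^sub>m r m) (0\<^sub>m r r) (0\<^sub>m m m) Kd) *\<^sub>v w
      = (cmat (0\<^sub>m r m) *\<^sub>v u + cmat (0\<^sub>m r r) *\<^sub>v ((-1) \<cdot>\<^sub>v ?y)) @\<^sub>v (cmat (0\<^sub>m m m) *\<^sub>v u + cmat Kd *\<^sub>v ((-1) \<cdot>\<^sub>v ?y))"
      unfolding w_def map_four_block_mat[OF zero_carrier_mat zero_carrier_mat zero_carrier_mat Kd]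
      by (rule four_block_mat_mult_vec[of _ r m _ r _ m]) (use Kd u y in auto)
    also have "cmat (0\<^sub>m r m) *\<^sub>v u = 0\<^sub>v r" unfolding zero by (rule zero_mat_mult_vec[OF u])
    also have "cmat (0\<^sub>m m m) *\<^sub>v u = 0\<^sub>v m" unfolding zero by (rule zero_mat_mult_vec[OF u])
    also have "cmat (0\<^sub>m r r) *\<^sub>v ((-1) \<cdot>\<^sub>v ?y) = 0\<^sub>v r" unfolding zero by (rule zero_mat_mult_vec[OF y(2)])
    finally show ?thesis unfolding BKy left_zero_vec[OF neg(2)] left_zero_vec[OF zero_carrier_vec] .
  qed
  show "cmat (four_block_mat C (0\<^sub>m r q) (Kd * C) Kc) *\<^sub>v (v @\<^sub>v 0\<^sub>v q)
      + cmat (four_block_mat (0\<^sub>m r m) (0\<^sub>m r r) (0\<^sub>m m m) Kd) *\<^sub>v w = (cmat C *\<^sub>v v) @\<^sub>v 0\<^sub>v m"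
    unfolding 3 4 by (rule append_vec_cancel(2)[OF cv(1-3,5) y(1)])
qed

text \<open>What an achievable level means once the controller is silenced: a disturbance that cancels the
  measured output keeps the controller at rest. The vector \<open>x0\<close> below is an initial state of the plant.\<close>

lemma Hinf_level_achievable_bound:
  assumes A: "A \<in> carrier_mat n n" and B: "B \<in> carrier_mat n m" and C: "C \<in> carrier_mat r n"
    and ach: "Hinf_level_achievable n m r A B C g"
  shows "0 < g \<and> (\<forall>x0\<in>carrier_vec n. \<exists>(\<phi> :: complex \<Rightarrow> complex vec).
     (\<forall>i<r. (\<lambda>s. \<phi> s $ i) holomorphic_on {s. 0 \<le> Re s} \<and> ((\<lambda>s. \<phi> s $ i) \<longlongrightarrow> 0) right_infinity) \<and>
     (x0 = 0\<^sub>v n \<longrightarrow> (\<forall>s. 0 \<le> Re s \<longrightarrow> (\<forall>i<r. \<phi> s $ i = 0))) \<and>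
     (\<forall>s v u. 0 \<le> Re s \<and> v \<in> carrier_vec n \<and> u \<in> carrier_vec m \<and>
        s \<cdot>\<^sub>v v - (cmat A *\<^sub>v v + cmat B *\<^sub>v u) = x0 \<longrightarrow>
        (\<Sum>i<r. (cmod ((cmat C *\<^sub>v v) $ i - \<phi> s $ i))\<^sup>2)
          \<le> g\<^sup>2 * ((\<Sum>i<m. (cmod (u $ i))\<^sup>2) + (\<Sum>i<r. (cmod ((cmat C *\<^sub>v v) $ i))\<^sup>2)))) \<and>
    (\<forall>s v. 0 \<le> Re s \<longrightarrow> v \<in> carrier_vec n \<longrightarrow> cmat A *\<^sub>v v = s \<cdot>\<^sub>v v \<longrightarrow> cmat C *\<^sub>v v = 0\<^sub>v r \<longrightarrow> v = 0\<^sub>v n)"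
proof -
  obtain q Ka Kb Kc Kd where K: "Ka \<in> carrier_mat q q" "Kb \<in> carrier_mat q r" "Kc \<in> carrier_mat m q" "Kd \<in> carrier_mat m r"
    and h0: "let Acl = four_block_mat (A + B * Kd * C) (B * Kc) (Kb * C) Ka;
            Bcl = four_block_mat B (B * Kd) (0\<^sub>m q m) Kb;
            Ccl = four_block_mat C (0\<^sub>m r q) (Kd * C) Kc;
            Dcl = four_block_mat (0\<^sub>m r m) (0\<^sub>m r r) (0\<^sub>m m m) Kd
        in hurwitz Acl \<and> Hinf_norm (transfer_mat Acl Bcl Ccl Dcl) < ereal g"
    using ach unfolding Hinf_level_achievable_def by (elim exE bexE) (rule that)
  define Acl where "Acl = four_block_mat (A + B * Kd * C) (B * Kc) (Kb * C) Ka"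
  define Bcl where "Bcl = four_block_mat B (B * Kd) (0\<^sub>m q m) Kb"
  define Ccl where "Ccl = four_block_mat C (0\<^sub>m r q) (Kd * C) Kc"
  define Dcl where "Dcl = four_block_mat (0\<^sub>m r m) (0\<^sub>m r r) (0\<^sub>m m m) Kd"
  have hurw: "hurwitz Acl" and norm: "Hinf_norm (transfer_mat Acl Bcl Ccl Dcl) < ereal g"
    using h0 by (simp_all add: Let_def Acl_def Bcl_def Ccl_def Dcl_def)
  have car: "Acl \<in> carrier_mat (n + q) (n + q)" "Bcl \<in> carrier_mat (n + q) (m + r)"
    "Ccl \<in> carrier_mat (r + m) (n + q)" "Dcl \<in> carrier_mat (r + m) (m + r)"
    unfolding Acl_def Bcl_def Ccl_def Dcl_def using A B C K by (auto intro!: four_block_carrier_mat)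
  have cAcl: "cmat Acl \<in> carrier_mat (n + q) (n + q)" and cCcl: "cmat Ccl \<in> carrier_mat (r + m) (n + q)" using car by auto
  note ident = closed_loop_identity[OF A B C K, folded Acl_def Bcl_def Ccl_def Dcl_def]
  have g: "0 < g"
    \<comment> \<open>Any point of the open half plane serves; zero data at s = 1 satisfy the
      resolvent equation.\<close>
    by (rule transfer_mat_bound(2)[OF car hurw norm, of 1 "0\<^sub>v (n + q)" "0\<^sub>v (m + r)"])
      (use car in \<open>auto intro!: eq_vecI\<close>)
  \<comment> \<open>Detectability: padded with zeros, an unobservable eigenvector of A is an
    eigenvector of the closed loop, which is Hurwitz.\<close>
  have obs: "v = 0\<^sub>v n" if s: "0 \<le> Re s" and v: "v \<in> carrier_vec n" and Av: "cmat A *\<^sub>v v = s \<cdot>\<^sub>v v"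
    and Cv: "cmat C *\<^sub>v v = 0\<^sub>v r" for s v
  proof (rule ccontr)
    assume nz: "v \<noteq> 0\<^sub>v n"
    let ?X = "v @\<^sub>v 0\<^sub>v q"
    have w0: "0\<^sub>v m @\<^sub>v ((-1) \<cdot>\<^sub>v (cmat C *\<^sub>v v)) = 0\<^sub>v (m + r)"
      unfolding Cv by (rule eq_vecI) auto
    have "cmat Acl *\<^sub>v ?X + cmat Bcl *\<^sub>v 0\<^sub>v (m + r) = (s \<cdot>\<^sub>v v + cmat B *\<^sub>v 0\<^sub>v m) @\<^sub>v 0\<^sub>v q"
      using ident(1)[OF v, of "0\<^sub>v m"] unfolding w0 Av by simp
    moreover have "cmat Bcl *\<^sub>v 0\<^sub>v (m + r) = 0\<^sub>v (n + q)" "cmat B *\<^sub>v 0\<^sub>v m = 0\<^sub>v n"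
      using car B by (auto intro!: eq_vecI)
    moreover have "cmat Acl *\<^sub>v ?X \<in> carrier_vec (n + q)" using cAcl v by (auto intro!: mult_mat_vec_carrier)
    moreover have "s \<cdot>\<^sub>v v \<in> carrier_vec n" using v by auto
    ultimately have "cmat Acl *\<^sub>v ?X = (s \<cdot>\<^sub>v v) @\<^sub>v 0\<^sub>v q" by simp
    also have "\<dots> = s \<cdot>\<^sub>v ?X" by (rule eq_vecI) (use v in \<open>auto simp: append_vec_def Let_def\<close>)
    finally have "cmat Acl *\<^sub>v ?X = s \<cdot>\<^sub>v ?X" .
    moreover have "?X \<noteq> 0\<^sub>v (n + q)"
    proof
      assume X0: "?X = 0\<^sub>v (n + q)"
      have "v $ i = 0" if "i < n" for i
        using arg_cong[OF X0, of "\<lambda>z. z $ i"] that v by (simp add: append_vec_def Let_def)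
      thus False using nz v by (auto simp: vec_eq_iff)
    qed
    ultimately have "eigenvalue (cmat Acl) s"
      using cAcl v unfolding eigenvalue_def eigenvector_def by (intro exI[of _ ?X]) auto
    thus False using hurw s by (auto simp: hurwitz_def)
  qed
  have main: "\<exists>(\<phi> :: complex \<Rightarrow> complex vec).
     (\<forall>i<r. (\<lambda>s. \<phi> s $ i) holomorphic_on {s. 0 \<le> Re s} \<and> ((\<lambda>s. \<phi> s $ i) \<longlongrightarrow> 0) right_infinity) \<and>
     (x0 = 0\<^sub>v n \<longrightarrow> (\<forall>s. 0 \<le> Re s \<longrightarrow> (\<forall>i<r. \<phi> s $ i = 0))) \<and>
     (\<forall>s v u. 0 \<le> Re s \<and> v \<in> carrier_vec n \<and> u \<in> carrier_vec m \<and>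
        s \<cdot>\<^sub>v v - (cmat A *\<^sub>v v + cmat B *\<^sub>v u) = x0 \<longrightarrow>
        (\<Sum>i<r. (cmod ((cmat C *\<^sub>v v) $ i - \<phi> s $ i))\<^sup>2)
          \<le> g\<^sup>2 * ((\<Sum>i<m. (cmod (u $ i))\<^sup>2) + (\<Sum>i<r. (cmod ((cmat C *\<^sub>v v) $ i))\<^sup>2)))"
    if x0: "x0 \<in> carrier_vec n" for x0
  proof -
    let ?b = "x0 @\<^sub>v 0\<^sub>v q"
    have b: "?b \<in> carrier_vec (n + q)" using x0 by auto
    obtain f where f: "\<forall>s. 0 \<le> Re s \<longrightarrow> f s \<in> carrier_vec (n + q) \<and> s \<cdot>\<^sub>v f s - cmat Acl *\<^sub>v f s = ?b"
      and hol: "\<forall>i<n + q. (\<lambda>s. f s $ i) holomorphic_on {s. 0 \<le> Re s}"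
    proof -
      have "\<exists>f. (\<forall>s. 0 \<le> Re s \<longrightarrow> f s \<in> carrier_vec (n + q) \<and> s \<cdot>\<^sub>v f s - cmat Acl *\<^sub>v f s = ?b) \<and>
        (\<forall>i<n + q. (\<lambda>s. f s $ i) holomorphic_on {s. 0 \<le> Re s})"
        by (rule resolvent_exists[OF cAcl b]) (use hurw in \<open>auto simp: hurwitz_def\<close>)
      thus ?thesis by (elim exE conjE) (rule that)
    qed
    note f' = f[rule_format]
    \<comment> \<open>The plant part of the performance output of the free closed loop started at
      (x0, 0). It depends on x0 and s only, which is why one \<phi> serves all v and u.\<close>
    define \<phi> where "\<phi> s = vec r (\<lambda>i. \<Sum>j<n + q. cmat Ccl $$ (i, j) * f s $ j)" for s
    have \<phi>_eq: "(cmat Ccl *\<^sub>v f s) $ i = \<phi> s $ i" if "0 \<le> Re s" "i < r" for s i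
      using mult_mat_vec_sum[OF cCcl conjunct1[OF f'[OF that(1)]], of i] that by (simp add: \<phi>_def)
    have \<phi>_hol: "(\<lambda>s. \<phi> s $ i) holomorphic_on {s. 0 \<le> Re s}" if "i < r" for i
      using that hol by (simp add: \<phi>_def) (intro holomorphic_intros, auto)
    have \<phi>_lim: "((\<lambda>s. \<phi> s $ i) \<longlongrightarrow> 0) right_infinity" if "i < r" for i
    proof -
      have "((\<lambda>s. \<Sum>j<n + q. cmat Ccl $$ (i, j) * f s $ j) \<longlongrightarrow> (\<Sum>j<n + q. cmat Ccl $$ (i, j) * 0)) right_infinity"
        by (intro tendsto_intros resolvent_decay(1)[OF cAcl b f']) auto
      thus ?thesis using that by (simp add: \<phi>_def)
    qed
    have bound: "(\<Sum>i<r. (cmod ((cmat C *\<^sub>v v) $ i - \<phi> s $ i))\<^sup>2)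
          \<le> g\<^sup>2 * ((\<Sum>i<m. (cmod (u $ i))\<^sup>2) + (\<Sum>i<r. (cmod ((cmat C *\<^sub>v v) $ i))\<^sup>2))"
      if s: "0 \<le> Re s" and v: "v \<in> carrier_vec n" and u: "u \<in> carrier_vec m"
        and eq: "s \<cdot>\<^sub>v v - (cmat A *\<^sub>v v + cmat B *\<^sub>v u) = x0" for s v u
    proof -
      let ?y = "cmat C *\<^sub>v v" and ?X = "v @\<^sub>v 0\<^sub>v q"
      let ?w = "u @\<^sub>v ((-1) \<cdot>\<^sub>v ?y)"
      have y: "?y \<in> carrier_vec r" using C v by auto
      have w: "?w \<in> carrier_vec (m + r)" using u y by auto
      have X: "?X \<in> carrier_vec (n + q)" using v by auto
      have fc: "f s \<in> carrier_vec (n + q)" and fe: "s \<cdot>\<^sub>v f s - cmat Acl *\<^sub>v f s = ?b" using f'[OF s] by auto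
      have Bw: "cmat Bcl *\<^sub>v ?w \<in> carrier_vec (n + q)" using car w by auto
      have AX: "cmat Acl *\<^sub>v ?X \<in> carrier_vec (n + q)" "cmat Acl *\<^sub>v f s \<in> carrier_vec (n + q)" using cAcl X fc by auto
      have e: "s \<cdot>\<^sub>v (?X - f s) - cmat Acl *\<^sub>v (?X - f s) = cmat Bcl *\<^sub>v ?w"
        unfolding mult_minus_distrib_mat_vec[OF cAcl X fc]
      proof (rule shifted_resolvent_equation[OF X fc AX Bw _ b ident(1)[OF v u] fe])
        show "(cmat A *\<^sub>v v + cmat B *\<^sub>v u) @\<^sub>v 0\<^sub>v q \<in> carrier_vec (n + q)"
          using A B v u by (intro append_carrier_vec add_carrier_vec mult_mat_vec_carrier) auto
        have "s \<cdot>\<^sub>v (v @\<^sub>v 0\<^sub>v q) - ((cmat A *\<^sub>v v + cmat B *\<^sub>v u) @\<^sub>v 0\<^sub>v q)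
            = (s \<cdot>\<^sub>v v - (cmat A *\<^sub>v v + cmat B *\<^sub>v u)) @\<^sub>v 0\<^sub>v q"
          by (rule eq_vecI) (use A B v in \<open>auto simp: append_vec_def Let_def\<close>)
        thus "s \<cdot>\<^sub>v (v @\<^sub>v 0\<^sub>v q) - ((cmat A *\<^sub>v v + cmat B *\<^sub>v u) @\<^sub>v 0\<^sub>v q) = ?b" unfolding eq .
      qed
      have Xf: "?X - f s \<in> carrier_vec (n + q)" using X fc by auto
      have z: "(cmat Ccl *\<^sub>v (?X - f s) + cmat Dcl *\<^sub>v ?w) $ i = ?y $ i - \<phi> s $ i" if i: "i < r" for i
      proof -
        have c1: "cmat Ccl *\<^sub>v ?X \<in> carrier_vec (r + m)" "cmat Ccl *\<^sub>v f s \<in> carrier_vec (r + m)" "cmat Dcl *\<^sub>v ?w \<in> carrier_vec (r + m)"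
          using cCcl X fc car w by auto
        have "(cmat Ccl *\<^sub>v ?X + cmat Dcl *\<^sub>v ?w) $ i = (?y @\<^sub>v 0\<^sub>v m) $ i" using ident(2)[OF v u] by simp
        hence "(cmat Ccl *\<^sub>v ?X) $ i + (cmat Dcl *\<^sub>v ?w) $ i = ?y $ i"
          using i carrier_vecD[OF c1(3)] carrier_vecD[OF y]
          by (simp add: append_vec_def Let_def del: index_mult_mat_vec dim_mult_mat_vec)
        moreover have "(cmat Ccl *\<^sub>v (?X - f s) + cmat Dcl *\<^sub>v ?w) $ i
            = (cmat Ccl *\<^sub>v ?X) $ i - (cmat Ccl *\<^sub>v f s) $ i + (cmat Dcl *\<^sub>v ?w) $ i"
          unfolding mult_minus_distrib_mat_vec[OF cCcl X fc]
          using i c1[THEN carrier_vecD] by (simp del: index_mult_mat_vec dim_mult_mat_vec)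
        ultimately show ?thesis using \<phi>_eq[OF s i] by (simp add: algebra_simps)
      qed
      have "(\<Sum>i<r. (cmod (?y $ i - \<phi> s $ i))\<^sup>2) = (\<Sum>i<r. (cmod ((cmat Ccl *\<^sub>v (?X - f s) + cmat Dcl *\<^sub>v ?w) $ i))\<^sup>2)"
        by (rule sum.cong) (simp_all add: z)
      also have "\<dots> \<le> (\<Sum>i<r + m. (cmod ((cmat Ccl *\<^sub>v (?X - f s) + cmat Dcl *\<^sub>v ?w) $ i))\<^sup>2)"
        by (rule sum_mono2) auto
      also have "\<dots> \<le> g\<^sup>2 * (\<Sum>i<m + r. (cmod (?w $ i))\<^sup>2)"
        by (rule transfer_mat_bound_closed[OF car hurw norm s Xf w e])
      also have "(\<Sum>i<m + r. (cmod (?w $ i))\<^sup>2) = (\<Sum>i<m. (cmod (u $ i))\<^sup>2) + (\<Sum>i<r. (cmod (?y $ i))\<^sup>2)"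
      proof -
        have "(\<Sum>i<m + r. (cmod (?w $ i))\<^sup>2) = (\<Sum>i<m. (cmod (?w $ i))\<^sup>2) + (\<Sum>i<r. (cmod (?w $ (m + i)))\<^sup>2)"
          by (induction r) (simp_all add: add.assoc)
        also have "(\<Sum>i<m. (cmod (?w $ i))\<^sup>2) = (\<Sum>i<m. (cmod (u $ i))\<^sup>2)"
          by (rule sum.cong) (use u in \<open>simp_all add: append_vec_def Let_def\<close>)
        also have "(\<Sum>i<r. (cmod (?w $ (m + i)))\<^sup>2) = (\<Sum>i<r. (cmod (?y $ i))\<^sup>2)"
          by (rule sum.cong)
            (use carrier_vecD[OF u] carrier_vecD[OF y] in \<open>simp_all add: append_vec_def Let_def del: index_mult_mat_vec dim_mult_mat_vec\<close>)
        finally show ?thesis .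
      qed
      finally show ?thesis .
    qed
    have zero: "\<phi> s $ i = 0" if x00: "x0 = 0\<^sub>v n" and s: "0 \<le> Re s" and i: "i < r" for s i
    proof -
      have fc: "f s \<in> carrier_vec (n + q)" and fe: "s \<cdot>\<^sub>v f s - cmat Acl *\<^sub>v f s = ?b" using f'[OF s] by auto
      have "?b = 0\<^sub>v (n + q)" unfolding x00 by (rule eq_vecI) auto
      hence "(s \<cdot>\<^sub>m 1\<^sub>m (n + q) - cmat Acl) *\<^sub>v f s = 0\<^sub>v (n + q)" using resolvent_mult[OF cAcl fc] fe by simp
      moreover have "\<not> eigenvalue (cmat Acl) s" using hurw s by (auto simp: hurwitz_def)
      hence "det (s \<cdot>\<^sub>m 1\<^sub>m (n + q) - cmat Acl) \<noteq> 0" by (rule resolvent_det_nonzero[OF cAcl])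
      moreover have "s \<cdot>\<^sub>m 1\<^sub>m (n + q) - cmat Acl \<in> carrier_mat (n + q) (n + q)" using cAcl by auto
      ultimately have "f s = 0\<^sub>v (n + q)" using det_0_iff_vec_prod_zero_field fc by metis
      thus ?thesis using i by (simp add: \<phi>_def)
    qed
    show ?thesis
    proof (intro exI[of _ \<phi>] conjI allI impI)
      fix s v u
      assume "0 \<le> Re s \<and> v \<in> carrier_vec n \<and> u \<in> carrier_vec m \<and> s \<cdot>\<^sub>v v - (cmat A *\<^sub>v v + cmat B *\<^sub>v u) = x0"
      thus "(\<Sum>i<r. (cmod ((cmat C *\<^sub>v v) $ i - \<phi> s $ i))\<^sup>2)
          \<le> g\<^sup>2 * ((\<Sum>i<m. (cmod (u $ i))\<^sup>2) + (\<Sum>i<r. (cmod ((cmat C *\<^sub>v v) $ i))\<^sup>2))"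
        by (elim conjE) (rule bound)
    next
      fix i assume i: "i < r"
      show "(\<lambda>s. \<phi> s $ i) holomorphic_on {s. 0 \<le> Re s}" by (rule \<phi>_hol[OF i])
      show "((\<lambda>s. \<phi> s $ i) \<longlongrightarrow> 0) right_infinity" by (rule \<phi>_lim[OF i])
    next
      fix s i assume "x0 = 0\<^sub>v n" "0 \<le> Re s" "i < r"
      thus "\<phi> s $ i = 0" by (rule zero)
    qed
  qed
  show ?thesis
    by (intro conjI g ballI main allI impI obs)
qed

section \<open>The Riccati equation\<close>

lemma cmat_mult_vec_index:
  assumes M: "M \<in> carrier_mat p n" and z: "z \<in> carrier_vec n" and i: "i < p"
  shows "(cmat M *\<^sub>v z) $ i = Complex ((M *\<^sub>v map_vec Re z) $ i) ((M *\<^sub>v map_vec Im z) $ i)"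
proof -
  have cM: "cmat M \<in> carrier_mat p n" and ab: "map_vec Re z \<in> carrier_vec n" "map_vec Im z \<in> carrier_vec n" using M z by auto
  show ?thesis
    unfolding mult_mat_vec_sum[OF cM z i] mult_mat_vec_sum[OF M ab(1) i] mult_mat_vec_sum[OF M ab(2) i]
    using M z i by (intro complex_eqI) auto
qed

lemma sum_cmod_cmat_mult_vec:
  assumes M: "M \<in> carrier_mat p n" and z: "z \<in> carrier_vec n"
  shows "(\<Sum>i<p. (cmod ((cmat M *\<^sub>v z) $ i))\<^sup>2)
    = (M *\<^sub>v map_vec Re z) \<bullet> (M *\<^sub>v map_vec Re z) + (M *\<^sub>v map_vec Im z) \<bullet> (M *\<^sub>v map_vec Im z)"
proof -
  have c: "M *\<^sub>v map_vec Re z \<in> carrier_vec p" "M *\<^sub>v map_vec Im z \<in> carrier_vec p" using M z by auto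
  show ?thesis
    unfolding scalar_prod_sum[OF c(1)] scalar_prod_sum[OF c(2)] sum.distrib[symmetric]
  proof (rule sum.cong[OF refl])
    fix i assume "i \<in> {..<p}"
    thus "(cmod ((cmat M *\<^sub>v z) $ i))\<^sup>2 = (M *\<^sub>v map_vec Re z) $ i * (M *\<^sub>v map_vec Re z) $ i
        + (M *\<^sub>v map_vec Im z) $ i * (M *\<^sub>v map_vec Im z) $ i"
      unfolding cmod_power2 by (simp add: cmat_mult_vec_index[OF M z] power2_eq_square del: index_mult_mat_vec)
  qed
qed

lemma smult_minus_index:
  assumes "v \<in> carrier_vec n" "w \<in> carrier_vec n" "i < n"
  shows "(s \<cdot>\<^sub>v v - w) $ i = s * v $ i - w $ i"
  using assms by simp

lemma symmetric_mat_scalar_prod: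
  assumes "V \<in> carrier_mat n n" "V\<^sup>T = V" "x \<in> carrier_vec n" "y \<in> carrier_vec n"
  shows "y \<bullet> (V *\<^sub>v x) = x \<bullet> (V *\<^sub>v y :: real vec)"
proof -
  have "y \<bullet> (V *\<^sub>v x) = (V\<^sup>T *\<^sub>v y) \<bullet> x" by (rule transpose_vec_mult_scalar[OF assms(1,3,4), symmetric])
  also have "\<dots> = x \<bullet> (V *\<^sub>v y)" unfolding assms(2)
    by (rule comm_scalar_prod[of _ n]) (use assms in auto)
  finally show ?thesis .
qed

text \<open>For s = i \<omega> and z = a + i b the equation splits into Ac a = x0 + \<omega> b and
  Ac b = -\<omega> a. Adding the quadratic identity at a and at b, the cross terms \<omega> b^T V a
  cancel by the symmetry of V. The case x0 = 0 treats eigenvectors, general x0 the semidefiniteness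
  of V.\<close>

lemma imaginary_axis_energy:
  fixes x0 :: "real vec"
  assumes Ac: "Ac \<in> carrier_mat n n" and V: "V \<in> carrier_mat n n" "V\<^sup>T = V" and x0: "x0 \<in> carrier_vec n"
    and ric: "\<And>z. z \<in> carrier_vec n \<Longrightarrow> 2 * ((Ac *\<^sub>v z) \<bullet> (V *\<^sub>v z)) = q z"
    and z: "z \<in> carrier_vec n" and s: "Re s = 0"
    and eq: "\<And>i. i < n \<Longrightarrow> s * z $ i + (cmat Ac *\<^sub>v z) $ i = complex_of_real (x0 $ i)"
  shows "2 * (x0 \<bullet> (V *\<^sub>v map_vec Re z)) = q (map_vec Re z) + q (map_vec Im z)"
proof -
  let ?a = "map_vec Re z" and ?b = "map_vec Im z" and ?w = "Im s"
  have a: "?a \<in> carrier_vec n" and b: "?b \<in> carrier_vec n" using z by auto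
  have Va: "V *\<^sub>v ?a \<in> carrier_vec n" and Vb: "V *\<^sub>v ?b \<in> carrier_vec n" using V a b by auto
  have Aa: "Ac *\<^sub>v ?a = x0 + ?w \<cdot>\<^sub>v ?b" and Ab: "Ac *\<^sub>v ?b = (- ?w) \<cdot>\<^sub>v ?a"
  proof -
    have "(Ac *\<^sub>v ?a) $ i = x0 $ i + ?w * Im (z $ i) \<and> (Ac *\<^sub>v ?b) $ i = - ?w * Re (z $ i)" if i: "i < n" for i
      using eq[OF i] s unfolding cmat_mult_vec_index[OF Ac z i] by (auto simp: complex_eq_iff simp del: index_mult_mat_vec)
    thus "Ac *\<^sub>v ?a = x0 + ?w \<cdot>\<^sub>v ?b" "Ac *\<^sub>v ?b = (- ?w) \<cdot>\<^sub>v ?a"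
      using Ac x0 z by (auto intro!: eq_vecI simp del: index_mult_mat_vec)
  qed
  have "q ?a = 2 * (x0 \<bullet> (V *\<^sub>v ?a) + ?w * (?b \<bullet> (V *\<^sub>v ?a)))"
    unfolding ric[OF a, symmetric] Aa using x0 b Va by (simp add: add_scalar_prod_distrib[of _ n])
  moreover have "q ?b = - (2 * (?w * (?a \<bullet> (V *\<^sub>v ?b))))"
    unfolding ric[OF b, symmetric] Ab using a Vb by simp
  moreover have "?b \<bullet> (V *\<^sub>v ?a) = ?a \<bullet> (V *\<^sub>v ?b)" by (rule symmetric_mat_scalar_prod[OF V a b])
  ultimately show ?thesis by simp
qed

text \<open>Reads the closed matrix as the plant driven by the feedback u = B^T V v, the form in
  which the level bound speaks.\<close>

lemma cmat_closed_matrix_mult: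
  assumes A: "A \<in> carrier_mat n n" and B: "B \<in> carrier_mat n m" and V: "V \<in> carrier_mat n n" and v: "v \<in> carrier_vec n"
  shows "cmat (A + B * B\<^sup>T * V) *\<^sub>v v = cmat A *\<^sub>v v + cmat B *\<^sub>v (cmat (B\<^sup>T * V) *\<^sub>v v)"
proof -
  have BV: "B\<^sup>T * V \<in> carrier_mat m n" using B V by auto
  have e: "B * B\<^sup>T * V = B * (B\<^sup>T * V)" using B V by (intro assoc_mult_mat) auto
  have add: "cmat (A + B * (B\<^sup>T * V)) = cmat A + cmat (B * (B\<^sup>T * V))"
    by (rule eq_matI) (use A B BV in auto)
  have hom: "cmat (B * (B\<^sup>T * V)) = cmat B * cmat (B\<^sup>T * V)" by (rule of_real_hom.mat_hom_mult[OF B BV])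
  have "cmat (A + B * B\<^sup>T * V) *\<^sub>v v = cmat A *\<^sub>v v + (cmat B * cmat (B\<^sup>T * V)) *\<^sub>v v"
    unfolding e add hom by (rule add_mult_distrib_mat_vec[of _ n n]) (use A B BV v in auto)
  also have "(cmat B * cmat (B\<^sup>T * V)) *\<^sub>v v = cmat B *\<^sub>v (cmat (B\<^sup>T * V) *\<^sub>v v)"
    by (rule assoc_mult_mat_vec) (use B BV v in auto)
  finally show ?thesis .
qed

text \<open>For an imaginary eigenvalue the energy balance is \<eta> Y + U = 0 and the level bound
  is Y \<le> g^2 (U + Y). Together they give Y \<le> (g/\<gamma>)^2 Y, hence Y = 0 and then U = 0.
  Without input the eigenvector belongs to A, without output it is unobservable, and detectability
  makes it zero.\<close>

lemma closed_matrix_no_imaginary_eigenvalue: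
  assumes A: "A \<in> carrier_mat n n" and B: "B \<in> carrier_mat n m" and C: "C \<in> carrier_mat r n"
    and V: "V \<in> carrier_mat n n" "V\<^sup>T = V"
    and ach: "Hinf_level_achievable n m r A B C g" and g: "g < \<gamma>" and eta: "\<eta> = 1 - 1 / \<gamma>\<^sup>2"
    and ric: "\<And>z. z \<in> carrier_vec n \<Longrightarrow> 2 * (((A + B * B\<^sup>T * V) *\<^sub>v z) \<bullet> (V *\<^sub>v z))
       = \<eta> * ((C *\<^sub>v z) \<bullet> (C *\<^sub>v z)) + ((B\<^sup>T * V) *\<^sub>v z) \<bullet> ((B\<^sup>T * V) *\<^sub>v z)"
    and ev: "eigenvalue (cmat (A + B * B\<^sup>T * V)) s"
  shows "Re s \<noteq> 0"
proof
  assume s0: "Re s = 0"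
  let ?Ac = "A + B * B\<^sup>T * V" and ?K = "B\<^sup>T * V"
  have Ac: "?Ac \<in> carrier_mat n n" and K: "?K \<in> carrier_mat m n" using A B V by auto
  note bnd = Hinf_level_achievable_bound[OF A B C ach]
  have g0: "0 < g" using bnd by blast
  obtain v where v: "v \<in> carrier_vec n" "v \<noteq> 0\<^sub>v n" and Av: "cmat ?Ac *\<^sub>v v = s \<cdot>\<^sub>v v"
    using ev Ac by (auto simp: eigenvalue_def eigenvector_def)
  let ?u = "cmat ?K *\<^sub>v v" and ?y = "cmat C *\<^sub>v v"
  have u: "?u \<in> carrier_vec m" and y: "?y \<in> carrier_vec r" using K C v by auto
  define Y where "Y = (\<Sum>i<r. (cmod (?y $ i))\<^sup>2)"
  define U where "U = (\<Sum>i<m. (cmod (?u $ i))\<^sup>2)"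
  have YU: "0 \<le> Y" "0 \<le> U" by (auto simp: Y_def U_def sum_nonneg)
  have "2 * (0\<^sub>v n \<bullet> (V *\<^sub>v map_vec Re v))
    = (\<eta> * ((C *\<^sub>v map_vec Re v) \<bullet> (C *\<^sub>v map_vec Re v)) + (?K *\<^sub>v map_vec Re v) \<bullet> (?K *\<^sub>v map_vec Re v))
    + (\<eta> * ((C *\<^sub>v map_vec Im v) \<bullet> (C *\<^sub>v map_vec Im v)) + (?K *\<^sub>v map_vec Im v) \<bullet> (?K *\<^sub>v map_vec Im v))"
    by (rule imaginary_axis_energy[OF Ac V zero_carrier_vec ric v(1), of "- s"])
      \<comment> \<open>The energy identity is stated for s z + Ac z, so the eigenvalue enters with
        the opposite sign and x0 = 0.\<close>
      (use s0 v Av in auto)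
  moreover have "0\<^sub>v n \<bullet> (V *\<^sub>v map_vec Re v) = 0" using V v by (intro scalar_prod_left_zero) auto
  moreover have "Y = (C *\<^sub>v map_vec Re v) \<bullet> (C *\<^sub>v map_vec Re v) + (C *\<^sub>v map_vec Im v) \<bullet> (C *\<^sub>v map_vec Im v)"
    unfolding Y_def by (rule sum_cmod_cmat_mult_vec[OF C v(1)])
  moreover have "U = (?K *\<^sub>v map_vec Re v) \<bullet> (?K *\<^sub>v map_vec Re v) + (?K *\<^sub>v map_vec Im v) \<bullet> (?K *\<^sub>v map_vec Im v)"
    unfolding U_def by (rule sum_cmod_cmat_mult_vec[OF K v(1)])
  ultimately have bal: "\<eta> * Y + U = 0" by (simp add: algebra_simps)
  obtain \<phi> :: "complex \<Rightarrow> complex vec" where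
    "\<forall>i<r. (\<lambda>s. \<phi> s $ i) holomorphic_on {s. 0 \<le> Re s} \<and> ((\<lambda>s. \<phi> s $ i) \<longlongrightarrow> 0) right_infinity"
    and \<phi>0: "(0\<^sub>v n :: complex vec) = 0\<^sub>v n \<longrightarrow> (\<forall>s. 0 \<le> Re s \<longrightarrow> (\<forall>i<r. \<phi> s $ i = 0))"
    and \<phi>: "\<forall>s v u. 0 \<le> Re s \<and> v \<in> carrier_vec n \<and> u \<in> carrier_vec m \<and>
        s \<cdot>\<^sub>v v - (cmat A *\<^sub>v v + cmat B *\<^sub>v u) = 0\<^sub>v n \<longrightarrow>
        (\<Sum>i<r. (cmod ((cmat C *\<^sub>v v) $ i - \<phi> s $ i))\<^sup>2)
          \<le> g\<^sup>2 * ((\<Sum>i<m. (cmod (u $ i))\<^sup>2) + (\<Sum>i<r. (cmod ((cmat C *\<^sub>v v) $ i))\<^sup>2))"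
    using bspec[OF conjunct1[OF conjunct2[OF bnd]] zero_carrier_vec] by (elim exE conjE) (rule that)
  have "s \<cdot>\<^sub>v v - (cmat A *\<^sub>v v + cmat B *\<^sub>v ?u) = 0\<^sub>v n"
    unfolding cmat_closed_matrix_mult[OF A B V(1) v(1), symmetric] Av using v by auto
  hence "(\<Sum>i<r. (cmod (?y $ i - \<phi> s $ i))\<^sup>2) \<le> g\<^sup>2 * (U + Y)"
    unfolding U_def Y_def using \<phi>[rule_format, of s v ?u] s0 v u by simp
  moreover have "(\<Sum>i<r. (cmod (?y $ i - \<phi> s $ i))\<^sup>2) = Y"
    unfolding Y_def using \<phi>0 s0 by (intro sum.cong) auto
  ultimately have "Y \<le> g\<^sup>2 * (U + Y)" by simp
  \<comment> \<open>This is the place where \<eta> = 1 - 1/\<gamma>^2 matches the level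
    bound.\<close>
  also have "U + Y = Y / \<gamma>\<^sup>2" using bal unfolding eta by (simp add: algebra_simps)
  finally have le: "Y \<le> g\<^sup>2 * (Y / \<gamma>\<^sup>2)" .
  have lt: "g\<^sup>2 < \<gamma>\<^sup>2" using g0 g by (intro power_strict_mono) auto
  have "Y = 0"
  proof (rule ccontr)
    assume "Y \<noteq> 0"
    hence "0 < Y" using YU by simp
    hence "g\<^sup>2 * (Y / \<gamma>\<^sup>2) < \<gamma>\<^sup>2 * (Y / \<gamma>\<^sup>2)" using lt g0 g by (intro mult_strict_right_mono) auto
    also have "\<dots> = Y" using g0 g by simp
    finally show False using le by simp
  qed
  hence "U = 0" using bal by simp
  have "?y $ i = 0" if "i < r" for i
    using \<open>Y = 0\<close> that unfolding Y_def by (subst (asm) sum_nonneg_eq_0_iff) auto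
  hence y0: "?y = 0\<^sub>v r" using carrier_vecD[OF y] by (auto intro!: eq_vecI simp del: index_mult_mat_vec dim_mult_mat_vec)
  have "?u $ i = 0" if "i < m" for i
    using \<open>U = 0\<close> that unfolding U_def by (subst (asm) sum_nonneg_eq_0_iff) auto
  hence u0: "?u = 0\<^sub>v m" using carrier_vecD[OF u] by (auto intro!: eq_vecI simp del: index_mult_mat_vec dim_mult_mat_vec)
  have "cmat B *\<^sub>v 0\<^sub>v m = 0\<^sub>v n" using B by (auto intro!: eq_vecI)
  moreover have "cmat A *\<^sub>v v \<in> carrier_vec n" using A v by auto
  ultimately have "cmat A *\<^sub>v v = s \<cdot>\<^sub>v v"
    using cmat_closed_matrix_mult[OF A B V(1) v(1)] unfolding u0 Av by simp
  hence "v = 0\<^sub>v n"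
    using conjunct2[OF conjunct2[OF bnd], rule_format, of s v] s0 v(1) y0 by simp
  thus False using v(2) by contradiction
qed

text \<open>The real part of \<open>\<chi>\<close> is nonnegative on the imaginary axis by the Riccati equation and the level bound,
  and \<open>s \<chi>(s)\<close> tends to \<open>x0\<^sup>T V x0\<close>: the maximum principle takes the place of Plancherel's identity.\<close>

lemma riccati_solution_psd:
  assumes A: "A \<in> carrier_mat n n" and B: "B \<in> carrier_mat n m" and C: "C \<in> carrier_mat r n"
    and V: "V \<in> carrier_mat n n" "V\<^sup>T = V"
    and ach: "Hinf_level_achievable n m r A B C g" and g: "g < \<gamma>" and eta: "\<eta> = 1 - 1 / \<gamma>\<^sup>2"
    and ric: "\<And>z. z \<in> carrier_vec n \<Longrightarrow> 2 * (((A + B * B\<^sup>T * V) *\<^sub>v z) \<bullet> (V *\<^sub>v z))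
       = \<eta> * ((C *\<^sub>v z) \<bullet> (C *\<^sub>v z)) + ((B\<^sup>T * V) *\<^sub>v z) \<bullet> ((B\<^sup>T * V) *\<^sub>v z)"
    and ev: "\<And>s. eigenvalue (cmat (- (A + B * B\<^sup>T * V))) s \<Longrightarrow> Re s < 0"
    and x0: "x0 \<in> carrier_vec n"
  shows "0 \<le> x0 \<bullet> (V *\<^sub>v x0)"
proof -
  let ?x = "cvec x0"
  obtain M where M_def: "A + B * B\<^sup>T * V = M" by blast
  obtain K where K_def: "B\<^sup>T * V = K" by blast
  note ric = ric[unfolded M_def K_def] and ev = ev[unfolded M_def]
  have M: "M \<in> carrier_mat n n" and K: "K \<in> carrier_mat m n" using A B V by (auto simp: M_def[symmetric] K_def[symmetric])
  have cM: "cmat M \<in> carrier_mat n n" using M by simp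
  have cN: "cmat (- M) \<in> carrier_mat n n" using M by simp
  have cC: "cmat C \<in> carrier_mat r n" using C by simp
  have x: "?x \<in> carrier_vec n" using x0 by simp
  note bnd = Hinf_level_achievable_bound[OF A B C ach]
  have g0: "0 < g" using bnd by blast
  \<comment> \<open>The resolvent of -M at x0, that is, the Laplace transform of the decaying
    trajectory of x' = -M x from x0.\<close>
  have "\<exists>\<nu>. (\<forall>s. 0 \<le> Re s \<longrightarrow> \<nu> s \<in> carrier_vec n \<and> s \<cdot>\<^sub>v \<nu> s - cmat (- M) *\<^sub>v \<nu> s = ?x) \<and>
     (\<forall>i<n. (\<lambda>s. \<nu> s $ i) holomorphic_on {s. 0 \<le> Re s})"
    by (rule resolvent_exists[OF cN x ev])
  then obtain \<nu> where \<nu>: "\<forall>s. 0 \<le> Re s \<longrightarrow> \<nu> s \<in> carrier_vec n \<and> s \<cdot>\<^sub>v \<nu> s - cmat (- M) *\<^sub>v \<nu> s = ?x"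
    and \<nu>_hol: "\<forall>i<n. (\<lambda>s. \<nu> s $ i) holomorphic_on {s. 0 \<le> Re s}"
    by (elim exE conjE) (rule that)
  note \<nu>' = \<nu>[rule_format]
  obtain \<phi> :: "complex \<Rightarrow> complex vec" where
    \<phi>_an: "\<forall>i<r. (\<lambda>s. \<phi> s $ i) holomorphic_on {s. 0 \<le> Re s} \<and> ((\<lambda>s. \<phi> s $ i) \<longlongrightarrow> 0) right_infinity"
    and "?x = 0\<^sub>v n \<longrightarrow> (\<forall>s. 0 \<le> Re s \<longrightarrow> (\<forall>i<r. \<phi> s $ i = 0))"
    and \<phi>: "\<forall>s v u. 0 \<le> Re s \<and> v \<in> carrier_vec n \<and> u \<in> carrier_vec m \<and>
        s \<cdot>\<^sub>v v - (cmat A *\<^sub>v v + cmat B *\<^sub>v u) = ?x \<longrightarrow>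
        (\<Sum>i<r. (cmod ((cmat C *\<^sub>v v) $ i - \<phi> s $ i))\<^sup>2)
          \<le> g\<^sup>2 * ((\<Sum>i<m. (cmod (u $ i))\<^sup>2) + (\<Sum>i<r. (cmod ((cmat C *\<^sub>v v) $ i))\<^sup>2))"
    using bspec[OF conjunct1[OF conjunct2[OF bnd]] x] by (elim exE conjE) (rule that)
  define p where "p = V *\<^sub>v x0"
  have p: "p \<in> carrier_vec n" using V x0 by (simp add: p_def)
  define y where "y s i = (\<Sum>j<n. cmat C $$ (i, j) * \<nu> s $ j)" for s i
  \<comment> \<open>On the axis the first sum has half the energy of the Riccati equation as its
    real part. The second sum compensates the cross term between y and \<phi> that the level bound
    leaves; its weight is fixed by dividing that bound by g^2.\<close>
  define \<chi> where "\<chi> s = (\<Sum>i<n. complex_of_real (p $ i) * \<nu> s $ i) - complex_of_real (1 / g\<^sup>2) * (\<Sum>i<r. y s i * \<phi> s $ i)" for s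
  have \<chi>_hol: "\<chi> holomorphic_on {s. 0 \<le> Re s}"
    unfolding \<chi>_def y_def using \<nu>_hol \<phi>_an by (intro holomorphic_intros) auto
  have \<nu>_lim: "((\<lambda>s. \<nu> s $ i) \<longlongrightarrow> 0) right_infinity" "((\<lambda>s. s * \<nu> s $ i) \<longlongrightarrow> ?x $ i) right_infinity" if "i < n" for i
    using resolvent_decay[OF cN x \<nu>'] that by blast+
  have \<phi>_lim: "((\<lambda>s. \<phi> s $ i) \<longlongrightarrow> 0) right_infinity" if "i < r" for i using \<phi>_an that by blast
  have "(\<chi> \<longlongrightarrow> (\<Sum>i<n. complex_of_real (p $ i) * 0) - complex_of_real (1 / g\<^sup>2) * (\<Sum>i<r. (\<Sum>j<n. cmat C $$ (i, j) * 0) * 0)) right_infinity"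
    unfolding \<chi>_def y_def by (intro tendsto_intros \<nu>_lim \<phi>_lim) auto
  hence \<chi>_lim: "(\<chi> \<longlongrightarrow> 0) right_infinity" by simp
  have bdry: "0 \<le> Re (\<chi> s)" if s: "Re s = 0" for s
  proof -
    have c: "\<nu> s \<in> carrier_vec n" and e: "s \<cdot>\<^sub>v \<nu> s - cmat (- M) *\<^sub>v \<nu> s = ?x" using \<nu>'[of s] s by auto
    have e_i: "s * \<nu> s $ i + (cmat M *\<^sub>v \<nu> s) $ i = complex_of_real (x0 $ i)" if i: "i < n" for i
    proof -
      have "(s \<cdot>\<^sub>v \<nu> s - cmat (- M) *\<^sub>v \<nu> s) $ i = ?x $ i" using e by simp
      moreover have "(cmat (- M) *\<^sub>v \<nu> s) $ i = - (cmat M *\<^sub>v \<nu> s) $ i"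
        unfolding mult_mat_vec_sum[OF cN c i] mult_mat_vec_sum[OF cM c i] sum_negf[symmetric]
        by (rule sum.cong) (use M i in auto)
      moreover have "cmat (- M) *\<^sub>v \<nu> s \<in> carrier_vec n" using cN c by (rule mult_mat_vec_carrier)
      ultimately show ?thesis using i x0 smult_minus_index[OF c _ i, of "cmat (- M) *\<^sub>v \<nu> s" s]
        by (simp del: index_mult_mat_vec)
    qed
    define a where "a = map_vec Re (\<nu> s)"
    define b where "b = map_vec Im (\<nu> s)"
    define Y where "Y = (\<Sum>i<r. (cmod (y s i))\<^sup>2)"
    define U where "U = (\<Sum>i<m. (cmod ((cmat K *\<^sub>v \<nu> s) $ i))\<^sup>2)"
    define W where "W = Re (\<Sum>i<r. y s i * \<phi> s $ i)"
    have y_eq: "y s i = (cmat C *\<^sub>v \<nu> s) $ i" if "i < r" for i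
      unfolding mult_mat_vec_sum[OF cC c that] y_def ..
    have energy: "2 * (x0 \<bullet> (V *\<^sub>v a)) = \<eta> * Y + U"
    proof -
      have "2 * (x0 \<bullet> (V *\<^sub>v a)) = (\<eta> * ((C *\<^sub>v a) \<bullet> (C *\<^sub>v a)) + (K *\<^sub>v a) \<bullet> (K *\<^sub>v a))
          + (\<eta> * ((C *\<^sub>v b) \<bullet> (C *\<^sub>v b)) + (K *\<^sub>v b) \<bullet> (K *\<^sub>v b))"
        unfolding a_def b_def by (rule imaginary_axis_energy[OF M V x0 ric c s e_i])
      moreover have "Y = (C *\<^sub>v a) \<bullet> (C *\<^sub>v a) + (C *\<^sub>v b) \<bullet> (C *\<^sub>v b)"
        unfolding a_def b_def Y_def sum_cmod_cmat_mult_vec[OF C c, symmetric] by (rule sum.cong) (simp_all add: y_eq)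
      moreover have "U = (K *\<^sub>v a) \<bullet> (K *\<^sub>v a) + (K *\<^sub>v b) \<bullet> (K *\<^sub>v b)"
        unfolding a_def b_def U_def by (rule sum_cmod_cmat_mult_vec[OF K c])
      ultimately show ?thesis by (simp add: algebra_simps)
    qed
    \<comment> \<open>On the axis cnj s = -s, so conjugating and negating turns (s + M) \<nu> = x0
      into (s - M) v = x0: the plant equation with the input K v and the same initial state, to
      which the level bound applies.\<close>
    define v where "v = vec n (\<lambda>i. - cnj (\<nu> s $ i))"
    have v: "v \<in> carrier_vec n" by (simp add: v_def)
    have conj_mult: "(cmat N *\<^sub>v v) $ i = - cnj ((cmat N *\<^sub>v \<nu> s) $ i)" if N: "N \<in> carrier_mat d n" and i: "i < d" for N d i
    proof -
      have cN: "cmat N \<in> carrier_mat d n" using N by simp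
      show ?thesis unfolding mult_mat_vec_sum[OF cN v i] mult_mat_vec_sum[OF cN c i] cnj_sum sum_negf[symmetric]
        by (rule sum.cong) (use N i in \<open>auto simp: v_def\<close>)
    qed
    have cs: "cnj s = - s" using s by (simp add: complex_eq_iff)
    have Kv: "cmat K *\<^sub>v v \<in> carrier_vec m" using K v by (intro mult_mat_vec_carrier[of _ m n]) auto
    have Mv: "cmat M *\<^sub>v v \<in> carrier_vec n" using cM v by (rule mult_mat_vec_carrier)
    have "s \<cdot>\<^sub>v v - (cmat A *\<^sub>v v + cmat B *\<^sub>v (cmat K *\<^sub>v v)) = ?x"
      unfolding cmat_closed_matrix_mult[OF A B V(1) v, symmetric, unfolded M_def K_def]
    proof (rule eq_vecI)
      fix i assume "i < dim_vec ?x"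
      hence i: "i < n" using x0 by simp
      have "cnj (s * \<nu> s $ i + (cmat M *\<^sub>v \<nu> s) $ i) = complex_of_real (x0 $ i)" unfolding e_i[OF i] by simp
      hence "s * v $ i - (cmat M *\<^sub>v v) $ i = complex_of_real (x0 $ i)"
        unfolding conj_mult[OF M i] using i cs by (simp add: v_def del: index_mult_mat_vec)
      thus "(s \<cdot>\<^sub>v v - cmat M *\<^sub>v v) $ i = ?x $ i"
        unfolding smult_minus_index[OF v Mv i] using i x0 by simp
    qed (use carrier_vecD[OF Mv] carrier_vecD[OF v] x0 in \<open>simp del: dim_mult_mat_vec\<close>)
    hence "(\<Sum>i<r. (cmod ((cmat C *\<^sub>v v) $ i - \<phi> s $ i))\<^sup>2)
          \<le> g\<^sup>2 * ((\<Sum>i<m. (cmod ((cmat K *\<^sub>v v) $ i))\<^sup>2) + (\<Sum>i<r. (cmod ((cmat C *\<^sub>v v) $ i))\<^sup>2))"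
      using \<phi>[rule_format, of s v "cmat K *\<^sub>v v"] s v Kv by simp
    also have "(\<Sum>i<m. (cmod ((cmat K *\<^sub>v v) $ i))\<^sup>2) = U"
      unfolding U_def by (rule sum.cong[OF refl]) (simp add: conj_mult[OF K] del: index_mult_mat_vec)
    also have "(\<Sum>i<r. (cmod ((cmat C *\<^sub>v v) $ i))\<^sup>2) = Y"
      unfolding Y_def by (rule sum.cong[OF refl]) (simp add: conj_mult[OF C] y_eq del: index_mult_mat_vec)
    finally have "(\<Sum>i<r. (cmod ((cmat C *\<^sub>v v) $ i - \<phi> s $ i))\<^sup>2) \<le> g\<^sup>2 * (U + Y)" .
    \<comment> \<open>Expanding |cnj y + \<phi>|^2 and dropping |\<phi>|^2.\<close>
    moreover have "Y + 2 * W \<le> (\<Sum>i<r. (cmod ((cmat C *\<^sub>v v) $ i - \<phi> s $ i))\<^sup>2)"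
    proof -
      have "Y + 2 * W = (\<Sum>i<r. (cmod (y s i))\<^sup>2 + 2 * Re (y s i * \<phi> s $ i))"
        unfolding Y_def W_def Re_sum sum.distrib sum_distrib_left ..
      also have "\<dots> \<le> (\<Sum>i<r. (cmod ((cmat C *\<^sub>v v) $ i - \<phi> s $ i))\<^sup>2)"
      proof (rule sum_mono)
        fix i assume "i \<in> {..<r}"
        hence e: "(cmat C *\<^sub>v v) $ i - \<phi> s $ i = - (cnj (y s i) + \<phi> s $ i)" using conj_mult[OF C, of i] y_eq[of i] by simp
        have "(cmod (cnj z + w))\<^sup>2 = (cmod z)\<^sup>2 + 2 * Re (z * w) + (cmod w)\<^sup>2" for z w
          unfolding cmod_power2 by (simp add: power2_eq_square algebra_simps)
        thus "(cmod (y s i))\<^sup>2 + 2 * Re (y s i * \<phi> s $ i) \<le> (cmod ((cmat C *\<^sub>v v) $ i - \<phi> s $ i))\<^sup>2"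
          unfolding e norm_minus_cancel by simp
      qed
      finally show ?thesis .
    qed
    ultimately have main: "Y + 2 * W \<le> g\<^sup>2 * (U + Y)" by linarith
    have "Re (\<Sum>i<n. complex_of_real (p $ i) * \<nu> s $ i) = (\<Sum>i<n. p $ i * a $ i)"
      unfolding Re_sum using c by (intro sum.cong) (auto simp: a_def)
    also have "\<dots> = p \<bullet> a" using c by (subst scalar_prod_sum[of a n]) (auto simp: a_def)
    also have "\<dots> = a \<bullet> p" using c p by (intro comm_scalar_prod[of _ n]) (auto simp: a_def)
    also have "\<dots> = x0 \<bullet> (V *\<^sub>v a)" unfolding p_def
      by (rule symmetric_mat_scalar_prod[OF V x0]) (use c in \<open>auto simp: a_def\<close>)
    finally have "Re (\<chi> s) = (\<eta> * Y + U) / 2 - 1 / g\<^sup>2 * W"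
      using energy unfolding \<chi>_def W_def by (simp add: Re_divide_of_real field_simps)
    moreover have "0 \<le> g\<^sup>2 * (\<eta> * Y + U) - 2 * W"
    proof -
      have "g\<^sup>2 \<le> \<gamma>\<^sup>2" using g0 g by (intro power_mono) auto
      hence "g\<^sup>2 * (1 - \<eta>) \<le> 1" using g0 g unfolding eta by simp
      moreover have "0 \<le> Y" unfolding Y_def by (simp add: sum_nonneg)
      ultimately have "g\<^sup>2 * (1 - \<eta>) * Y \<le> 1 * Y" by (rule mult_right_mono)
      thus ?thesis using main by (simp add: algebra_simps)
    qed
    ultimately have "0 \<le> 2 * g\<^sup>2 * Re (\<chi> s)" using g0 by (simp add: field_simps)
    thus ?thesis using g0 by (simp add: zero_le_mult_iff)
  qed
  have pos: "0 \<le> Re (\<chi> s)" if "0 < Re s" for s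
    by (rule right_half_plane_minimum_principle[OF \<chi>_hol \<chi>_lim bdry that])
  \<comment> \<open>In s \<chi>(s) the factor s is attached to \<nu>, which then tends to x0; the
    remaining factor \<phi> still tends to 0 and removes the second sum.\<close>
  have "((\<lambda>s. (\<Sum>i<n. complex_of_real (p $ i) * (s * \<nu> s $ i))
        - complex_of_real (1 / g\<^sup>2) * (\<Sum>i<r. (\<Sum>j<n. cmat C $$ (i, j) * (s * \<nu> s $ j)) * \<phi> s $ i))
     \<longlongrightarrow> (\<Sum>i<n. complex_of_real (p $ i) * ?x $ i)
        - complex_of_real (1 / g\<^sup>2) * (\<Sum>i<r. (\<Sum>j<n. cmat C $$ (i, j) * ?x $ j) * 0)) right_infinity"
    by (intro tendsto_intros \<nu>_lim \<phi>_lim) auto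
  moreover have "(\<Sum>i<n. complex_of_real (p $ i) * (s * \<nu> s $ i))
        - complex_of_real (1 / g\<^sup>2) * (\<Sum>i<r. (\<Sum>j<n. cmat C $$ (i, j) * (s * \<nu> s $ j)) * \<phi> s $ i) = s * \<chi> s" for s
    unfolding \<chi>_def y_def right_diff_distrib sum_distrib_left sum_distrib_right by (simp only: mult_ac)
  moreover have "(\<Sum>i<n. complex_of_real (p $ i) * ?x $ i)
        - complex_of_real (1 / g\<^sup>2) * (\<Sum>i<r. (\<Sum>j<n. cmat C $$ (i, j) * ?x $ j) * 0) = complex_of_real (x0 \<bullet> p)"
  proof -
    have "x0 \<bullet> p = (\<Sum>i<n. x0 $ i * p $ i)" by (rule scalar_prod_sum[OF p])
    thus ?thesis using x0 by (simp add: mult.commute)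
  qed
  ultimately have "((\<lambda>s. s * \<chi> s) \<longlongrightarrow> complex_of_real (x0 \<bullet> p)) right_infinity" by (simp only:)
  hence "((\<lambda>t. Re (complex_of_real t * \<chi> (complex_of_real t))) \<longlongrightarrow> Re (complex_of_real (x0 \<bullet> p))) at_top"
    by (intro tendsto_Re filterlim_compose[OF _ filterlim_of_real_right_infinity])
  moreover have "eventually (\<lambda>t. 0 \<le> Re (complex_of_real t * \<chi> (complex_of_real t))) at_top"
    using eventually_gt_at_top[of "0::real"] by eventually_elim (simp add: pos)
  ultimately have "0 \<le> Re (complex_of_real (x0 \<bullet> p))" by (rule tendsto_lowerbound) simp
  thus ?thesis by (simp add: p_def)
qed

section \<open>The linear systems\<close>

text \<open>Sorts the quadruples by a = p + q, as the stated right-hand side does. Any upper limit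
  from k on is admissible, because i + j \<ge> 4 leaves a \<le> k - 2.\<close>

lemma sum_antidiagonal_quadruples:
  fixes T :: "nat \<Rightarrow> nat \<Rightarrow> nat \<Rightarrow> nat \<Rightarrow> real"
  assumes "k \<le> N"
  shows "(\<Sum>((p, i), (q, j))\<in>{((p, i), (q, j)). 2 \<le> i \<and> 2 \<le> j \<and> p + q + i + j = k + 2}. T p q i j)
    = (\<Sum>a\<in>{0..N}. \<Sum>(p, q)\<in>{(p, q). p + q = a}. \<Sum>(i, j)\<in>{(i, j). 2 \<le> i \<and> 2 \<le> j \<and> i + j + a = k + 2}. T p q i j)"
proof -
  have f1: "finite {(p, q). p + q = a}" for a :: nat by (rule finite_subset[of _ "{..a} \<times> {..a}"]) auto
  have f2: "finite {(i, j). 2 \<le> i \<and> 2 \<le> j \<and> i + j + a = k + 2}" for a :: nat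
    by (rule finite_subset[of _ "{..k + 2} \<times> {..k + 2}"]) auto
  have "(\<Sum>a\<in>{0..N}. \<Sum>pq\<in>{(p, q). p + q = a}. \<Sum>ij\<in>{(i, j). 2 \<le> i \<and> 2 \<le> j \<and> i + j + a = k + 2}. T (fst pq) (snd pq) (fst ij) (snd ij))
     = (\<Sum>(a, pq, ij)\<in>(SIGMA a:{0..N}. {(p, q). p + q = a} \<times> {(i, j). 2 \<le> i \<and> 2 \<le> j \<and> i + j + a = k + 2}). T (fst pq) (snd pq) (fst ij) (snd ij))"
    by (subst sum.Sigma[symmetric]) (use f1 f2 in \<open>auto simp: sum.cartesian_product case_prod_beta\<close>)
  also have "\<dots> = (\<Sum>((p, i), (q, j))\<in>{((p, i), (q, j)). 2 \<le> i \<and> 2 \<le> j \<and> p + q + i + j = k + 2}. T p q i j)"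
    by (rule sum.reindex_bij_witness[where j = "\<lambda>(a, (p, q), (i, j)). ((p, i), (q, j))"
          and i = "\<lambda>((p, i), (q, j)). (p + q, (p, q), (i, j))"]) (use assms in auto)
  finally show ?thesis by (simp add: case_prod_beta)
qed

lemma vectorize_carrier: "M \<in> carrier_mat a b \<Longrightarrow> vectorize M \<in> carrier_vec (a * b)"
  by (auto simp: vectorize_def)

lemma past_rhs_scalar_prod:
  assumes F: "\<And>p. F p \<in> carrier_mat n (n^p)"
    and G: "\<And>p. G p \<in> carrier_mat n (m * n^p)"
    and H: "\<And>p. H p \<in> carrier_mat r (n^p)"
    and V: "\<And>i. 2 \<le> i \<Longrightarrow> i \<le> k \<Longrightarrow> V i \<in> carrier_mat n (n^(i-1)) \<and> v i = vectorize (V i)"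
    and sym: "\<And>i. 2 \<le> i \<Longrightarrow> i \<le> k \<Longrightarrow> symmetric_coeff n i (v i)"
    and x: "x \<in> carrier_vec n"
  shows "past_rhs n m l \<eta> F G H v V k \<bullet> x ^\<^sub>\<otimes> k =
     - (\<Sum>(i, p)\<in>{(i, p). 2 \<le> i \<and> 2 \<le> p \<and> i + p = k + 1}. real i * ((V i *\<^sub>v x ^\<^sub>\<otimes> (i - 1)) \<bullet> (F p *\<^sub>v x ^\<^sub>\<otimes> p)))
     - 1/4 * (\<Sum>(i, j)\<in>{(i, j). 2 < i \<and> 2 < j \<and> i + j = k + 2}.
          real (i * j) * (input_term m G V x 0 i \<bullet> input_term m G V x 0 j))
     + \<eta> * (\<Sum>(p, q)\<in>{(p, q). 1 \<le> p \<and> 1 \<le> q \<and> p + q = k}. (H p *\<^sub>v x ^\<^sub>\<otimes> p) \<bullet> (H q *\<^sub>v x ^\<^sub>\<otimes> q))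
     - 1/4 * (\<Sum>a\<in>{1..2 * l}. \<Sum>(p, q)\<in>{(p, q). p + q = a}. \<Sum>(i, j)\<in>{(i, j). 2 \<le> i \<and> 2 \<le> j \<and> i + j + a = k + 2}.
          real (i * j) * (input_term m G V x p i \<bullet> input_term m G V x q j))"
proof -
  have xk: "x ^\<^sub>\<otimes> k \<in> carrier_vec (n ^ k)" using x by (rule kron_pow_carrier)
  have G0: "G 0 \<in> carrier_mat n m" using G[of 0] by simp
  have lin: "(- a - (1/4) \<cdot>\<^sub>v b + \<eta> \<cdot>\<^sub>v c - (1/4) \<cdot>\<^sub>v e) \<bullet> z = - (a \<bullet> z) - 1/4 * (b \<bullet> z) + \<eta> * (c \<bullet> z) - 1/4 * (e \<bullet> z)"
    if "a \<in> carrier_vec N" "b \<in> carrier_vec N" "c \<in> carrier_vec N" "e \<in> carrier_vec N" "z \<in> carrier_vec N"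
    for a b c e z :: "real vec" and N
    using that by (simp add: minus_scalar_prod_distrib[of _ N] add_scalar_prod_distrib[of _ N])
  have vs: "vec_sum N f S \<in> carrier_vec N" for N S and f :: "'x \<Rightarrow> real vec" by (simp add: vec_sum_def)
  have one: "((lyapunov_mat i (F p))\<^sup>T *\<^sub>v v i) \<bullet> x ^\<^sub>\<otimes> k = real i * ((V i *\<^sub>v x ^\<^sub>\<otimes> (i - 1)) \<bullet> (F p *\<^sub>v x ^\<^sub>\<otimes> p))"
    if "2 \<le> i" "2 \<le> p" "i + p = k + 1" for i p
  proof -
    have ik: "i \<le> k" and K: "k = i - 1 + p" using that by auto
    note Vi = V[OF that(1) ik] and si = sym[OF that(1) ik]
    have Fx: "F p *\<^sub>v x ^\<^sub>\<otimes> p \<in> carrier_vec n" using F kron_pow_carrier[OF x] by (rule mult_mat_vec_carrier)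
    have Vx: "V i *\<^sub>v x ^\<^sub>\<otimes> (i - 1) \<in> carrier_vec n" using conjunct1[OF Vi] kron_pow_carrier[OF x] by (rule mult_mat_vec_carrier)
    have "((lyapunov_mat i (F p))\<^sup>T *\<^sub>v v i) \<bullet> x ^\<^sub>\<otimes> k = v i \<bullet> dkron n i x (F p *\<^sub>v x ^\<^sub>\<otimes> p)"
      by (rule lyapunov_mat_transpose_scalar_prod[OF F x symmetric_coeff_carrier[OF si] K])
    also have "\<dots> = real i * ((F p *\<^sub>v x ^\<^sub>\<otimes> p) \<bullet> (V i *\<^sub>v x ^\<^sub>\<otimes> (i - 1)))"
      by (rule symmetric_vectorize_dkron[OF si conjunct1[OF Vi] conjunct2[OF Vi] x Fx])
    also have "(F p *\<^sub>v x ^\<^sub>\<otimes> p) \<bullet> (V i *\<^sub>v x ^\<^sub>\<otimes> (i - 1)) = (V i *\<^sub>v x ^\<^sub>\<otimes> (i - 1)) \<bullet> (F p *\<^sub>v x ^\<^sub>\<otimes> p)"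
      by (rule comm_scalar_prod[OF Fx Vx])
    finally show ?thesis .
  qed
  have two: "(real (i * j) \<cdot>\<^sub>v vectorize ((V i)\<^sup>T * G 0 * (G 0)\<^sup>T * V j)) \<bullet> x ^\<^sub>\<otimes> k
      = real (i * j) * (input_term m G V x 0 i \<bullet> input_term m G V x 0 j)"
    if "2 < i" "2 < j" "i + j = k + 2" for i j
  proof -
    have K: "k = (i - 1) + (j - 1)" using that by auto
    have Vi: "V i \<in> carrier_mat n (n^(i-1))" and Vj: "V j \<in> carrier_mat n (n^(j-1))" using V[of i] V[of j] that by auto
    have GV: "(G 0)\<^sup>T * V i \<in> carrier_mat m (n^(i-1))" "(G 0)\<^sup>T * V j \<in> carrier_mat m (n^(j-1))"
      by (rule mult_carrier_mat[OF transpose_carrier_mat[THEN iffD2, OF G0]], fact)+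
    have t: "((G 0)\<^sup>T * V i)\<^sup>T = (V i)\<^sup>T * G 0"
      using transpose_mult[OF transpose_carrier_mat[THEN iffD2, OF G0] Vi] by simp
    have e: "(V i)\<^sup>T * G 0 * (G 0)\<^sup>T * V j = ((G 0)\<^sup>T * V i)\<^sup>T * ((G 0)\<^sup>T * V j)"
      unfolding t by (rule assoc_mult_mat) (use G0 Vi Vj in auto)
    have it0: "input_term m G V x 0 a = ((G 0)\<^sup>T * V a) *\<^sub>v x ^\<^sub>\<otimes> (a - 1)" if Va: "V a \<in> carrier_mat n (n^(a-1))" for a
      unfolding input_term_0[of G n m V a x, OF G0 Va x]
      by (rule assoc_mult_mat_vec[symmetric, OF transpose_carrier_mat[THEN iffD2, OF G0] Va kron_pow_carrier[OF x]])
    note it = it0[OF Vi] it0[OF Vj]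
    have "vectorize (((G 0)\<^sup>T * V i)\<^sup>T * ((G 0)\<^sup>T * V j)) \<bullet> x ^\<^sub>\<otimes> k = input_term m G V x 0 i \<bullet> input_term m G V x 0 j"
      unfolding it by (rule vectorize_transpose_mult_scalar_prod[OF GV x K])
    moreover have "vectorize (((G 0)\<^sup>T * V i)\<^sup>T * ((G 0)\<^sup>T * V j)) \<in> carrier_vec (n ^ k)"
      using vectorize_carrier[OF mult_carrier_mat[OF transpose_carrier_mat[THEN iffD2, OF GV(1)] GV(2)]]
      unfolding K power_add .
    ultimately show ?thesis unfolding e by (simp only: smult_scalar_prod_distrib[OF _ xk])
  qed
  have three: "vectorize ((H p)\<^sup>T * H q) \<bullet> x ^\<^sub>\<otimes> (p + q) = (H p *\<^sub>v x ^\<^sub>\<otimes> p) \<bullet> (H q *\<^sub>v x ^\<^sub>\<otimes> q)" for p q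
    by (rule vectorize_transpose_mult_scalar_prod[OF H H x refl])
  have four: "(real (i * j) \<cdot>\<^sub>v cross_term n m G V k p q i j) \<bullet> x ^\<^sub>\<otimes> k
      = real (i * j) * (input_term m G V x p i \<bullet> input_term m G V x q j)"
    if "2 \<le> i" "2 \<le> j" "i + j + (p + q) = k + 2" for i j p q
  proof -
    have Vi: "V i \<in> carrier_mat n (n^(i-1))" and Vj: "V j \<in> carrier_mat n (n^(j-1))" using V[of i] V[of j] that by auto
    show ?thesis unfolding smult_scalar_prod_distrib[OF cross_term_scalar_prod(2)[of G n m V i j x p q k, OF G Vi Vj x that] xk]
      cross_term_scalar_prod(1)[of G n m V i j x p q k, OF G Vi Vj x that] ..
  qed
  have s1: "vec_sum (n^k) (\<lambda>(i, p). (lyapunov_mat i (F p))\<^sup>T *\<^sub>v v i) {(i, p). 2 \<le> i \<and> 2 \<le> p \<and> i + p = k + 1} \<bullet> x ^\<^sub>\<otimes> k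
      = (\<Sum>(i, p)\<in>{(i, p). 2 \<le> i \<and> 2 \<le> p \<and> i + p = k + 1}. real i * ((V i *\<^sub>v x ^\<^sub>\<otimes> (i - 1)) \<bullet> (F p *\<^sub>v x ^\<^sub>\<otimes> p)))"
    unfolding vec_sum_scalar_prod[OF xk] by (rule sum.cong[OF refl], clarify) (simp only: one split_conv)
  have s2: "vec_sum (n^k) (\<lambda>(i, j). real (i * j) \<cdot>\<^sub>v vectorize ((V i)\<^sup>T * G 0 * (G 0)\<^sup>T * V j)) {(i, j). 2 < i \<and> 2 < j \<and> i + j = k + 2} \<bullet> x ^\<^sub>\<otimes> k
      = (\<Sum>(i, j)\<in>{(i, j). 2 < i \<and> 2 < j \<and> i + j = k + 2}. real (i * j) * (input_term m G V x 0 i \<bullet> input_term m G V x 0 j))"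
    unfolding vec_sum_scalar_prod[OF xk] by (rule sum.cong[OF refl], clarify) (simp only: two split_conv)
  have s3: "vec_sum (n^k) (\<lambda>(p, q). vectorize ((H p)\<^sup>T * H q)) {(p, q). 1 \<le> p \<and> 1 \<le> q \<and> p + q = k} \<bullet> x ^\<^sub>\<otimes> k
      = (\<Sum>(p, q)\<in>{(p, q). 1 \<le> p \<and> 1 \<le> q \<and> p + q = k}. (H p *\<^sub>v x ^\<^sub>\<otimes> p) \<bullet> (H q *\<^sub>v x ^\<^sub>\<otimes> q))"
    unfolding vec_sum_scalar_prod[OF xk] by (rule sum.cong[OF refl], clarify) (simp only: three split_conv)
  have s4: "vec_sum (n^k) (\<lambda>a. vec_sum (n^k) (\<lambda>(p, q). vec_sum (n^k) (\<lambda>(i, j). real (i * j) \<cdot>\<^sub>v cross_term n m G V k p q i j)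
             {(i, j). 2 \<le> i \<and> 2 \<le> j \<and> i + j + a = k + 2}) {(p, q). p + q = a}) {1..2 * l} \<bullet> x ^\<^sub>\<otimes> k
      = (\<Sum>a\<in>{1..2 * l}. \<Sum>(p, q)\<in>{(p, q). p + q = a}. \<Sum>(i, j)\<in>{(i, j). 2 \<le> i \<and> 2 \<le> j \<and> i + j + a = k + 2}.
          real (i * j) * (input_term m G V x p i \<bullet> input_term m G V x q j))"
    unfolding vec_sum_scalar_prod[OF xk]
    by (rule sum.cong[OF refl], rule sum.cong[OF refl], clarify, unfold split_conv vec_sum_scalar_prod[OF xk], rule sum.cong[OF refl], clarify)
      (simp only: four split_conv)
  show ?thesis unfolding past_rhs_def lin[OF vs vs vs vs xk] s1 s2 s3 s4 ..
qed

lemma closed_matrix_mult: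
  fixes A B V :: "real mat"
  assumes A: "A \<in> carrier_mat n n" and B: "B \<in> carrier_mat n m" and V: "V \<in> carrier_mat n n" and x: "x \<in> carrier_vec n"
  shows "(A + B * B\<^sup>T * V) *\<^sub>v x = A *\<^sub>v x + B *\<^sub>v (B\<^sup>T *\<^sub>v (V *\<^sub>v x))"
proof -
  have BT: "B\<^sup>T \<in> carrier_mat m n" using B by simp
  have BB: "B * B\<^sup>T \<in> carrier_mat n n" using B BT by (rule mult_carrier_mat)
  have Vx: "V *\<^sub>v x \<in> carrier_vec n" using V x by (rule mult_mat_vec_carrier)
  have "(A + B * B\<^sup>T * V) *\<^sub>v x = A *\<^sub>v x + (B * B\<^sup>T * V) *\<^sub>v x"
    by (rule add_mult_distrib_mat_vec[OF A mult_carrier_mat[OF BB V] x])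
  also have "(B * B\<^sup>T * V) *\<^sub>v x = (B * B\<^sup>T) *\<^sub>v (V *\<^sub>v x)" by (rule assoc_mult_mat_vec[OF BB V x])
  also have "\<dots> = B *\<^sub>v (B\<^sup>T *\<^sub>v (V *\<^sub>v x))" by (rule assoc_mult_mat_vec[OF B BT Vx])
  finally show ?thesis .
qed

lemma closed_matrix_scalar_prod:
  fixes A B V :: "real mat"
  assumes A: "A \<in> carrier_mat n n" and B: "B \<in> carrier_mat n m" and V: "V \<in> carrier_mat n n" and x: "x \<in> carrier_vec n"
    and z: "z \<in> carrier_vec n"
  shows "((A + B * B\<^sup>T * V) *\<^sub>v x) \<bullet> z = z \<bullet> (A *\<^sub>v x) + (B\<^sup>T *\<^sub>v (V *\<^sub>v x)) \<bullet> (B\<^sup>T *\<^sub>v z)"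
proof -
  have BT: "B\<^sup>T \<in> carrier_mat m n" using B by simp
  have w: "B\<^sup>T *\<^sub>v (V *\<^sub>v x) \<in> carrier_vec m" using BT mult_mat_vec_carrier[OF V x] by (rule mult_mat_vec_carrier)
  have Ax: "A *\<^sub>v x \<in> carrier_vec n" using A x by (rule mult_mat_vec_carrier)
  have Bw: "B *\<^sub>v (B\<^sup>T *\<^sub>v (V *\<^sub>v x)) \<in> carrier_vec n" using B w by (rule mult_mat_vec_carrier)
  have BTz: "B\<^sup>T *\<^sub>v z \<in> carrier_vec m" using BT z by (rule mult_mat_vec_carrier)
  have "((A + B * B\<^sup>T * V) *\<^sub>v x) \<bullet> z = (A *\<^sub>v x) \<bullet> z + (B *\<^sub>v (B\<^sup>T *\<^sub>v (V *\<^sub>v x))) \<bullet> z"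
    unfolding closed_matrix_mult[OF A B V x] by (rule add_scalar_prod_distrib[OF Ax Bw z])
  also have "(A *\<^sub>v x) \<bullet> z = z \<bullet> (A *\<^sub>v x)" by (rule comm_scalar_prod[OF Ax z])
  also have "(B *\<^sub>v (B\<^sup>T *\<^sub>v (V *\<^sub>v x))) \<bullet> z = z \<bullet> (B *\<^sub>v (B\<^sup>T *\<^sub>v (V *\<^sub>v x)))" by (rule comm_scalar_prod[OF Bw z])
  also have "\<dots> = (B\<^sup>T *\<^sub>v z) \<bullet> (B\<^sup>T *\<^sub>v (V *\<^sub>v x))" by (rule transpose_vec_mult_scalar[OF B w z, symmetric])
  also have "\<dots> = (B\<^sup>T *\<^sub>v (V *\<^sub>v x)) \<bullet> (B\<^sup>T *\<^sub>v z)" by (rule comm_scalar_prod[OF BTz w])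
  finally show ?thesis .
qed

text \<open>In the part of degree k the coefficient v_k meets only the linear drift and, with p = q
  = 0, the two pairs (2, k) and (k, 2) of the quadratic term. Together these are the derivative
  along Ac x. After doubling, the remaining terms are the right-hand side of the system, whose
  second sum has i, j > 2 for this reason.\<close>

lemma lyapunov_system:
  assumes A: "A \<in> carrier_mat n n" and B: "B \<in> carrier_mat n m"
    and F: "\<And>p. F p \<in> carrier_mat n (n^p)"
    and G: "\<And>p. G p \<in> carrier_mat n (m * n^p)"
    and H: "\<And>p. H p \<in> carrier_mat r (n^p)"
    and G0: "G 0 = B"
    and G_zero: "\<And>p. 1 \<le> p \<Longrightarrow> l < p \<Longrightarrow> G p = 0\<^sub>m n (m * n^p)"
    and V: "\<And>i. 2 \<le> i \<Longrightarrow> i \<le> k \<Longrightarrow> V i \<in> carrier_mat n (n^(i-1)) \<and> v i = vectorize (V i)"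
    and sym: "\<And>i. 2 \<le> i \<Longrightarrow> i \<le> k \<Longrightarrow> symmetric_coeff n i (v i)"
    and x: "x \<in> carrier_vec n" and k: "3 \<le> k"
    and hom: "(\<Sum>(i, p)\<in>{(i, p). 2 \<le> i \<and> 1 \<le> p \<and> i + p = k + 1}.
            real i / 2 * ((V i *\<^sub>v x ^\<^sub>\<otimes> (i - 1)) \<bullet> ((F(1 := A)) p *\<^sub>v x ^\<^sub>\<otimes> p)))
       + 1/2 * (\<Sum>((p, i), (q, j))\<in>{((p, i), (q, j)). 2 \<le> i \<and> 2 \<le> j \<and> p + q + i + j = k + 2}.
            real i / 2 * (real j / 2) * (input_term m G V x p i \<bullet> input_term m G V x q j))
       - \<eta>/2 * (\<Sum>(p, q)\<in>{(p, q). 1 \<le> p \<and> 1 \<le> q \<and> p + q = k}.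
            (H p *\<^sub>v x ^\<^sub>\<otimes> p) \<bullet> (H q *\<^sub>v x ^\<^sub>\<otimes> q)) = 0"
  shows "v k \<bullet> dkron n k x ((A + B * B\<^sup>T * V 2) *\<^sub>v x) = past_rhs n m l \<eta> F G H v V k \<bullet> x ^\<^sub>\<otimes> k"
proof -
  define P where "P i p = (V i *\<^sub>v x ^\<^sub>\<otimes> (i - 1)) \<bullet> (F p *\<^sub>v x ^\<^sub>\<otimes> p)" for i p
  define T where "T p q i j = real (i * j) * (input_term m G V x p i \<bullet> input_term m G V x q j)" for p q i j
  define a0 where "a0 = (V k *\<^sub>v x ^\<^sub>\<otimes> (k - 1)) \<bullet> (A *\<^sub>v x)"
  define b0 where "b0 = input_term m G V x 0 2 \<bullet> input_term m G V x 0 k"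
  define s1 where "s1 = (\<Sum>(i, p)\<in>{(i, p). 2 \<le> i \<and> 2 \<le> p \<and> i + p = k + 1}. real i * P i p)"
  define s2 where "s2 = (\<Sum>(i, j)\<in>{(i, j). 2 < i \<and> 2 < j \<and> i + j = k + 2}. T 0 0 i j)"
  define s4 where "s4 = (\<Sum>a\<in>{1..2 * l}. \<Sum>(p, q)\<in>{(p, q). p + q = a}. \<Sum>(i, j)\<in>{(i, j). 2 \<le> i \<and> 2 \<le> j \<and> i + j + a = k + 2}. T p q i j)"
  define s3 where "s3 = (\<Sum>(p, q)\<in>{(p, q). 1 \<le> p \<and> 1 \<le> q \<and> p + q = k}. (H p *\<^sub>v x ^\<^sub>\<otimes> p) \<bullet> (H q *\<^sub>v x ^\<^sub>\<otimes> q))"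
  have V2: "V 2 \<in> carrier_mat n n" using V[of 2] k by auto
  have Vk: "V k \<in> carrier_mat n (n ^ (k - 1))" and vk: "v k = vectorize (V k)" using V[of k] k by auto
  have c1: "(\<Sum>(i, p)\<in>{(i, p). 2 \<le> i \<and> 1 \<le> p \<and> i + p = k + 1}.
            real i / 2 * ((V i *\<^sub>v x ^\<^sub>\<otimes> (i - 1)) \<bullet> ((F(1 := A)) p *\<^sub>v x ^\<^sub>\<otimes> p))) = (real k * a0 + s1) / 2"
  proof -
    let ?S = "{(i, p). 2 \<le> i \<and> 2 \<le> p \<and> i + p = k + 1}"
    have f: "finite ?S" by (rule finite_subset[of _ "{..k + 1} \<times> {..k + 1}"]) auto
    have e: "{(i, p). 2 \<le> i \<and> 1 \<le> p \<and> i + p = k + 1} = insert (k, 1) ?S" using k by auto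
    have "(\<Sum>(i, p)\<in>?S. real i / 2 * ((V i *\<^sub>v x ^\<^sub>\<otimes> (i - 1)) \<bullet> ((F(1 := A)) p *\<^sub>v x ^\<^sub>\<otimes> p))) = (\<Sum>(i, p)\<in>?S. real i * P i p / 2)"
      by (rule sum.cong[OF refl]) (auto simp: P_def)
    also have "\<dots> = s1 / 2" unfolding s1_def sum_divide_distrib by (simp add: case_prod_beta)
    finally show ?thesis unfolding e using f by (subst sum.insert) (auto simp: a0_def add_divide_distrib)
  qed
  have it_zero: "T p q i j = 0" if "2 * l < p + q" "2 \<le> i" "2 \<le> j" "i + j + (p + q) = k + 2" for p q i j
  proof -
    have Vi: "V i \<in> carrier_mat n (n^(i-1))" and Vj: "V j \<in> carrier_mat n (n^(j-1))" using V[of i] V[of j] that by auto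
    have c: "input_term m G V x a b \<in> carrier_vec m" for a b by (rule input_term_carrier)
    show ?thesis
    proof (cases "l < p")
      case True
      hence "input_term m G V x p i = 0\<^sub>v m" using input_term_zero[of G p n m V i x] G_zero Vi x by simp
      thus ?thesis using c[of q j] by (simp add: T_def)
    next
      case False
      hence "l < q" using that(1) by linarith
      hence "input_term m G V x q j = 0\<^sub>v m" using input_term_zero[of G q n m V j x] G_zero Vj x by simp
      thus ?thesis using c[of p i] by (simp add: T_def)
    qed
  qed
  have c2: "(\<Sum>((p, i), (q, j))\<in>{((p, i), (q, j)). 2 \<le> i \<and> 2 \<le> j \<and> p + q + i + j = k + 2}.
            real i / 2 * (real j / 2) * (input_term m G V x p i \<bullet> input_term m G V x q j)) = (4 * real k * b0 + s2 + s4) / 4"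
  proof -
    \<comment> \<open>Covers both the values of a that occur and the fixed range up to 2 l of the
      stated sum.\<close>
    define N where "N = max k (2 * l)"
    define R where "R a = (\<Sum>(p, q)\<in>{(p, q). p + q = a}. \<Sum>(i, j)\<in>{(i, j). 2 \<le> i \<and> 2 \<le> j \<and> i + j + a = k + 2}. T p q i j)" for a
    have "(\<Sum>((p, i), (q, j))\<in>{((p, i), (q, j)). 2 \<le> i \<and> 2 \<le> j \<and> p + q + i + j = k + 2}.
            real i / 2 * (real j / 2) * (input_term m G V x p i \<bullet> input_term m G V x q j))
       = (\<Sum>((p, i), (q, j))\<in>{((p, i), (q, j)). 2 \<le> i \<and> 2 \<le> j \<and> p + q + i + j = k + 2}. T p q i j / 4)"
      by (rule sum.cong[OF refl]) (auto simp: T_def)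
    also have "\<dots> = (\<Sum>((p, i), (q, j))\<in>{((p, i), (q, j)). 2 \<le> i \<and> 2 \<le> j \<and> p + q + i + j = k + 2}. T p q i j) / 4"
      unfolding sum_divide_distrib by (simp add: case_prod_beta)
    also have "(\<Sum>((p, i), (q, j))\<in>{((p, i), (q, j)). 2 \<le> i \<and> 2 \<le> j \<and> p + q + i + j = k + 2}. T p q i j) = (\<Sum>a\<in>{0..N}. R a)"
      unfolding R_def by (rule sum_antidiagonal_quadruples) (simp add: N_def)
    also have "\<dots> = R 0 + (\<Sum>a\<in>{1..N}. R a)" by (simp add: sum.atLeast_Suc_atMost)
    \<comment> \<open>For a > 2 l one of p and q exceeds l, and the corresponding G is zero.\<close>
    also have "(\<Sum>a\<in>{1..N}. R a) = (\<Sum>a\<in>{1..2 * l}. R a)"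
    proof (rule sum.mono_neutral_right)
      show "\<forall>a\<in>{1..N} - {1..2 * l}. R a = 0"
        unfolding R_def by (intro ballI sum.neutral) (auto intro!: sum.neutral it_zero)
    qed (auto simp: N_def)
    also have "\<dots> = s4" unfolding s4_def R_def ..
    also have "R 0 = 4 * real k * b0 + s2"
    proof -
      let ?S = "{(i, j). 2 < i \<and> 2 < j \<and> i + j = k + 2}"
      have f: "finite ?S" by (rule finite_subset[of _ "{..k + 2} \<times> {..k + 2}"]) auto
      \<comment> \<open>Since k \<ge> 3, the pairs (2, k) and (k, 2) are different; this yields the
        factor 2 in front of the mixed term.\<close>
      have e: "{(i, j). 2 \<le> i \<and> 2 \<le> j \<and> i + j + 0 = k + 2} = insert (2, k) (insert (k, 2) ?S)" using k by auto
      have z: "{(p, q). p + q = (0::nat)} = {(0, 0)}" by auto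
      have "T 0 0 k 2 = T 0 0 2 k"
        unfolding T_def using comm_scalar_prod[OF input_term_carrier input_term_carrier, of m G V x 0 k G V x 0 2] by (simp add: mult.commute)
      moreover have "T 0 0 2 k = 2 * real k * b0" by (simp add: T_def b0_def)
      ultimately show ?thesis unfolding R_def z e s2_def using k f by simp
    qed
    finally show ?thesis .
  qed
  have main: "real k * a0 + real k * b0 + s1 + s2 / 4 + s4 / 4 - \<eta> * s3 = 0"
    using hom unfolding c1 c2 s3_def[symmetric] by (simp add: field_simps)
  have Vx: "V k *\<^sub>v x ^\<^sub>\<otimes> (k - 1) \<in> carrier_vec n" using Vk kron_pow_carrier[OF x] by (rule mult_mat_vec_carrier)
  have BB: "B * B\<^sup>T \<in> carrier_mat n n" using B by simp
  have Ac: "A + B * B\<^sup>T * V 2 \<in> carrier_mat n n" by (rule add_carrier_mat[OF mult_carrier_mat[OF BB V2]])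
  have Acx: "(A + B * B\<^sup>T * V 2) *\<^sub>v x \<in> carrier_vec n" using Ac x by (rule mult_mat_vec_carrier)
  have G0': "G 0 \<in> carrier_mat n m" using B G0 by simp
  have V2': "V 2 \<in> carrier_mat n (n ^ (2 - 1))" using V2 by simp
  have "v k \<bullet> dkron n k x ((A + B * B\<^sup>T * V 2) *\<^sub>v x)
      = real k * (((A + B * B\<^sup>T * V 2) *\<^sub>v x) \<bullet> (V k *\<^sub>v x ^\<^sub>\<otimes> (k - 1)))"
    by (rule symmetric_vectorize_dkron[OF sym Vk vk x Acx]) (use k in auto)
  also have "\<dots> = real k * (a0 + b0)"
    unfolding closed_matrix_scalar_prod[OF A B V2 x Vx] a0_def b0_def
      input_term_0[of G n m V k x, OF G0' Vk x] input_term_0[of G n m V 2 x, OF G0' V2' x] by (simp add: G0)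
  also have "\<dots> = - s1 - 1/4 * s2 + \<eta> * s3 - 1/4 * s4" using main by (simp add: algebra_simps)
  also have "\<dots> = past_rhs n m l \<eta> F G H v V k \<bullet> x ^\<^sub>\<otimes> k"
    unfolding s1_def s2_def s3_def s4_def P_def T_def
    by (rule past_rhs_scalar_prod[of F n G m H r k V v x l \<eta>, OF F G H V sym x, symmetric])
  finally show ?thesis .
qed

section \<open>Linearization of the closed loop\<close>

text \<open>Neighbourhoods of the origin among vectors of dimension n, as a filter, so that
  remainders can be handled by the calculus of big O.\<close>

definition near_0 :: "nat \<Rightarrow> real vec filter" where
  "near_0 n = (INF \<rho>\<in>{0<..}. principal {x \<in> carrier_vec n. vnorm x < \<rho>})"

lemma eventually_near_0:
  "eventually P (near_0 n) \<longleftrightarrow> (\<exists>\<rho>>0. \<forall>x\<in>carrier_vec n. vnorm x < \<rho> \<longrightarrow> P x)"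
  unfolding near_0_def
proof (subst eventually_INF_base)
  show "{0<..} \<noteq> ({} :: real set)" by (rule greaterThan_non_empty)
next
  fix a b :: real assume "a \<in> {0<..}" "b \<in> {0<..}"
  thus "\<exists>x\<in>{0<..}. principal {xa \<in> carrier_vec n. vnorm xa < x}
     \<le> inf (principal {x \<in> carrier_vec n. vnorm (x :: real vec) < a}) (principal {x \<in> carrier_vec n. vnorm x < b})"
    by (intro bexI[of _ "min a b"]) auto
qed (auto simp: eventually_principal)

lemma near_0_bigoI:
  assumes "0 < \<rho>" "\<And>x. x \<in> carrier_vec n \<Longrightarrow> vnorm x < \<rho> \<Longrightarrow> \<bar>\<phi> x\<bar> \<le> K * vnorm x ^ k"
  shows "\<phi> \<in> O[near_0 n](\<lambda>x. vnorm x ^ k)"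
  by (rule bigoI[of _ K]) (use assms in \<open>auto simp: eventually_near_0\<close>)

lemma near_0_bigo_mono:
  assumes "j \<le> k" "\<phi> \<in> O[near_0 n](\<lambda>x. vnorm x ^ k)"
  shows "\<phi> \<in> O[near_0 n](\<lambda>x. vnorm x ^ j)"
proof (rule landau_o.big_trans[OF assms(2)])
  show "(\<lambda>x. vnorm x ^ k) \<in> O[near_0 n](\<lambda>x. vnorm x ^ j)"
    by (rule near_0_bigoI[of 1 _ _ 1]) (use assms(1) in \<open>auto intro!: power_decreasing\<close>)
qed

lemma near_0_bigo_mult:
  assumes "\<phi> \<in> O[near_0 n](\<lambda>x. vnorm x ^ j)" "\<psi> \<in> O[near_0 n](\<lambda>x. vnorm x ^ k)"
  shows "(\<lambda>x. \<phi> x * \<psi> x) \<in> O[near_0 n](\<lambda>x. vnorm x ^ (j + k))"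
  using landau_o.big.mult[OF assms] by (simp add: power_add)

lemma near_0_bigo_const: "(\<lambda>x. c) \<in> O[near_0 n](\<lambda>x. vnorm x ^ 0)"
  by (rule near_0_bigoI[of 1 _ _ "\<bar>c\<bar>"]) auto

text \<open>The matrix identities hold on the carrier only, and the filter looks at nothing
  else.\<close>

lemma near_0_bigo_cong:
  assumes "\<And>x. x \<in> carrier_vec n \<Longrightarrow> \<phi> x = \<psi> x" "\<psi> \<in> O[near_0 n](g)"
  shows "\<phi> \<in> O[near_0 n](g)"
proof -
  have "eventually (\<lambda>x. \<phi> x = \<psi> x) (near_0 n)" unfolding eventually_near_0 using assms(1) by (intro exI[of _ 1]) auto
  thus ?thesis using assms(2) by (simp add: landau_o.big.in_cong)
qed

lemma kron_pow_bigo: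
  assumes j: "j < n ^ p"
  shows "(\<lambda>x. (x ^\<^sub>\<otimes> p) $ j) \<in> O[near_0 n](\<lambda>x. vnorm x ^ p)"
proof (rule near_0_bigoI[of 1 _ _ 1])
  fix x :: "real vec" assume x: "x \<in> carrier_vec n"
  have "\<bar>(x ^\<^sub>\<otimes> p) $ j\<bar> \<le> vnorm x ^ p"
    by (rule abs_kron_pow_index_le[OF x _ j]) (use abs_index_le_vnorm[of _ x] x in auto)
  thus "\<bar>(x ^\<^sub>\<otimes> p) $ j\<bar> \<le> 1 * vnorm x ^ p" by simp
qed simp

lemma mult_kron_pow_bigo:
  assumes M: "M \<in> carrier_mat r (n ^ p)" and i: "i < r"
  shows "(\<lambda>x. (M *\<^sub>v x ^\<^sub>\<otimes> p) $ i) \<in> O[near_0 n](\<lambda>x. vnorm x ^ p)"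
proof (rule near_0_bigo_cong)
  show "(M *\<^sub>v x ^\<^sub>\<otimes> p) $ i = (\<Sum>j<n ^ p. M $$ (i, j) * (x ^\<^sub>\<otimes> p) $ j)" if "x \<in> carrier_vec n" for x
    by (rule mult_mat_vec_sum[OF M kron_pow_carrier[OF that] i])
  show "(\<lambda>x. \<Sum>j<n ^ p. M $$ (i, j) * (x ^\<^sub>\<otimes> p) $ j) \<in> O[near_0 n](\<lambda>x. vnorm x ^ p)"
    by (rule big_sum_in_bigo, rule near_0_bigo_mult[of _ _ 0, simplified add_0, OF near_0_bigo_const kron_pow_bigo]) simp
qed

lemma drift_bigo:
  assumes A: "A \<in> carrier_mat n n" and F: "\<And>p. F p \<in> carrier_mat n (n^p)" and i: "i < n"
  shows "(\<lambda>x. drift A F l x $ i - (A *\<^sub>v x) $ i) \<in> O[near_0 n](\<lambda>x. vnorm x ^ 2)"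
proof (rule near_0_bigo_cong)
  show "drift A F l x $ i - (A *\<^sub>v x) $ i = (\<Sum>p\<in>{2..l}. (F p *\<^sub>v x ^\<^sub>\<otimes> p) $ i)" if "x \<in> carrier_vec n" for x
    using A i by (simp add: drift_def vec_sum_def del: index_mult_mat_vec)
  show "(\<lambda>x. \<Sum>p\<in>{2..l}. (F p *\<^sub>v x ^\<^sub>\<otimes> p) $ i) \<in> O[near_0 n](\<lambda>x. vnorm x ^ 2)"
    by (rule big_sum_in_bigo, rule near_0_bigo_mono[OF _ mult_kron_pow_bigo[OF F i]]) simp
qed

lemma input_mat_bigo:
  assumes B: "B \<in> carrier_mat n m" and G: "\<And>p. G p \<in> carrier_mat n (m * n^p)" and i: "i < n" and a: "a < m"
  shows "(\<lambda>x. input_mat B G l x $$ (i, a) - B $$ (i, a)) \<in> O[near_0 n](\<lambda>x. vnorm x ^ 1)"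
proof (rule near_0_bigo_cong)
  show "input_mat B G l x $$ (i, a) - B $$ (i, a)
      = (\<Sum>p\<in>{1..l}. \<Sum>j<m * n ^ p. G p $$ (i, j) * (1\<^sub>m m $$ (j mod m, a) * (x ^\<^sub>\<otimes> p) $ (j div m)))" (is "?L = ?R")
    if x: "x \<in> carrier_vec n" for x
  proof -
    have "?L = (\<Sum>p\<in>{1..l}. (G p * (col_mat (x ^\<^sub>\<otimes> p) \<otimes>\<^sub>m 1\<^sub>m m)) $$ (i, a))"
      using B i a by (simp add: input_mat_def mat_sum_def)
    also have "\<dots> = ?R"
    proof (rule sum.cong[OF refl])
      fix p
      have c: "col_mat (x ^\<^sub>\<otimes> p) \<otimes>\<^sub>m 1\<^sub>m m \<in> carrier_mat (m * n ^ p) m"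
        using x by (auto simp: kron_def col_mat_def mult.commute)
      have e: "(col_mat (x ^\<^sub>\<otimes> p) \<otimes>\<^sub>m 1\<^sub>m m) $$ (j, a) = 1\<^sub>m m $$ (j mod m, a) * (x ^\<^sub>\<otimes> p) $ (j div m)" if j: "j < m * n ^ p" for j
        using x j a by (auto simp: kron_def col_mat_def mult.commute mat_of_cols_index less_mult_imp_div_less)
      have "(G p * (col_mat (x ^\<^sub>\<otimes> p) \<otimes>\<^sub>m 1\<^sub>m m)) $$ (i, a) = row (G p) i \<bullet> col (col_mat (x ^\<^sub>\<otimes> p) \<otimes>\<^sub>m 1\<^sub>m m) a"
        by (rule index_mult_mat(1)) (use carrier_matD[OF G[of p]] carrier_matD[OF c] i a in simp_all)
      also have "\<dots> = (\<Sum>j<m * n ^ p. G p $$ (i, j) * (1\<^sub>m m $$ (j mod m, a) * (x ^\<^sub>\<otimes> p) $ (j div m)))"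
        unfolding scalar_prod_def dim_col carrier_matD[OF c] atLeast0LessThan
      proof (rule sum.cong[OF refl])
        fix j assume "j \<in> {..<m * n ^ p}"
        hence j: "j < m * n ^ p" by simp
        have "row (G p) i $ j = G p $$ (i, j)" using carrier_matD[OF G[of p]] i j by simp
        moreover have "col (col_mat (x ^\<^sub>\<otimes> p) \<otimes>\<^sub>m 1\<^sub>m m) a $ j = (col_mat (x ^\<^sub>\<otimes> p) \<otimes>\<^sub>m 1\<^sub>m m) $$ (j, a)"
          by (rule index_col) (use carrier_matD[OF c] a j in \<open>simp_all add: mult.commute\<close>)
        ultimately show "row (G p) i $ j * col (col_mat (x ^\<^sub>\<otimes> p) \<otimes>\<^sub>m 1\<^sub>m m) a $ j
          = G p $$ (i, j) * (1\<^sub>m m $$ (j mod m, a) * (x ^\<^sub>\<otimes> p) $ (j div m))"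
          using e[OF j] by simp
      qed
      finally show "(G p * (col_mat (x ^\<^sub>\<otimes> p) \<otimes>\<^sub>m 1\<^sub>m m)) $$ (i, a) = \<dots>" .
    qed
    finally show ?thesis .
  qed
  show "(\<lambda>x. \<Sum>p\<in>{1..l}. \<Sum>j<m * n ^ p. G p $$ (i, j) * (1\<^sub>m m $$ (j mod m, a) * (x ^\<^sub>\<otimes> p) $ (j div m)))
     \<in> O[near_0 n](\<lambda>x. vnorm x ^ 1)"
  proof (intro big_sum_in_bigo)
    fix p j assume p: "p \<in> {1..l}" and j: "j \<in> {..<m * n ^ p}"
    have "j div m < n ^ p" using j by (simp add: less_mult_imp_div_less mult.commute)
    from near_0_bigo_mult[OF near_0_bigo_const near_0_bigo_mult[OF near_0_bigo_const kron_pow_bigo[OF this]]]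
    have "(\<lambda>x. G p $$ (i, j) * (1\<^sub>m m $$ (j mod m, a) * (x ^\<^sub>\<otimes> p) $ (j div m))) \<in> O[near_0 n](\<lambda>x. vnorm x ^ p)" by simp
    thus "(\<lambda>x. G p $$ (i, j) * (1\<^sub>m m $$ (j mod m, a) * (x ^\<^sub>\<otimes> p) $ (j div m))) \<in> O[near_0 n](\<lambda>x. vnorm x ^ 1)"
      by (rule near_0_bigo_mono[rotated]) (use p in simp)
  qed
qed

lemma gradient_bigo:
  assumes taylor: "energy_taylor_coeffs n d E v" and d: "2 \<le> d"
    and V: "\<And>i. 2 \<le> i \<Longrightarrow> i \<le> d \<Longrightarrow> V i \<in> carrier_mat n (n^(i-1)) \<and> v i = vectorize (V i)"
    and i: "i < n"
  shows "(\<lambda>x. gradient n E x $ i - (V 2 *\<^sub>v x) $ i) \<in> O[near_0 n](\<lambda>x. vnorm x ^ 2)"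
proof -
  have "\<exists>\<rho>>0. \<exists>K\<ge>0. \<forall>x\<in>carrier_vec n. vnorm x < \<rho> \<longrightarrow> (\<forall>i<n.
     \<bar>gradient n E x $ i - (\<Sum>k\<in>{2..2}. real k / 2 * (V k *\<^sub>v x ^\<^sub>\<otimes> (k - 1)) $ i)\<bar> \<le> K * vnorm x ^ 2)"
    by (rule gradient_taylor_remainder[OF taylor d V])
  then obtain \<rho> K where \<rho>: "0 < \<rho>" and "0 \<le> K" and
    b: "\<forall>x\<in>carrier_vec n. vnorm x < \<rho> \<longrightarrow> (\<forall>i<n.
     \<bar>gradient n E x $ i - (\<Sum>k\<in>{2..2}. real k / 2 * (V k *\<^sub>v x ^\<^sub>\<otimes> (k - 1)) $ i)\<bar> \<le> K * vnorm x ^ 2)"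
    by (elim exE conjE) (rule that)
  show ?thesis
  proof (rule near_0_bigoI[OF \<rho>])
    fix x :: "real vec" assume "x \<in> carrier_vec n" "vnorm x < \<rho>"
    from b[rule_format, OF this i]
    show "\<bar>gradient n E x $ i - (V 2 *\<^sub>v x) $ i\<bar> \<le> K * vnorm x ^ 2" by (simp del: index_mult_mat_vec)
  qed
qed

text \<open>Replacing the factors of \<open>g g\<^sup>T \<nabla>E\<close> one at a time by their leading parts costs a second order term each.\<close>

lemma closed_loop_linearization:
  assumes A: "A \<in> carrier_mat n n" and B: "B \<in> carrier_mat n m"
    and F: "\<And>p. F p \<in> carrier_mat n (n^p)" and G: "\<And>p. G p \<in> carrier_mat n (m * n^p)"
    and taylor: "energy_taylor_coeffs n d E v" and d: "2 \<le> d"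
    and V: "\<And>i. 2 \<le> i \<Longrightarrow> i \<le> d \<Longrightarrow> V i \<in> carrier_mat n (n^(i-1)) \<and> v i = vectorize (V i)"
    and \<Phi>: "\<Phi> = (\<lambda>x. - drift A F l x - (input_mat B G l x * (input_mat B G l x)\<^sup>T) *\<^sub>v gradient n E x)"
  shows "\<exists>\<rho>>0. \<exists>K. \<forall>x\<in>carrier_vec n. vnorm x < \<rho> \<longrightarrow>
    \<Phi> x \<in> carrier_vec n \<and> vnorm (\<Phi> x - (- (A + B * B\<^sup>T * V 2)) *\<^sub>v x) \<le> K * (vnorm x)\<^sup>2"
proof -
  let ?g = "input_mat B G l" and ?e = "gradient n E" and ?M = "- (A + B * B\<^sup>T * V 2)"
  have V2: "V 2 \<in> carrier_mat n n" using V[of 2] d by simp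
  have M: "?M \<in> carrier_mat n n"
    by (rule uminus_carrier_mat[OF add_carrier_mat[OF mult_carrier_mat[OF mult_carrier_mat[OF B transpose_carrier_mat[THEN iffD2, OF B]] V2]]])
  have gc: "?g x \<in> carrier_mat n m" for x using carrier_matD[OF B] by (intro carrier_matI) (simp_all add: input_mat_def mat_sum_def)
  have ec: "?e x \<in> carrier_vec n" for x by (simp add: gradient_def)
  have gge: "(?g x * (?g x)\<^sup>T) *\<^sub>v ?e x = ?g x *\<^sub>v ((?g x)\<^sup>T *\<^sub>v ?e x)" for x
    by (rule assoc_mult_mat_vec[OF gc transpose_carrier_mat[THEN iffD2, OF gc] ec])
  have fc: "drift A F l x \<in> carrier_vec n" for x using carrier_matD[OF A] by (intro carrier_vecI) (simp add: drift_def vec_sum_def)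
  have ggec: "(?g x * (?g x)\<^sup>T) *\<^sub>v ?e x \<in> carrier_vec n" for x
    by (rule mult_mat_vec_carrier[OF mult_carrier_mat[OF gc transpose_carrier_mat[THEN iffD2, OF gc]] ec])
  have \<Phi>c: "\<Phi> x \<in> carrier_vec n" for x unfolding \<Phi> by (rule minus_carrier_vec[OF uminus_carrier_vec[THEN iffD2, OF fc] ggec])
  have expand: "(P *\<^sub>v (P\<^sup>T *\<^sub>v z)) $ i = (\<Sum>a<m. \<Sum>b<n. P $$ (i, a) * (P $$ (b, a) * z $ b))"
    if P: "P \<in> carrier_mat n m" and z: "z \<in> carrier_vec n" and i: "i < n" for P :: "real mat" and z i
  proof -
    have PT: "P\<^sup>T \<in> carrier_mat m n" using P by simp
    show ?thesis unfolding mult_mat_vec_sum[OF P mult_mat_vec_carrier[OF PT z] i]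
      by (rule sum.cong[OF refl]) (use P in \<open>simp add: mult_mat_vec_sum[OF PT z] sum_distrib_left del: index_mult_mat_vec\<close>)
  qed
  have comp: "(\<lambda>x. (\<Phi> x - ?M *\<^sub>v x) $ i) \<in> O[near_0 n](\<lambda>x. vnorm x ^ 2)" if i: "i < n" for i
  proof (rule near_0_bigo_cong)
    fix x :: "real vec" assume x: "x \<in> carrier_vec n"
    have Vx: "V 2 *\<^sub>v x \<in> carrier_vec n" using V2 x by (rule mult_mat_vec_carrier)
    have Ax: "A *\<^sub>v x \<in> carrier_vec n" using A x by (rule mult_mat_vec_carrier)
    have BT: "B\<^sup>T \<in> carrier_mat m n" using B by simp
    have Bw: "B *\<^sub>v (B\<^sup>T *\<^sub>v (V 2 *\<^sub>v x)) \<in> carrier_vec n"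
      by (rule mult_mat_vec_carrier[OF B mult_mat_vec_carrier[OF BT Vx]])
    have Mx: "(?M *\<^sub>v x) $ i = - ((A *\<^sub>v x) $ i) - (B *\<^sub>v (B\<^sup>T *\<^sub>v (V 2 *\<^sub>v x))) $ i"
    proof -
      have "?M *\<^sub>v x = - ((A + B * B\<^sup>T * V 2) *\<^sub>v x)"
        by (rule uminus_mult_mat_vec) (use carrier_matD[OF V2] x in simp)
      also have "\<dots> = - (A *\<^sub>v x + B *\<^sub>v (B\<^sup>T *\<^sub>v (V 2 *\<^sub>v x)))" unfolding closed_matrix_mult[OF A B V2 x] ..
      finally show ?thesis using i carrier_vecD[OF Ax] carrier_vecD[OF Bw] by (simp del: index_mult_mat_vec dim_mult_mat_vec)
    qed
    have "(\<Phi> x - ?M *\<^sub>v x) $ i = \<Phi> x $ i - (?M *\<^sub>v x) $ i"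
      using i carrier_vecD[OF mult_mat_vec_carrier[OF M x]] by (simp del: index_mult_mat_vec dim_mult_mat_vec)
    also have "\<Phi> x $ i = - drift A F l x $ i - (?g x *\<^sub>v ((?g x)\<^sup>T *\<^sub>v ?e x)) $ i"
      unfolding \<Phi> gge[symmetric] using i carrier_vecD[OF fc] carrier_vecD[OF ggec] by (simp del: index_mult_mat_vec dim_mult_mat_vec)
    finally have e: "(\<Phi> x - ?M *\<^sub>v x) $ i = - (drift A F l x $ i - (A *\<^sub>v x) $ i)
      - ((?g x *\<^sub>v ((?g x)\<^sup>T *\<^sub>v ?e x)) $ i - (B *\<^sub>v (B\<^sup>T *\<^sub>v (V 2 *\<^sub>v x))) $ i)" unfolding Mx by linarith
    \<comment> \<open>The telescoping identity that exchanges e, g2 and g1 for w, b2 and b1 in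
      turn.\<close>
    have split: "g1 * (g2 * (e - w)) + (g1 * ((g2 - b2) * w) + (g1 - b1) * (b2 * w)) = g1 * (g2 * e) - b1 * (b2 * w)"
      for g1 g2 e w b1 b2 :: real by (simp add: algebra_simps)
    show "(\<Phi> x - ?M *\<^sub>v x) $ i = - (drift A F l x $ i - (A *\<^sub>v x) $ i)
      - (\<Sum>a<m. \<Sum>b<n. ?g x $$ (i, a) * (?g x $$ (b, a) * (?e x $ b - (V 2 *\<^sub>v x) $ b))
           + (?g x $$ (i, a) * ((?g x $$ (b, a) - B $$ (b, a)) * (V 2 *\<^sub>v x) $ b)
           + (?g x $$ (i, a) - B $$ (i, a)) * (B $$ (b, a) * (V 2 *\<^sub>v x) $ b)))"
      unfolding e expand[OF gc ec i] expand[OF B Vx i]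
      by (simp only: split sum_subtractf)
  next
    have g1: "(\<lambda>x. ?g x $$ (b, a) - B $$ (b, a)) \<in> O[near_0 n](\<lambda>x. vnorm x ^ 1)" if "a < m" "b < n" for a b
      by (rule input_mat_bigo[OF B G that(2,1)])
    have g0: "(\<lambda>x. ?g x $$ (b, a)) \<in> O[near_0 n](\<lambda>x. vnorm x ^ 0)" if "a < m" "b < n" for a b
      using sum_in_bigo(1)[OF near_0_bigo_mono[OF _ g1[OF that], of 0] near_0_bigo_const[of "B $$ (b, a)"]] by simp
    have e2: "(\<lambda>x. ?e x $ b - (V 2 *\<^sub>v x) $ b) \<in> O[near_0 n](\<lambda>x. vnorm x ^ 2)" if "b < n" for b
      by (rule gradient_bigo[of n d E v V, OF taylor d V that])
    have V1: "(\<lambda>x. (V 2 *\<^sub>v x) $ b) \<in> O[near_0 n](\<lambda>x. vnorm x ^ 1)" if "b < n" for b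
      using mult_kron_pow_bigo[of "V 2" n n 1, OF _ that] V2 by (simp del: index_mult_mat_vec)
    show "(\<lambda>x. - (drift A F l x $ i - (A *\<^sub>v x) $ i)
      - (\<Sum>a<m. \<Sum>b<n. ?g x $$ (i, a) * (?g x $$ (b, a) * (?e x $ b - (V 2 *\<^sub>v x) $ b))
           + (?g x $$ (i, a) * ((?g x $$ (b, a) - B $$ (b, a)) * (V 2 *\<^sub>v x) $ b)
           + (?g x $$ (i, a) - B $$ (i, a)) * (B $$ (b, a) * (V 2 *\<^sub>v x) $ b)))) \<in> O[near_0 n](\<lambda>x. vnorm x ^ 2)"
    proof (intro sum_in_bigo big_sum_in_bigo)
      show "(\<lambda>x. - (drift A F l x $ i - (A *\<^sub>v x) $ i)) \<in> O[near_0 n](\<lambda>x. vnorm x ^ 2)"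
        using drift_bigo[OF A F i, of l] by (simp only: landau_o.big.uminus_in_iff)
    next
      fix a b assume "a \<in> {..<m}" "b \<in> {..<n}"
      hence ab: "a < m" "b < n" by auto
      show "(\<lambda>x. ?g x $$ (i, a) * (?g x $$ (b, a) * (?e x $ b - (V 2 *\<^sub>v x) $ b))) \<in> O[near_0 n](\<lambda>x. vnorm x ^ 2)"
        using near_0_bigo_mult[OF g0[OF ab(1) i] near_0_bigo_mult[OF g0[OF ab] e2[OF ab(2)]]] by (simp only: add_0)
      show "(\<lambda>x. ?g x $$ (i, a) * ((?g x $$ (b, a) - B $$ (b, a)) * (V 2 *\<^sub>v x) $ b)) \<in> O[near_0 n](\<lambda>x. vnorm x ^ 2)"
        using near_0_bigo_mult[OF g0[OF ab(1) i] near_0_bigo_mult[OF g1[OF ab] V1[OF ab(2)]]] by (simp only: add_0 one_add_one)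
      show "(\<lambda>x. (?g x $$ (i, a) - B $$ (i, a)) * (B $$ (b, a) * (V 2 *\<^sub>v x) $ b)) \<in> O[near_0 n](\<lambda>x. vnorm x ^ 2)"
        using near_0_bigo_mult[OF g1[OF ab(1) i] near_0_bigo_mult[OF near_0_bigo_const V1[OF ab(2)]]] by (simp only: add_0 one_add_one)
    qed
  qed
  have "(\<lambda>x. \<Sum>i<n. \<bar>(\<Phi> x - ?M *\<^sub>v x) $ i\<bar>) \<in> O[near_0 n](\<lambda>x. vnorm x ^ 2)"
    by (rule big_sum_in_bigo) (use comp in \<open>simp del: index_minus_vec index_mult_mat_vec\<close>)
  then obtain K where "eventually (\<lambda>x. norm (\<Sum>i<n. \<bar>(\<Phi> x - ?M *\<^sub>v x) $ i\<bar>) \<le> K * norm (vnorm x ^ 2)) (near_0 n)"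
    by (elim landau_o.bigE)
  then obtain \<rho> where \<rho>: "0 < \<rho>" and b: "\<forall>x\<in>carrier_vec n. vnorm x < \<rho> \<longrightarrow> norm (\<Sum>i<n. \<bar>(\<Phi> x - ?M *\<^sub>v x) $ i\<bar>) \<le> K * norm (vnorm x ^ 2)"
    unfolding eventually_near_0 by (elim exE conjE) (rule that)
  have "vnorm (\<Phi> x - ?M *\<^sub>v x) \<le> K * (vnorm x)\<^sup>2" if x: "x \<in> carrier_vec n" "vnorm x < \<rho>" for x
  proof -
    have "dim_vec (\<Phi> x - ?M *\<^sub>v x) = n" using carrier_vecD[OF mult_mat_vec_carrier[OF M x(1)]] by (simp del: dim_mult_mat_vec)
    hence "vnorm (\<Phi> x - ?M *\<^sub>v x) \<le> (\<Sum>i<n. \<bar>(\<Phi> x - ?M *\<^sub>v x) $ i\<bar>)" using vnorm_le_sum[of "\<Phi> x - ?M *\<^sub>v x"] by (simp only:)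
    moreover have "(\<Sum>i<n. \<bar>(\<Phi> x - ?M *\<^sub>v x) $ i\<bar>) \<le> K * norm (vnorm x ^ 2)"
      by (rule order_trans[OF _ b[rule_format, OF x]]) (simp only: real_norm_def abs_ge_self)
    ultimately have "vnorm (\<Phi> x - ?M *\<^sub>v x) \<le> K * norm (vnorm x ^ 2)" by (rule order_trans)
    thus ?thesis by simp
  qed
  thus ?thesis using \<rho> \<Phi>c by (intro exI[of _ \<rho>] conjI exI[of _ K] ballI impI)
qed

section \<open>Symmetry of V_2 and the Riccati equation as a quadratic form\<close>

lemma eigenvalue_uminus:
  assumes M: "M \<in> carrier_mat n n" and ev: "eigenvalue (cmat M) s"
  shows "eigenvalue (cmat (- M)) (- s)"
proof -
  obtain z where z: "z \<in> carrier_vec n" "z \<noteq> 0\<^sub>v n" and Mz: "cmat M *\<^sub>v z = s \<cdot>\<^sub>v z"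
    using ev M by (auto simp: eigenvalue_def eigenvector_def)
  have e: "cmat (- M) = - cmat M" by (rule eq_matI) (use M in auto)
  have "- cmat M *\<^sub>v z = - (cmat M *\<^sub>v z)" by (rule uminus_mult_mat_vec) (use M z in simp)
  also have "\<dots> = (- s) \<cdot>\<^sub>v z" unfolding Mz using z by auto
  finally show ?thesis unfolding eigenvalue_def eigenvector_def e using z M by auto
qed

text \<open>In degree 2 the derivative x \<otimes> y + y \<otimes> x is symmetric in the point and
  the direction, and it evaluates to twice the bilinear form of V.\<close>

lemma symmetric_coeff_2_transpose:
  assumes v: "symmetric_coeff n 2 v" and V: "V \<in> carrier_mat n n" "v = vectorize V"
  shows "V\<^sup>T = V"
proof (rule eq_matI)
  have V1: "V \<in> carrier_mat n (n ^ (2 - 1))" using V by simp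
  fix i j assume "i < dim_row V" "j < dim_col V"
  hence i: "i < n" and j: "j < n" using V by auto
  let ?x = "unit_vec n i :: real vec" and ?y = "unit_vec n j :: real vec"
  have two: "dkron n 2 x y = kron_vec y x + kron_vec x y" if "x \<in> carrier_vec n" "y \<in> carrier_vec n" for x y :: "real vec"
  proof -
    have z: "kron_vec x (0\<^sub>v (Suc 0)) = 0\<^sub>v n" using that by (auto simp: kron_vec_def)
    have "dkron n (Suc 0) x y = y" using that by (simp add: dkron_Suc dkron_0 z)
    thus ?thesis using that by (simp add: numeral_2_eq_2 dkron_Suc)
  qed
  have "dkron n 2 ?x ?y = dkron n 2 ?y ?x"
    by (simp add: two) (rule comm_add_vec[of _ "n * n"], auto intro!: carrier_vecI)
  hence "2 * (?y \<bullet> (V *\<^sub>v ?x)) = 2 * (?x \<bullet> (V *\<^sub>v ?y))"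
    using symmetric_vectorize_dkron[OF v V1 V(2), of ?x ?y] symmetric_vectorize_dkron[OF v V1 V(2), of ?y ?x]
    by (simp del: index_mult_mat_vec)
  moreover have "unit_vec n a \<bullet> (V *\<^sub>v unit_vec n b) = V $$ (a, b)" if "a < n" "b < n" for a b
    using V that by (simp add: scalar_prod_left_unit scalar_prod_right_unit)
  ultimately show "V\<^sup>T $$ (i, j) = V $$ (i, j)" using V i j by simp
qed (use V in auto)

text \<open>Polarization: the HJB equation only provides the diagonal values of the Riccati
  residual, and its symmetry recovers the matrix.\<close>

lemma quadratic_form_zero_imp_zero:
  fixes R :: "real mat"
  assumes R: "R \<in> carrier_mat n n"
    and sym: "\<And>x y. x \<in> carrier_vec n \<Longrightarrow> y \<in> carrier_vec n \<Longrightarrow> x \<bullet> (R *\<^sub>v y) = y \<bullet> (R *\<^sub>v x)"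
    and zero: "\<And>x. x \<in> carrier_vec n \<Longrightarrow> x \<bullet> (R *\<^sub>v x) = 0"
  shows "R = 0\<^sub>m n n"
proof (rule eq_matI)
  fix i j assume "i < dim_row (0\<^sub>m n n)" "j < dim_col (0\<^sub>m n n)"
  hence i: "i < n" and j: "j < n" by auto
  let ?x = "unit_vec n i :: real vec" and ?y = "unit_vec n j :: real vec"
  have c: "?x \<in> carrier_vec n" "?y \<in> carrier_vec n" by auto
  note Rc = mult_mat_vec_carrier[OF R c(1)] mult_mat_vec_carrier[OF R c(2)]
  have "0 = (?x + ?y) \<bullet> (R *\<^sub>v (?x + ?y))" using zero[of "?x + ?y"] c by (simp del: index_mult_mat_vec)
  also have "\<dots> = ?x \<bullet> (R *\<^sub>v ?x) + ?x \<bullet> (R *\<^sub>v ?y) + (?y \<bullet> (R *\<^sub>v ?x) + ?y \<bullet> (R *\<^sub>v ?y))"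
    unfolding mult_add_distrib_mat_vec[OF R c] add_scalar_prod_distrib[OF c add_carrier_vec[OF Rc]]
      scalar_prod_add_distrib[OF c(1) Rc] scalar_prod_add_distrib[OF c(2) Rc] ..
  also have "\<dots> = 2 * (?x \<bullet> (R *\<^sub>v ?y))" unfolding zero[OF c(1)] zero[OF c(2)] sym[OF c(2,1)] by simp
  also have "?x \<bullet> (R *\<^sub>v ?y) = R $$ (i, j)" using R i j by (simp add: scalar_prod_left_unit scalar_prod_right_unit)
  finally show "R $$ (i, j) = 0\<^sub>m n n $$ (i, j)" using i j by simp
qed (use R in auto)

lemma riccati_scalar_prod:
  fixes A B C V :: "real mat"
  assumes A: "A \<in> carrier_mat n n" and B: "B \<in> carrier_mat n m" and C: "C \<in> carrier_mat r n"
    and V: "V \<in> carrier_mat n n" "V\<^sup>T = V" and x: "x \<in> carrier_vec n" and y: "y \<in> carrier_vec n"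
  shows "x \<bullet> ((A\<^sup>T * V + V * A - \<eta> \<cdot>\<^sub>m (C\<^sup>T * C) + V * B * B\<^sup>T * V) *\<^sub>v y)
    = (A *\<^sub>v x) \<bullet> (V *\<^sub>v y) + (V *\<^sub>v x) \<bullet> (A *\<^sub>v y) - \<eta> * ((C *\<^sub>v x) \<bullet> (C *\<^sub>v y))
      + (B\<^sup>T *\<^sub>v (V *\<^sub>v x)) \<bullet> (B\<^sup>T *\<^sub>v (V *\<^sub>v y))"
proof -
  have AT: "A\<^sup>T \<in> carrier_mat n n" and BT: "B\<^sup>T \<in> carrier_mat m n" and CT: "C\<^sup>T \<in> carrier_mat n r" using A B C by auto
  note car = mult_carrier_mat mult_mat_vec_carrier
  have Vx: "V *\<^sub>v x \<in> carrier_vec n" and Vy: "V *\<^sub>v y \<in> carrier_vec n" and Ay: "A *\<^sub>v y \<in> carrier_vec n" and Cy: "C *\<^sub>v y \<in> carrier_vec r"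
    using mult_mat_vec_carrier[OF V(1) x] mult_mat_vec_carrier[OF V(1) y] mult_mat_vec_carrier[OF A y] mult_mat_vec_carrier[OF C y] .
  have BVy: "B\<^sup>T *\<^sub>v (V *\<^sub>v y) \<in> carrier_vec m" by (rule mult_mat_vec_carrier[OF BT Vy])
  have BBVy: "B *\<^sub>v (B\<^sup>T *\<^sub>v (V *\<^sub>v y)) \<in> carrier_vec n" by (rule mult_mat_vec_carrier[OF B BVy])
  have P1: "A\<^sup>T * V \<in> carrier_mat n n" and P2: "V * A \<in> carrier_mat n n" and P3: "C\<^sup>T * C \<in> carrier_mat n n"
    and VB: "V * B \<in> carrier_mat n m" and VBB: "V * B * B\<^sup>T \<in> carrier_mat n n" and P4: "V * B * B\<^sup>T * V \<in> carrier_mat n n"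
    using A B C V AT BT CT by auto
  have t: "x \<bullet> (V *\<^sub>v z) = (V *\<^sub>v x) \<bullet> z" if "z \<in> carrier_vec n" for z
    using transpose_vec_mult_scalar[OF V(1) that x] unfolding V(2) by simp
  have e1: "x \<bullet> ((A\<^sup>T * V) *\<^sub>v y) = (A *\<^sub>v x) \<bullet> (V *\<^sub>v y)"
    unfolding assoc_mult_mat_vec[OF AT V(1) y] using transpose_vec_mult_scalar[OF AT Vy x] by simp
  have e2: "x \<bullet> ((V * A) *\<^sub>v y) = (V *\<^sub>v x) \<bullet> (A *\<^sub>v y)"
    unfolding assoc_mult_mat_vec[OF V(1) A y] by (rule t[OF Ay])
  have e3: "x \<bullet> ((C\<^sup>T * C) *\<^sub>v y) = (C *\<^sub>v x) \<bullet> (C *\<^sub>v y)"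
    unfolding assoc_mult_mat_vec[OF CT C y] using transpose_vec_mult_scalar[OF CT Cy x] by simp
  have "(V * B * B\<^sup>T * V) *\<^sub>v y = V *\<^sub>v (B *\<^sub>v (B\<^sup>T *\<^sub>v (V *\<^sub>v y)))"
    unfolding assoc_mult_mat_vec[OF VBB V(1) y] assoc_mult_mat_vec[OF VB BT Vy] assoc_mult_mat_vec[OF V(1) B BVy] ..
  hence e4: "x \<bullet> ((V * B * B\<^sup>T * V) *\<^sub>v y) = (B\<^sup>T *\<^sub>v (V *\<^sub>v x)) \<bullet> (B\<^sup>T *\<^sub>v (V *\<^sub>v y))"
    using t[OF BBVy] transpose_vec_mult_scalar[OF B BVy Vx] by simp
  have c3: "\<eta> \<cdot>\<^sub>m (C\<^sup>T * C) \<in> carrier_mat n n" and c12: "A\<^sup>T * V + V * A \<in> carrier_mat n n"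
    using P1 P2 P3 by auto
  have c123: "A\<^sup>T * V + V * A - \<eta> \<cdot>\<^sub>m (C\<^sup>T * C) \<in> carrier_mat n n" by (rule minus_carrier_mat[OF c3])
  note yc = mult_mat_vec_carrier[OF _ y]
  have s3: "(\<eta> \<cdot>\<^sub>m (C\<^sup>T * C)) *\<^sub>v y = \<eta> \<cdot>\<^sub>v ((C\<^sup>T * C) *\<^sub>v y)"
    by (rule eq_vecI) (use carrier_matD[OF P3] y in auto)
  have gen: "x \<bullet> (a + b - \<eta> \<cdot>\<^sub>v c + e) = x \<bullet> a + x \<bullet> b - \<eta> * (x \<bullet> c) + x \<bullet> e"
    if "a \<in> carrier_vec n" "b \<in> carrier_vec n" "c \<in> carrier_vec n" "e \<in> carrier_vec n" for a b c e :: "real vec"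
    using x that by (simp add: scalar_prod_add_distrib[of _ n] scalar_prod_minus_distrib[of _ n])
  show ?thesis
    unfolding add_mult_distrib_mat_vec[OF c123 P4 y] minus_mult_distrib_mat_vec[OF c12 c3 y] add_mult_distrib_mat_vec[OF P1 P2 y]
      s3 gen[OF yc[OF P1] yc[OF P2] yc[OF P3] yc[OF P4]] e1 e2 e3 e4 ..
qed

theorem theorem1:
  fixes n m r l d :: nat
    and A B C :: "real mat" and F G H :: "nat \<Rightarrow> real mat"
    and f h :: "real vec \<Rightarrow> real vec" and g :: "real vec \<Rightarrow> real mat"
    and \<gamma> \<gamma>\<^sub>0 \<eta> :: real
    and E :: "real vec \<Rightarrow> real"
    and v :: "nat \<Rightarrow> real vec" and V :: "nat \<Rightarrow> real mat"
  assumes A: "A \<in> carrier_mat n n" and B: "B \<in> carrier_mat n m" and C: "C \<in> carrier_mat r n"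
    and F: "\<And>p. F p \<in> carrier_mat n (n^p)"
    and G: "\<And>p. G p \<in> carrier_mat n (m * n^p)"
    and H: "\<And>p. H p \<in> carrier_mat r (n^p)"
    and G0: "G 0 = B" and H1: "H 1 = C"
    and F_zero: "\<And>p. 2 \<le> p \<Longrightarrow> l < p \<Longrightarrow> F p = 0\<^sub>m n (n^p)"
    and G_zero: "\<And>p. 1 \<le> p \<Longrightarrow> l < p \<Longrightarrow> G p = 0\<^sub>m n (m * n^p)"
    and H_zero: "\<And>p. 2 \<le> p \<Longrightarrow> l < p \<Longrightarrow> H p = 0\<^sub>m r (n^p)"
    and f_def: "f = drift A F l" and g_def: "g = input_mat B G l" and h_def: "h = output_map C H l"
    and gamma0: "ereal \<gamma>\<^sub>0 = Hinf_optimal_level n m r A B C" "0 \<le> \<gamma>\<^sub>0"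
    and gamma: "\<gamma>\<^sub>0 < \<gamma>" "\<gamma> \<noteq> 1"
    and eta: "\<eta> = 1 - 1 / \<gamma>\<^sup>2"
    and past_energy: "is_past_energy n m f g h \<eta> E"
    and HJB: "solves_past_HJB n f g h \<eta> E"
    and E_zero: "E (0\<^sub>v n) = 0"
    and stable: "asymptotically_stable n (\<lambda>x. - f x - (g x * (g x)\<^sup>T) *\<^sub>v gradient n E x)"
    and analytic: "analytic_at_0 n E"
    and d: "2 \<le> d"
    and taylor: "energy_taylor_coeffs n d E v"
    and V: "\<And>i. 2 \<le> i \<Longrightarrow> i \<le> d \<Longrightarrow> V i \<in> carrier_mat n (n^(i-1)) \<and> v i = vectorize (V i)"
  shows "v 2 = vectorize (V 2) \<and> (V 2)\<^sup>T = V 2 \<and>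
      (\<forall>x\<in>carrier_vec n. 0 \<le> x \<bullet> (V 2 *\<^sub>v x)) \<and>
      0\<^sub>m n n = A\<^sup>T * V 2 + V 2 * A - \<eta> \<cdot>\<^sub>m (C\<^sup>T * C) + V 2 * B * B\<^sup>T * V 2 \<and>
      (\<forall>k\<in>{3..d}. \<forall>w\<in>carrier_vec (n^k).
         (lyapunov_mat k (A + B * B\<^sup>T * V 2))\<^sup>T *\<^sub>v w = past_rhs n m l \<eta> F G H v V k \<longrightarrow>
         v k = symmetrization n k w)"
proof -
  have V2: "V 2 \<in> carrier_mat n n" and v2: "v 2 = vectorize (V 2)" using V[of 2] d by auto
  have sym: "symmetric_coeff n k (v k)" if "2 \<le> k" "k \<le> d" for k
    using taylor that unfolding energy_taylor_coeffs_def by auto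
  have V2T: "(V 2)\<^sup>T = V 2" by (rule symmetric_coeff_2_transpose[OF sym[OF order_refl d] V2 v2])
  have hom: "(\<Sum>(i, p)\<in>{(i, p). 2 \<le> i \<and> 1 \<le> p \<and> i + p = k + 1}.
            real i / 2 * ((V i *\<^sub>v x ^\<^sub>\<otimes> (i - 1)) \<bullet> ((F(1 := A)) p *\<^sub>v x ^\<^sub>\<otimes> p)))
       + 1/2 * (\<Sum>((p, i), (q, j))\<in>{((p, i), (q, j)). 2 \<le> i \<and> 2 \<le> j \<and> p + q + i + j = k + 2}.
            real i / 2 * (real j / 2) * (input_term m G V x p i \<bullet> input_term m G V x q j))
       - \<eta>/2 * (\<Sum>(p, q)\<in>{(p, q). 1 \<le> p \<and> 1 \<le> q \<and> p + q = k}.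
            (H p *\<^sub>v x ^\<^sub>\<otimes> p) \<bullet> (H q *\<^sub>v x ^\<^sub>\<otimes> q)) = 0"
    if "x \<in> carrier_vec n" "2 \<le> k" "k \<le> d" for x k
    by (rule HJB_homogeneous_part[OF A B C F G H G0 H1 F_zero G_zero H_zero
      HJB[unfolded f_def g_def h_def] d taylor V that])
  let ?Ac = "A + B * B\<^sup>T * V 2"
  have BT: "B\<^sup>T \<in> carrier_mat m n" using B by simp
  have Ac: "?Ac \<in> carrier_mat n n"
    by (rule add_carrier_mat[OF mult_carrier_mat[OF mult_carrier_mat[OF B BT] V2]])
  \<comment> \<open>In degree 2 each of the three sums has a single term.\<close>
  have quad: "2 * ((V 2 *\<^sub>v x) \<bullet> (A *\<^sub>v x)) + (B\<^sup>T *\<^sub>v (V 2 *\<^sub>v x)) \<bullet> (B\<^sup>T *\<^sub>v (V 2 *\<^sub>v x))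
      - \<eta> * ((C *\<^sub>v x) \<bullet> (C *\<^sub>v x)) = 0" if x: "x \<in> carrier_vec n" for x
  proof -
    have s1: "{(i, p). (2::nat) \<le> i \<and> (1::nat) \<le> p \<and> i + p = 2 + 1} = {(2, 1)}" by auto
    have s2: "{((p, i), (q, j)). (2::nat) \<le> i \<and> (2::nat) \<le> j \<and> p + q + i + j = 2 + 2} = {((0, 2), (0, 2))}" by auto
    have s3: "{(p, q). (1::nat) \<le> p \<and> (1::nat) \<le> q \<and> p + q = 2} = {(1, 1)}" by auto
    have it: "input_term m G V x 0 2 = B\<^sup>T *\<^sub>v (V 2 *\<^sub>v x)"
      using input_term_0[of G n m V 2 x] B V2 x by (simp add: G0)
    show ?thesis using hom[OF x order_refl d] unfolding s1 s2 s3 using H1 by (simp add: it algebra_simps del: index_mult_mat_vec)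
  qed
  have ric: "2 * ((?Ac *\<^sub>v z) \<bullet> (V 2 *\<^sub>v z))
       = \<eta> * ((C *\<^sub>v z) \<bullet> (C *\<^sub>v z)) + ((B\<^sup>T * V 2) *\<^sub>v z) \<bullet> ((B\<^sup>T * V 2) *\<^sub>v z)" if z: "z \<in> carrier_vec n" for z
    using quad[OF z] unfolding closed_matrix_scalar_prod[OF A B V2 z mult_mat_vec_carrier[OF V2 z]] assoc_mult_mat_vec[OF BT V2 z]
    by argo
  let ?R = "A\<^sup>T * V 2 + V 2 * A - \<eta> \<cdot>\<^sub>m (C\<^sup>T * C) + V 2 * B * B\<^sup>T * V 2"
  have "?R = 0\<^sub>m n n"
  proof (rule quadratic_form_zero_imp_zero)
    show "?R \<in> carrier_mat n n" using A B C V2 by auto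
    note Rf = riccati_scalar_prod[OF A B C V2 V2T]
    show "x \<bullet> (?R *\<^sub>v y) = y \<bullet> (?R *\<^sub>v x)" if x: "x \<in> carrier_vec n" and y: "y \<in> carrier_vec n" for x y
      unfolding Rf[OF x y] Rf[OF y x]
        comm_scalar_prod[OF mult_mat_vec_carrier[OF A x] mult_mat_vec_carrier[OF V2 y]]
        comm_scalar_prod[OF mult_mat_vec_carrier[OF V2 x] mult_mat_vec_carrier[OF A y]]
        comm_scalar_prod[OF mult_mat_vec_carrier[OF C x] mult_mat_vec_carrier[OF C y]]
        comm_scalar_prod[OF mult_mat_vec_carrier[OF BT mult_mat_vec_carrier[OF V2 x]] mult_mat_vec_carrier[OF BT mult_mat_vec_carrier[OF V2 y]]]
      by linarith
    show "x \<bullet> (?R *\<^sub>v x) = 0" if x: "x \<in> carrier_vec n" for x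
      using quad[OF x] unfolding Rf[OF x x] comm_scalar_prod[OF mult_mat_vec_carrier[OF A x] mult_mat_vec_carrier[OF V2 x]] by linarith
  qed
  obtain g0 where ach: "Hinf_level_achievable n m r A B C g0" and g0: "g0 < \<gamma>"
  proof -
    \<comment> \<open>The optimal level is an infimum, possibly not attained; the strict inequality
      \<gamma>0 < \<gamma> leaves room for an achievable level below \<gamma>.\<close>
    have "Inf {ereal g | g. Hinf_level_achievable n m r A B C g} < ereal \<gamma>"
      using gamma0(1) gamma(1) unfolding Hinf_optimal_level_def by (metis less_ereal.simps(1))
    thus ?thesis using that by (auto simp: Inf_less_iff)
  qed
  have "\<exists>\<rho>>0. \<exists>K. \<forall>x\<in>carrier_vec n. vnorm x < \<rho> \<longrightarrow>
    - f x - (g x * (g x)\<^sup>T) *\<^sub>v gradient n E x \<in> carrier_vec n \<and>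
    vnorm (- f x - (g x * (g x)\<^sup>T) *\<^sub>v gradient n E x - (- ?Ac) *\<^sub>v x) \<le> K * (vnorm x)\<^sup>2"
    unfolding f_def g_def by (rule closed_loop_linearization[OF A B F G taylor d V refl])
  then obtain \<rho> K where \<rho>: "0 < \<rho>" and lin: "\<forall>x\<in>carrier_vec n. vnorm x < \<rho> \<longrightarrow>
    - f x - (g x * (g x)\<^sup>T) *\<^sub>v gradient n E x \<in> carrier_vec n \<and>
    vnorm (- f x - (g x * (g x)\<^sup>T) *\<^sub>v gradient n E x - (- ?Ac) *\<^sub>v x) \<le> K * (vnorm x)\<^sup>2"
    by (elim exE conjE) (rule that)
  have mAc: "- ?Ac \<in> carrier_mat n n" using Ac by (rule uminus_carrier_mat)
  have ev_le: "Re s \<le> 0" if "eigenvalue (cmat (- ?Ac)) s" for s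
    by (rule asymptotically_stable_imp_Re_eigenvalue_le[OF mAc \<rho> lin[rule_format] stable that])
  have ev_ne: "Re s \<noteq> 0" if "eigenvalue (cmat ?Ac) s" for s
    by (rule closed_matrix_no_imaginary_eigenvalue[OF A B C V2 V2T ach g0 eta ric that])
  have ev_Ac: "0 < Re s" if "eigenvalue (cmat ?Ac) s" for s
    using ev_le[OF eigenvalue_uminus[OF Ac that]] ev_ne[OF that] by simp
  have ev_mAc: "Re s < 0" if "eigenvalue (cmat (- ?Ac)) s" for s
    using ev_Ac[of "- s"] eigenvalue_uminus[OF mAc that] unfolding uminus_uminus_mat by simp
  have psd: "0 \<le> x \<bullet> (V 2 *\<^sub>v x)" if x: "x \<in> carrier_vec n" for x
    by (rule riccati_solution_psd[OF A B C V2 V2T ach g0 eta ric ev_mAc x])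
  \<comment> \<open>The Lyapunov form on the line c = 0; with the whole spectrum of Ac to its right
    the form is coercive.\<close>
  have "\<exists>P \<delta> \<mu>. P \<in> carrier_mat n n \<and> P\<^sup>T = P \<and> 0 < \<delta> \<and> 0 < \<mu> \<and>
    (\<forall>x\<in>carrier_vec n. 0 * (x \<bullet> (P *\<^sub>v x)) + \<delta> * (x \<bullet> x) \<le> x \<bullet> (P *\<^sub>v (?Ac *\<^sub>v x))) \<and>
    ((\<forall>s. eigenvalue (cmat ?Ac) s \<longrightarrow> 0 < Re s) \<longrightarrow> (\<forall>x\<in>carrier_vec n. \<mu> * (x \<bullet> x) \<le> x \<bullet> (P *\<^sub>v x))) \<and>
    ((\<exists>s. eigenvalue (cmat ?Ac) s \<and> 0 < Re s) \<longrightarrow> (\<exists>x\<in>carrier_vec n. 0 < x \<bullet> (P *\<^sub>v x)))"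
    by (rule lyapunov_form[OF Ac]) (use ev_ne in blast)
  then obtain P \<delta> \<mu> where P: "P \<in> carrier_mat n n" "P\<^sup>T = P" and pos: "0 < \<delta>" "0 < \<mu>"
    and lyap: "\<forall>x\<in>carrier_vec n. 0 * (x \<bullet> (P *\<^sub>v x)) + \<delta> * (x \<bullet> x) \<le> x \<bullet> (P *\<^sub>v (?Ac *\<^sub>v x))"
    and low: "(\<forall>s. eigenvalue (cmat ?Ac) s \<longrightarrow> 0 < Re s) \<longrightarrow> (\<forall>x\<in>carrier_vec n. \<mu> * (x \<bullet> x) \<le> x \<bullet> (P *\<^sub>v x))"
    and "(\<exists>s. eigenvalue (cmat ?Ac) s \<and> 0 < Re s) \<longrightarrow> (\<exists>x\<in>carrier_vec n. 0 < x \<bullet> (P *\<^sub>v x))"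
    by (elim exE conjE) (rule that)
  have low': "\<mu> * (x \<bullet> x) \<le> x \<bullet> (P *\<^sub>v x)" if "x \<in> carrier_vec n" for x using low ev_Ac that by blast
  have lyap': "\<delta> * (x \<bullet> x) \<le> x \<bullet> (P *\<^sub>v (?Ac *\<^sub>v x))" if "x \<in> carrier_vec n" for x
    using bspec[OF lyap that] by (simp only: mult_zero_left add_0)
  \<comment> \<open>A zero derivative is nonnegative for u and for -u alike, so both polynomials are
    nonnegative.\<close>
  have uniq: "u \<bullet> x ^\<^sub>\<otimes> k = 0" if u: "u \<in> carrier_vec (n ^ k)" and k: "1 \<le> k" and x: "x \<in> carrier_vec n"
    and zero: "\<And>x. x \<in> carrier_vec n \<Longrightarrow> u \<bullet> dkron n k x (?Ac *\<^sub>v x) = 0" for u k x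
  proof -
    have "0 \<le> u \<bullet> x ^\<^sub>\<otimes> k"
      by (rule lyapunov_derivative_nonneg_imp_nonneg[OF k u Ac P pos low' lyap' _ x]) (simp_all only: zero order_refl)
    moreover have "0 \<le> - u \<bullet> x ^\<^sub>\<otimes> k"
    proof (rule lyapunov_derivative_nonneg_imp_nonneg[OF k uminus_carrier_vec[THEN iffD2, OF u] Ac P pos low' lyap' _ x])
      fix z :: "real vec" assume "z \<in> carrier_vec n"
      thus "0 \<le> - u \<bullet> dkron n k z (?Ac *\<^sub>v z)"
        using zero scalar_prod_uminus_left[of u "dkron n k z (?Ac *\<^sub>v z)"] carrier_vecD[OF u] by (simp only: dim_dkron)
    qed
    moreover have "- u \<bullet> x ^\<^sub>\<otimes> k = - (u \<bullet> x ^\<^sub>\<otimes> k)" by (rule scalar_prod_uminus_left) (use u x in simp)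
    ultimately show ?thesis by simp
  qed
  have coeff: "v k = symmetrization n k w"
    if k: "3 \<le> k" "k \<le> d" and w: "w \<in> carrier_vec (n ^ k)"
      and sys: "(lyapunov_mat k ?Ac)\<^sup>T *\<^sub>v w = past_rhs n m l \<eta> F G H v V k" for k w
  proof (rule symmetrization_eqI[symmetric])
    have k2: "2 \<le> k" using k by simp
    show vk: "symmetric_coeff n k (v k)" by (rule sym[OF k2 k(2)])
    note vkc = symmetric_coeff_carrier[OF vk]
    have Ac1: "?Ac \<in> carrier_mat n (n ^ 1)" using Ac by simp
    have V': "V i \<in> carrier_mat n (n^(i-1)) \<and> v i = vectorize (V i)" if "2 \<le> i" "i \<le> k" for i using V[of i] that k by simp
    have sym': "symmetric_coeff n i (v i)" if "2 \<le> i" "i \<le> k" for i using sym[of i] that k by simp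
    \<comment> \<open>Both coefficients satisfy the linear system when it is tested on powers, w by
      assumption and v_k by the HJB equation.\<close>
    have zero: "(w - v k) \<bullet> dkron n k x (?Ac *\<^sub>v x) = 0" if x: "x \<in> carrier_vec n" for x
    proof -
      have "w \<bullet> dkron n k x (?Ac *\<^sub>v x ^\<^sub>\<otimes> 1) = ((lyapunov_mat k ?Ac)\<^sup>T *\<^sub>v w) \<bullet> x ^\<^sub>\<otimes> k"
        by (rule lyapunov_mat_transpose_scalar_prod[OF Ac1 x w, symmetric]) (use k in simp)
      also have "\<dots> = v k \<bullet> dkron n k x (?Ac *\<^sub>v x)" unfolding sys
        by (rule lyapunov_system[of A n B m F G H r l k V v x \<eta>, OF A B F G H G0 G_zero V' sym' x k(1) hom[OF x k2 k(2)], symmetric])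
      finally show ?thesis using w vkc by (simp add: minus_scalar_prod_distrib[OF w vkc dkron_carrier] del: index_mult_mat_vec)
    qed
    fix x :: "real vec" assume x: "x \<in> carrier_vec n"
    have "(w - v k) \<bullet> x ^\<^sub>\<otimes> k = 0" by (rule uniq[OF minus_carrier_vec[OF w vkc] _ x zero]) (use k in auto)
    thus "v k \<bullet> x ^\<^sub>\<otimes> k = w \<bullet> x ^\<^sub>\<otimes> k" unfolding minus_scalar_prod_distrib[OF w vkc kron_pow_carrier[OF x]] by simp
  qed
  show ?thesis using v2 V2T psd \<open>?R = 0\<^sub>m n n\<close>[symmetric] coeff by auto
qed

end
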